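(* Let $H$ be a finite dimensional cosemisimple Hopf algebra of odd dimension over an algebraically closed field $k$. If $H$ contains a simple subcoalgebra of dimension $9$ and no simple subcoalgebras of even dimension, then $\dim_{k} H$ is divisible by $3$.
   Context: A coalgebra is simple if it is nonzero and has no proper nonzero subcoalgebras; $H$ is cosemisimple if it is the sum of its simple subcoalgebras. *)

theory Defs
  imports
    "HOL-Computational_Algebra.Polynomial"
    "HOL-Library.Poly_Mapping"
begin

text \<open>
  Tensor products are built as usual: \<open>V \<otimes> V\<close> is the free vector space on the set \<open>V \<times> V\<close>
  modulo the bilinearity relations, and \<open>V \<otimes> V \<otimes> V\<close> is the free vector space on
  \<open>V \<times> V \<times> V\<close> modulo the trilinearity relations. Tensors are handled through
  representatives: an element of \<open>V \<otimes> V\<close> is given by a formal linear combination of pairs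
  (the pair \<open>(x, y)\<close> standing for the pure tensor of \<open>x\<close> and \<open>y\<close>), and equality in the
  tensor product is congruence modulo the relations.
\<close>

definition fscale :: "'k::field \<Rightarrow> ('a \<Rightarrow>\<^sub>0 'k) \<Rightarrow> ('a \<Rightarrow>\<^sub>0 'k)" where
  "fscale c p = Poly_Mapping.map ((*) c) p"

lemma lookup_fscale [simp]:
  "Poly_Mapping.lookup (fscale c p) x = c * Poly_Mapping.lookup p x"
  by (simp add: fscale_def Poly_Mapping.map.rep_eq when_def)

global_interpretation free_vs: vector_space fscale
  by unfold_locales (auto intro!: poly_mapping_eqI simp: lookup_add algebra_simps)

definition gen :: "'a \<Rightarrow> ('a \<Rightarrow>\<^sub>0 'k::field)" where
  "gen x = Poly_Mapping.single x 1"

text \<open>The linear map out of the free vector space that extends \<open>f\<close>; the first argument is the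
  scalar multiplication of the target.\<close>

definition lin_ext :: "('k::field \<Rightarrow> 'v \<Rightarrow> 'v::ab_group_add) \<Rightarrow> ('a \<Rightarrow> 'v) \<Rightarrow> ('a \<Rightarrow>\<^sub>0 'k) \<Rightarrow> 'v" where
  "lin_ext s f p = (\<Sum>x\<in>Poly_Mapping.keys p. s (Poly_Mapping.lookup p x) (f x))"

locale tensor_powers = vector_space scale
  for scale :: "'a::field \<Rightarrow> 'b::ab_group_add \<Rightarrow> 'b" (infixr \<open>*s\<close> 75)
begin

definition tensor2_rel :: "('b \<times> 'b \<Rightarrow>\<^sub>0 'a) set" where
  "tensor2_rel = free_vs.span (
     {gen (x + x', y) - gen (x, y) - gen (x', y) | x x' y. True} \<union>
     {gen (x, y + y') - gen (x, y) - gen (x, y') | x y y'. True} \<union>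
     {gen (c *s x, y) - fscale c (gen (x, y)) | c x y. True} \<union>
     {gen (x, c *s y) - fscale c (gen (x, y)) | c x y. True})"

definition tensor3_rel :: "('b \<times> 'b \<times> 'b \<Rightarrow>\<^sub>0 'a) set" where
  "tensor3_rel = free_vs.span (
     {gen (x + x', y, z) - gen (x, y, z) - gen (x', y, z) | x x' y z. True} \<union>
     {gen (x, y + y', z) - gen (x, y, z) - gen (x, y', z) | x y y' z. True} \<union>
     {gen (x, y, z + z') - gen (x, y, z) - gen (x, y, z') | x y z z'. True} \<union>
     {gen (c *s x, y, z) - fscale c (gen (x, y, z)) | c x y z. True} \<union>
     {gen (x, c *s y, z) - fscale c (gen (x, y, z)) | c x y z. True} \<union>
     {gen (x, y, c *s z) - fscale c (gen (x, y, z)) | c x y z. True})"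

definition tensor2_eq :: "('b \<times> 'b \<Rightarrow>\<^sub>0 'a) \<Rightarrow> ('b \<times> 'b \<Rightarrow>\<^sub>0 'a) \<Rightarrow> bool"
    (infix \<open>\<approx>\<^sub>2\<close> 50) where
  "p \<approx>\<^sub>2 q \<longleftrightarrow> p - q \<in> tensor2_rel"

definition tensor3_eq :: "('b \<times> 'b \<times> 'b \<Rightarrow>\<^sub>0 'a) \<Rightarrow> ('b \<times> 'b \<times> 'b \<Rightarrow>\<^sub>0 'a) \<Rightarrow> bool"
    (infix \<open>\<approx>\<^sub>3\<close> 50) where
  "p \<approx>\<^sub>3 q \<longleftrightarrow> p - q \<in> tensor3_rel"

end

text \<open>
  The value \<open>\<Delta> x\<close> is a representative of the coproduct of \<open>x\<close>, so \<open>\<Delta>\<close> itself need not be linear: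
  only the map to the tensor product that it induces is. Every linear map from \<open>V\<close> to
  \<open>V \<otimes> V\<close> is induced by some such \<open>\<Delta>\<close>, and no notion below depends on the choice of
  representatives.
\<close>

locale coalgebra = tensor_powers scale
  for scale :: "'k::field \<Rightarrow> 'c::ab_group_add \<Rightarrow> 'c" (infixr \<open>*s\<close> 75) +
  fixes \<Delta> :: "'c \<Rightarrow> ('c \<times> 'c \<Rightarrow>\<^sub>0 'k)"
    and \<epsilon> :: "'c \<Rightarrow> 'k"
  assumes comult_add: "\<Delta> (x + y) \<approx>\<^sub>2 \<Delta> x + \<Delta> y"
    and comult_scale: "\<Delta> (c *s x) \<approx>\<^sub>2 fscale c (\<Delta> x)"
    and counit_linear: "Vector_Spaces.linear scale (*) \<epsilon>"
    and coassoc: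
      "lin_ext fscale (\<lambda>(x, y). lin_ext fscale (\<lambda>(a, b). gen (a, b, y)) (\<Delta> x)) (\<Delta> h) \<approx>\<^sub>3
       lin_ext fscale (\<lambda>(x, y). lin_ext fscale (\<lambda>(a, b). gen (x, a, b)) (\<Delta> y)) (\<Delta> h)"
    and counit_left: "lin_ext scale (\<lambda>(x, y). \<epsilon> x *s y) (\<Delta> h) = h"
    and counit_right: "lin_ext scale (\<lambda>(x, y). \<epsilon> y *s x) (\<Delta> h) = h"
begin

text \<open>The second conjunct says that \<open>\<Delta> C\<close> lies in the image of \<open>C \<otimes> C\<close> in the tensor square.\<close>

definition subcoalgebra :: "'c set \<Rightarrow> bool" where
  "subcoalgebra C \<longleftrightarrow>
     subspace C \<and> (\<forall>x\<in>C. \<exists>p. Poly_Mapping.keys p \<subseteq> C \<times> C \<and> \<Delta> x \<approx>\<^sub>2 p)"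

definition simple_subcoalgebra :: "'c set \<Rightarrow> bool" where
  "simple_subcoalgebra C \<longleftrightarrow>
     subcoalgebra C \<and> C \<noteq> {0} \<and> (\<forall>D. subcoalgebra D \<and> D \<subseteq> C \<longrightarrow> D = {0} \<or> D = C)"

definition cosemisimple :: bool where
  "cosemisimple \<longleftrightarrow> span (\<Union> {C. simple_subcoalgebra C}) = UNIV"

end

locale hopf_algebra = coalgebra scale \<Delta> \<epsilon>
  for scale :: "'k::field \<Rightarrow> 'h::ring_1 \<Rightarrow> 'h" (infixr \<open>*s\<close> 75)
    and \<Delta> :: "'h \<Rightarrow> ('h \<times> 'h \<Rightarrow>\<^sub>0 'k)"
    and \<epsilon> :: "'h \<Rightarrow> 'k" +
  fixes S :: "'h \<Rightarrow> 'h"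
  assumes scale_mult_left: "(c *s x) * y = c *s (x * y)"
    and scale_mult_right: "x * (c *s y) = c *s (x * y)"
    and comult_one: "\<Delta> 1 \<approx>\<^sub>2 gen (1, 1)"
    and comult_mult: "\<Delta> (x * y) \<approx>\<^sub>2
      lin_ext fscale (\<lambda>(a, b). lin_ext fscale (\<lambda>(a', b'). gen (a * a', b * b')) (\<Delta> y)) (\<Delta> x)"
    and counit_one: "\<epsilon> 1 = 1"
    and counit_mult: "\<epsilon> (x * y) = \<epsilon> x * \<epsilon> y"
    and antipode_linear: "Vector_Spaces.linear scale scale S"
    and antipode_left: "lin_ext scale (\<lambda>(x, y). S x * y) (\<Delta> h) = \<epsilon> h *s 1"
    and antipode_right: "lin_ext scale (\<lambda>(x, y). x * S y) (\<Delta> h) = \<epsilon> h *s 1"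

end

theory Submission
  imports Defs "HOL-Library.Function_Algebras" "HOL-Library.Nat_Bijection"
begin

text \<open>
  The statement follows from a fact about the Grothendieck ring of the category of finite dimensional
  comodules of \<open>H\<close>. Cosemisimplicity provides a Haar functional (\<open>haar_exists\<close>), hence Maschke's theorem
  for comodules. Over an algebraically closed field the irreducible comodules \<open>a\<close>, of degree \<open>d a\<close>,
  satisfy Schur's lemma; their matrix entries form a basis of \<open>H\<close>, so that \<open>dim H\<close> is the sum of the
  \<open>(d a)\<^sup>2\<close> and the simple subcoalgebras are exactly the spans of the entries of one \<open>a\<close>, of dimension \<open>(d a)\<^sup>2\<close>
  (\<open>simple_iff\<close>, \<open>dim_simple\<close>). Tensor products and duals turn the set of irreducibles into a based ring
  with nonnegative structure constants and Frobenius reciprocity. A set of irreducibles that is closed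
  under products and duals spans a Hopf subalgebra, whose dimension divides \<open>dim H\<close> by the theorem of
  Nichols and Zoeller (\<open>hopf_subalgebra_dim_dvd\<close>).

  Suppose now that \<open>dim H\<close> is odd and prime to 3, that all degrees are odd and that some degree is 3.
  Every closed set of irreducibles then has dimension prime to 6. Counting the elements of degree one in
  \<open>a a\<^sup>*\<close>, which form a group of order prime to 6, gives \<open>a a\<^sup>* = 1 + \<psi> + \<phi>\<close> with degrees 1, 3 and 5 when
  \<open>d a = 3\<close>, and a parity argument on norms produces a self-dual \<open>\<chi>\<close> of degree 3 with
  \<open>\<chi>\<^sup>2 = 1 + \<chi> + \<phi>\<close> (\<open>so3_generator\<close>). This is the first step of the Clebsch-Gordan rule of \<open>SO(3)\<close>,
  and the rule propagates: there are irreducibles \<open>q i\<close> of degree \<open>2 i + 1\<close> with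
  \<open>\<chi> q i = q (i - 1) + q i + q (i + 1)\<close> for all \<open>i\<close> (\<open>extend\<close>), which is impossible in a finite set.
  Each way in which the rule could break down at \<open>q k\<close> is excluded by comparing degrees with the
  nonnegativity of products such as \<open>\<phi> q k\<close> and \<open>(q 3) q k\<close>, or by producing a group element of order 2 or
  a closed set of even dimension. The longest analysis is
  needed at \<open>k = 2\<close>, where \<open>\<chi> \<phi> = \<chi> + \<beta> + \<gamma>\<close> could have constituents of degrees 5 and 7.
\<close>

section \<open>Finitely generated subspaces of a vector space\<close>

locale kspace = vector_space scale
  for scale :: "'a::field \<Rightarrow> 'b::ab_group_add \<Rightarrow> 'b"
begin

definition fg :: "'b set \<Rightarrow> bool" where
  "fg V \<longleftrightarrow> subspace V \<and> (\<exists>W. finite W \<and> V \<subseteq> span W)"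

lemma fg_subspace: "fg V \<Longrightarrow> subspace V"
  by (simp add: fg_def)

lemma fg_span: "finite W \<Longrightarrow> fg (span W)"
  unfolding fg_def by auto

lemma fg_subset: "fg V \<Longrightarrow> subspace U \<Longrightarrow> U \<subseteq> V \<Longrightarrow> fg U"
  unfolding fg_def by blast

lemma fg_independent_finite:
  assumes "fg V" "independent X" "X \<subseteq> V"
  shows "finite X"
  using assms independent_span_bound[of _ X] unfolding fg_def by (meson subset_trans)

lemma fg_extend_basis:
  assumes "fg V" "independent X" "X \<subseteq> V"
  obtains Y where "X \<subseteq> Y" "finite Y" "independent Y" "span Y = V" "card Y = dim V"
proof -
  obtain Y where Y: "X \<subseteq> Y" "Y \<subseteq> V" "independent Y" "V \<subseteq> span Y"
    using maximal_independent_subset_extend[OF assms(3,2)] by metis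
  have "span Y = V"
    using Y span_minimal[OF Y(2) fg_subspace[OF assms(1)]] by auto
  moreover have "finite Y" using fg_independent_finite assms(1) Y by blast
  ultimately show thesis using that Y basis_card_eq_dim by metis
qed

lemma fg_basis:
  assumes "fg V"
  obtains Y where "finite Y" "independent Y" "span Y = V" "card Y = dim V"
  using fg_extend_basis[OF assms, of "{}"] by (metis empty_subsetI independent_empty)

lemma fg_dim_mono:
  assumes "fg V" "subspace U" "U \<subseteq> V"
  shows "dim U \<le> dim V"
proof -
  obtain X where X: "finite X" "independent X" "span X = U" "card X = dim U"
    using fg_basis[OF fg_subset[OF assms]] .
  then have "X \<subseteq> V" using assms(3) span_superset by blast
  then obtain Y where "X \<subseteq> Y" "finite Y" "card Y = dim V"
    using fg_extend_basis[OF assms(1) X(2)] by metis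
  then show ?thesis using X(4) by (metis card_mono)
qed

lemma fg_dim_eq:
  assumes "fg V" "subspace U" "U \<subseteq> V" "dim V \<le> dim U"
  shows "U = V"
proof -
  obtain X where X: "finite X" "independent X" "span X = U" "card X = dim U"
    using fg_basis[OF fg_subset[OF assms(1-3)]] .
  then have "X \<subseteq> V" using assms(3) span_superset by blast
  then obtain Y where Y: "X \<subseteq> Y" "finite Y" "card Y = dim V" "span Y = V"
    using fg_extend_basis[OF assms(1) X(2)] by metis
  then have "X = Y" using X(4) assms(4) by (metis card_seteq)
  then show ?thesis using X Y by simp
qed

lemma dim_zero_space: "dim {0} = 0"
  using dim_eq_card_independent[OF independent_empty] dim_span[of "{}"] by simp

lemma dim_span_le_card: "finite W \<Longrightarrow> dim (span W) \<le> card W"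
  by (rule dim_le_card) auto

end

locale kspace_pair = vs1: kspace s1 + vs2: kspace s2
  for s1 :: "'a::field \<Rightarrow> 'b::ab_group_add \<Rightarrow> 'b"
    and s2 :: "'a::field \<Rightarrow> 'c::ab_group_add \<Rightarrow> 'c"
begin

sublocale vector_space_pair s1 s2 ..

text \<open>Rank-nullity for the map that \<open>f\<close> induces from \<open>A\<close> to the quotient by \<open>U\<close>.\<close>

lemma dim_add_image:
  assumes f: "Vector_Spaces.linear s1 s2 f" and A: "vs1.fg A" and U: "vs2.fg U"
  shows "vs2.fg {u + f x | u x. u \<in> U \<and> x \<in> A}"
    and "vs2.dim {u + f x | u x. u \<in> U \<and> x \<in> A} + vs1.dim {x\<in>A. f x \<in> U} = vs2.dim U + vs1.dim A"
proof -
  interpret f: Vector_Spaces.linear s1 s2 f by (fact f)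
  let ?A0 = "{x\<in>A. f x \<in> U}"
  have sA: "vs1.subspace A" and sU: "vs2.subspace U"
    using A U vs1.fg_subspace vs2.fg_subspace by blast+
  have sA0: "vs1.subspace ?A0"
    using sA sU by (auto simp: vs1.subspace_def vs2.subspace_def f.add f.scale f.zero)
  obtain B0 where B0: "finite B0" "vs1.independent B0" "vs1.span B0 = ?A0" "card B0 = vs1.dim ?A0"
    using vs1.fg_basis[OF vs1.fg_subset[OF A sA0 Collect_restrict]] .
  have "B0 \<subseteq> A" using B0(3) vs1.span_superset by auto
  then obtain B1 where B1: "B0 \<subseteq> B1" "finite B1" "vs1.independent B1" "vs1.span B1 = A" "card B1 = vs1.dim A"
    using vs1.fg_extend_basis[OF A B0(2)] by metis
  obtain C where C: "finite C" "vs2.independent C" "vs2.span C = U" "card C = vs2.dim U"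
    using vs2.fg_basis[OF U] .
  have key: "vs2.independent (C \<union> f ` E) \<and> card (C \<union> f ` E) = card C + card E"
    if "E \<subseteq> B1 - B0" for E
  proof -
    have "finite E" using that B1(2) finite_subset by blast
    then show ?thesis using that
    proof (induction E rule: finite_induct)
      case empty
      then show ?case using C by simp
    next
      case (insert d E)
      have d: "d \<in> B1" "d \<notin> B0" "E \<subseteq> B1 - B0" using insert by auto
      have nin: "f d \<notin> vs2.span (C \<union> f ` E)"
      proof
        assume "f d \<in> vs2.span (C \<union> f ` E)"
        then obtain u y where u: "u \<in> U" and y: "y \<in> vs2.span (f ` E)" and e: "f d = u + y"
          unfolding vs2.span_Un C(3) by auto
        obtain x where x: "x \<in> vs1.span E" "y = f x"
          using y linear_span_image[OF f] by auto
        have xA: "x \<in> A" using x(1) d(3) B1(4) vs1.span_mono by blast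
        have dA: "d \<in> A" using d(1) B1(4) vs1.span_base by blast
        have "f (d - x) = u" using e x by (simp add: f.diff)
        then have "d - x \<in> vs1.span B0" unfolding B0(3) using u vs1.subspace_diff[OF sA dA xA] by simp
        then have 1: "d - x \<in> vs1.span (B0 \<union> E)"
          by (rule subsetD[OF vs1.span_mono, rotated]) simp
        have 2: "x \<in> vs1.span (B0 \<union> E)"
          by (rule subsetD[OF vs1.span_mono x(1)]) simp
        have 3: "d \<in> vs1.span (B0 \<union> E)" using vs1.span_add[OF 1 2] by simp
        have "B0 \<union> E \<subseteq> B1 - {d}" using d insert.hyps B1(1) by auto
        then have "d \<in> vs1.span (B1 - {d})" using 3 vs1.span_mono by (meson subsetD)
        then show False using B1(3) d(1) vs1.dependent_def by blast
      qed
      have IH: "vs2.independent (C \<union> f ` E)" "card (C \<union> f ` E) = card C + card E"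
        using insert d by auto
      have "f d \<notin> C \<union> f ` E" using nin vs2.span_base[of "f d" "C \<union> f ` E"] by metis
      then have "card (insert (f d) (C \<union> f ` E)) = Suc (card C + card E)"
        using IH insert.hyps C(1) by simp
      moreover have "vs2.independent (insert (f d) (C \<union> f ` E))"
        using vs2.independent_insertI[OF nin IH(1)] .
      moreover have "C \<union> f ` insert d E = insert (f d) (C \<union> f ` E)" by auto
      ultimately show ?case using insert.hyps by simp
    qed
  qed
  let ?T = "C \<union> f ` (B1 - B0)" and ?V = "{u + f x | u x. u \<in> U \<and> x \<in> A}"
  have "vs2.span ?T = {u + y | u y. u \<in> U \<and> y \<in> f ` vs1.span (B1 - B0)}"
    unfolding vs2.span_Un C(3) linear_span_image[OF f] ..
  also have "\<dots> = ?V"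
  proof (intro equalityI subsetI)
    fix z assume "z \<in> {u + y | u y. u \<in> U \<and> y \<in> f ` vs1.span (B1 - B0)}"
    then obtain u x where z: "z = u + f x" "u \<in> U" "x \<in> vs1.span (B1 - B0)" by auto
    have "x \<in> A" using z(3) B1(4) vs1.span_mono[of "B1 - B0" B1] by (metis Diff_subset subsetD)
    then show "z \<in> ?V" using z by auto
  next
    fix z assume "z \<in> ?V"
    then obtain u x where z: "z = u + f x" "u \<in> U" "x \<in> A" by auto
    have "B0 \<union> (B1 - B0) = B1" using B1(1) by auto
    then have "x \<in> vs1.span (B0 \<union> (B1 - B0))" using z B1(4) by simp
    then obtain p q where x: "p \<in> ?A0" "q \<in> vs1.span (B1 - B0)" "x = p + q"
      unfolding vs1.span_Un B0(3) by auto
    have "z = (u + f p) + f q" using z x by (simp add: f.add add.assoc)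
    moreover have "u + f p \<in> U" using z x sU vs2.subspace_add by auto
    ultimately show "z \<in> {u + y | u y. u \<in> U \<and> y \<in> f ` vs1.span (B1 - B0)}" using x by blast
  qed
  finally have sp: "vs2.span ?T = ?V" .
  have finT: "finite ?T" using C(1) B1(2) by auto
  show "vs2.fg ?V" using vs2.fg_span[OF finT] sp by simp
  have "vs2.dim ?V = card ?T"
    using key[of "B1 - B0"] vs2.dim_span_eq_card_independent[of ?T] unfolding sp by simp
  also have "\<dots> = card C + card (B1 - B0)" using key by blast
  finally show "vs2.dim ?V + vs1.dim ?A0 = vs2.dim U + vs1.dim A"
    using B0(1,4) B1(1,2,5) C(4) card_mono[OF B1(2,1)] card_Diff_subset[OF B0(1) B1(1)] by linarith
qed

lemma dim_inj_image:
  assumes f: "Vector_Spaces.linear s1 s2 f" and A: "vs1.fg A" and inj: "\<And>x. x \<in> A \<Longrightarrow> f x = 0 \<Longrightarrow> x = 0"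
  shows "vs2.fg (f ` A)" "vs2.dim (f ` A) = vs1.dim A"
proof -
  interpret f: Vector_Spaces.linear s1 s2 f by (fact f)
  have U: "vs2.fg {0}" using vs2.fg_span[of "{}"] by simp
  have e: "{u + f x | u x. u \<in> {0} \<and> x \<in> A} = f ` A" by auto
  have z: "{x\<in>A. f x \<in> {0}} = {0}"
    using inj vs1.subspace_0[OF vs1.fg_subspace[OF A]] f.zero by auto
  show "vs2.fg (f ` A)" using dim_add_image(1)[OF f A U] unfolding e .
  show "vs2.dim (f ` A) = vs1.dim A"
    using dim_add_image(2)[OF f A U] unfolding e z
    by (simp add: vs1.dim_zero_space vs2.dim_zero_space)
qed

end

section \<open>Sweedler calculus in coordinates\<close>

definition lin :: "('k::field \<Rightarrow> 'a::ab_group_add \<Rightarrow> 'a) \<Rightarrow> ('k \<Rightarrow> 'b::ab_group_add \<Rightarrow> 'b) \<Rightarrow> ('a \<Rightarrow> 'b) \<Rightarrow> bool" where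
  "lin s t f \<longleftrightarrow> (\<forall>x y. f (x + y) = f x + f y) \<and> (\<forall>c x. f (s c x) = t c (f x))"

lemma linI: "(\<And>x y. f (x + y) = f x + f y) \<Longrightarrow> (\<And>c x. f (s c x) = t c (f x)) \<Longrightarrow> lin s t f"
  by (simp add: lin_def)

lemma lin_add: "lin s t f \<Longrightarrow> f (x + y) = f x + f y"
  and lin_scale: "lin s t f \<Longrightarrow> f (s c x) = t c (f x)"
  by (simp_all add: lin_def)

lemma lin_zero: "lin s t f \<Longrightarrow> f 0 = 0"
  using lin_add[of s t f 0 0] by simp

lemma lin_diff: "lin s t f \<Longrightarrow> f (x - y) = f x - f y"
  using lin_add[of s t f "x - y" y] by (simp add: algebra_simps)

lemma lin_sum: "lin s t f \<Longrightarrow> f (\<Sum>i\<in>A. g i) = (\<Sum>i\<in>A. f (g i))"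
  by (induction A rule: infinite_finite_induct) (auto simp: lin_zero lin_add)

lemma lin_iff_linear: "vector_space s \<Longrightarrow> vector_space t \<Longrightarrow> lin s t f \<longleftrightarrow> Vector_Spaces.linear s t f"
  by (auto simp: lin_def Vector_Spaces.linear_iff)

lemma vector_space_mult: "vector_space ((*) :: 'k::field \<Rightarrow> 'k \<Rightarrow> 'k)"
  by unfold_locales (auto simp: algebra_simps)

definition bilin :: "('k::field \<Rightarrow> 'a::ab_group_add \<Rightarrow> 'a) \<Rightarrow> ('k \<Rightarrow> 'b::ab_group_add \<Rightarrow> 'b) \<Rightarrow> ('a \<Rightarrow> 'a \<Rightarrow> 'b) \<Rightarrow> bool" where
  "bilin s t f \<longleftrightarrow> (\<forall>x. lin s t (f x)) \<and> (\<forall>y. lin s t (\<lambda>x. f x y))"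

lemma bilinI: "(\<And>x. lin s t (f x)) \<Longrightarrow> (\<And>y. lin s t (\<lambda>x. f x y)) \<Longrightarrow> bilin s t f"
  by (simp add: bilin_def)

lemma bilin1: "bilin s t f \<Longrightarrow> lin s t (f x)"
  and bilin2: "bilin s t f \<Longrightarrow> lin s t (\<lambda>x. f x y)"
  by (simp_all add: bilin_def)

lemma lin_ext_superset:
  assumes "vector_space s" "finite A" "Poly_Mapping.keys p \<subseteq> A"
  shows "lin_ext s f p = (\<Sum>x\<in>A. s (Poly_Mapping.lookup p x) (f x))"
proof -
  interpret vector_space s by fact
  show ?thesis unfolding lin_ext_def
    by (rule sum.mono_neutral_left) (use assms in \<open>auto simp: not_in_keys_iff_lookup_eq_zero\<close>)
qed

lemma lin_ext_lin:
  fixes s :: "'k::field \<Rightarrow> 'v::ab_group_add \<Rightarrow> 'v" and f :: "'x \<Rightarrow> 'v"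
  assumes s: "vector_space s"
  shows "lin fscale s (lin_ext s f)"
proof -
  interpret vector_space s by fact
  show ?thesis
  proof (rule linI)
    fix p q :: "'x \<Rightarrow>\<^sub>0 'k"
    let ?A = "Poly_Mapping.keys p \<union> Poly_Mapping.keys q"
    have "Poly_Mapping.keys (p + q) \<subseteq> ?A" by (rule Poly_Mapping.keys_add)
    then show "lin_ext s f (p + q) = lin_ext s f p + lin_ext s f q"
      using lin_ext_superset[OF s, of ?A p f] lin_ext_superset[OF s, of ?A q f]
        lin_ext_superset[OF s, of ?A "p + q" f]
      by (simp add: lookup_add scale_left_distrib sum.distrib)
  next
    fix c and p :: "'x \<Rightarrow>\<^sub>0 'k"
    have "Poly_Mapping.keys (fscale c p) \<subseteq> Poly_Mapping.keys p"
      by (auto simp: in_keys_iff)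
    then show "lin_ext s f (fscale c p) = s c (lin_ext s f p)"
      using lin_ext_superset[OF s, of "Poly_Mapping.keys p" "fscale c p" f]
      by (simp add: lin_ext_def scale_sum_right)
  qed
qed

lemma lin_ext_gen: "vector_space s \<Longrightarrow> lin_ext s f (gen x) = f x"
  unfolding lin_ext_def gen_def by (simp add: vector_space.vector_space_assms)

lemma lin_ext_comp:
  assumes s: "vector_space s"
  shows "lin_ext s f (lin_ext fscale g p) = lin_ext s (\<lambda>x. lin_ext s f (g x)) p"
  by (simp add: lin_ext_def[of fscale g] lin_ext_def[of s "\<lambda>x. lin_ext s f (g x)"]
      lin_sum[OF lin_ext_lin[OF s]] lin_scale[OF lin_ext_lin[OF s]])

lemma (in tensor_powers) lin_ext_tensor2:
  assumes t: "vector_space t" and f: "bilin scale t f" and pq: "p \<approx>\<^sub>2 q"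
  shows "lin_ext t (\<lambda>(x, y). f x y) p = lin_ext t (\<lambda>(x, y). f x y) q"
proof -
  interpret t: vector_space t by fact
  let ?F = "lin_ext t (\<lambda>(x, y). f x y)"
  note L = lin_ext_lin[OF t, of "\<lambda>(x, y). f x y"]
  note s = lin_ext_gen[OF t] lin_diff[OF L] lin_scale[OF L] lin_add[OF bilin1[OF f]] lin_add[OF bilin2[OF f]]
    lin_scale[OF bilin1[OF f]] lin_scale[OF bilin2[OF f]]
  have "free_vs.subspace {r. ?F r = 0}"
    by (auto simp: free_vs.subspace_def lin_zero[OF L] lin_add[OF L] lin_scale[OF L])
  then have "tensor2_rel \<subseteq> {r. ?F r = 0}"
    unfolding tensor2_rel_def by (intro free_vs.span_minimal) (auto simp: s)
  then show ?thesis using pq unfolding tensor2_eq_def by (auto simp: lin_diff[OF L])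
qed

definition trilin :: "('k::field \<Rightarrow> 'a::ab_group_add \<Rightarrow> 'a) \<Rightarrow> ('k \<Rightarrow> 'b::ab_group_add \<Rightarrow> 'b) \<Rightarrow> ('a \<Rightarrow> 'a \<Rightarrow> 'a \<Rightarrow> 'b) \<Rightarrow> bool" where
  "trilin s t f \<longleftrightarrow> (\<forall>x y. lin s t (f x y)) \<and> (\<forall>x z. lin s t (\<lambda>y. f x y z)) \<and> (\<forall>y z. lin s t (\<lambda>x. f x y z))"

lemma (in tensor_powers) lin_ext_tensor3:
  assumes t: "vector_space t" and f: "trilin scale t f" and pq: "p \<approx>\<^sub>3 q"
  shows "lin_ext t (\<lambda>(x, y, z). f x y z) p = lin_ext t (\<lambda>(x, y, z). f x y z) q"
proof -
  interpret t: vector_space t by fact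
  let ?F = "lin_ext t (\<lambda>(x, y, z). f x y z)"
  note L = lin_ext_lin[OF t, of "\<lambda>(x, y, z). f x y z"]
  have f1: "lin scale t (f x y)" and f2: "lin scale t (\<lambda>y. f x y z)" and f3: "lin scale t (\<lambda>x. f x y z)"
    for x y z using f by (auto simp: trilin_def)
  note s = lin_ext_gen[OF t] lin_diff[OF L] lin_scale[OF L] lin_add[OF f1] lin_add[OF f2] lin_add[OF f3]
    lin_scale[OF f1] lin_scale[OF f2] lin_scale[OF f3]
  have "free_vs.subspace {r. ?F r = 0}"
    by (auto simp: free_vs.subspace_def lin_zero[OF L] lin_add[OF L] lin_scale[OF L])
  then have "tensor3_rel \<subseteq> {r. ?F r = 0}"
    unfolding tensor3_rel_def by (intro free_vs.span_minimal) (auto simp: s)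
  then show ?thesis using pq unfolding tensor3_eq_def by (auto simp: lin_diff[OF L])
qed

locale fd_hopf = hopf_algebra scale \<Delta> \<epsilon> S + finite_dimensional_vector_space scale B
  for scale :: "'k::field \<Rightarrow> 'h::ring_1 \<Rightarrow> 'h" (infixr \<open>*s\<close> 75)
    and \<Delta> :: "'h \<Rightarrow> ('h \<times> 'h \<Rightarrow>\<^sub>0 'k)" and \<epsilon> :: "'h \<Rightarrow> 'k" and S :: "'h \<Rightarrow> 'h" and B :: "'h set"
begin

sublocale kspace scale ..

abbreviation "lf \<equiv> lin scale (*)"
abbreviation "lh \<equiv> lin scale scale"

definition co :: "'h \<Rightarrow> 'h \<Rightarrow> 'k" where "co b x = representation B x b"

text \<open>The coefficient of the basis vector \<open>b\<close> in the first tensor factor of \<open>\<Delta> h\<close>, so that \<open>\<Delta> h\<close> is the sum of the \<open>b \<otimes> D b h\<close> and \<open>SW f h\<close>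
  is \<open>f h\<^sub>1 h\<^sub>2\<close> in Sweedler notation.\<close>

definition D :: "'h \<Rightarrow> 'h \<Rightarrow> 'h" where
  "D b h = lin_ext scale (\<lambda>(x, y). co b x *s y) (\<Delta> h)"

definition SW :: "('h \<Rightarrow> 'h \<Rightarrow> 'v::ab_group_add) \<Rightarrow> 'h \<Rightarrow> 'v" where
  "SW f h = (\<Sum>b\<in>B. f b (D b h))"

lemma vs: "vector_space scale" ..

lemma finite_B: "finite B" by (rule finite_Basis)

lemma co_lin: "lf (co b)"
  unfolding co_def
  by (rule linI) (simp_all add: representation_add representation_scale independent_Basis span_Basis)

lemma co_sum: "(\<Sum>b\<in>B. co b x *s b) = x"
  unfolding co_def using sum_representation_eq[OF independent_Basis _ finite_Basis order_refl] span_Basis by simp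

lemma co_basis: "b \<in> B \<Longrightarrow> co a b = (if a = b then 1 else 0)"
  unfolding co_def by (simp add: representation_basis independent_Basis)

lemma co_out: "b \<notin> B \<Longrightarrow> co b x = 0"
  unfolding co_def using representation_ne_zero by blast

lemma lin_co: "lin scale t f \<Longrightarrow> f x = (\<Sum>b\<in>B. t (co b x) (f b))"
  using lin_sum[of scale t f "\<lambda>b. co b x *s b" B] by (simp add: co_sum lin_scale)

lemma counit_lin: "lf \<epsilon>"
  using counit_linear by (simp add: lin_iff_linear vs vector_space_mult)

lemma antipode_lin: "lh S"
  using antipode_linear by (simp add: lin_iff_linear vs)

lemma bilin_co: "bilin scale scale (\<lambda>x y. co b x *s y)"
  by (intro bilinI linI) (simp_all add: lin_add[OF co_lin] lin_scale[OF co_lin] algebra_simps)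

lemma D_lin: "lh (D b)"
proof -
  note L = lin_ext_lin[OF vs, of "\<lambda>(x, y). co b x *s y"]
  show ?thesis
    unfolding D_def
    by (intro linI)
      (simp_all add: lin_ext_tensor2[OF vs bilin_co comult_add] lin_ext_tensor2[OF vs bilin_co comult_scale]
         lin_add[OF L] lin_scale[OF L])
qed

lemma D_out: "b \<notin> B \<Longrightarrow> D b h = 0"
  by (simp add: D_def co_out lin_ext_def case_prod_unfold)

lemma lin_ext_SW:
  assumes t: "vector_space t" and f: "bilin scale t f"
  shows "lin_ext t (\<lambda>(x, y). f x y) p = (\<Sum>b\<in>B. f b (lin_ext scale (\<lambda>(x, y). co b x *s y) p))"
proof -
  interpret t: vector_space t by fact
  have "lin_ext t (\<lambda>(x, y). f x y) p
      = (\<Sum>z\<in>Poly_Mapping.keys p. t (Poly_Mapping.lookup p z) (\<Sum>b\<in>B. t (co b (fst z)) (f b (snd z))))"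
    unfolding lin_ext_def by (intro sum.cong refl) (simp add: case_prod_unfold lin_co[OF bilin2[OF f], symmetric])
  also have "\<dots> = (\<Sum>b\<in>B. \<Sum>z\<in>Poly_Mapping.keys p. t (Poly_Mapping.lookup p z) (t (co b (fst z)) (f b (snd z))))"
    by (subst sum.swap) (simp add: t.scale_sum_right)
  also have "\<dots> = (\<Sum>b\<in>B. f b (lin_ext scale (\<lambda>(x, y). co b x *s y) p))"
    by (intro sum.cong refl)
      (simp add: lin_ext_def case_prod_unfold lin_sum[OF bilin1[OF f]] lin_scale[OF bilin1[OF f]])
  finally show ?thesis .
qed

lemma SW_eq:
  "vector_space t \<Longrightarrow> bilin scale t f \<Longrightarrow> lin_ext t (\<lambda>(x, y). f x y) (\<Delta> h) = SW f h"
  by (simp add: SW_def D_def lin_ext_SW)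

lemma SW_lin: "bilin scale t f \<Longrightarrow> lin scale t (SW f)" if "vector_space t"
proof -
  interpret t: vector_space t by fact
  show ?thesis if f: "bilin scale t f"
    unfolding SW_def
    by (intro linI) (simp_all add: lin_add[OF D_lin] lin_scale[OF D_lin] lin_add[OF bilin1[OF f]]
        lin_scale[OF bilin1[OF f]] sum.distrib t.scale_sum_right)
qed

lemma SW_cong: "(\<And>a b. f a b = g a b) \<Longrightarrow> SW f x = SW g x"
  by (simp add: SW_def)

lemma lin_SW: "lin s t F \<Longrightarrow> F (SW f x) = SW (\<lambda>a b. F (f a b)) x"
  by (simp add: SW_def lin_sum)

lemma SW_coassoc:
  assumes t: "vector_space t" and f: "trilin scale t f"
  shows "SW (\<lambda>x y. SW (\<lambda>a b. f a b y) x) h = SW (\<lambda>x y. SW (\<lambda>a b. f x a b) y) h"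
proof -
  interpret t: vector_space t by fact
  have f1: "lin scale t (f x y)" and f2: "lin scale t (\<lambda>y. f x y z)" and f3: "lin scale t (\<lambda>x. f x y z)"
    for x y z using f by (auto simp: trilin_def)
  note fs = lin_add[OF f1] lin_add[OF f2] lin_add[OF f3] lin_scale[OF f1] lin_scale[OF f2] lin_scale[OF f3]
  have b1: "bilin scale t (\<lambda>a b. f a b y)" for y by (auto intro!: bilinI simp: f2 f3)
  have b2: "bilin scale t (f x)" for x by (auto intro!: bilinI simp: f1 f2)
  have b3: "bilin scale t (\<lambda>x y. SW (\<lambda>a b. f a b y) x)"
    by (intro bilinI SW_lin[OF t b1] linI) (simp_all add: SW_def fs sum.distrib t.scale_sum_right)
  have b4: "bilin scale t (\<lambda>x y. SW (f x) y)"
    by (intro bilinI SW_lin[OF t b2] linI) (simp_all add: SW_def fs sum.distrib t.scale_sum_right)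
  have "lin_ext t (\<lambda>(x, y, z). f x y z)
     (lin_ext fscale (\<lambda>(x, y). lin_ext fscale (\<lambda>(a, b). gen (a, b, y)) (\<Delta> x)) (\<Delta> h))
    = lin_ext t (\<lambda>(x, y). lin_ext t (\<lambda>(a, b). f a b y) (\<Delta> x)) (\<Delta> h)"
    by (simp add: lin_ext_comp[OF t] case_prod_unfold lin_ext_gen[OF t])
  also have "\<dots> = SW (\<lambda>x y. SW (\<lambda>a b. f a b y) x) h"
    by (simp add: SW_eq[OF t b1] SW_eq[OF t b3])
  moreover have "lin_ext t (\<lambda>(x, y, z). f x y z)
     (lin_ext fscale (\<lambda>(x, y). lin_ext fscale (\<lambda>(a, b). gen (x, a, b)) (\<Delta> y)) (\<Delta> h))
    = lin_ext t (\<lambda>(x, y). lin_ext t (\<lambda>(a, b). f x a b) (\<Delta> y)) (\<Delta> h)"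
    by (simp add: lin_ext_comp[OF t] case_prod_unfold lin_ext_gen[OF t])
  moreover have "\<dots> = SW (\<lambda>x y. SW (\<lambda>a b. f x a b) y) h"
    by (simp add: SW_eq[OF t b2] SW_eq[OF t b4])
  ultimately show ?thesis using lin_ext_tensor3[OF t f coassoc[of h]] by simp
qed

lemma SW_counit_left: "SW (\<lambda>a b. \<epsilon> a *s b) h = h"
  using SW_eq[OF vs, of "\<lambda>a b. \<epsilon> a *s b" h] counit_left[of h]
  by (simp add: bilin_def lin_def lin_add[OF counit_lin] lin_scale[OF counit_lin] algebra_simps)

lemma SW_counit_right: "SW (\<lambda>a b. \<epsilon> b *s a) h = h"
  using SW_eq[OF vs, of "\<lambda>a b. \<epsilon> b *s a" h] counit_right[of h]
  by (simp add: bilin_def lin_def lin_add[OF counit_lin] lin_scale[OF counit_lin] algebra_simps)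

lemma SW_antipode_left: "SW (\<lambda>a b. S a * b) h = \<epsilon> h *s 1"
  using SW_eq[OF vs, of "\<lambda>a b. S a * b" h] antipode_left[of h]
  by (simp add: bilin_def lin_def lin_add[OF antipode_lin] lin_scale[OF antipode_lin] algebra_simps
      scale_mult_left scale_mult_right)

lemma SW_antipode_right: "SW (\<lambda>a b. a * S b) h = \<epsilon> h *s 1"
  using SW_eq[OF vs, of "\<lambda>a b. a * S b" h] antipode_right[of h]
  by (simp add: bilin_def lin_def lin_add[OF antipode_lin] lin_scale[OF antipode_lin] algebra_simps
      scale_mult_left scale_mult_right)

lemma SW_one:
  assumes t: "vector_space t" and f: "bilin scale t f"
  shows "SW f 1 = f 1 1"
  using lin_ext_tensor2[OF t f comult_one] by (simp add: SW_eq[OF t f] lin_ext_gen[OF t])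

lemma SW_mult:
  assumes t: "vector_space t" and f: "bilin scale t f"
  shows "SW f (x * y) = SW (\<lambda>a b. SW (\<lambda>a' b'. f (a * a') (b * b')) y) x"
proof -
  interpret t: vector_space t by fact
  note fs = lin_add[OF bilin1[OF f]] lin_add[OF bilin2[OF f]] lin_scale[OF bilin1[OF f]] lin_scale[OF bilin2[OF f]]
  have b1: "bilin scale t (\<lambda>a' b'. f (a * a') (b * b'))" for a b
    by (intro bilinI linI) (simp_all add: fs distrib_left scale_mult_right)
  have b2: "bilin scale t (\<lambda>a b. SW (\<lambda>a' b'. f (a * a') (b * b')) y)"
    by (intro bilinI linI) (simp_all add: fs distrib_right scale_mult_left SW_def sum.distrib t.scale_sum_right)
  show ?thesis
    using lin_ext_tensor2[OF t f comult_mult[of x y]]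
    by (simp add: SW_eq[OF t f, unfolded case_prod_unfold] lin_ext_comp[OF t] case_prod_unfold lin_ext_gen[OF t]
       SW_eq[OF t b1, unfolded case_prod_unfold] SW_eq[OF t b2, unfolded case_prod_unfold])
qed

end

section \<open>Subcoalgebras and the Haar functional\<close>

lemma (in tensor_powers) subspace_tensor2_rel: "free_vs.subspace tensor2_rel"
  unfolding tensor2_rel_def by (rule free_vs.subspace_span)

lemma (in tensor_powers) tensor2_eq_refl: "p \<approx>\<^sub>2 p"
  unfolding tensor2_eq_def using free_vs.subspace_0[OF subspace_tensor2_rel] by simp

lemma (in tensor_powers) tensor2_eq_sym: "p \<approx>\<^sub>2 q \<Longrightarrow> q \<approx>\<^sub>2 p"
  unfolding tensor2_eq_def using free_vs.subspace_neg[OF subspace_tensor2_rel, of "p - q"] by simp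

lemma (in tensor_powers) tensor2_eq_trans [trans]: "p \<approx>\<^sub>2 q \<Longrightarrow> q \<approx>\<^sub>2 r \<Longrightarrow> p \<approx>\<^sub>2 r"
  unfolding tensor2_eq_def using free_vs.subspace_add[OF subspace_tensor2_rel, of "p - q" "q - r"] by simp

lemma (in tensor_powers) tensor2_eq_add: "p \<approx>\<^sub>2 q \<Longrightarrow> p' \<approx>\<^sub>2 q' \<Longrightarrow> p + p' \<approx>\<^sub>2 q + q'"
  unfolding tensor2_eq_def using free_vs.subspace_add[OF subspace_tensor2_rel, of "p - q" "p' - q'"]
  by (simp add: algebra_simps)

lemma (in tensor_powers) tensor2_eq_fscale: "p \<approx>\<^sub>2 q \<Longrightarrow> fscale c p \<approx>\<^sub>2 fscale c q"
  unfolding tensor2_eq_def using free_vs.subspace_scale[OF subspace_tensor2_rel, of "p - q" c]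
  by (simp add: free_vs.scale_right_diff_distrib)

lemma (in tensor_powers) tensor2_eq_sum: "(\<And>i. i \<in> A \<Longrightarrow> p i \<approx>\<^sub>2 q i) \<Longrightarrow> (\<Sum>i\<in>A. p i) \<approx>\<^sub>2 (\<Sum>i\<in>A. q i)"
  by (induction A rule: infinite_finite_induct) (auto simp: tensor2_eq_refl intro!: tensor2_eq_add)

lemma (in tensor_powers) tensor2_eq_gen:
  "gen (x + x', y) \<approx>\<^sub>2 gen (x, y) + gen (x', y)"
  "gen (x, y + y') \<approx>\<^sub>2 gen (x, y) + gen (x, y')"
  "gen (c *s x, y) \<approx>\<^sub>2 fscale c (gen (x, y))"
  "gen (x, c *s y) \<approx>\<^sub>2 fscale c (gen (x, y))"
  unfolding tensor2_eq_def tensor2_rel_def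
  by (rule free_vs.span_base, simp add: diff_diff_eq[symmetric], blast)+

lemma (in tensor_powers) tensor2_eq_gen_sum: "gen (\<Sum>i\<in>A. f i, y) \<approx>\<^sub>2 (\<Sum>i\<in>A. gen (f i, y))"
proof (induction A rule: infinite_finite_induct)
  case (insert a A)
  then show ?case
    using tensor2_eq_trans[OF tensor2_eq_gen(1) tensor2_eq_add[OF tensor2_eq_refl insert.IH]] by simp
qed (use tensor2_eq_gen(3)[of 0 0 y] in auto)

lemma (in tensor_powers) tensor2_eq_gen_sum_right: "gen (y, \<Sum>i\<in>A. f i) \<approx>\<^sub>2 (\<Sum>i\<in>A. gen (y, f i))"
proof (induction A rule: infinite_finite_induct)
  case (insert a A)
  then show ?case
    using tensor2_eq_trans[OF tensor2_eq_gen(2) tensor2_eq_add[OF tensor2_eq_refl insert.IH]] by simp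
qed (use tensor2_eq_gen(4)[of y 0 0] in auto)

lemma poly_mapping_sum_gen: "p = (\<Sum>z\<in>Poly_Mapping.keys p. fscale (Poly_Mapping.lookup p z) (gen z))"
proof (rule poly_mapping_eqI)
  fix k
  have "Poly_Mapping.lookup (\<Sum>z\<in>Poly_Mapping.keys p. fscale (Poly_Mapping.lookup p z) (gen z)) k
    = (\<Sum>z\<in>Poly_Mapping.keys p. if z = k then Poly_Mapping.lookup p z else 0)"
    by (simp add: lookup_sum gen_def lookup_single when_def if_distrib cong: if_cong)
  also have "\<dots> = Poly_Mapping.lookup p k"
    by (simp add: in_keys_iff)
  finally show "Poly_Mapping.lookup p k
    = Poly_Mapping.lookup (\<Sum>z\<in>Poly_Mapping.keys p. fscale (Poly_Mapping.lookup p z) (gen z)) k" by simp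
qed

context fd_hopf
begin

lemma tensor2_normal_form:
  "p \<approx>\<^sub>2 (\<Sum>b\<in>B. gen (b, lin_ext scale (\<lambda>(x, y). co b x *s y) p))"
proof -
  let ?c = "\<lambda>z. Poly_Mapping.lookup p z"
  have 1: "gen (x, y) \<approx>\<^sub>2 (\<Sum>b\<in>B. gen (b, co b x *s y))" for x y
  proof -
    have "gen (x, y) \<approx>\<^sub>2 (\<Sum>b\<in>B. gen (co b x *s b, y))"
      using tensor2_eq_gen_sum[of "\<lambda>b. co b x *s b" B y] by (simp add: co_sum)
    also have "\<dots> \<approx>\<^sub>2 (\<Sum>b\<in>B. gen (b, co b x *s y))"
      by (intro tensor2_eq_sum) (meson tensor2_eq_gen tensor2_eq_sym tensor2_eq_trans)
    finally show ?thesis .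
  qed
  have "(\<Sum>z\<in>Poly_Mapping.keys p. fscale (?c z) (gen z))
    \<approx>\<^sub>2 (\<Sum>z\<in>Poly_Mapping.keys p. fscale (?c z) (\<Sum>b\<in>B. gen (b, co b (fst z) *s snd z)))"
    using 1[of "fst z" "snd z" for z] by (intro tensor2_eq_sum tensor2_eq_fscale) simp
  also have "\<dots> = (\<Sum>b\<in>B. \<Sum>z\<in>Poly_Mapping.keys p. fscale (?c z) (gen (b, co b (fst z) *s snd z)))"
    by (subst sum.swap) (simp add: free_vs.scale_sum_right)
  also have "\<dots> \<approx>\<^sub>2 (\<Sum>b\<in>B. \<Sum>z\<in>Poly_Mapping.keys p. gen (b, ?c z *s (co b (fst z) *s snd z)))"
    by (intro tensor2_eq_sum tensor2_eq_sym[OF tensor2_eq_gen(4)])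
  also have "\<dots> \<approx>\<^sub>2 (\<Sum>b\<in>B. gen (b, \<Sum>z\<in>Poly_Mapping.keys p. ?c z *s (co b (fst z) *s snd z)))"
    by (intro tensor2_eq_sum tensor2_eq_sym[OF tensor2_eq_gen_sum_right])
  finally show ?thesis
    using poly_mapping_sum_gen[of p] by (simp add: lin_ext_def case_prod_unfold)
qed

lemma tensor2_eqI:
  assumes "\<And>b. b \<in> B \<Longrightarrow> lin_ext scale (\<lambda>(x, y). co b x *s y) p = lin_ext scale (\<lambda>(x, y). co b x *s y) q"
  shows "p \<approx>\<^sub>2 q"
proof -
  have "(\<Sum>b\<in>B. gen (b, lin_ext scale (\<lambda>(x, y). co b x *s y) p) :: _ \<Rightarrow>\<^sub>0 'k)
    = (\<Sum>b\<in>B. gen (b, lin_ext scale (\<lambda>(x, y). co b x *s y) q))"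
    using assms by (intro sum.cong refl) simp
  then show ?thesis
    by (rule tensor2_eq_trans[OF tensor2_normal_form[of p, THEN back_subst[where P = "\<lambda>r. p \<approx>\<^sub>2 r"]]
        tensor2_eq_sym[OF tensor2_normal_form[of q]]])
qed

text \<open>The slices of \<open>\<Delta> x\<close> in the second tensor factor; those in the first one are \<open>D b x\<close>.\<close>

definition E :: "'h \<Rightarrow> 'h \<Rightarrow> 'h" where
  "E b x = SW (\<lambda>p q. co b q *s p) x"

lemma bilin_co_right: "bilin scale scale (\<lambda>x y. co b y *s x)"
  by (intro bilinI linI) (simp_all add: lin_add[OF co_lin] lin_scale[OF co_lin] algebra_simps)

lemma co_E: "a \<in> B \<Longrightarrow> co a (E c x) = co c (D a x)"
  unfolding E_def SW_def by (simp add: lin_sum[OF co_lin] lin_scale[OF co_lin] co_basis finite_B if_distrib cong: if_cong)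

text \<open>Subcoalgebras in coordinates: closed under contracting either tensor factor of \<open>\<Delta>\<close> with a coordinate functional.\<close>

definition subco :: "'h set \<Rightarrow> bool" where
  "subco C \<longleftrightarrow> subspace C \<and> (\<forall>x\<in>C. \<forall>b\<in>B. D b x \<in> C \<and> E b x \<in> C)"

lemma lin_ext_in_subspace:
  "subspace C \<Longrightarrow> (\<And>z. z \<in> Poly_Mapping.keys p \<Longrightarrow> f z \<in> C) \<Longrightarrow> lin_ext scale f p \<in> C"
  unfolding lin_ext_def by (intro subspace_sum subspace_scale)

text \<open>An element of \<open>H \<otimes> H\<close> lies in \<open>C \<otimes> C\<close> as soon as all its slices do: a projection onto \<open>C\<close>
  in the first factor then fixes it.\<close>

lemma subcoalgebra_iff: "subcoalgebra C \<longleftrightarrow> subco C"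
proof
  assume C: "subcoalgebra C"
  then have sC: "subspace C" by (simp add: subcoalgebra_def)
  show "subco C" unfolding subco_def
  proof (intro conjI ballI sC)
    fix x b assume x: "x \<in> C"
    then obtain p where p: "Poly_Mapping.keys p \<subseteq> C \<times> C" "\<Delta> x \<approx>\<^sub>2 p"
      using C unfolding subcoalgebra_def by blast
    show "D b x \<in> C" unfolding D_def lin_ext_tensor2[OF vs bilin_co p(2)]
      using p(1) by (intro lin_ext_in_subspace sC) (auto intro!: subspace_scale sC)
    show "E b x \<in> C" unfolding E_def SW_eq[OF vs bilin_co_right, symmetric] lin_ext_tensor2[OF vs bilin_co_right p(2)]
      using p(1) by (intro lin_ext_in_subspace sC) (auto intro!: subspace_scale sC)
  qed
next
  assume C: "subco C"
  then have sC: "subspace C" by (simp add: subco_def)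
  interpret vp: vector_space_pair scale scale ..
  obtain \<pi> where \<pi>: "range \<pi> \<subseteq> C" "Vector_Spaces.linear scale scale \<pi>" "\<And>v. v \<in> C \<Longrightarrow> \<pi> v = v"
    using vp.linear_exists_left_inverse_on[OF linear_id sC] by (auto simp: id_def)
  have lpi: "lh \<pi>" using \<pi>(2) by (simp add: lin_iff_linear vs)
  show "subcoalgebra C" unfolding subcoalgebra_def
  proof (intro conjI ballI sC)
    fix x assume x: "x \<in> C"
    let ?p = "\<Sum>b\<in>B. gen (\<pi> b, D b x) :: _ \<Rightarrow>\<^sub>0 'k"
    have Dx: "b \<in> B \<Longrightarrow> D b x \<in> C" and Ex: "b \<in> B \<Longrightarrow> E b x \<in> C" for b
      using C x by (auto simp: subco_def)
    have "Poly_Mapping.keys ?p \<subseteq> (\<Union>b\<in>B. Poly_Mapping.keys (gen (\<pi> b, D b x) :: _ \<Rightarrow>\<^sub>0 'k))"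
      by (rule Poly_Mapping.keys_sum)
    also have "\<dots> \<subseteq> C \<times> C" using \<pi>(1) Dx by (auto simp: gen_def)
    finally have "Poly_Mapping.keys ?p \<subseteq> C \<times> C" .
    moreover have "\<Delta> x \<approx>\<^sub>2 ?p"
    proof (rule tensor2_eqI)
      fix a assume a: "a \<in> B"
      have "lin_ext scale (\<lambda>(x, y). co a x *s y) ?p = (\<Sum>b\<in>B. co a (\<pi> b) *s D b x)"
        by (simp add: lin_sum[OF lin_ext_lin[OF vs]] lin_ext_gen[OF vs])
      also have "\<dots> = D a x"
      proof -
        have "co c (\<Sum>b\<in>B. co a (\<pi> b) *s D b x) = co c (D a x)" if c: "c \<in> B" for c
        proof -
          have "co c (\<Sum>b\<in>B. co a (\<pi> b) *s D b x) = (\<Sum>b\<in>B. co c (D b x) * co a (\<pi> b))"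
            by (simp add: lin_sum[OF co_lin] lin_scale[OF co_lin] mult.commute)
          also have "\<dots> = co a (\<pi> (E c x))"
            unfolding E_def SW_def
            by (simp add: lin_sum[OF lpi] lin_scale[OF lpi] lin_sum[OF co_lin] lin_scale[OF co_lin])
          also have "\<dots> = co c (D a x)" using \<pi>(3)[OF Ex[OF c]] a by (simp add: co_E)
          finally show ?thesis .
        qed
        then show ?thesis
          using co_sum[of "\<Sum>b\<in>B. co a (\<pi> b) *s D b x"] co_sum[of "D a x"] by (metis (no_types, lifting) sum.cong)
      qed
      finally show "lin_ext scale (\<lambda>(x, y). co a x *s y) (\<Delta> x) = lin_ext scale (\<lambda>(x, y). co a x *s y) ?p"
        by (simp add: D_def)
    qed
    ultimately show "\<exists>p. Poly_Mapping.keys p \<subseteq> C \<times> C \<and> \<Delta> x \<approx>\<^sub>2 p" by blast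
  qed
qed

lemma E_lin: "lh (E b)"
  unfolding E_def by (rule SW_lin[OF vs bilin_co_right])

lemma subco_Int: "subco C \<Longrightarrow> subco C' \<Longrightarrow> subco (C \<inter> C')"
  by (auto simp: subco_def subspace_inter)

lemma subco_zero: "subco {0}"
  by (auto simp: subco_def lin_zero[OF D_lin] lin_zero[OF E_lin] subspace_single_0)

lemma subco_sum: "subco C \<Longrightarrow> subco C' \<Longrightarrow> subco {x + y | x y. x \<in> C \<and> y \<in> C'}"
  unfolding subco_def
  by (intro conjI subspace_sums; (simp; fail)?) (auto simp: lin_add[OF D_lin] lin_add[OF E_lin], blast+)

lemma subco_span:
  assumes "\<And>x b. x \<in> X \<Longrightarrow> b \<in> B \<Longrightarrow> D b x \<in> span X \<and> E b x \<in> span X"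
  shows "subco (span X)"
proof -
  have "D b x \<in> span X \<and> E b x \<in> span X" if "x \<in> span X" "b \<in> B" for x b
    using that(1)
    by (induction rule: span_induct_alt)
      (auto simp: lin_zero[OF D_lin] lin_zero[OF E_lin] lin_add[OF D_lin] lin_add[OF E_lin]
        lin_scale[OF D_lin] lin_scale[OF E_lin] span_zero intro!: span_add span_scale dest: assms[OF _ that(2)])
  then show ?thesis by (auto simp: subco_def)
qed

lemma D_one: "D b 1 = co b 1 *s 1"
proof (cases "b \<in> B")
  case True
  have "D b 1 = SW (\<lambda>x y. co b x *s y) 1"
    unfolding D_def by (rule SW_eq[OF vs bilin_co])
  then show ?thesis by (simp add: SW_one[OF vs bilin_co])
qed (simp add: D_out co_out)

lemma E_one: "E b 1 = co b 1 *s 1"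
  unfolding E_def by (rule SW_one[OF vs bilin_co_right])

lemma subco_one: "subco (span {1})"
  by (rule subco_span) (auto simp: D_one E_one intro: span_scale span_base)

lemma D_eq_SW: "D b x = SW (\<lambda>p q. co b p *s q) x"
  unfolding D_def by (rule SW_eq[OF vs bilin_co])

text \<open>A normalised invariant integral on \<open>H\<close>.\<close>

definition haar :: "('h \<Rightarrow> 'k) \<Rightarrow> bool" where
  "haar \<Lambda> \<longleftrightarrow> lf \<Lambda> \<and> \<Lambda> 1 = 1 \<and> (\<forall>x. SW (\<lambda>a b. \<Lambda> b *s a) x = \<Lambda> x *s 1)"

text \<open>A maximal subcoalgebra \<open>M\<close> not containing \<open>1\<close> is a complement of \<open>k1\<close>: a simple subcoalgebra
  outside \<open>k1 + M\<close> would meet \<open>k1 + M\<close> trivially and could be added to \<open>M\<close>. The projection onto \<open>k1\<close>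
  along \<open>M\<close> is invariant because both summands are subcoalgebras.\<close>

lemma haar_exists:
  assumes cs: "cosemisimple"
  shows "\<exists>\<Lambda>. haar \<Lambda>"
proof -
  let ?P = "\<lambda>M. subco M \<and> 1 \<notin> M"
  have fg: "fg V" if "subspace V" for V
    unfolding fg_def using that finite_Basis span_Basis by blast
  have "?P {0}" using subco_zero by simp
  then obtain M where M: "?P M" and max: "\<And>M'. ?P M' \<Longrightarrow> dim M' \<le> dim M"
    using ex_has_greatest_nat[of ?P "{0}" dim "Suc dimension"] dim_subset_UNIV le_imp_less_Suc by metis
  then have sM: "subspace M" by (simp add: subco_def)
  define N where "N = {x + y | x y. x \<in> span {1} \<and> y \<in> M}"
  have sN0: "subco N" unfolding N_def by (rule subco_sum[OF subco_one conjunct1[OF M]])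
  then have sN: "subspace N" by (simp add: subco_def)
  have MN: "M \<subseteq> N" unfolding N_def using span_zero by force
  have oneN: "1 \<in> N" unfolding N_def using span_base[of 1 "{1}"] subspace_0[OF sM] by force
  have "\<Union> {C. simple_subcoalgebra C} \<subseteq> N"
  proof (rule ccontr)
    assume "\<not> ?thesis"
    then obtain C where C: "simple_subcoalgebra C" "\<not> C \<subseteq> N" by blast
    then have sC: "subco C" by (simp add: simple_subcoalgebra_def subcoalgebra_iff)
    have "C \<inter> N = {0} \<or> C \<inter> N = C"
      using C(1) subco_Int[OF sC sN0] unfolding simple_subcoalgebra_def subcoalgebra_iff by (meson Int_lower1)
    then have CN: "C \<inter> N = {0}" using C(2) by (metis Int_lower2)
    define M' where "M' = {x + y | x y. x \<in> C \<and> y \<in> M}"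
    have sM': "subco M'" unfolding M'_def by (rule subco_sum[OF sC conjunct1[OF M]])
    have "1 \<notin> M'"
    proof
      assume "1 \<in> M'"
      then obtain c d where cd: "1 = c + d" "c \<in> C" "d \<in> M" by (unfold M'_def) (elim CollectE exE conjE)
      have "c = 1 - d" unfolding cd(1) by simp
      then have "c \<in> N" using subspace_diff[OF sN oneN subsetD[OF MN cd(3)]] by (simp only:)
      then have "c \<in> C \<inter> N" by (rule IntI[OF cd(2)])
      then have "c = 0" unfolding CN by simp
      then show False using cd M by simp
    qed
    then have le: "dim M' \<le> dim M" using max sM' by blast
    have "0 \<in> C" using sC subspace_0 unfolding subco_def by blast
    then have "M \<subseteq> M'" unfolding M'_def by force
    moreover have "subspace M'" using sM' unfolding subco_def by (rule conjunct1)
    ultimately have "M = M'" using fg_dim_eq[OF fg sM _ le] by (simp only:)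
    moreover have "C \<subseteq> M'" unfolding M'_def using subspace_0[OF sM] by force
    ultimately have "C \<subseteq> M" by (simp only:)
    then show False using C(2) MN by (metis subset_trans)
  qed
  then have "span (\<Union> {C. simple_subcoalgebra C}) \<subseteq> N" by (rule span_minimal[OF _ sN])
  then have N_UNIV: "x \<in> N" for x using cs unfolding cosemisimple_def by blast
  have ex: "\<exists>t. x - t *s 1 \<in> M" for x
  proof -
    obtain k y where "x = k *s 1 + y" "y \<in> M" using N_UNIV[of x] unfolding N_def by (auto simp: span_singleton)
    then have "x - k *s 1 \<in> M" by simp
    then show ?thesis ..
  qed
  have uni: "t = u" if "x - t *s 1 \<in> M" "x - u *s 1 \<in> M" for x t u
  proof (rule ccontr)
    assume "t \<noteq> u"
    have "(u - t) *s 1 \<in> M" using subspace_diff[OF sM that] by (simp add: scale_left_diff_distrib)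
    then have "inverse (u - t) *s ((u - t) *s 1) \<in> M" by (rule subspace_scale[OF sM])
    then show False using M \<open>t \<noteq> u\<close> by simp
  qed
  define \<Lambda> where "\<Lambda> x = (SOME t. x - t *s 1 \<in> M)" for x
  have \<Lambda>: "x - \<Lambda> x *s 1 \<in> M" for x unfolding \<Lambda>_def using ex by (rule someI_ex)
  have \<Lambda>I: "\<Lambda> x = t" if "x - t *s 1 \<in> M" for x t using uni[OF \<Lambda> that] .
  have linL: "lf \<Lambda>"
  proof (rule linI)
    show "\<Lambda> (x + y) = \<Lambda> x + \<Lambda> y" for x y
      using subspace_add[OF sM \<Lambda>[of x] \<Lambda>[of y]] by (intro \<Lambda>I) (simp add: algebra_simps)
    show "\<Lambda> (c *s x) = c * \<Lambda> x" for c x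
      using subspace_scale[OF sM \<Lambda>[of x], of c] by (intro \<Lambda>I) (simp add: algebra_simps)
  qed
  have \<Lambda>M: "\<Lambda> x = 0" if "x \<in> M" for x using that by (intro \<Lambda>I) simp
  have \<Lambda>1: "\<Lambda> 1 = 1" using subspace_0[OF sM] by (intro \<Lambda>I) simp
  have bl: "bilin scale scale (\<lambda>a b. \<Lambda> b *s a)"
    by (intro bilinI linI) (simp_all add: lin_add[OF linL] lin_scale[OF linL] algebra_simps)
  have "SW (\<lambda>a b. \<Lambda> b *s a) x = \<Lambda> x *s 1" for x
  proof -
    let ?d = "x - \<Lambda> x *s 1"
    have "SW (\<lambda>a b. \<Lambda> b *s a) ?d = 0"
      unfolding SW_def using M \<Lambda>[of x] by (intro sum.neutral) (auto simp: subco_def \<Lambda>M)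
    moreover have "SW (\<lambda>a b. \<Lambda> b *s a) x = SW (\<lambda>a b. \<Lambda> b *s a) (?d + \<Lambda> x *s 1)" by simp
    ultimately show ?thesis
      unfolding lin_add[OF SW_lin[OF vs bl]] lin_scale[OF SW_lin[OF vs bl]]
      by (simp add: SW_one[OF vs bl] \<Lambda>1)
  qed
  then show ?thesis unfolding haar_def using linL \<Lambda>1 by blast
qed

end

section \<open>Comodules as multiplicative matrices\<close>

definition fs :: "'k::field \<Rightarrow> ('x \<Rightarrow> 'k) \<Rightarrow> ('x \<Rightarrow> 'k)" where
  "fs c f = (\<lambda>x. c * f x)"

lemma fs_apply [simp]: "fs c f x = c * f x"
  by (simp add: fs_def)

global_interpretation fsp: kspace "fs :: 'k::field \<Rightarrow> ('x \<Rightarrow> 'k) \<Rightarrow> _"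
  by unfold_locales (auto simp: fun_eq_iff algebra_simps)

lemma vs_fs: "vector_space (fs :: 'k::field \<Rightarrow> ('x \<Rightarrow> 'k) \<Rightarrow> _)" ..

lemma sum_apply: "(\<Sum>i\<in>A. f i) x = (\<Sum>i\<in>A. f i x)"
  for f :: "'i \<Rightarrow> 'x \<Rightarrow> 'v::comm_monoid_add"
  by (induction A rule: infinite_finite_induct) auto

lemma sum_rotate3: "(\<Sum>p\<in>A. \<Sum>q\<in>B. \<Sum>l\<in>C. g p q l) = (\<Sum>l\<in>C. \<Sum>p\<in>A. \<Sum>q\<in>B. g p q l)"
  for g :: "'p \<Rightarrow> 'q \<Rightarrow> 'r \<Rightarrow> 'v::comm_monoid_add"
proof -
  have "(\<Sum>q\<in>B. \<Sum>l\<in>C. g p q l) = (\<Sum>l\<in>C. \<Sum>q\<in>B. g p q l)" for p by (rule sum.swap)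
  then show ?thesis by (simp only:) (rule sum.swap)
qed

definition dirac :: "'x \<Rightarrow> 'x \<Rightarrow> 'k::field" where
  "dirac a = (\<lambda>x. if x = a then 1 else 0)"

lemma dirac_sum: "finite A \<Longrightarrow> (\<And>x. x \<notin> A \<Longrightarrow> f x = 0) \<Longrightarrow> f = (\<Sum>a\<in>A. fs (f a) (dirac a))"
  by (auto simp: fun_eq_iff sum_apply dirac_def if_distrib cong: if_cong)

lemma fsp_supported:
  assumes "finite A"
  shows "fsp.fg {f :: 'x \<Rightarrow> 'k::field. \<forall>x. x \<notin> A \<longrightarrow> f x = 0}"
    and "fsp.dim {f :: 'x \<Rightarrow> 'k::field. \<forall>x. x \<notin> A \<longrightarrow> f x = 0} = card A"
proof -
  let ?V = "{f :: 'x \<Rightarrow> 'k. \<forall>x. x \<notin> A \<longrightarrow> f x = 0}"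
  have sub: "fsp.subspace ?V" by (auto simp: fsp.subspace_def)
  have "f \<in> fsp.span (dirac ` A)" if "f \<in> ?V" for f
  proof -
    have "f = (\<Sum>a\<in>A. fs (f a) (dirac a))" using that assms by (intro dirac_sum) auto
    then show ?thesis
      by (metis (no_types, lifting) fsp.span_base fsp.span_scale fsp.span_sum imageI)
  qed
  moreover have "dirac ` A \<subseteq> ?V" by (auto simp: dirac_def)
  ultimately have span: "fsp.span (dirac ` A) = ?V"
    using fsp.span_minimal[OF _ sub] by blast
  have inj: "inj_on (dirac :: 'x \<Rightarrow> 'x \<Rightarrow> 'k) A"
  proof (rule inj_onI)
    fix a b assume "(dirac a :: 'x \<Rightarrow> 'k) = dirac b"
    then have "(dirac a :: 'x \<Rightarrow> 'k) a = dirac b a" by simp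
    then show "a = b" by (auto simp: dirac_def split: if_splits)
  qed
  have "fsp.independent (dirac ` A :: ('x \<Rightarrow> 'k) set)"
  proof (rule fsp.independent_if_scalars_zero)
    show "finite (dirac ` A :: ('x \<Rightarrow> 'k) set)" using assms by simp
    fix f :: "('x \<Rightarrow> 'k) \<Rightarrow> 'k" and x :: "'x \<Rightarrow> 'k" assume 0: "(\<Sum>v\<in>dirac ` A. fs (f v) v) = (0 :: 'x \<Rightarrow> 'k)" and "x \<in> dirac ` A"
    then obtain a where a: "a \<in> A" "x = dirac a" by auto
    have "(\<Sum>v\<in>dirac ` A. fs (f v) v) a = (\<Sum>b\<in>A. f (dirac b) * dirac b a)"
      by (simp add: sum_apply sum.reindex[OF inj])
    also have "\<dots> = f x" using a assms by (simp add: dirac_def if_distrib cong: if_cong)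
    finally show "f x = 0" using 0 by simp
  qed
  then show "fsp.dim ?V = card A"
    using fsp.dim_span_eq_card_independent card_image[OF inj] unfolding span[symmetric] by metis
  show "fsp.fg ?V"
    unfolding span[symmetric] using assms by (intro fsp.fg_span) simp
qed

text \<open>Products of matrices that are indexed by arbitrary finite sets; a matrix vanishes outside its index set.\<close>

definition mc :: "nat set \<Rightarrow> (nat \<times> nat \<Rightarrow> 'k::field) \<Rightarrow> (nat \<times> nat \<Rightarrow> 'k) \<Rightarrow> nat \<times> nat \<Rightarrow> 'k" where
  "mc J T T' = (\<lambda>(i, j). \<Sum>l\<in>J. T (i, l) * T' (l, j))"

definition idm :: "nat set \<Rightarrow> nat \<times> nat \<Rightarrow> 'k::field" where
  "idm J = (\<lambda>(i, j). if i = j \<and> i \<in> J then 1 else 0)"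

definition supp :: "nat set \<Rightarrow> nat set \<Rightarrow> (nat \<times> nat \<Rightarrow> 'k::field) \<Rightarrow> bool" where
  "supp I J T \<longleftrightarrow> (\<forall>p. p \<notin> I \<times> J \<longrightarrow> T p = 0)"

lemma suppD: "supp I J T \<Longrightarrow> i \<notin> I \<or> j \<notin> J \<Longrightarrow> T (i, j) = 0"
  by (auto simp: supp_def)

lemma supp_eqI: "supp I J T \<Longrightarrow> supp I J T' \<Longrightarrow> (\<And>i j. i \<in> I \<Longrightarrow> j \<in> J \<Longrightarrow> T (i, j) = T' (i, j)) \<Longrightarrow> T = T'"
  unfolding supp_def fun_eq_iff by (metis SigmaE)

lemma mc_assoc: "mc K (mc J T T') T'' = mc J T (mc K T' T'')"
  unfolding mc_def
  by (auto simp: fun_eq_iff sum_distrib_left sum_distrib_right mult.assoc intro: sum.swap)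

lemma mc_id_left:
  assumes "finite I" "supp I J T"
  shows "mc I (idm I) T = T"
proof -
  have "mc I (idm I) T (a, b) = T (a, b)" for a b
    using assms by (cases "a \<in> I")
      (auto simp: mc_def idm_def suppD if_distrib[of "\<lambda>t. t * _"] cong: if_cong)
  then show ?thesis by (auto simp: fun_eq_iff)
qed

lemma mc_id_right: "finite J \<Longrightarrow> supp I J T \<Longrightarrow> mc J T (idm J) = T"
  by (auto simp: mc_def idm_def fun_eq_iff suppD if_distrib cong: if_cong)

lemma supp_mc: "supp I J T \<Longrightarrow> supp J K T' \<Longrightarrow> supp I K (mc J T T')"
  by (auto simp: supp_def mc_def)

lemma supp_idm: "supp I I (idm I)" by (auto simp: supp_def idm_def)

lemma mc_linear:
  "mc J (T + T') U = mc J T U + mc J T' U" "mc J (fs c T) U = fs c (mc J T U)"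
  "mc J U (T + T') = mc J U T + mc J U T'" "mc J U (fs c T) = fs c (mc J U T)"
  "mc J (T - T') U = mc J T U - mc J T' U" "mc J U (T - T') = mc J U T - mc J U T'"
  "mc J 0 U = 0" "mc J U 0 = 0"
  by (auto simp: mc_def fun_eq_iff distrib_left distrib_right sum.distrib sum_distrib_left mult.assoc
      mult.left_commute left_diff_distrib right_diff_distrib sum_subtractf)

lemma generalized_inverse:
  fixes N :: "nat \<times> nat \<Rightarrow> 'k::field"
  assumes fin: "finite I" "finite J" and N: "supp I J N"
  shows "\<exists>M. supp J I M \<and> mc J N (mc I M N) = N"
proof -
  let ?f = "\<lambda>v i. if i \<in> I then \<Sum>j\<in>J. N (i, j) * v j else 0"
  let ?V = "{v :: nat \<Rightarrow> 'k. \<forall>x. x \<notin> J \<longrightarrow> v x = 0}"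
  interpret vp: vector_space_pair "fs :: 'k \<Rightarrow> (nat \<Rightarrow> 'k) \<Rightarrow> _" "fs :: 'k \<Rightarrow> (nat \<Rightarrow> 'k) \<Rightarrow> _" ..
  have f: "Vector_Spaces.linear fs fs ?f"
    unfolding lin_iff_linear[OF vs_fs vs_fs, symmetric]
    by (intro linI) (auto simp: fun_eq_iff distrib_left sum.distrib sum_distrib_left mult.left_commute)
  have V: "fsp.subspace ?V" by (auto simp: fsp.subspace_def)
  obtain g where g': "range g \<subseteq> ?V \<and> Vector_Spaces.linear fs fs g \<and> (\<forall>v\<in>?f ` ?V. ?f (g v) = v)"
    using vp.linear_exists_right_inverse_on[OF f V] by (elim exE)
  note g = conjunct1[OF g'] conjunct1[OF conjunct2[OF g']] bspec[OF conjunct2[OF conjunct2[OF g']]]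
  have lg: "lin fs fs g" using g(2) unfolding lin_iff_linear[OF vs_fs vs_fs] .
  define M where "M = (\<lambda>(j, i). if i \<in> I then g (dirac i) j else 0)"
  have "supp J I M" unfolding supp_def M_def using g(1) by auto
  moreover have "mc J N (mc I M N) = N"
  proof (rule supp_eqI)
    show "supp I J (mc J N (mc I M N))"
      by (rule supp_mc[OF N supp_mc[OF \<open>supp J I M\<close> N]])
    fix i j assume ij: "i \<in> I" "j \<in> J"
    let ?w = "\<lambda>i. N (i, j)"
    have w: "?w = ?f (dirac j)"
      using N ij fin by (auto simp: fun_eq_iff dirac_def if_distrib suppD cong: if_cong)
    then have "?f (g ?w) = ?w" using ij by (intro g(3)) (auto simp: dirac_def)
    moreover have "g ?w l = (\<Sum>i\<in>I. M (l, i) * N (i, j))" for l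
    proof -
      have "?w = (\<Sum>i\<in>I. fs (?w i) (dirac i))" by (rule dirac_sum) (use fin N in \<open>auto simp: suppD\<close>)
      then have "g ?w = g (\<Sum>i\<in>I. fs (?w i) (dirac i))" by (rule arg_cong)
      also have "\<dots> = (\<Sum>i\<in>I. fs (?w i) (g (dirac i)))" by (simp add: lin_sum[OF lg] lin_scale[OF lg])
      finally have "g ?w = (\<Sum>i\<in>I. fs (?w i) (g (dirac i)))" .
      then show ?thesis by (auto simp: sum_apply M_def mult.commute intro!: sum.cong)
    qed
    ultimately show "mc J N (mc I M N) (i, j) = N (i, j)"
      using ij by (auto simp: mc_def fun_eq_iff dest!: spec[of _ i])
  qed (fact N)
  ultimately show ?thesis by blast
qed

type_synonym 'h comd = "nat set \<times> (nat \<Rightarrow> nat \<Rightarrow> 'h)"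

abbreviation ix :: "'h comd \<Rightarrow> nat set" where "ix \<equiv> fst"
abbreviation mt :: "'h comd \<Rightarrow> nat \<Rightarrow> nat \<Rightarrow> 'h" where "mt \<equiv> snd"

context fd_hopf
begin

text \<open>A comodule with chosen basis is a square matrix \<open>c\<close> over \<open>H\<close> with \<open>\<Delta> c\<^sub>i\<^sub>j = \<Sum>\<^sub>l c\<^sub>i\<^sub>l \<otimes> c\<^sub>l\<^sub>j\<close> and \<open>\<epsilon> c = 1\<close>. Index sets are sets of naturals, so
  that all comodules live in one type. The comultiplication is tested on pairs of functionals.\<close>

definition comod :: "'h comd \<Rightarrow> bool" where
  "comod X \<longleftrightarrow> finite (ix X) \<and> (\<forall>i\<in>ix X. \<forall>j\<in>ix X. \<epsilon> (mt X i j) = (if i = j then 1 else 0) \<and>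
     (\<forall>\<phi> \<psi>. lf \<phi> \<longrightarrow> lf \<psi> \<longrightarrow>
        SW (\<lambda>a b. \<phi> a * \<psi> b) (mt X i j) = (\<Sum>l\<in>ix X. \<phi> (mt X i l) * \<psi> (mt X l j))))"

lemma comod_finite: "comod X \<Longrightarrow> finite (ix X)"
  and comod_counit: "comod X \<Longrightarrow> i \<in> ix X \<Longrightarrow> j \<in> ix X \<Longrightarrow> \<epsilon> (mt X i j) = (if i = j then 1 else 0)"
  by (simp_all add: comod_def)

lemma bilin_expand:
  assumes t: "vector_space t" and f: "bilin scale t f"
  shows "f x y = (\<Sum>p\<in>B. \<Sum>q\<in>B. t (co p x * co q y) (f p q))"
proof -
  interpret t: vector_space t by fact
  have "f x y = (\<Sum>p\<in>B. t (co p x) (f p y))" using lin_co[OF bilin2[OF f]] .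
  also have "\<dots> = (\<Sum>p\<in>B. t (co p x) (\<Sum>q\<in>B. t (co q y) (f p q)))"
    using lin_co[OF bilin1[OF f]] by (intro sum.cong refl arg_cong[where f = "t _"])
  finally show ?thesis by (simp add: t.scale_sum_right)
qed

lemma comod_SW:
  assumes X: "comod X" "i \<in> ix X" "j \<in> ix X" and t: "vector_space t" and f: "bilin scale t f"
  shows "SW f (mt X i j) = (\<Sum>l\<in>ix X. f (mt X i l) (mt X l j))"
proof -
  interpret t: vector_space t by fact
  have "SW f (mt X i j) = SW (\<lambda>x y. \<Sum>p\<in>B. \<Sum>q\<in>B. t (co p x * co q y) (f p q)) (mt X i j)"
    using bilin_expand[OF t f] by (rule SW_cong)
  also have "\<dots> = (\<Sum>p\<in>B. \<Sum>q\<in>B. t (SW (\<lambda>x y. co p x * co q y) (mt X i j)) (f p q))"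
    unfolding SW_def t.scale_sum_left by (subst sum.swap, rule sum.cong[OF refl], rule sum.swap)
  also have "\<dots> = (\<Sum>p\<in>B. \<Sum>q\<in>B. \<Sum>l\<in>ix X. t (co p (mt X i l) * co q (mt X l j)) (f p q))"
    using X by (simp add: comod_def co_lin t.scale_sum_left)
  also have "\<dots> = (\<Sum>l\<in>ix X. \<Sum>p\<in>B. \<Sum>q\<in>B. t (co p (mt X i l) * co q (mt X l j)) (f p q))"
    by (rule sum_rotate3)
  also have "\<dots> = (\<Sum>l\<in>ix X. f (mt X i l) (mt X l j))"
    by (simp only: bilin_expand[OF t f, symmetric])
  finally show ?thesis .
qed

lemma comodI:
  assumes "finite J" "\<And>i j. i \<in> J \<Longrightarrow> j \<in> J \<Longrightarrow> \<epsilon> (c i j) = (if i = j then 1 else 0)"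
    "\<And>i j \<phi> \<psi>. i \<in> J \<Longrightarrow> j \<in> J \<Longrightarrow> lf \<phi> \<Longrightarrow> lf \<psi> \<Longrightarrow>
      SW (\<lambda>a b. \<phi> a * \<psi> b) (c i j) = (\<Sum>l\<in>J. \<phi> (c i l) * \<psi> (c l j))"
  shows "comod (J, c)"
  using assms by (simp add: comod_def)

lemma bilin_functionals: "lf \<phi> \<Longrightarrow> lf \<psi> \<Longrightarrow> bilin scale (*) (\<lambda>a b. \<phi> a * \<psi> b)"
  by (auto simp: bilin_def lin_def algebra_simps)

lemma bilin_S_mult: "bilin scale scale (\<lambda>a b. S a * b)" "bilin scale scale (\<lambda>a b. a * S b)"
  by (simp_all add: bilin_def lin_def lin_add[OF antipode_lin] lin_scale[OF antipode_lin] algebra_simps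
      scale_mult_left scale_mult_right)

lemma comod_S_left:
  "comod X \<Longrightarrow> i \<in> ix X \<Longrightarrow> j \<in> ix X \<Longrightarrow> (\<Sum>l\<in>ix X. S (mt X i l) * mt X l j) = (if i = j then 1 else 0)"
  using comod_SW[OF _ _ _ vs bilin_S_mult(1), of X i j] SW_antipode_left[of "mt X i j"]
  by (auto simp: comod_counit split: if_splits)

lemma comod_S_right:
  "comod X \<Longrightarrow> i \<in> ix X \<Longrightarrow> j \<in> ix X \<Longrightarrow> (\<Sum>l\<in>ix X. mt X i l * S (mt X l j)) = (if i = j then 1 else 0)"
  using comod_SW[OF _ _ _ vs bilin_S_mult(2), of X i j] SW_antipode_right[of "mt X i j"]
  by (auto simp: comod_counit split: if_splits)

lemma S_one: "S 1 = 1"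
proof -
  have "SW (\<lambda>a b. S a * b) 1 = S 1 * 1" by (rule SW_one[OF vs bilin_S_mult(1)])
  then show ?thesis using SW_antipode_left[of 1] by (simp add: counit_one)
qed

text \<open>Both sides are entries of an inverse of the matrix \<open>\<Delta> c\<close> over \<open>H \<otimes> H\<close>.\<close>

lemma SW_antipode:
  assumes X: "comod X" "i \<in> ix X" "j \<in> ix X" and t: "vector_space t" and f: "bilin scale t f"
  shows "SW f (S (mt X i j)) = (\<Sum>l\<in>ix X. f (S (mt X l j)) (S (mt X i l)))"
proof -
  interpret t: vector_space t by fact
  let ?J = "ix X" and ?c = "mt X"
  note fin = comod_finite[OF X(1)]
  note fs = lin_add[OF bilin1[OF f]] lin_add[OF bilin2[OF f]] lin_scale[OF bilin1[OF f]] lin_scale[OF bilin2[OF f]]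
    lin_sum[OF bilin1[OF f]] lin_sum[OF bilin2[OF f]] lin_zero[OF bilin1[OF f]] lin_zero[OF bilin2[OF f]]
  have bf: "bilin scale t (\<lambda>a b. f (a * s) (b * u))" for s u
    by (intro bilinI linI) (simp_all add: fs distrib_right scale_mult_left)
  \<comment> \<open>\<open>\<Delta>(c) \<cdot> G = 1\<close> with \<open>G\<close> the right-hand side\<close>
  have G: "(\<Sum>k\<in>?J. \<Sum>m\<in>?J. \<Sum>p\<in>?J. f (a * (?c l p * S (?c m j))) (b * (?c p k * S (?c k m)))) = (if l = j then f a b else 0)"
    if l: "l \<in> ?J" for l a b
  proof -
    have "(\<Sum>k\<in>?J. \<Sum>m\<in>?J. \<Sum>p\<in>?J. f (a * (?c l p * S (?c m j))) (b * (?c p k * S (?c k m))))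
      = (\<Sum>m\<in>?J. \<Sum>p\<in>?J. f (a * (?c l p * S (?c m j))) (b * (\<Sum>k\<in>?J. ?c p k * S (?c k m))))"
      by (subst sum.swap, rule sum.cong[OF refl], subst sum.swap) (simp add: fs sum_distrib_left)
    also have "\<dots> = (\<Sum>m\<in>?J. \<Sum>p\<in>?J. if p = m then f (a * (?c l p * S (?c m j))) b else 0)"
      by (intro sum.cong refl) (simp add: comod_S_right[OF X(1)] fs)
    also have "\<dots> = (\<Sum>m\<in>?J. f (a * (?c l m * S (?c m j))) b)"
      by (simp add: fin)
    also have "\<dots> = f (a * (\<Sum>m\<in>?J. ?c l m * S (?c m j))) b"
      by (simp add: fs sum_distrib_left)
    finally show ?thesis using l X by (simp add: comod_S_right[OF X(1)] fs)
  qed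
  have "SW f (S (?c i j)) = (\<Sum>l\<in>?J. if l = j then SW f (S (?c i l)) else 0)"
    using X fin by simp
  also have "\<dots> = (\<Sum>l\<in>?J. SW (\<lambda>a b. if l = j then f a b else 0) (S (?c i l)))"
    by (intro sum.cong refl) (simp add: SW_def)
  also have "\<dots> = (\<Sum>l\<in>?J. SW (\<lambda>a b. \<Sum>k\<in>?J. \<Sum>m\<in>?J. \<Sum>p\<in>?J. f (a * (?c l p * S (?c m j))) (b * (?c p k * S (?c k m)))) (S (?c i l)))"
    by (intro sum.cong refl SW_cong) (simp add: G)
  also have "\<dots> = (\<Sum>l\<in>?J. \<Sum>k\<in>?J. \<Sum>m\<in>?J. SW (\<lambda>a b. \<Sum>p\<in>?J. f (a * (?c l p * S (?c m j))) (b * (?c p k * S (?c k m)))) (S (?c i l)))"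
    unfolding SW_def
    by (intro sum.cong refl) (subst sum.swap, intro sum.cong refl, rule sum.swap)
  also have "\<dots> = (\<Sum>k\<in>?J. \<Sum>m\<in>?J. \<Sum>l\<in>?J. SW (\<lambda>a b. SW (\<lambda>a' b'. f (a * a' * S (?c m j)) (b * b' * S (?c k m))) (?c l k)) (S (?c i l)))"
  proof -
    have "SW (\<lambda>a b. \<Sum>p\<in>?J. f (a * (?c l p * S (?c m j))) (b * (?c p k * S (?c k m)))) (S (?c i l))
      = SW (\<lambda>a b. SW (\<lambda>a' b'. f (a * a' * S (?c m j)) (b * b' * S (?c k m))) (?c l k)) (S (?c i l))"
      if "l \<in> ?J" "k \<in> ?J" for l k m
    proof (rule SW_cong)
      fix a b
      have "bilin scale t (\<lambda>a' b'. f (a * a' * S (?c m j)) (b * b' * S (?c k m)))"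
        by (intro bilinI linI) (simp_all add: fs distrib_right distrib_left scale_mult_left scale_mult_right)
      from comod_SW[OF X(1) that t this]
      show "(\<Sum>p\<in>?J. f (a * (?c l p * S (?c m j))) (b * (?c p k * S (?c k m))))
        = SW (\<lambda>a' b'. f (a * a' * S (?c m j)) (b * b' * S (?c k m))) (?c l k)"
        by (simp add: mult.assoc)
    qed
    then show ?thesis
      by (subst sum_rotate3[symmetric]) (intro sum.cong refl, simp)
  qed
  also have "\<dots> = (\<Sum>k\<in>?J. \<Sum>m\<in>?J. \<Sum>l\<in>?J. SW (\<lambda>a b. f (a * S (?c m j)) (b * S (?c k m))) (S (?c i l) * ?c l k))"
    by (simp add: SW_mult[OF t bf])
  also have "\<dots> = (\<Sum>k\<in>?J. \<Sum>m\<in>?J. SW (\<lambda>a b. f (a * S (?c m j)) (b * S (?c k m))) (\<Sum>l\<in>?J. S (?c i l) * ?c l k))"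
    by (simp add: lin_sum[OF SW_lin[OF t bf]])
  also have "\<dots> = (\<Sum>k\<in>?J. \<Sum>m\<in>?J. if i = k then f (S (?c m j)) (S (?c i m)) else 0)"
    using X by (intro sum.cong refl) (simp add: comod_S_left SW_one[OF t bf] lin_zero[OF SW_lin[OF t bf]])
  also have "\<dots> = (\<Sum>m\<in>?J. f (S (?c m j)) (S (?c i m)))"
    using X fin by (subst sum.swap) simp
  finally show ?thesis .
qed

subsection \<open>Homomorphisms, tensor products and duals\<close>

definition Hom :: "'h comd \<Rightarrow> 'h comd \<Rightarrow> (nat \<times> nat \<Rightarrow> 'k) set" where
  "Hom X Y = {T. supp (ix Y) (ix X) T \<and>
     (\<forall>i\<in>ix Y. \<forall>j\<in>ix X. (\<Sum>l\<in>ix Y. T (l, j) *s mt Y i l) = (\<Sum>l\<in>ix X. T (i, l) *s mt X l j))}"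

lemma HomD:
  "T \<in> Hom X Y \<Longrightarrow> i \<in> ix Y \<Longrightarrow> j \<in> ix X \<Longrightarrow> (\<Sum>l\<in>ix Y. T (l, j) *s mt Y i l) = (\<Sum>l\<in>ix X. T (i, l) *s mt X l j)"
  and Hom_supp: "T \<in> Hom X Y \<Longrightarrow> supp (ix Y) (ix X) T"
  by (simp_all add: Hom_def)

lemma subspace_Hom: "fsp.subspace (Hom X Y)"
  unfolding fsp.subspace_def Hom_def supp_def
  by (auto simp: scale_left_distrib sum.distrib scale_sum_right[symmetric] scale_scale[symmetric] simp del: scale_scale)

lemma fg_Hom: "comod X \<Longrightarrow> comod Y \<Longrightarrow> fsp.fg (Hom X Y)"
  by (rule fsp.fg_subset[OF fsp_supported(1)[of "ix Y \<times> ix X"] subspace_Hom])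
    (auto simp: comod_finite Hom_def supp_def)

definition m :: "'h comd \<Rightarrow> 'h comd \<Rightarrow> nat" where
  "m X Y = fsp.dim (Hom X Y)"

lemma Hom_comp:
  assumes T: "T \<in> Hom Y Z" and T': "T' \<in> Hom X Y"
  shows "mc (ix Y) T T' \<in> Hom X Z"
proof -
  have "(\<Sum>l\<in>ix Z. mc (ix Y) T T' (l, j) *s mt Z i l) = (\<Sum>l\<in>ix X. mc (ix Y) T T' (i, l) *s mt X l j)"
    if "i \<in> ix Z" "j \<in> ix X" for i j
  proof -
    have "(\<Sum>l\<in>ix Z. mc (ix Y) T T' (l, j) *s mt Z i l) = (\<Sum>y\<in>ix Y. T' (y, j) *s (\<Sum>l\<in>ix Z. T (l, y) *s mt Z i l))"
      unfolding mc_def by (simp add: scale_sum_left scale_sum_right mult.commute) (rule sum.swap)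
    also have "\<dots> = (\<Sum>y\<in>ix Y. T' (y, j) *s (\<Sum>l\<in>ix Y. T (i, l) *s mt Y l y))"
      using HomD[OF T that(1)] by simp
    also have "\<dots> = (\<Sum>l\<in>ix Y. T (i, l) *s (\<Sum>y\<in>ix Y. T' (y, j) *s mt Y l y))"
      by (simp add: scale_sum_right mult.commute) (rule sum.swap)
    also have "\<dots> = (\<Sum>l\<in>ix Y. T (i, l) *s (\<Sum>x\<in>ix X. T' (l, x) *s mt X x j))"
      using HomD[OF T' _ that(2)] by simp
    also have "\<dots> = (\<Sum>l\<in>ix X. mc (ix Y) T T' (i, l) *s mt X l j)"
      unfolding mc_def by (simp add: scale_sum_left scale_sum_right) (rule sum.swap)
    finally show ?thesis .
  qed
  then show ?thesis using supp_mc[OF Hom_supp[OF T] Hom_supp[OF T']] by (simp add: Hom_def)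
qed

lemma Hom_id: "comod X \<Longrightarrow> idm (ix X) \<in> Hom X X"
  unfolding Hom_def using supp_idm[of "ix X"]
  by (simp add: idm_def comod_finite if_distrib[of "\<lambda>t. t *s _"] cong: if_cong)

lemma Hom_S: "T \<in> Hom X Y \<Longrightarrow> i \<in> ix Y \<Longrightarrow> j \<in> ix X \<Longrightarrow>
    (\<Sum>l\<in>ix Y. T (l, j) *s S (mt Y i l)) = (\<Sum>l\<in>ix X. T (i, l) *s S (mt X l j))"
  using arg_cong[OF HomD, of T X Y i j S] by (simp add: lin_sum[OF antipode_lin] lin_scale[OF antipode_lin])

definition tn :: "'h comd \<Rightarrow> 'h comd \<Rightarrow> 'h comd" where
  "tn X Y = (prod_encode ` (ix X \<times> ix Y),
     \<lambda>p q. mt X (fst (prod_decode p)) (fst (prod_decode q)) * mt Y (snd (prod_decode p)) (snd (prod_decode q)))"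

definition du :: "'h comd \<Rightarrow> 'h comd" where
  "du X = (ix X, \<lambda>i j. S (mt X j i))"

definition un :: "'h comd" where
  "un = ({0}, \<lambda>_ _. 1)"

lemma ix_tn: "ix (tn X Y) = prod_encode ` (ix X \<times> ix Y)"
  and mt_tn: "mt (tn X Y) (prod_encode (i, k)) (prod_encode (j, l)) = mt X i j * mt Y k l"
  and mem_tn: "prod_encode (i, k) \<in> ix (tn X Y) \<longleftrightarrow> i \<in> ix X \<and> k \<in> ix Y"
  by (auto simp: tn_def)

lemma sum_tn: "(\<Sum>p\<in>ix (tn X Y). g p) = (\<Sum>i\<in>ix X. \<Sum>k\<in>ix Y. g (prod_encode (i, k)))"
  unfolding ix_tn by (subst sum.reindex) (auto simp: inj_prod_encode sum.cartesian_product case_prod_unfold)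

lemma ball_tn: "(\<forall>p\<in>ix (tn X Y). P p) \<longleftrightarrow> (\<forall>i\<in>ix X. \<forall>k\<in>ix Y. P (prod_encode (i, k)))"
  unfolding ix_tn by auto

lemma ix_du: "ix (du X) = ix X" and mt_du: "mt (du X) i j = S (mt X j i)"
  by (simp_all add: du_def)

lemma ix_un: "ix un = {0}" and mt_un: "mt un i j = 1"
  by (simp_all add: un_def)

lemma counit_S: "comod X \<Longrightarrow> i \<in> ix X \<Longrightarrow> j \<in> ix X \<Longrightarrow> \<epsilon> (S (mt X i j)) = (if i = j then 1 else 0)"
proof -
  assume X: "comod X" "i \<in> ix X" "j \<in> ix X"
  have "\<epsilon> (\<Sum>l\<in>ix X. S (mt X i l) * mt X l j) = \<epsilon> (S (mt X i j))"
    using X comod_finite[OF X(1)] by (simp add: lin_sum[OF counit_lin] counit_mult comod_counit if_distrib cong: if_cong)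
  then show ?thesis using comod_S_left[OF X] by (auto simp: counit_one lin_zero[OF counit_lin] split: if_splits)
qed

lemma comod_du: "comod X \<Longrightarrow> comod (du X)"
  unfolding du_def
  by (intro comodI) (auto simp: comod_finite counit_S SW_antipode[OF _ _ _ vector_space_mult bilin_functionals])

lemma comod_un: "comod un"
  unfolding un_def
  by (intro comodI) (auto simp: counit_one SW_one[OF vector_space_mult bilin_functionals])

lemma comod_tn:
  assumes X: "comod X" and Y: "comod Y"
  shows "comod (tn X Y)"
proof -
  have "SW (\<lambda>a b. \<phi> a * \<psi> b) (mt X i j * mt Y k l)
     = (\<Sum>m\<in>ix X. \<Sum>n\<in>ix Y. \<phi> (mt X i m * mt Y k n) * \<psi> (mt X m j * mt Y n l))"
    if "i \<in> ix X" "j \<in> ix X" "k \<in> ix Y" "l \<in> ix Y" and \<phi>: "lf \<phi>" and \<psi>: "lf \<psi>" for i j k l \<phi> \<psi>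
  proof -
    note b = bilin_functionals[OF \<phi> \<psi>]
    note fs = lin_add[OF \<phi>] lin_add[OF \<psi>] lin_scale[OF \<phi>] lin_scale[OF \<psi>]
    have b1: "bilin scale (*) (\<lambda>a' b'. \<phi> (a * a') * \<psi> (b * b'))" for a b
      by (intro bilinI linI) (simp_all add: fs algebra_simps scale_mult_right)
    have b2: "bilin scale (*) (\<lambda>a b. \<Sum>n\<in>ix Y. \<phi> (a * mt Y k n) * \<psi> (b * mt Y n l))"
      by (intro bilinI linI) (simp_all add: fs algebra_simps scale_mult_left sum.distrib sum_distrib_left)
    have "SW (\<lambda>a b. \<phi> a * \<psi> b) (mt X i j * mt Y k l)
      = SW (\<lambda>a b. SW (\<lambda>a' b'. \<phi> (a * a') * \<psi> (b * b')) (mt Y k l)) (mt X i j)"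
      by (rule SW_mult[OF vector_space_mult b])
    also have "\<dots> = SW (\<lambda>a b. \<Sum>n\<in>ix Y. \<phi> (a * mt Y k n) * \<psi> (b * mt Y n l)) (mt X i j)"
      by (rule SW_cong, rule comod_SW[OF Y that(3,4) vector_space_mult b1])
    finally show ?thesis
      by (simp only: comod_SW[OF X that(1,2) vector_space_mult b2])
  qed
  then have "\<forall>p\<in>ix (tn X Y). \<forall>q\<in>ix (tn X Y). \<epsilon> (mt (tn X Y) p q) = (if p = q then 1 else 0) \<and>
     (\<forall>\<phi> \<psi>. lf \<phi> \<longrightarrow> lf \<psi> \<longrightarrow> SW (\<lambda>a b. \<phi> a * \<psi> b) (mt (tn X Y) p q)
       = (\<Sum>l\<in>ix (tn X Y). \<phi> (mt (tn X Y) p l) * \<psi> (mt (tn X Y) l q)))"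
    using X Y unfolding ball_tn sum_tn mt_tn by (auto simp: counit_mult comod_counit)
  then show ?thesis unfolding comod_def ix_tn using X Y by (auto simp: comod_finite)
qed

end

section \<open>Semisimplicity of the comodule category\<close>

text \<open>Eigenvectors exist because some nonzero polynomial in \<open>L\<close> kills \<open>x\<close>; its linear factors are
  peeled off one at a time.\<close>

lemma (in kspace) poly_annihilates:
  assumes L: "lin scale scale L" and V: "fg V" "L ` V \<subseteq> V" and x: "x \<in> V"
  shows "\<exists>p. p \<noteq> 0 \<and> (\<forall>n>degree p. (\<Sum>i<n. scale (coeff p i) ((L ^^ i) x)) = 0)"
proof -
  interpret vp: kspace_pair "fs :: 'a \<Rightarrow> (nat \<Rightarrow> 'a) \<Rightarrow> _" scale ..
  define d where "d = Suc (dim V)"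
  let ?A = "{f :: nat \<Rightarrow> 'a. \<forall>x. x \<notin> {..<d} \<longrightarrow> f x = 0}"
  let ?f = "\<lambda>c. \<Sum>i<d. scale (c i) ((L ^^ i) x)"
  have A: "fsp.fg ?A" "fsp.dim ?A = d" using fsp_supported[of "{..<d}"] by simp_all
  have Lx: "(L ^^ i) x \<in> V" for i using x V(2) by (induction i) auto
  have sV: "subspace V" using V(1) by (rule fg_subspace)
  have f: "Vector_Spaces.linear fs scale ?f"
    unfolding lin_iff_linear[OF vs_fs vector_space_axioms, symmetric]
    by (intro linI) (simp_all add: scale_left_distrib sum.distrib scale_sum_right)
  have "\<not> (\<forall>c\<in>?A. ?f c = 0 \<longrightarrow> c = 0)"
  proof
    assume "\<forall>c\<in>?A. ?f c = 0 \<longrightarrow> c = 0"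
    then have "dim (?f ` ?A) = d" using vp.dim_inj_image(2)[OF f A(1)] A(2) by simp
    moreover have "subspace (?f ` ?A)"
      using fg_subspace[OF vp.dim_inj_image(1)[OF f A(1)]] \<open>\<forall>c\<in>?A. ?f c = 0 \<longrightarrow> c = 0\<close> by simp
    moreover have "?f ` ?A \<subseteq> V" by (auto intro!: subspace_sum[OF sV] subspace_scale[OF sV] Lx)
    ultimately show False using fg_dim_mono[OF V(1)] unfolding d_def by fastforce
  qed
  then obtain c where c: "c \<in> ?A" "?f c = 0" "c \<noteq> 0" by auto
  define p where "p = (\<Sum>i<d. monom (c i) i)"
  have cp: "coeff p i = c i" for i
    using c(1) unfolding p_def by (simp add: coeff_sum if_distrib cong: if_cong)
  have "(\<Sum>i<n. scale (coeff p i) ((L ^^ i) x)) = 0" if n: "n > degree p" for n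
  proof -
    have "(\<Sum>i<n. scale (coeff p i) ((L ^^ i) x)) = (\<Sum>i<max n d. scale (coeff p i) ((L ^^ i) x))"
      by (rule sum.mono_neutral_left) (use n in \<open>auto simp: coeff_eq_0\<close>)
    also have "\<dots> = (\<Sum>i<d. scale (coeff p i) ((L ^^ i) x))"
      by (rule sum.mono_neutral_right) (use c(1) in \<open>auto simp: cp\<close>)
    finally show ?thesis using c(2) by (simp add: cp)
  qed
  moreover have "p \<noteq> 0" using c(3) cp by (auto simp: fun_eq_iff)
  ultimately show ?thesis by blast
qed

locale kspace_alg_closed = kspace scale
  for scale :: "'a::alg_closed_field \<Rightarrow> 'b::ab_group_add \<Rightarrow> 'b"
begin

lemma eigenvector:
  assumes L: "lin scale scale L" and V: "fg V" "L ` V \<subseteq> V" and x: "x \<in> V" "x \<noteq> 0"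
  shows "\<exists>z v. v \<in> V \<and> v \<noteq> 0 \<and> L v = scale z v"
proof -
  have sV: "subspace V" using V(1) by (rule fg_subspace)
  have Lx: "(L ^^ i) x \<in> V" for i using x V(2) by (induction i) auto
  have "\<exists>z v. v \<in> V \<and> v \<noteq> 0 \<and> L v = scale z v"
    if "p \<noteq> 0" "\<forall>n>degree p. (\<Sum>i<n. scale (coeff p i) ((L ^^ i) x)) = 0" for p
    using that
  proof (induction "degree p" arbitrary: p rule: less_induct)
    case less
    show ?case
    proof (cases "degree p = 0")
      case True
      then have "scale (coeff p 0) x = 0" using less.prems(2)[rule_format, of "Suc 0"] by simp
      moreover have "coeff p 0 \<noteq> 0" using True less.prems(1) by (metis leading_coeff_0_iff)
      ultimately show ?thesis using x(2) by simp
    next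
      case False
      then obtain z where "poly p z = 0" using alg_closed_imp_poly_has_root by blast
      then obtain q where p: "p = [:-z, 1:] * q" by (metis dvdE poly_eq_0_iff_dvd)
      have q0: "q \<noteq> 0" using less.prems(1) p by auto
      have dq: "degree p = Suc (degree q)" unfolding p using q0 by (subst degree_mult_eq) auto
      define P where "P n = (\<Sum>i<n. scale (coeff q i) ((L ^^ i) x))" for n
      have Pc: "P n = P (Suc (degree q))" if "n > degree q" for n
        unfolding P_def by (rule sum.mono_neutral_right) (use that in \<open>auto simp: coeff_eq_0\<close>)
      let ?n = "Suc (Suc (degree q))"
      have cp: "coeff p i = (case i of 0 \<Rightarrow> 0 | Suc j \<Rightarrow> coeff q j) - z * coeff q i" for i
        unfolding p by (cases i) auto
      have "degree p < ?n" using dq by simp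
      then have "0 = (\<Sum>i<?n. scale (coeff p i) ((L ^^ i) x))" by (rule less.prems(2)[rule_format, symmetric])
      also have "\<dots> = (\<Sum>i<?n. scale (case i of 0 \<Rightarrow> 0 | Suc j \<Rightarrow> coeff q j) ((L ^^ i) x)) - scale z (P ?n)"
        unfolding cp P_def by (simp add: scale_left_diff_distrib sum_subtractf scale_sum_right scale_right_distrib del: sum.lessThan_Suc)
      also have "(\<Sum>i<?n. scale (case i of 0 \<Rightarrow> 0 | Suc j \<Rightarrow> coeff q j) ((L ^^ i) x)) = L (P (Suc (degree q)))"
        unfolding P_def by (subst sum.lessThan_Suc_shift) (simp add: lin_sum[OF L] lin_scale[OF L] lin_add[OF L] del: sum.lessThan_Suc)
      finally have eig: "L (P (Suc (degree q))) = scale z (P (Suc (degree q)))" using Pc[of ?n] by simp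
      show ?thesis
      proof (cases "P (Suc (degree q)) = 0")
        case True
        then have "\<forall>n>degree q. P n = 0" using Pc by metis
        then show ?thesis using less.hyps[of q] dq q0 unfolding P_def by simp
      next
        case False
        moreover have "P (Suc (degree q)) \<in> V"
          unfolding P_def by (intro subspace_sum[OF sV] subspace_scale[OF sV] Lx)
        ultimately show ?thesis using eig by blast
      qed
    qed
  qed
  then show ?thesis using poly_annihilates[OF L V x(1)] by blast
qed

end

global_interpretation fspc: kspace_alg_closed "fs :: 'k::alg_closed_field \<Rightarrow> ('x \<Rightarrow> 'k) \<Rightarrow> _" ..

global_interpretation fspp: kspace_pair "fs :: 'k::field \<Rightarrow> ('x \<Rightarrow> 'k) \<Rightarrow> _" "fs :: 'k::field \<Rightarrow> ('y \<Rightarrow> 'k) \<Rightarrow> _" ..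

definition apm :: "nat set \<Rightarrow> nat set \<Rightarrow> (nat \<times> nat \<Rightarrow> 'k::field) \<Rightarrow> (nat \<Rightarrow> 'k) \<Rightarrow> (nat \<Rightarrow> 'k)" where
  "apm I J T v = (\<lambda>i. if i \<in> I then \<Sum>j\<in>J. T (i, j) * v j else 0)"

lemma apm_lin: "lin fs fs (apm I J T)"
  by (intro linI) (auto simp: apm_def fun_eq_iff distrib_left sum.distrib sum_distrib_left mult.left_commute)

text \<open>Rank factorisation of an idempotent matrix.\<close>

lemma idempotent_factor:
  fixes e :: "nat \<times> nat \<Rightarrow> 'k::field"
  assumes J: "finite J" and e: "supp J J e" "mc J e e = e"
  shows "\<exists>r P Q. supp J {..<r} P \<and> supp {..<r} J Q \<and> mc {..<r} P Q = e \<and> mc J Q P = idm {..<r}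
    \<and> r \<le> card J \<and> (r = card J \<longrightarrow> e = idm J)"
proof -
  let ?V = "{v :: nat \<Rightarrow> 'k. \<forall>x. x \<notin> J \<longrightarrow> v x = 0}"
  let ?f = "apm J J e"
  have V: "fsp.fg ?V" "fsp.dim ?V = card J" using fsp_supported[OF J] by simp_all
  have lf: "Vector_Spaces.linear fs fs ?f" using apm_lin lin_iff_linear[OF vs_fs vs_fs] by blast
  interpret f: Vector_Spaces.linear fs fs ?f by (fact lf)
  have sub: "fsp.subspace (?f ` ?V)" by (rule f.subspace_image[OF fsp.fg_subspace[OF V(1)]])
  have fV: "?f ` ?V \<subseteq> ?V" by (auto simp: apm_def)
  have ff: "?f w = w" if w: "w \<in> ?f ` ?V" for w
  proof -
    obtain v where v: "w = ?f v" using w by blast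
    have "?f (?f v) i = ?f v i" for i
    proof (cases "i \<in> J")
      case True
      have "?f (?f v) i = (\<Sum>j\<in>J. \<Sum>l\<in>J. e (i, j) * e (j, l) * v l)"
        using True by (simp add: apm_def sum_distrib_left mult.assoc)
      also have "\<dots> = (\<Sum>l\<in>J. mc J e e (i, l) * v l)"
        by (subst sum.swap) (simp add: mc_def sum_distrib_right)
      finally show ?thesis using True by (simp add: e(2) apm_def)
    qed (simp add: apm_def)
    then show ?thesis unfolding v by (rule ext)
  qed
  obtain X where X: "finite X" "fsp.independent X" "fsp.span X = ?f ` ?V" "card X = fsp.dim (?f ` ?V)"
    using fsp.fg_basis[OF fsp.fg_subset[OF V(1) sub fV]] .
  define r where "r = card X"
  obtain b where b: "bij_betw b {..<r} X"
    using X(1) unfolding r_def by (metis atLeast0LessThan ex_bij_betw_nat_finite)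
  define P where "P = (\<lambda>(i, s). if s < r then b s i else 0)"
  define Q where "Q = (\<lambda>(s, j). if s < r \<and> j \<in> J then fsp.representation X (?f (dirac j)) (b s) else 0)"
  have bX: "b s \<in> X" if "s < r" for s using b that by (auto simp: bij_betw_def)
  have bV: "b s \<in> ?f ` ?V" if "s < r" for s using X(3) fsp.span_base[OF bX[OF that]] by simp
  have bV': "b s \<in> ?V" if "s < r" for s using subsetD[OF fV bV[OF that]] .
  have sP: "supp J {..<r} P" using bV' by (auto simp: supp_def P_def)
  have sQ: "supp {..<r} J Q" by (auto simp: supp_def Q_def)
  have dV: "dirac j \<in> ?V" if "j \<in> J" for j using that by (auto simp: dirac_def)
  have fdirac: "?f (dirac j) i = e (i, j)" if "j \<in> J" for i j
    using that J e(1) by (auto simp: apm_def dirac_def if_distrib suppD cong: if_cong)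
  have PQ: "mc {..<r} P Q = e"
  proof (rule supp_eqI[OF supp_mc[OF sP sQ] e(1)])
    fix i j assume ij: "i \<in> J" "j \<in> J"
    let ?w = "?f (dirac j)"
    have w: "?w \<in> fsp.span X" unfolding X(3) using dV[OF ij(2)] by (rule imageI)
    have "e (i, j) = (\<Sum>x\<in>X. fs (fsp.representation X ?w x) x) i"
      using fsp.sum_representation_eq[OF X(2) w X(1) order_refl] fdirac[OF ij(2)] by simp
    also have "\<dots> = (\<Sum>s<r. fsp.representation X ?w (b s) * b s i)"
      by (simp add: sum_apply sum.reindex_bij_betw[OF b, symmetric])
    finally show "mc {..<r} P Q (i, j) = e (i, j)" using ij by (simp add: mc_def P_def Q_def mult.commute)
  qed
  have QP: "mc J Q P = idm {..<r}"
  proof (rule supp_eqI[OF supp_mc[OF sQ sP] supp_idm])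
    fix s t assume st: "s \<in> {..<r}" "t \<in> {..<r}"
    have lr: "lin fs (*) (\<lambda>v. if v \<in> fsp.span X then fsp.representation X v (b s) else 0)" if "fsp.span X = UNIV" for s
      using that by (intro linI) (simp_all add: fsp.representation_add[OF X(2)] fsp.representation_scale[OF X(2)])
    have sp: "?f (dirac j) \<in> fsp.span X" if "j \<in> J" for j unfolding X(3) using dV[OF that] by (rule imageI)
    have "b t = (\<Sum>j\<in>J. fs (b t j) (dirac j))" using bV'[of t] st J by (intro dirac_sum) auto
    then have "?f (b t) = ?f (\<Sum>j\<in>J. fs (b t j) (dirac j))" by (rule arg_cong)
    then have "b t = (\<Sum>j\<in>J. fs (b t j) (?f (dirac j)))"
      using ff[OF bV[of t]] st by (simp add: lin_sum[OF apm_lin] lin_scale[OF apm_lin])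
    then have "fsp.representation X (b t) (b s) = fsp.representation X (\<Sum>j\<in>J. fs (b t j) (?f (dirac j))) (b s)"
      by simp
    also have "\<dots> = (\<Sum>j\<in>J. b t j * fsp.representation X (?f (dirac j)) (b s))"
    proof -
      have "fsp.representation X (\<Sum>j\<in>J'. fs (b t j) (?f (dirac j))) = (\<lambda>x. \<Sum>j\<in>J'. b t j * fsp.representation X (?f (dirac j)) x)"
        if "J' \<subseteq> J" for J'
        using finite_subset[OF that J] that
      proof (induction J' rule: finite_induct)
        case empty
        show ?case unfolding sum.empty by (rule fsp.representation_zero)
      next
        case (insert a F)
        have "(\<Sum>j\<in>F. fs (b t j) (?f (dirac j))) \<in> fsp.span X"
          using insert.prems by (intro fsp.span_sum fsp.span_scale sp) auto
        moreover have "?f (dirac a) \<in> fsp.span X" using insert.prems by (intro sp) simp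
        ultimately show ?case
          using insert
          by (simp add: fsp.representation_add[OF X(2)] fsp.representation_scale[OF X(2)] fsp.span_scale
              del: fs_apply plus_fun_apply)
      qed
      then show ?thesis by simp
    qed
    finally have "(\<Sum>j\<in>J. b t j * fsp.representation X (?f (dirac j)) (b s)) = (if b s = b t then 1 else 0)"
      using fsp.representation_basis[OF X(2) bX[of t]] st by simp
    moreover have "b s = b t \<longleftrightarrow> s = t" using b st by (auto simp: bij_betw_def inj_on_def)
    ultimately show "mc J Q P (s, t) = idm {..<r} (s, t)"
      using st by (simp add: mc_def P_def Q_def idm_def mult.commute)
  qed
  have "r \<le> card J" unfolding r_def X(4) V(2)[symmetric] by (rule fsp.fg_dim_mono[OF V(1) sub fV])
  moreover have "e = idm J" if "r = card J"
  proof (rule supp_eqI[OF e(1) supp_idm])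
    fix i j assume ij: "i \<in> J" "j \<in> J"
    have "?f ` ?V = ?V" using that X(4) V(2) by (intro fsp.fg_dim_eq[OF V(1) sub fV]) (simp add: r_def)
    then have "?f (dirac j) = dirac j" using dV[OF ij(2)] by (intro ff) simp
    then show "e (i, j) = idm J (i, j)" using fdirac[OF ij(2), of i] ij by (simp add: dirac_def idm_def)
  qed
  ultimately show ?thesis using sP sQ PQ QP by blast
qed

lemma sum_rotate4: "(\<Sum>p\<in>A. \<Sum>q\<in>B. \<Sum>k\<in>C. \<Sum>l\<in>D. g p q k l) = (\<Sum>k\<in>C. \<Sum>l\<in>D. \<Sum>p\<in>A. \<Sum>q\<in>B. g p q k l)"
  for g :: "'p \<Rightarrow> 'q \<Rightarrow> 'r \<Rightarrow> 's \<Rightarrow> 'v::comm_monoid_add"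
  unfolding sum_rotate3[where A = C and B = D and C = B, symmetric]
  by (rule sum_rotate3[symmetric])

locale cosemisimple_hopf = fd_hopf scale \<Delta> \<epsilon> S B
  for scale :: "'k::alg_closed_field \<Rightarrow> 'h::ring_1 \<Rightarrow> 'h" (infixr \<open>*s\<close> 75)
    and \<Delta> :: "'h \<Rightarrow> ('h \<times> 'h \<Rightarrow>\<^sub>0 'k)" and \<epsilon> :: "'h \<Rightarrow> 'k" and S :: "'h \<Rightarrow> 'h" and B :: "'h set" +
  fixes \<Lambda> :: "'h \<Rightarrow> 'k"
  assumes haar: "haar \<Lambda>"
begin

lemma haar_lin: "lf \<Lambda>" and haar_one: "\<Lambda> 1 = 1" and haar_inv: "SW (\<lambda>a b. \<Lambda> b *s a) x = \<Lambda> x *s 1"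
  using haar by (simp_all add: haar_def)

lemma haar_matrix:
  assumes X: "comod X" and Y: "comod Y" and i: "i \<in> ix X" "k \<in> ix X" "l \<in> ix Y" "q \<in> ix Y"
  shows "(\<Sum>m\<in>ix X. \<Lambda> (mt X m k * S (mt Y l q)) *s mt X i m) = (\<Sum>j\<in>ix Y. \<Lambda> (mt X i k * S (mt Y l j)) *s mt Y j q)"
proof -
  let ?Z = "tn X (du Y)"
  have Z: "comod ?Z" using comod_tn comod_du X Y by blast
  have bl: "bilin scale scale (\<lambda>a b. \<Lambda> b *s a)"
    by (intro bilinI linI) (simp_all add: lin_add[OF haar_lin] lin_scale[OF haar_lin] algebra_simps)
  have inv: "(\<Sum>m\<in>ix X. \<Sum>p\<in>ix Y. \<Lambda> (mt X m k * S (mt Y l p)) *s (mt X i m * S (mt Y p j))) = \<Lambda> (mt X i k * S (mt Y l j)) *s 1"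
    if j: "j \<in> ix Y" for j
    using comod_SW[OF Z _ _ vs bl, of "prod_encode (i, j)" "prod_encode (k, l)"] i j
    by (simp add: mem_tn mt_tn sum_tn ix_du mt_du haar_inv)
  have "(\<Sum>j\<in>ix Y. \<Lambda> (mt X i k * S (mt Y l j)) *s mt Y j q)
     = (\<Sum>j\<in>ix Y. (\<Sum>m\<in>ix X. \<Sum>p\<in>ix Y. \<Lambda> (mt X m k * S (mt Y l p)) *s (mt X i m * S (mt Y p j))) * mt Y j q)"
    by (intro sum.cong refl) (simp add: inv scale_mult_left)
  also have "\<dots> = (\<Sum>j\<in>ix Y. \<Sum>m\<in>ix X. \<Sum>p\<in>ix Y. \<Lambda> (mt X m k * S (mt Y l p)) *s (mt X i m * (S (mt Y p j) * mt Y j q)))"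
    by (simp add: sum_distrib_right scale_mult_left mult.assoc)
  also have "\<dots> = (\<Sum>m\<in>ix X. \<Sum>p\<in>ix Y. \<Sum>j\<in>ix Y. \<Lambda> (mt X m k * S (mt Y l p)) *s (mt X i m * (S (mt Y p j) * mt Y j q)))"
    by (rule sum_rotate3[symmetric])
  also have "\<dots> = (\<Sum>m\<in>ix X. \<Sum>p\<in>ix Y. \<Lambda> (mt X m k * S (mt Y l p)) *s (mt X i m * (\<Sum>j\<in>ix Y. S (mt Y p j) * mt Y j q)))"
    by (simp add: sum_distrib_left scale_sum_right)
  also have "\<dots> = (\<Sum>m\<in>ix X. \<Sum>p\<in>ix Y. if p = q then \<Lambda> (mt X m k * S (mt Y l p)) *s mt X i m else 0)"
    using i by (intro sum.cong refl) (simp add: comod_S_left[OF Y])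
  also have "\<dots> = (\<Sum>m\<in>ix X. \<Lambda> (mt X m k * S (mt Y l q)) *s mt X i m)"
    using i comod_finite[OF Y] by simp
  finally show ?thesis by simp
qed

text \<open>The average \<open>\<Lambda>(X M S(Y))\<close> of a matrix \<open>M\<close> of scalars, the analogue of summing \<open>g M g\<^sup>-\<^sup>1\<close> over a finite group.\<close>

definition av :: "'h comd \<Rightarrow> 'h comd \<Rightarrow> (nat \<times> nat \<Rightarrow> 'k) \<Rightarrow> nat \<times> nat \<Rightarrow> 'k" where
  "av X Y M = (\<lambda>(i, j). if i \<in> ix X \<and> j \<in> ix Y
     then \<Sum>k\<in>ix X. \<Sum>l\<in>ix Y. \<Lambda> (mt X i k * S (mt Y l j)) * M (k, l) else 0)"

lemma av_Hom:
  assumes X: "comod X" and Y: "comod Y"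
  shows "av X Y M \<in> Hom Y X"
proof -
  have "(\<Sum>m\<in>ix X. av X Y M (m, q) *s mt X i m) = (\<Sum>j\<in>ix Y. av X Y M (i, j) *s mt Y j q)"
    if "i \<in> ix X" "q \<in> ix Y" for i q
  proof -
    have "(\<Sum>m\<in>ix X. av X Y M (m, q) *s mt X i m)
      = (\<Sum>m\<in>ix X. \<Sum>k\<in>ix X. \<Sum>l\<in>ix Y. M (k, l) *s (\<Lambda> (mt X m k * S (mt Y l q)) *s mt X i m))"
      using that by (simp add: av_def scale_sum_left mult.commute)
    also have "\<dots> = (\<Sum>k\<in>ix X. \<Sum>l\<in>ix Y. M (k, l) *s (\<Sum>m\<in>ix X. \<Lambda> (mt X m k * S (mt Y l q)) *s mt X i m))"
      by (simp only: scale_sum_right) (rule sum_rotate3[symmetric])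
    also have "\<dots> = (\<Sum>k\<in>ix X. \<Sum>l\<in>ix Y. M (k, l) *s (\<Sum>j\<in>ix Y. \<Lambda> (mt X i k * S (mt Y l j)) *s mt Y j q))"
      using that by (simp add: haar_matrix[OF X Y])
    also have "\<dots> = (\<Sum>j\<in>ix Y. \<Sum>k\<in>ix X. \<Sum>l\<in>ix Y. M (k, l) *s (\<Lambda> (mt X i k * S (mt Y l j)) *s mt Y j q))"
      by (simp only: scale_sum_right) (rule sum_rotate3)
    also have "\<dots> = (\<Sum>j\<in>ix Y. av X Y M (i, j) *s mt Y j q)"
      using that by (simp add: av_def scale_sum_left mult.commute)
    finally show ?thesis .
  qed
  then show ?thesis by (auto simp: Hom_def supp_def av_def)
qed

text \<open>Every matrix has a generalised inverse; the average of a generalised inverse of a homomorphism is a homomorphism,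
  and still a generalised inverse. This takes the place of invariant complements.\<close>

lemma maschke:
  assumes X: "comod X" and Y: "comod Y" and N: "N \<in> Hom X Y"
  shows "\<exists>M\<in>Hom Y X. mc (ix X) N (mc (ix Y) M N) = N"
proof -
  note fX = comod_finite[OF X] and fY = comod_finite[OF Y] and sN = Hom_supp[OF N]
  obtain M where M: "supp (ix X) (ix Y) M" "mc (ix X) N (mc (ix Y) M N) = N"
    using generalized_inverse[OF fY fX sN] by auto
  have NX: "(\<Sum>p\<in>ix X. N (i, p) *s mt X p k) = (\<Sum>p\<in>ix Y. N (p, k) *s mt Y i p)"
    if "i \<in> ix Y" "k \<in> ix X" for i k using HomD[OF N that] by simp
  have NS: "(\<Sum>q\<in>ix Y. N (q, j) *s S (mt Y l q)) = (\<Sum>q\<in>ix X. N (l, q) *s S (mt X q j))"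
    if "l \<in> ix Y" "j \<in> ix X" for l j using Hom_S[OF N that] .
  let ?A = "av X Y M"
  have "mc (ix X) N (mc (ix Y) ?A N) = N"
  proof (rule supp_eqI[OF supp_mc[OF sN supp_mc[OF Hom_supp[OF av_Hom[OF X Y]] sN]] sN])
    fix i j assume ij: "i \<in> ix Y" "j \<in> ix X"
    have "mc (ix X) N (mc (ix Y) ?A N) (i, j)
      = (\<Sum>p\<in>ix X. \<Sum>q\<in>ix Y. \<Sum>k\<in>ix X. \<Sum>l\<in>ix Y. M (k, l) * \<Lambda> ((N (i, p) *s mt X p k) * (N (q, j) *s S (mt Y l q))))"
      by (simp add: mc_def av_def sum_distrib_left sum_distrib_right scale_mult_left scale_mult_right
          lin_scale[OF haar_lin] mult_ac)
    also have "\<dots> = (\<Sum>k\<in>ix X. \<Sum>l\<in>ix Y. \<Sum>p\<in>ix X. \<Sum>q\<in>ix Y. M (k, l) * \<Lambda> ((N (i, p) *s mt X p k) * (N (q, j) *s S (mt Y l q))))"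
      by (rule sum_rotate4)
    also have "\<dots> = (\<Sum>k\<in>ix X. \<Sum>l\<in>ix Y. M (k, l) * \<Lambda> ((\<Sum>p\<in>ix X. N (i, p) *s mt X p k) * (\<Sum>q\<in>ix Y. N (q, j) *s S (mt Y l q))))"
      unfolding sum_product lin_sum[OF haar_lin] by (simp only: sum_distrib_left)
    also have "\<dots> = (\<Sum>k\<in>ix X. \<Sum>l\<in>ix Y. M (k, l) * \<Lambda> ((\<Sum>p\<in>ix Y. N (p, k) *s mt Y i p) * (\<Sum>q\<in>ix X. N (l, q) *s S (mt X q j))))"
      using ij by (simp add: NX NS)
    also have "\<dots> = (\<Sum>k\<in>ix X. \<Sum>l\<in>ix Y. \<Sum>p\<in>ix Y. \<Sum>q\<in>ix X. N (p, k) * M (k, l) * N (l, q) * \<Lambda> (mt Y i p * S (mt X q j)))"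
      unfolding sum_product lin_sum[OF haar_lin]
      by (simp add: sum_distrib_left scale_mult_left scale_mult_right lin_scale[OF haar_lin] mult_ac)
    also have "\<dots> = (\<Sum>p\<in>ix Y. \<Sum>q\<in>ix X. \<Sum>k\<in>ix X. \<Sum>l\<in>ix Y. N (p, k) * M (k, l) * N (l, q) * \<Lambda> (mt Y i p * S (mt X q j)))"
      by (rule sum_rotate4)
    also have "\<dots> = (\<Sum>p\<in>ix Y. \<Sum>q\<in>ix X. mc (ix X) N (mc (ix Y) M N) (p, q) * \<Lambda> (mt Y i p * S (mt X q j)))"
      by (simp add: mc_def sum_distrib_left sum_distrib_right mult_ac)
    also have "\<dots> = (\<Sum>p\<in>ix Y. \<Lambda> (mt Y i p * (\<Sum>q\<in>ix X. N (p, q) *s S (mt X q j))))"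
      by (simp add: M(2) sum_distrib_left lin_sum[OF haar_lin] lin_scale[OF haar_lin] scale_mult_right)
    also have "\<dots> = (\<Sum>p\<in>ix Y. \<Lambda> (mt Y i p * (\<Sum>q\<in>ix Y. N (q, j) *s S (mt Y p q))))"
      using ij by (simp add: NS)
    also have "\<dots> = (\<Sum>q\<in>ix Y. N (q, j) * \<Lambda> (\<Sum>p\<in>ix Y. mt Y i p * S (mt Y p q)))"
      by (simp add: sum_distrib_left lin_sum[OF haar_lin] lin_scale[OF haar_lin] scale_mult_right) (rule sum.swap)
    also have "\<dots> = (\<Sum>q\<in>ix Y. if i = q then N (q, j) else 0)"
      using ij by (intro sum.cong refl) (simp add: comod_S_right[OF Y] haar_one lin_zero[OF haar_lin])
    also have "\<dots> = N (i, j)" using ij fY by simp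
    finally show "mc (ix X) N (mc (ix Y) ?A N) (i, j) = N (i, j)" .
  qed
  then show ?thesis using av_Hom[OF X Y] by blast
qed

subsection \<open>Decompositions\<close>

text \<open>\<open>X\<close> is the direct sum of \<open>X1\<close> and \<open>X2\<close>, with inclusions \<open>A1\<close>, \<open>A2\<close> and projections \<open>B1\<close>, \<open>B2\<close>.\<close>

definition split :: "'h comd \<Rightarrow> 'h comd \<Rightarrow> 'h comd \<Rightarrow> bool" where
  "split X X1 X2 \<longleftrightarrow> (\<exists>A1\<in>Hom X1 X. \<exists>B1\<in>Hom X X1. \<exists>A2\<in>Hom X2 X. \<exists>B2\<in>Hom X X2.
     mc (ix X) B1 A1 = idm (ix X1) \<and> mc (ix X) B2 A2 = idm (ix X2) \<and>
     mc (ix X1) A1 B1 + mc (ix X2) A2 B2 = idm (ix X) \<and>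
     mc (ix X) B1 A2 = 0 \<and> mc (ix X) B2 A1 = 0)"

text \<open>Additive functions stand for homomorphisms from the Grothendieck group. Identities between multiplicities are proved by
  comparing additive functions on irreducible comodules.\<close>

definition additive :: "('h comd \<Rightarrow> nat) \<Rightarrow> bool" where
  "additive F \<longleftrightarrow> (\<forall>X X1 X2. comod X \<longrightarrow> comod X1 \<longrightarrow> comod X2 \<longrightarrow> split X X1 X2 \<longrightarrow> F X = F X1 + F X2)"

definition zc :: "'h comd" where "zc = ({}, \<lambda>_ _. 0)"

lemma comod_zc: "comod zc" by (simp add: zc_def comod_def)

lemma ix_zc: "ix zc = {}" by (simp add: zc_def)

lemma Hom_zero: "0 \<in> Hom X Y"
  using fsp.subspace_0[OF subspace_Hom] .

definition iso :: "'h comd \<Rightarrow> 'h comd \<Rightarrow> bool" where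
  "iso X Y \<longleftrightarrow> (\<exists>A\<in>Hom Y X. \<exists>C\<in>Hom X Y. mc (ix X) C A = idm (ix Y) \<and> mc (ix Y) A C = idm (ix X))"

lemma idm_empty: "idm {} = 0"
  by (auto simp: idm_def fun_eq_iff)

lemma iso_split:
  assumes "iso X Y"
  shows "split X Y zc"
proof -
  obtain A C where A: "A \<in> Hom Y X" "C \<in> Hom X Y" "mc (ix X) C A = idm (ix Y)" "mc (ix Y) A C = idm (ix X)"
    using assms unfolding iso_def by blast
  moreover have "mc {} T T' = 0" for T T' :: "nat \<times> nat \<Rightarrow> 'k" by (auto simp: mc_def fun_eq_iff)
  ultimately show ?thesis
    unfolding split_def
    by (intro bexI[of _ A] bexI[of _ C] bexI[where x = 0]) (simp_all add: ix_zc idm_empty mc_linear Hom_zero)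
qed

lemma additive_zc: "additive F \<Longrightarrow> F zc = 0"
proof -
  assume F: "additive F"
  have "split zc zc zc"
    unfolding split_def by (intro bexI[where x = 0] conjI) (simp_all add: ix_zc idm_empty mc_linear Hom_zero)
  then have "F zc = F zc + F zc" by (rule F[unfolded additive_def, rule_format, OF comod_zc comod_zc comod_zc])
  then show ?thesis by simp
qed

lemma additive_iso: "additive F \<Longrightarrow> comod X \<Longrightarrow> comod Y \<Longrightarrow> iso X Y \<Longrightarrow> F X = F Y"
  using additive_zc[of F] iso_split[of X Y] comod_zc unfolding additive_def by (metis add_0_right)

lemma lin_linear_fs: "lin fs fs f \<Longrightarrow> Vector_Spaces.linear fs fs (f :: (nat \<times> nat \<Rightarrow> 'k) \<Rightarrow> (nat \<times> nat \<Rightarrow> 'k))"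
  by (simp add: lin_iff_linear vs_fs)

lemma additive_m_left:
  assumes Z: "comod Z"
  shows "additive (\<lambda>X. m X Z)"
  unfolding additive_def
proof (intro allI impI)
  fix X X1 X2 assume X: "comod X" and X1: "comod X1" and X2: "comod X2" and s: "split X X1 X2"
  then obtain A1 B1 A2 B2 where A: "A1 \<in> Hom X1 X" "B1 \<in> Hom X X1" "A2 \<in> Hom X2 X" "B2 \<in> Hom X X2"
    and e: "mc (ix X) B1 A1 = idm (ix X1)" "mc (ix X) B2 A2 = idm (ix X2)"
      "mc (ix X1) A1 B1 + mc (ix X2) A2 B2 = idm (ix X)" "mc (ix X) B1 A2 = 0" "mc (ix X) B2 A1 = 0"
    unfolding split_def by blast
  let ?f1 = "\<lambda>T. mc (ix X1) T B1" and ?f2 = "\<lambda>T. mc (ix X2) T B2"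
  have l: "Vector_Spaces.linear fs fs ?f1" "Vector_Spaces.linear fs fs ?f2"
    by (rule lin_linear_fs[OF linI]; simp add: mc_linear)+
  have id: "mc (ix X') T (idm (ix X')) = T" if "T \<in> Hom X' Z" "comod X'" for T X'
    using mc_id_right[OF comod_finite[OF that(2)] Hom_supp[OF that(1)]] .
  have r1: "mc (ix X) (?f1 T) A1 = T" if "T \<in> Hom X1 Z" for T
    using that X1 by (simp add: mc_assoc e id)
  have r2: "mc (ix X) (?f2 T) A2 = T" if "T \<in> Hom X2 Z" for T
    using that X2 by (simp add: mc_assoc e id)
  have r12: "mc (ix X) (?f1 T) A2 = 0" for T by (simp add: mc_assoc e mc_linear)
  have i1: "T = 0" if "T \<in> Hom X1 Z" "?f1 T = 0" for T
    using r1[OF that(1)] that(2) by (simp add: mc_linear)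
  note d1 = fspp.dim_inj_image[OF l(1) fg_Hom[OF X1 Z] i1]
  have sum: "{u + ?f2 x | u x. u \<in> ?f1 ` Hom X1 Z \<and> x \<in> Hom X2 Z} = Hom X Z"
  proof (intro equalityI subsetI)
    fix T assume "T \<in> {u + ?f2 x | u x. u \<in> ?f1 ` Hom X1 Z \<and> x \<in> Hom X2 Z}"
    then obtain u x where T: "T = ?f1 u + ?f2 x" and u: "u \<in> Hom X1 Z" and x: "x \<in> Hom X2 Z" by blast
    show "T \<in> Hom X Z"
      unfolding T using fsp.subspace_add[OF subspace_Hom Hom_comp[OF u A(2)] Hom_comp[OF x A(4)]] .
  next
    fix T assume T: "T \<in> Hom X Z"
    have "T = ?f1 (mc (ix X) T A1) + ?f2 (mc (ix X) T A2)"
      using id[OF T X] e(3)[symmetric] by (simp add: mc_assoc mc_linear)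
    then show "T \<in> {u + ?f2 x | u x. u \<in> ?f1 ` Hom X1 Z \<and> x \<in> Hom X2 Z}"
      using Hom_comp[OF T A(1)] Hom_comp[OF T A(3)] by blast
  qed
  have "x = 0" if x: "x \<in> Hom X2 Z" "?f2 x \<in> ?f1 ` Hom X1 Z" for x
  proof -
    obtain u where "?f2 x = ?f1 u" using x(2) by blast
    then have "mc (ix X) (?f2 x) A2 = 0" using r12[of u] by simp
    then show ?thesis using r2[OF x(1)] by simp
  qed
  moreover have "?f2 0 \<in> ?f1 ` Hom X1 Z"
    using Hom_zero by (intro image_eqI[where x = 0]) (simp_all add: mc_linear)
  ultimately have "{x \<in> Hom X2 Z. ?f2 x \<in> ?f1 ` Hom X1 Z} = {0}"
    using Hom_zero by (intro equalityI subsetI) simp_all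
  then show "m X Z = m X1 Z + m X2 Z"
    using fspp.dim_add_image(2)[OF l(2) fg_Hom[OF X2 Z] d1(1)] d1(2)
    unfolding sum m_def by (simp add: fsp.dim_zero_space)
qed

lemma additive_m_right:
  assumes Z: "comod Z"
  shows "additive (m Z)"
  unfolding additive_def
proof (intro allI impI)
  fix X X1 X2 assume X: "comod X" and X1: "comod X1" and X2: "comod X2" and s: "split X X1 X2"
  then obtain A1 B1 A2 B2 where A: "A1 \<in> Hom X1 X" "B1 \<in> Hom X X1" "A2 \<in> Hom X2 X" "B2 \<in> Hom X X2"
    and e: "mc (ix X) B1 A1 = idm (ix X1)" "mc (ix X) B2 A2 = idm (ix X2)"
      "mc (ix X1) A1 B1 + mc (ix X2) A2 B2 = idm (ix X)" "mc (ix X) B1 A2 = 0" "mc (ix X) B2 A1 = 0"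
    unfolding split_def by blast
  let ?f1 = "\<lambda>T. mc (ix X1) A1 T" and ?f2 = "\<lambda>T. mc (ix X2) A2 T"
  have l: "Vector_Spaces.linear fs fs ?f1" "Vector_Spaces.linear fs fs ?f2"
    by (rule lin_linear_fs[OF linI]; simp add: mc_linear)+
  have id: "mc (ix X') (idm (ix X')) T = T" if "T \<in> Hom Z X'" "comod X'" for T X'
    using mc_id_left[OF comod_finite[OF that(2)] Hom_supp[OF that(1)]] .
  have r1: "mc (ix X) B1 (?f1 T) = T" if "T \<in> Hom Z X1" for T
    using that X1 by (simp add: mc_assoc[symmetric] e id)
  have r2: "mc (ix X) B2 (?f2 T) = T" if "T \<in> Hom Z X2" for T
    using that X2 by (simp add: mc_assoc[symmetric] e id)
  have r12: "mc (ix X) B2 (?f1 T) = 0" for T by (simp add: mc_assoc[symmetric] e mc_linear)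
  have i1: "T = 0" if "T \<in> Hom Z X1" "?f1 T = 0" for T
    using r1[OF that(1)] that(2) by (simp add: mc_linear)
  note d1 = fspp.dim_inj_image[OF l(1) fg_Hom[OF Z X1] i1]
  have sum: "{u + ?f2 x | u x. u \<in> ?f1 ` Hom Z X1 \<and> x \<in> Hom Z X2} = Hom Z X"
  proof (intro equalityI subsetI)
    fix T assume "T \<in> {u + ?f2 x | u x. u \<in> ?f1 ` Hom Z X1 \<and> x \<in> Hom Z X2}"
    then obtain u x where T: "T = ?f1 u + ?f2 x" and u: "u \<in> Hom Z X1" and x: "x \<in> Hom Z X2" by blast
    show "T \<in> Hom Z X"
      unfolding T using fsp.subspace_add[OF subspace_Hom Hom_comp[OF A(1) u] Hom_comp[OF A(3) x]] .
  next
    fix T assume T: "T \<in> Hom Z X"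
    have "T = ?f1 (mc (ix X) B1 T) + ?f2 (mc (ix X) B2 T)"
      using id[OF T X] e(3)[symmetric] by (simp add: mc_assoc[symmetric] mc_linear(1)[symmetric])
    then show "T \<in> {u + ?f2 x | u x. u \<in> ?f1 ` Hom Z X1 \<and> x \<in> Hom Z X2}"
      using Hom_comp[OF A(2) T] Hom_comp[OF A(4) T] by blast
  qed
  have "x = 0" if x: "x \<in> Hom Z X2" "?f2 x \<in> ?f1 ` Hom Z X1" for x
  proof -
    obtain u where "?f2 x = ?f1 u" using x(2) by blast
    then have "mc (ix X) B2 (?f2 x) = 0" using r12[of u] by simp
    then show ?thesis using r2[OF x(1)] by simp
  qed
  moreover have "?f2 0 \<in> ?f1 ` Hom Z X1"
    using Hom_zero by (intro image_eqI[where x = 0]) (simp_all add: mc_linear)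
  ultimately have "{x \<in> Hom Z X2. ?f2 x \<in> ?f1 ` Hom Z X1} = {0}"
    using Hom_zero by (intro equalityI subsetI) simp_all
  then show "m Z X = m Z X1 + m Z X2"
    using fspp.dim_add_image(2)[OF l(2) fg_Hom[OF Z X2] d1(1)] d1(2)
    unfolding sum m_def by (simp add: fsp.dim_zero_space)
qed

text \<open>The summand of a comodule that is cut out by an idempotent endomorphism.\<close>

lemma idempotent_summand:
  assumes X: "comod X" and e: "e \<in> Hom X X" "mc (ix X) e e = e"
  shows "\<exists>X1 A C. comod X1 \<and> A \<in> Hom X1 X \<and> C \<in> Hom X X1 \<and> mc (ix X) C A = idm (ix X1) \<and> mc (ix X1) A C = e
     \<and> card (ix X1) \<le> card (ix X) \<and> (card (ix X1) = card (ix X) \<longrightarrow> e = idm (ix X))"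
proof -
  let ?J = "ix X"
  note fin = comod_finite[OF X]
  obtain r P Q where PQ: "supp ?J {..<r} P" "supp {..<r} ?J Q" "mc {..<r} P Q = e" "mc ?J Q P = idm {..<r}"
    "r \<le> card ?J" "r = card ?J \<longrightarrow> e = idm ?J"
    using idempotent_factor[OF fin Hom_supp[OF e(1)] e(2)] by auto
  define X1 :: "'h comd" where "X1 = ({..<r}, \<lambda>s t. \<Sum>i\<in>?J. \<Sum>j\<in>?J. (Q (s, i) * P (j, t)) *s mt X i j)"
  have ix1: "ix X1 = {..<r}" and mt1: "mt X1 s t = (\<Sum>i\<in>?J. \<Sum>j\<in>?J. (Q (s, i) * P (j, t)) *s mt X i j)" for s t
    by (simp_all add: X1_def)
  have eP: "mc ?J e P = P" and Qe: "mc ?J Q e = Q"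
    using mc_assoc[of ?J "{..<r}" P Q P] mc_assoc[of "{..<r}" ?J Q P Q] PQ
    by (simp_all add: mc_id_left[OF _ PQ(2)] mc_id_right[OF _ PQ(1)])
  have A: "P \<in> Hom X1 X"
  proof -
    have "(\<Sum>l\<in>?J. P (l, t) *s mt X i l) = (\<Sum>s<r. P (i, s) *s mt X1 s t)" if "i \<in> ?J" for i t
    proof -
      have "(\<Sum>s<r. P (i, s) *s mt X1 s t) = (\<Sum>i'\<in>?J. \<Sum>j\<in>?J. \<Sum>s<r. (P (i, s) * Q (s, i') * P (j, t)) *s mt X i' j)"
        unfolding mt1 by (subst sum_rotate3) (simp add: scale_sum_right mult.assoc)
      also have "\<dots> = (\<Sum>j\<in>?J. \<Sum>i'\<in>?J. (e (i, i') * P (j, t)) *s mt X i' j)"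
        unfolding PQ(3)[symmetric] by (subst sum.swap) (simp add: mc_def scale_sum_left sum_distrib_right)
      also have "\<dots> = (\<Sum>j\<in>?J. P (j, t) *s (\<Sum>i'\<in>?J. e (i, i') *s mt X i' j))"
        by (simp add: scale_sum_right mult.commute)
      also have "\<dots> = (\<Sum>j\<in>?J. P (j, t) *s (\<Sum>l\<in>?J. e (l, j) *s mt X i l))"
        using HomD[OF e(1) that] by simp
      also have "\<dots> = (\<Sum>l\<in>?J. (\<Sum>j\<in>?J. e (l, j) * P (j, t)) *s mt X i l)"
        by (simp add: scale_sum_right scale_sum_left mult.commute) (rule sum.swap)
      also have "\<dots> = (\<Sum>l\<in>?J. mc ?J e P (l, t) *s mt X i l)" by (simp add: mc_def)
      finally show ?thesis by (simp add: eP)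
    qed
    then show ?thesis using PQ(1) by (simp add: Hom_def ix1)
  qed
  have C: "Q \<in> Hom X X1"
  proof -
    have "(\<Sum>s<r. Q (s, j) *s mt X1 t s) = (\<Sum>l\<in>?J. Q (t, l) *s mt X l j)" if "j \<in> ?J" for j t
    proof -
      have "(\<Sum>s<r. Q (s, j) *s mt X1 t s) = (\<Sum>i\<in>?J. \<Sum>j'\<in>?J. \<Sum>s<r. (Q (t, i) * (P (j', s) * Q (s, j))) *s mt X i j')"
        unfolding mt1 by (subst sum_rotate3) (simp add: scale_sum_right mult_ac)
      also have "\<dots> = (\<Sum>i\<in>?J. \<Sum>j'\<in>?J. (Q (t, i) * e (j', j)) *s mt X i j')"
        unfolding PQ(3)[symmetric] by (simp add: mc_def scale_sum_left sum_distrib_left)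
      also have "\<dots> = (\<Sum>i\<in>?J. Q (t, i) *s (\<Sum>j'\<in>?J. e (j', j) *s mt X i j'))"
        by (simp add: scale_sum_right)
      also have "\<dots> = (\<Sum>i\<in>?J. Q (t, i) *s (\<Sum>l\<in>?J. e (i, l) *s mt X l j))"
        using HomD[OF e(1) _ that] by simp
      also have "\<dots> = (\<Sum>l\<in>?J. mc ?J Q e (t, l) *s mt X l j)"
        by (simp add: mc_def scale_sum_right scale_sum_left) (rule sum.swap)
      finally show ?thesis by (simp add: Qe)
    qed
    then show ?thesis using PQ(2) by (simp add: Hom_def ix1)
  qed
  have "comod X1"
    unfolding comod_def ix1
  proof (intro conjI ballI allI impI)
    fix s t assume st: "s \<in> {..<r}" "t \<in> {..<r}"
    have "\<epsilon> (mt X1 s t) = (\<Sum>i\<in>?J. Q (s, i) * P (i, t))"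
      unfolding mt1 using fin
      by (simp add: lin_sum[OF counit_lin] lin_scale[OF counit_lin] comod_counit[OF X] if_distrib cong: if_cong)
    also have "\<dots> = mc ?J Q P (s, t)" by (simp add: mc_def)
    finally show "\<epsilon> (mt X1 s t) = (if s = t then 1 else 0)" using PQ(4) st by (simp add: idm_def)
    fix \<phi> \<psi> assume \<phi>: "lf \<phi>" and \<psi>: "lf \<psi>"
    note b = SW_lin[OF vector_space_mult bilin_functionals[OF \<phi> \<psi>]]
    \<comment> \<open>\<open>c\<close> restricted to the summand: \<open>c A = A c\<^sub>1\<close> and \<open>Q c = c\<^sub>1 Q\<close>\<close>
    have QX: "(\<Sum>i\<in>?J. Q (s, i) *s mt X i l) = (\<Sum>u<r. Q (u, l) *s mt X1 s u)" if "l \<in> ?J" for l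
      using HomD[OF C, of s l] st that by (simp add: ix1)
    have PX: "(\<Sum>l\<in>?J. Q (u, l) *s (\<Sum>j\<in>?J. P (j, t) *s mt X l j)) = mt X1 u t" for u
      unfolding mt1 by (simp add: scale_sum_right)
    have "SW (\<lambda>a b. \<phi> a * \<psi> b) (mt X1 s t) = (\<Sum>i\<in>?J. \<Sum>j\<in>?J. (Q (s, i) * P (j, t)) * (\<Sum>l\<in>?J. \<phi> (mt X i l) * \<psi> (mt X l j)))"
      unfolding mt1 using X by (simp add: lin_sum[OF b] lin_scale[OF b] comod_def \<phi> \<psi>)
    also have "\<dots> = (\<Sum>i\<in>?J. \<Sum>j\<in>?J. \<Sum>l\<in>?J. (Q (s, i) * P (j, t)) * (\<phi> (mt X i l) * \<psi> (mt X l j)))"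
      by (simp add: sum_distrib_left)
    also have "\<dots> = (\<Sum>l\<in>?J. \<phi> (\<Sum>i\<in>?J. Q (s, i) *s mt X i l) * \<psi> (\<Sum>j\<in>?J. P (j, t) *s mt X l j))"
      by (subst sum_rotate3) (simp add: lin_sum[OF \<phi>] lin_scale[OF \<phi>] lin_sum[OF \<psi>] lin_scale[OF \<psi>] sum_product mult_ac,
          rule sum.cong[OF refl], rule sum.swap)
    also have "\<dots> = (\<Sum>l\<in>?J. \<Sum>u<r. \<phi> (mt X1 s u) * (Q (u, l) * \<psi> (\<Sum>j\<in>?J. P (j, t) *s mt X l j)))"
      by (intro sum.cong refl) (simp add: QX lin_sum[OF \<phi>] lin_scale[OF \<phi>] sum_distrib_right mult_ac)
    also have "\<dots> = (\<Sum>u<r. \<phi> (mt X1 s u) * \<psi> (\<Sum>l\<in>?J. Q (u, l) *s (\<Sum>j\<in>?J. P (j, t) *s mt X l j)))"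
      by (subst sum.swap) (simp only: lin_sum[OF \<psi>] lin_scale[OF \<psi>] sum_distrib_left)
    finally show "SW (\<lambda>a b. \<phi> a * \<psi> b) (mt X1 s t) = (\<Sum>l<r. \<phi> (mt X1 s l) * \<psi> (mt X1 l t))"
      unfolding PX .
  qed simp
  then show ?thesis using A C PQ by (intro exI[of _ X1] exI[of _ P] exI[of _ Q]) (simp add: ix1)
qed

end

lemma (in kspace) dim_one_span:
  assumes "fg V" "dim V = 1" "x \<in> V" "x \<noteq> 0" "y \<in> V"
  shows "\<exists>c. y = scale c x"
proof -
  have "independent {x}" using assms(4) by simp
  then have "dim (span {x}) = 1" using dim_span_eq_card_independent by fastforce
  moreover have "span {x} \<subseteq> V" by (rule span_minimal[OF _ fg_subspace[OF assms(1)]]) (use assms in simp)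
  ultimately have "span {x} = V" using fg_dim_eq[OF assms(1) subspace_span] assms(2) by simp
  then show ?thesis using assms(5) span_singleton by auto
qed

context cosemisimple_hopf
begin

definition irr :: "'h comd \<Rightarrow> bool" where
  "irr X \<longleftrightarrow> comod X \<and> m X X = 1"

lemma irr_comod: "irr X \<Longrightarrow> comod X" by (simp add: irr_def)

lemma m_empty: "ix X = {} \<Longrightarrow> m X Y = 0"
proof -
  assume "ix X = {}"
  then have "T = 0" if "T \<in> Hom X Y" for T using Hom_supp[OF that] by (auto simp: supp_def)
  then have "Hom X Y = {0}" using Hom_zero by blast
  then show ?thesis by (simp add: m_def fsp.dim_zero_space)
qed

lemma irr_nonempty: "irr X \<Longrightarrow> ix X \<noteq> {}"
  using m_empty by (fastforce simp: irr_def)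

lemma idm_nonzero: "J \<noteq> {} \<Longrightarrow> idm J \<noteq> (0 :: nat \<times> nat \<Rightarrow> 'k)"
  by (auto simp: idm_def fun_eq_iff)

lemma irr_End: "irr X \<Longrightarrow> T \<in> Hom X X \<Longrightarrow> \<exists>c. T = fs c (idm (ix X))"
  using fsp.dim_one_span[OF fg_Hom _ Hom_id idm_nonzero] irr_nonempty[of X]
  by (simp add: irr_def m_def)

lemma m_nonzeroD: "m X Y \<noteq> 0 \<Longrightarrow> \<exists>N\<in>Hom X Y. N \<noteq> 0"
proof (rule ccontr)
  assume "m X Y \<noteq> 0" "\<not> (\<exists>N\<in>Hom X Y. N \<noteq> 0)"
  then have "Hom X Y = {0}" using Hom_zero by blast
  then show False using \<open>m X Y \<noteq> 0\<close> by (simp add: m_def fsp.dim_zero_space)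
qed

lemma iso_sym: "iso X Y \<Longrightarrow> iso Y X"
  unfolding iso_def by blast

text \<open>A nonzero homomorphism has a generalised inverse that is a homomorphism too. Both composites are nonzero idempotents in
  algebras of scalars, hence identities.\<close>

lemma schur:
  assumes X: "irr X" and Y: "irr Y" and N: "m X Y \<noteq> 0"
  shows "iso X Y"
proof -
  note cX = irr_comod[OF X] and cY = irr_comod[OF Y]
  obtain N where N: "N \<in> Hom X Y" "N \<noteq> 0" using m_nonzeroD[OF N] by blast
  obtain M where M: "M \<in> Hom Y X" "mc (ix X) N (mc (ix Y) M N) = N" using maschke[OF cX cY N(1)] by blast
  obtain c where c: "mc (ix Y) M N = fs c (idm (ix X))" using irr_End[OF X Hom_comp[OF M(1) N(1)]] by blast
  obtain c' where c': "mc (ix X) N M = fs c' (idm (ix Y))" using irr_End[OF Y Hom_comp[OF N(1) M(1)]] by blast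
  have "fs c N = N" using M(2) unfolding c mc_linear mc_id_right[OF comod_finite[OF cX] Hom_supp[OF N(1)]] .
  then have "fs (c - 1) N = 0" by (auto simp: fun_eq_iff algebra_simps)
  then have "c = 1" using N(2) fsp.scale_eq_0_iff by fastforce
  have "fs c' N = N"
    using M(2) unfolding mc_assoc[symmetric] c' mc_linear mc_id_left[OF comod_finite[OF cY] Hom_supp[OF N(1)]] .
  then have "fs (c' - 1) N = 0" by (auto simp: fun_eq_iff algebra_simps)
  then have "c' = 1" using N(2) fsp.scale_eq_0_iff by fastforce
  then show ?thesis
    unfolding iso_def using M(1) N(1) c c' \<open>c = 1\<close> by (intro bexI[of _ M] bexI[of _ N]) (simp_all add: fs_def)
qed

lemma iso_m_left: "comod X \<Longrightarrow> comod Y \<Longrightarrow> comod Z \<Longrightarrow> iso X Y \<Longrightarrow> m X Z = m Y Z"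
  using additive_iso[OF additive_m_left] .

lemma iso_m_right: "comod X \<Longrightarrow> comod Y \<Longrightarrow> comod Z \<Longrightarrow> iso X Y \<Longrightarrow> m Z X = m Z Y"
  using additive_iso[OF additive_m_right] .

text \<open>If \<open>X\<close> has an endomorphism that is no scalar, subtracting an eigenvalue gives a singular nonzero endomorphism, and a generalised
  inverse turns it into a proper idempotent.\<close>

lemma irr_split:
  assumes X: "comod X" "ix X \<noteq> {}" "\<not> irr X"
  shows "\<exists>X1 X2. comod X1 \<and> comod X2 \<and> split X X1 X2 \<and> card (ix X1) < card (ix X) \<and> card (ix X2) < card (ix X)"
proof -
  let ?J = "ix X"
  note fin = comod_finite[OF X(1)]
  let ?V = "{v :: nat \<Rightarrow> 'k. \<forall>x. x \<notin> ?J \<longrightarrow> v x = 0}"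
  have id: "idm ?J \<in> Hom X X" "idm ?J \<noteq> (0 :: nat \<times> nat \<Rightarrow> 'k)"
    using Hom_id[OF X(1)] idm_nonzero[OF X(2)] .
  have "\<exists>T\<in>Hom X X. T \<notin> fsp.span {idm ?J}"
  proof (rule ccontr)
    assume "\<not> ?thesis"
    moreover have "fsp.span {idm ?J} \<subseteq> Hom X X" by (rule fsp.span_minimal[OF _ subspace_Hom]) (use id in simp)
    ultimately have "Hom X X = fsp.span {idm ?J}" by blast
    then have "m X X = card {idm ?J :: nat \<times> nat \<Rightarrow> 'k}"
      unfolding m_def using fsp.dim_span_eq_card_independent[of "{idm ?J}"] id(2) by simp
    then show False using X by (simp add: irr_def)
  qed
  then obtain T where T: "T \<in> Hom X X" "T \<notin> fsp.span {idm ?J}" by blast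
  obtain j0 where j0: "j0 \<in> ?J" using X(2) by blast
  have "\<exists>z v. v \<in> ?V \<and> v \<noteq> 0 \<and> apm ?J ?J T v = fs z v"
  proof (rule fspc.eigenvector[OF apm_lin fsp_supported(1)[OF fin]])
    show "apm ?J ?J T ` ?V \<subseteq> ?V" by (auto simp: apm_def)
    show "(dirac j0 :: nat \<Rightarrow> 'k) \<in> ?V" using j0 by (auto simp: dirac_def)
    show "(dirac j0 :: nat \<Rightarrow> 'k) \<noteq> 0" by (auto simp: dirac_def fun_eq_iff)
  qed
  then obtain z v where v: "v \<in> ?V" "v \<noteq> 0" "apm ?J ?J T v = fs z v" by blast
  define N where "N = T - fs z (idm ?J)"
  have N: "N \<in> Hom X X"
    unfolding N_def by (intro fsp.subspace_diff[OF subspace_Hom] fsp.subspace_scale[OF subspace_Hom] T(1) id(1))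
  have N0: "N \<noteq> 0" using T(2) fsp.span_scale[OF fsp.span_base, of "idm ?J" "{idm ?J}" z] unfolding N_def by auto
  have Nv: "(\<Sum>j\<in>?J. N (i, j) * v j) = 0" if i: "i \<in> ?J" for i
  proof -
    have Ti: "(\<Sum>j\<in>?J. T (i, j) * v j) = z * v i" using fun_cong[OF v(3), of i] i by (simp add: apm_def)
    have "(\<Sum>j\<in>?J. z * idm ?J (i, j) * v j) = (\<Sum>j\<in>?J. if i = j then z * v j else 0)"
      using i by (intro sum.cong refl) (simp add: idm_def)
    then have zi: "(\<Sum>j\<in>?J. z * idm ?J (i, j) * v j) = z * v i" using i fin by simp
    show ?thesis by (simp add: N_def left_diff_distrib sum_subtractf Ti zi)
  qed
  obtain M where M: "M \<in> Hom X X" "mc ?J N (mc ?J M N) = N" using maschke[OF X(1) X(1) N] by blast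
  define e where "e = mc ?J M N"
  have e: "e \<in> Hom X X" unfolding e_def by (rule Hom_comp[OF M(1) N])
  have ee: "mc ?J e e = e" unfolding e_def mc_assoc M(2) ..
  note idl = mc_id_left[OF fin Hom_supp] and idr = mc_id_right[OF fin Hom_supp]
  have f: "idm ?J - e \<in> Hom X X" by (intro fsp.subspace_diff[OF subspace_Hom] id e)
  have ff: "mc ?J (idm ?J - e) (idm ?J - e) = idm ?J - e"
    by (simp add: mc_linear idl[OF e] idr[OF e] idl[OF id(1)] ee)
  obtain X1 A1 C1 where 1: "comod X1" "A1 \<in> Hom X1 X" "C1 \<in> Hom X X1" "mc ?J C1 A1 = idm (ix X1)"
    "mc (ix X1) A1 C1 = e" "card (ix X1) \<le> card ?J" "card (ix X1) = card ?J \<longrightarrow> e = idm ?J"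
    using idempotent_summand[OF X(1) e ee] by blast
  obtain X2 A2 C2 where 2: "comod X2" "A2 \<in> Hom X2 X" "C2 \<in> Hom X X2" "mc ?J C2 A2 = idm (ix X2)"
    "mc (ix X2) A2 C2 = idm ?J - e" "card (ix X2) \<le> card ?J" "card (ix X2) = card ?J \<longrightarrow> idm ?J - e = idm ?J"
    using idempotent_summand[OF X(1) f ff] by blast
  have C1: "mc ?J C1 e = C1"
    unfolding 1(5)[symmetric] mc_assoc[symmetric] 1(4) by (rule mc_id_left[OF comod_finite[OF 1(1)] Hom_supp[OF 1(3)]])
  have A1: "mc ?J e A1 = A1"
    unfolding 1(5)[symmetric] mc_assoc 1(4) by (rule mc_id_right[OF comod_finite[OF 1(1)] Hom_supp[OF 1(2)]])
  have A2: "mc ?J e A2 = 0"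
  proof -
    have "mc ?J (idm ?J - e) A2 = A2"
      unfolding 2(5)[symmetric] mc_assoc 2(4) by (rule mc_id_right[OF comod_finite[OF 2(1)] Hom_supp[OF 2(2)]])
    then show ?thesis by (simp add: mc_linear mc_id_left[OF fin Hom_supp[OF 2(2)]])
  qed
  have C2: "mc ?J C2 e = 0"
  proof -
    have "mc ?J C2 (idm ?J - e) = C2"
      unfolding 2(5)[symmetric] mc_assoc[symmetric] 2(4) by (rule mc_id_left[OF comod_finite[OF 2(1)] Hom_supp[OF 2(3)]])
    then show ?thesis by (simp add: mc_linear mc_id_right[OF fin Hom_supp[OF 2(3)]])
  qed
  have "mc ?J C1 A2 = 0" using mc_assoc[of ?J ?J C1 e A2] by (simp add: C1 A2 mc_linear)
  moreover have "mc ?J C2 A1 = 0" using mc_assoc[of ?J ?J C2 e A1] by (simp add: C2 A1 mc_linear)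
  ultimately have "split X X1 X2"
    unfolding split_def using 1 2 by (intro bexI[of _ A1] bexI[of _ C1] bexI[of _ A2] bexI[of _ C2]) simp_all
  moreover have "card (ix X1) \<noteq> card ?J"
  proof
    assume "card (ix X1) = card ?J"
    then have ei: "e = idm ?J" using 1 by blast
    have "v i = 0" for i
    proof (cases "i \<in> ?J")
      case True
      have "v i = (\<Sum>j\<in>?J. e (i, j) * v j)"
        unfolding ei using True fin by (simp add: idm_def if_distrib[of "\<lambda>t. t * _"] cong: if_cong)
      also have "\<dots> = (\<Sum>l\<in>?J. M (i, l) * (\<Sum>j\<in>?J. N (l, j) * v j))"
        unfolding e_def mc_def by (simp add: sum_distrib_left sum_distrib_right mult.assoc) (rule sum.swap)
      finally show ?thesis by (simp add: Nv)
    qed (use v(1) in simp)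
    then show False using v(2) by auto
  qed
  moreover have "card (ix X2) \<noteq> card ?J"
  proof
    assume "card (ix X2) = card ?J"
    then have "e = 0" using 2 by simp
    then show False using M(2) N0 unfolding e_def by (simp add: mc_linear)
  qed
  ultimately show ?thesis using 1 2 by (meson le_neq_implies_less)
qed

text \<open>The span of the entries of a comodule is its coefficient coalgebra.\<close>

definition cf :: "'h comd \<Rightarrow> 'h set" where
  "cf X = {mt X i j | i j. i \<in> ix X \<and> j \<in> ix X}"

lemma split_cf:
  assumes "comod X" "split X X1 X2"
  shows "cf X \<subseteq> span (cf X1 \<union> cf X2)"
proof
  fix x assume "x \<in> cf X"
  then obtain i j where ij: "i \<in> ix X" "j \<in> ix X" "x = mt X i j" by (auto simp: cf_def)
  obtain A1 B1 A2 B2 where A: "A1 \<in> Hom X1 X" "B1 \<in> Hom X X1" "A2 \<in> Hom X2 X" "B2 \<in> Hom X X2"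
    and e: "mc (ix X1) A1 B1 + mc (ix X2) A2 B2 = idm (ix X)"
    using assms(2) unfolding split_def by blast
  have part: "(\<Sum>l\<in>ix X. mc (ix Y) A C (i, l) *s mt X l j) \<in> span (cf X1 \<union> cf X2)"
    if C: "C \<in> Hom X Y" and Y: "Y = X1 \<or> Y = X2" for Y A C
  proof -
    have "(\<Sum>l\<in>ix X. mc (ix Y) A C (i, l) *s mt X l j) = (\<Sum>s\<in>ix Y. A (i, s) *s (\<Sum>l\<in>ix X. C (s, l) *s mt X l j))"
      unfolding mc_def by (simp add: scale_sum_left scale_sum_right) (rule sum.swap)
    also have "\<dots> = (\<Sum>s\<in>ix Y. A (i, s) *s (\<Sum>u\<in>ix Y. C (u, j) *s mt Y s u))"
      using HomD[OF C _ ij(2)] by simp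
    also have "\<dots> \<in> span (cf X1 \<union> cf X2)"
      using Y by (intro span_sum span_scale span_base) (auto simp: cf_def)
    finally show ?thesis .
  qed
  have "x = (\<Sum>l\<in>ix X. idm (ix X) (i, l) *s mt X l j)"
    using ij comod_finite[OF assms(1)] by (simp add: idm_def if_distrib[of "\<lambda>t. t *s _"] cong: if_cong)
  also have "\<dots> = (\<Sum>l\<in>ix X. mc (ix X1) A1 B1 (i, l) *s mt X l j) + (\<Sum>l\<in>ix X. mc (ix X2) A2 B2 (i, l) *s mt X l j)"
    unfolding e[symmetric] by (simp add: scale_left_distrib sum.distrib)
  also have "\<dots> \<in> span (cf X1 \<union> cf X2)" using part[OF A(2)] part[OF A(4)] by (intro span_add) auto
  finally show "x \<in> span (cf X1 \<union> cf X2)" .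
qed

lemma cf_empty: "ix X = {} \<Longrightarrow> cf X = {}" by (simp add: cf_def)

lemma iso_cf: "comod X \<Longrightarrow> iso X Y \<Longrightarrow> span (cf X) \<subseteq> span (cf Y)"
  using split_cf[OF _ iso_split] cf_empty[OF ix_zc] by (simp add: span_minimal)

text \<open>One representative for each isomorphism class of irreducible comodules.\<close>

definition rp :: "'h comd \<Rightarrow> 'h comd" where
  "rp X = (SOME Y. irr Y \<and> m X Y \<noteq> 0)"

definition Irr :: "'h comd set" where
  "Irr = rp ` {X. irr X}"

lemma rp: "irr X \<Longrightarrow> irr (rp X) \<and> m X (rp X) \<noteq> 0"
  unfolding rp_def by (rule someI[of _ X]) (simp add: irr_def)

lemma rp_iso: "irr X \<Longrightarrow> iso X (rp X)"
  using rp schur by blast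

lemma Irr_irr: "a \<in> Irr \<Longrightarrow> irr a"
  using rp by (auto simp: Irr_def)

lemma Irr_comod: "a \<in> Irr \<Longrightarrow> comod a"
  using Irr_irr irr_comod by blast

lemma rp_Irr: "irr X \<Longrightarrow> rp X \<in> Irr"
  by (simp add: Irr_def)

lemma Irr_m:
  assumes "a \<in> Irr" "b \<in> Irr"
  shows "m a b = (if a = b then 1 else 0)"
proof (cases "m a b = 0")
  case True
  then show ?thesis using Irr_irr[OF assms(1)] by (auto simp: irr_def)
next
  case False
  obtain X Y where XY: "irr X" "a = rp X" "irr Y" "b = rp Y" using assms by (auto simp: Irr_def)
  have ab: "iso a b" using schur[OF Irr_irr[OF assms(1)] Irr_irr[OF assms(2)] False] .
  have "m X Z = m Y Z" if Z: "irr Z" for Z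
  proof -
    have "m X Z = m a Z" using iso_m_left[OF _ _ _ rp_iso[OF XY(1)]] XY Z rp irr_comod by blast
    also have "\<dots> = m b Z" using iso_m_left[OF _ _ _ ab] assms Irr_comod irr_comod[OF Z] by blast
    also have "\<dots> = m Y Z" using iso_m_left[OF _ _ _ rp_iso[OF XY(3)]] XY Z rp irr_comod by metis
    finally show ?thesis .
  qed
  then have "(\<lambda>Z. irr Z \<and> m X Z \<noteq> 0) = (\<lambda>Z. irr Z \<and> m Y Z \<noteq> 0)" by auto
  then have "a = b" unfolding XY rp_def by simp
  then show ?thesis using Irr_irr[OF assms(1)] by (simp add: irr_def)
qed

lemma decomposition:
  "comod X \<Longrightarrow> \<exists>as. set as \<subseteq> Irr \<and> (\<forall>F. additive F \<longrightarrow> F X = (\<Sum>a\<leftarrow>as. F a)) \<and> cf X \<subseteq> span (\<Union>a\<in>set as. cf a)"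
proof (induction "card (ix X)" arbitrary: X rule: less_induct)
  case less
  consider (e) "ix X = {}" | (i) "irr X" | (s) "ix X \<noteq> {}" "\<not> irr X" by blast
  then show ?case
  proof cases
    case e
    have "iso X zc" unfolding iso_def using Hom_zero e
      by (intro bexI[where x = 0]) (auto simp: ix_zc idm_empty mc_linear)
    then have "F X = 0" if "additive F" for F
      using additive_iso[OF that less.prems comod_zc] additive_zc[OF that] by simp
    then show ?thesis by (intro exI[of _ "[]"]) (simp add: cf_empty[OF e])
  next
    case i
    have "F X = F (rp X)" if "additive F" for F
      using additive_iso[OF that less.prems irr_comod rp_iso[OF i]] rp[OF i] by blast
    moreover have "cf X \<subseteq> span (cf (rp X))" using iso_cf[OF less.prems rp_iso[OF i]] span_superset by blast
    ultimately show ?thesis using rp_Irr[OF i] by (intro exI[of _ "[rp X]"]) simp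
  next
    case s
    obtain X1 X2 where x: "comod X1" "comod X2" "split X X1 X2" "card (ix X1) < card (ix X)" "card (ix X2) < card (ix X)"
      using irr_split[OF less.prems s] by blast
    obtain as1 where 1: "set as1 \<subseteq> Irr" "\<And>F. additive F \<Longrightarrow> F X1 = (\<Sum>a\<leftarrow>as1. F a)" "cf X1 \<subseteq> span (\<Union>a\<in>set as1. cf a)"
      using less.hyps[OF x(4,1)] by blast
    obtain as2 where 2: "set as2 \<subseteq> Irr" "\<And>F. additive F \<Longrightarrow> F X2 = (\<Sum>a\<leftarrow>as2. F a)" "cf X2 \<subseteq> span (\<Union>a\<in>set as2. cf a)"
      using less.hyps[OF x(5,2)] by blast
    let ?U = "span (\<Union>a\<in>set (as1 @ as2). cf a)"
    have "cf X1 \<subseteq> ?U" by (rule order_trans[OF 1(3) span_mono]) auto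
    moreover have "cf X2 \<subseteq> ?U" by (rule order_trans[OF 2(3) span_mono]) auto
    ultimately have "span (cf X1 \<union> cf X2) \<subseteq> ?U" by (intro span_minimal) auto
    then have "cf X \<subseteq> ?U" using split_cf[OF less.prems x(3)] by (rule order_trans[rotated])
    moreover have "F X = (\<Sum>a\<leftarrow>as1 @ as2. F a)" if F: "additive F" for F
      using F[unfolded additive_def, rule_format, OF less.prems x(1-3)] 1(2)[OF F] 2(2)[OF F] by simp
    ultimately show ?thesis using 1(1) 2(1) by (intro exI[of _ "as1 @ as2"]) simp
  qed
qed

end

context cosemisimple_hopf
begin

subsection \<open>The regular comodule\<close>

abbreviation "deg X \<equiv> card (ix X)"

definition enum :: "nat \<Rightarrow> 'h" where
  "enum = (SOME f. bij_betw f {..<card B} B)"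

lemma enum: "bij_betw enum {..<card B} B"
  unfolding enum_def using ex_bij_betw_nat_finite[OF finite_B] unfolding atLeast0LessThan by (rule someI_ex)

lemma enum_in: "i < card B \<Longrightarrow> enum i \<in> B"
  using enum by (auto simp: bij_betw_def)

lemma enum_sum: "(\<Sum>b\<in>B. f b) = (\<Sum>i<card B. f (enum i))"
  by (rule sum.reindex_bij_betw[OF enum, symmetric])

lemma enum_eq: "i < card B \<Longrightarrow> j < card B \<Longrightarrow> enum i = enum j \<longleftrightarrow> i = j"
  using enum by (auto simp: bij_betw_def inj_on_def)

definition reg :: "'h comd" where
  "reg = ({..<card B}, \<lambda>i j. D (enum i) (enum j))"

lemma ix_reg: "ix reg = {..<card B}" and mt_reg: "mt reg i j = D (enum i) (enum j)"
  by (simp_all add: reg_def)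

lemma counit_D: "\<epsilon> (D b h) = co b h"
proof -
  have "co b h = co b (SW (\<lambda>a c. \<epsilon> c *s a) h)" by (simp add: SW_counit_right)
  also have "\<dots> = (\<Sum>a\<in>B. \<epsilon> (D a h) * co b a)"
    by (simp add: SW_def lin_sum[OF co_lin] lin_scale[OF co_lin])
  also have "\<dots> = (\<Sum>a\<in>B. if b = a then \<epsilon> (D a h) else 0)"
    by (intro sum.cong refl) (simp add: co_basis)
  also have "\<dots> = \<epsilon> (D b h)" using finite_B by (simp add: D_out lin_zero[OF counit_lin])
  finally show ?thesis by simp
qed

lemma SW_D:
  assumes \<phi>: "lf \<phi>" and \<psi>: "lf \<psi>" and b: "b \<in> B"
  shows "SW (\<lambda>x y. \<phi> x * \<psi> y) (D b h) = (\<Sum>c\<in>B. \<phi> (D b c) * \<psi> (D c h))"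
proof -
  note fs = lin_add[OF \<phi>] lin_add[OF \<psi>] lin_scale[OF \<phi>] lin_scale[OF \<psi>] lin_add[OF co_lin] lin_scale[OF co_lin]
  have t: "trilin scale (*) (\<lambda>x y z. co b x * \<phi> y * \<psi> z)"
    by (auto simp: trilin_def lin_def fs algebra_simps)
  have "SW (\<lambda>x y. SW (\<lambda>p q. co b x * \<phi> p * \<psi> q) y) h = SW (\<lambda>x y. co b x * SW (\<lambda>p q. \<phi> p * \<psi> q) y) h"
    by (simp add: SW_def sum_distrib_left mult.assoc)
  also have "\<dots> = SW (\<lambda>p q. \<phi> p * \<psi> q) (D b h)"
    using b finite_B by (simp add: SW_def[of "\<lambda>x y. co b x * SW (\<lambda>p q. \<phi> p * \<psi> q) y"] co_basis if_distrib[of "\<lambda>t. t * _"] cong: if_cong)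
  finally have 1: "SW (\<lambda>x y. SW (\<lambda>p q. co b x * \<phi> p * \<psi> q) y) h = SW (\<lambda>p q. \<phi> p * \<psi> q) (D b h)" .
  have 2: "SW (\<lambda>p q. co b p * \<phi> q * \<psi> y) x = \<phi> (D b x) * \<psi> y" for x y
  proof -
    have "\<phi> (D b x) = SW (\<lambda>p q. co b p * \<phi> q) x"
      unfolding D_eq_SW[of b x] lin_SW[OF \<phi>] lin_scale[OF \<phi>] ..
    then show ?thesis by (simp add: SW_def sum_distrib_right)
  qed
  show ?thesis
    using SW_coassoc[OF vector_space_mult t, of h] unfolding 1 2 by (simp add: SW_def)
qed

lemma comod_reg: "comod reg"
  unfolding reg_def
  by (rule comodI) (auto simp: counit_D co_basis enum_in enum_eq SW_D enum_sum)

text \<open>Homomorphisms to the regular comodule correspond to functionals on the source, by composition with the counit.\<close>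

lemma m_reg: "comod X \<Longrightarrow> m X reg = deg X"
proof -
  assume X: "comod X"
  let ?n = "card B"
  let ?V = "{f :: nat \<Rightarrow> 'k. \<forall>x. x \<notin> ix X \<longrightarrow> f x = 0}"
  let ?f = "\<lambda>t (i, j). if i < ?n \<and> j \<in> ix X then \<Sum>l\<in>ix X. t l * co (enum i) (mt X l j) else 0"
  note V = fsp_supported[OF comod_finite[OF X]]
  have f: "Vector_Spaces.linear fs fs ?f"
    unfolding lin_iff_linear[OF vs_fs vs_fs, symmetric]
    by (intro linI) (auto simp: fun_eq_iff distrib_right sum.distrib sum_distrib_left mult.assoc)
  have rec: "(\<Sum>i<?n. ?f t (i, j) *s enum i) = (\<Sum>l\<in>ix X. t l *s mt X l j)" if "j \<in> ix X" for t j
  proof -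
    have "(\<Sum>i<?n. ?f t (i, j) *s enum i) = (\<Sum>b\<in>B. co b (\<Sum>l\<in>ix X. t l *s mt X l j) *s b)"
      using that by (simp add: enum_sum lin_sum[OF co_lin] lin_scale[OF co_lin])
    then show ?thesis by (simp add: co_sum)
  qed
  have inj: "t = 0" if t: "t \<in> ?V" "?f t = 0" for t
  proof (rule ext)
    fix j
    show "t j = 0 j"
    proof (cases "j \<in> ix X")
      case True
      have "(\<Sum>l\<in>ix X. t l *s mt X l j) = 0" unfolding rec[OF True, symmetric] t(2) by simp
      then have "\<epsilon> (\<Sum>l\<in>ix X. t l *s mt X l j) = 0" by (simp add: lin_zero[OF counit_lin])
      then show ?thesis
        using True comod_finite[OF X]
        by (simp add: lin_sum[OF counit_lin] lin_scale[OF counit_lin] comod_counit[OF X] if_distrib cong: if_cong)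
    qed (use t(1) in simp)
  qed
  have "?f ` ?V = Hom X reg"
  proof (intro equalityI subsetI)
    fix T assume "T \<in> ?f ` ?V"
    then obtain t where T: "T = ?f t" by blast
    have "(\<Sum>l<?n. T (l, j) *s mt reg i l) = (\<Sum>p\<in>ix X. T (i, p) *s mt X p j)"
      if i: "i < ?n" and j: "j \<in> ix X" for i j
    proof -
      have "(\<Sum>l<?n. T (l, j) *s mt reg i l) = D (enum i) (\<Sum>l<?n. T (l, j) *s enum l)"
        by (simp add: mt_reg lin_sum[OF D_lin] lin_scale[OF D_lin])
      also have "\<dots> = (\<Sum>l\<in>ix X. t l *s D (enum i) (mt X l j))"
        unfolding T rec[OF j] by (simp add: lin_sum[OF D_lin] lin_scale[OF D_lin])
      also have "\<dots> = (\<Sum>l\<in>ix X. t l *s (\<Sum>p\<in>ix X. co (enum i) (mt X l p) *s mt X p j))"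
        using j by (simp add: D_eq_SW comod_SW[OF X _ _ vs bilin_co])
      also have "\<dots> = (\<Sum>p\<in>ix X. (\<Sum>l\<in>ix X. t l * co (enum i) (mt X l p)) *s mt X p j)"
        by (simp add: scale_sum_right scale_sum_left) (rule sum.swap)
      also have "\<dots> = (\<Sum>p\<in>ix X. T (i, p) *s mt X p j)" unfolding T using i by simp
      finally show ?thesis .
    qed
    then show "T \<in> Hom X reg" unfolding Hom_def by (auto simp: ix_reg supp_def T)
  next
    fix T assume T: "T \<in> Hom X reg"
    define x where "x j = (\<Sum>l<?n. T (l, j) *s enum l)" for j
    define t where "t l = (if l \<in> ix X then \<epsilon> (x l) else 0)" for l
    have T0: "T (i, j) = 0" if "\<not> i < ?n \<or> j \<notin> ix X" for i j
      using suppD[OF Hom_supp[OF T]] that by (simp add: ix_reg)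
    have cox: "co (enum i) (x j) = T (i, j)" if "i < ?n" for i j
      unfolding x_def using that
      by (simp add: lin_sum[OF co_lin] lin_scale[OF co_lin] co_basis enum_in enum_eq if_distrib cong: if_cong)
    have Dx: "D (enum i) (x j) = (\<Sum>p\<in>ix X. T (i, p) *s mt X p j)" if "i < ?n" "j \<in> ix X" for i j
      using HomD[OF T, of i j] that
      by (simp add: x_def lin_sum[OF D_lin] lin_scale[OF D_lin] ix_reg mt_reg)
    have xe: "x j = (\<Sum>l\<in>ix X. t l *s mt X l j)" if "j \<in> ix X" for j
    proof -
      have "x j = SW (\<lambda>a b. \<epsilon> a *s b) (x j)" by (simp add: SW_counit_left)
      also have "\<dots> = (\<Sum>i<?n. \<epsilon> (enum i) *s (\<Sum>p\<in>ix X. T (i, p) *s mt X p j))"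
        using that by (simp add: SW_def enum_sum Dx)
      also have "\<dots> = (\<Sum>p\<in>ix X. \<epsilon> (x p) *s mt X p j)"
        by (simp add: x_def lin_sum[OF counit_lin] lin_scale[OF counit_lin] scale_sum_right scale_sum_left mult.commute)
          (rule sum.swap)
      finally show ?thesis by (simp add: t_def)
    qed
    have "T p = ?f t p" for p
    proof (cases p)
      case (Pair i j)
      show ?thesis
      proof (cases "i < ?n \<and> j \<in> ix X")
        case True
        then have "T (i, j) = co (enum i) (\<Sum>l\<in>ix X. t l *s mt X l j)" using cox[of i j] xe[of j] by metis
        then show ?thesis using True Pair by (simp add: lin_sum[OF co_lin] lin_scale[OF co_lin])
      qed (use T0 Pair in auto)
    qed
    then have "T = ?f t" by (rule ext)
    moreover have "t \<in> ?V" by (simp add: t_def)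
    ultimately show "T \<in> ?f ` ?V" by blast
  qed
  then show ?thesis
    using fspp.dim_inj_image(2)[OF f V(1) inj] V(2) by (simp add: m_def)
qed

lemma additive_deg: "additive deg"
  using additive_m_left[OF comod_reg] unfolding additive_def by (simp add: m_reg)

lemma cf_reg: "span (cf reg) = UNIV"
proof -
  have "b \<in> span (cf reg)" if "b \<in> B" for b
  proof -
    have "b \<in> enum ` {..<card B}" using that bij_betw_imp_surj_on[OF enum] by simp
    then obtain j where j: "j < card B" "b = enum j" by blast
    have "b = (\<Sum>i<card B. \<epsilon> (enum i) *s mt reg i j)"
      using SW_counit_left[of b] unfolding SW_def enum_sum by (simp add: mt_reg j)
    also have "\<dots> \<in> span (cf reg)"
      using j by (intro span_sum span_scale span_base) (auto simp: cf_def ix_reg)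
    finally show ?thesis .
  qed
  then have "span B \<subseteq> span (cf reg)" by (intro span_minimal) auto
  then show ?thesis using span_Basis by auto
qed

lemma Irr_deg_pos: "a \<in> Irr \<Longrightarrow> deg a > 0"
  using irr_nonempty[OF Irr_irr] comod_finite[OF Irr_comod] by (simp add: card_gt_0_iff)

lemma sum_list_m_left: "set as \<subseteq> Irr \<Longrightarrow> a \<in> Irr \<Longrightarrow> (\<Sum>b\<leftarrow>as. m a b) = count_list as a"
  by (induction as) (auto simp: Irr_m)

lemma sum_list_m_right: "set as \<subseteq> Irr \<Longrightarrow> a \<in> Irr \<Longrightarrow> (\<Sum>b\<leftarrow>as. m b a) = count_list as a"
  by (induction as) (auto simp: Irr_m)

lemma finite_Irr: "finite Irr"
proof -
  obtain as where as: "set as \<subseteq> Irr" "\<And>F. additive F \<Longrightarrow> F reg = (\<Sum>a\<leftarrow>as. F a)"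
    using decomposition[OF comod_reg] by blast
  have "a \<in> set as" if a: "a \<in> Irr" for a
  proof -
    have "count_list as a = m a reg"
      using as(2)[OF additive_m_right[OF Irr_comod[OF a]]] sum_list_m_left[OF as(1) a] by simp
    then show ?thesis using m_reg[OF Irr_comod[OF a]] Irr_deg_pos[OF a] by (metis count_notin less_numeral_extra(3))
  qed
  then show ?thesis by (meson List.finite_set finite_subset subsetI)
qed

text \<open>Every comodule behaves like the sum of its irreducible constituents, counted with multiplicity.\<close>

lemma additive_expand:
  assumes X: "comod X"
  shows "additive F \<Longrightarrow> F X = (\<Sum>a\<in>Irr. m a X * F a)"
    and "a \<in> Irr \<Longrightarrow> m X a = m a X"
    and "cf X \<subseteq> span (\<Union>a\<in>{a\<in>Irr. m a X \<noteq> 0}. cf a)"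
proof -
  obtain as where as: "set as \<subseteq> Irr" "\<And>F. additive F \<Longrightarrow> F X = (\<Sum>a\<leftarrow>as. F a)" "cf X \<subseteq> span (\<Union>a\<in>set as. cf a)"
    using decomposition[OF X] by blast
  have c: "m a X = count_list as a" if "a \<in> Irr" for a
    using as(2)[OF additive_m_right[OF Irr_comod[OF that]]] sum_list_m_left[OF as(1) that] by simp
  show "F X = (\<Sum>a\<in>Irr. m a X * F a)" if "additive F"
  proof -
    have "F X = (\<Sum>a\<in>set as. count_list as a * F a)" using as(2)[OF that] by (simp add: sum_list_map_eq_sum_count)
    also have "\<dots> = (\<Sum>a\<in>Irr. count_list as a * F a)"
      by (rule sum.mono_neutral_left[OF finite_Irr as(1)]) (auto simp: count_list_0_iff)
    finally show ?thesis by (simp add: c)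
  qed
  show "m X a = m a X" if "a \<in> Irr"
    using as(2)[OF additive_m_left[OF Irr_comod[OF that]]] sum_list_m_right[OF as(1) that] c[OF that] by simp
  have "set as \<subseteq> {a\<in>Irr. m a X \<noteq> 0}"
  proof
    fix a assume a: "a \<in> set as"
    then have "a \<in> Irr" using as(1) by blast
    moreover have "m a X \<noteq> 0" using a c[OF \<open>a \<in> Irr\<close>] by (simp only: count_list_0_iff) simp
    ultimately show "a \<in> {a\<in>Irr. m a X \<noteq> 0}" by simp
  qed
  then have "(\<Union>a\<in>set as. cf a) \<subseteq> (\<Union>a\<in>{a\<in>Irr. m a X \<noteq> 0}. cf a)" by blast
  then show "cf X \<subseteq> span (\<Union>a\<in>{a\<in>Irr. m a X \<noteq> 0}. cf a)"
    using as(3) span_mono by (metis (no_types, lifting) order_trans)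
qed

text \<open>The degree of the regular comodule, expanded with the multiplicities of \<open>m_reg\<close>.\<close>

lemma sum_deg_squares: "(\<Sum>a\<in>Irr. deg a * deg a) = card B"
  using additive_expand(1)[OF comod_reg additive_deg] m_reg[OF Irr_comod] by (simp add: ix_reg)

text \<open>The matrix entries of the irreducible comodules span \<open>H\<close>, and there are only \<open>dim H\<close> of them.\<close>

definition Om :: "('h comd \<times> nat \<times> nat) set" where
  "Om = (SIGMA a:Irr. ix a \<times> ix a)"

definition ent :: "'h comd \<times> nat \<times> nat \<Rightarrow> 'h" where
  "ent = (\<lambda>(a, i, j). mt a i j)"

lemma finite_Om: "finite Om"
  unfolding Om_def using finite_Irr comod_finite[OF Irr_comod] by (intro finite_SigmaI) auto

lemma card_Om: "card Om = card B"
  unfolding Om_def using finite_Irr comod_finite[OF Irr_comod] sum_deg_squares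
  by (subst card_SigmaI) (auto simp: card_cartesian_product)

lemma ent_image: "ent ` Om = (\<Union>a\<in>Irr. cf a)"
  unfolding ent_def Om_def cf_def by force

lemma span_ent: "span (ent ` Om) = UNIV"
proof -
  have "span (cf reg) \<subseteq> span (\<Union>a\<in>{a\<in>Irr. m a reg \<noteq> 0}. cf a)"
    by (rule span_minimal[OF additive_expand(3)[OF comod_reg] subspace_span])
  also have "\<dots> \<subseteq> span (\<Union>a\<in>Irr. cf a)" by (rule span_mono) blast
  finally show ?thesis unfolding cf_reg ent_image by auto
qed

lemma dim_UNIV_B: "dim UNIV = card B"
  by (rule dim_UNIV)

lemma ent_basis: "inj_on ent Om" "independent (ent ` Om)"
proof -
  have "card B \<le> card (ent ` Om)"
    using dim_span_le_card[of "ent ` Om"] finite_Om unfolding span_ent dim_UNIV_B by simp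
  then have c: "card (ent ` Om) = card Om" using card_image_le[OF finite_Om, of ent] card_Om by simp
  then show "inj_on ent Om" by (rule eq_card_imp_inj_on[OF finite_Om])
  show "independent (ent ` Om)"
    by (rule card_le_dim_spanning[of _ UNIV]) (use span_ent finite_Om c card_Om in \<open>auto simp: dim_UNIV_B\<close>)
qed

end

context cosemisimple_hopf
begin

subsection \<open>Tensor products and multiplicities\<close>

definition kr :: "(nat \<times> nat \<Rightarrow> 'k) \<Rightarrow> (nat \<times> nat \<Rightarrow> 'k) \<Rightarrow> nat \<times> nat \<Rightarrow> 'k" where
  "kr T U = (\<lambda>(p, q). T (fst (prod_decode p), fst (prod_decode q)) * U (snd (prod_decode p), snd (prod_decode q)))"

lemma kr_apply: "kr T U (prod_encode (i, k), prod_encode (j, l)) = T (i, j) * U (k, l)"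
  by (simp add: kr_def)

lemma kr_eqI:
  assumes "\<And>i j k l. f (prod_encode (i, k), prod_encode (j, l)) = g (prod_encode (i, k), prod_encode (j, l))"
  shows "f = g"
proof (rule ext, clarify)
  fix p q
  show "f (p, q) = g (p, q)"
    using assms[of "fst (prod_decode p)" "snd (prod_decode p)" "fst (prod_decode q)" "snd (prod_decode q)"] by simp
qed

lemma supp_encI:
  assumes "\<And>i k j l. \<not> (i \<in> I \<and> k \<in> I' \<and> j \<in> J \<and> l \<in> J') \<Longrightarrow> T (prod_encode (i, k), prod_encode (j, l)) = 0"
  shows "supp (prod_encode ` (I \<times> I')) (prod_encode ` (J \<times> J')) T"
  unfolding supp_def
proof (intro allI impI)
  fix r assume r: "r \<notin> prod_encode ` (I \<times> I') \<times> prod_encode ` (J \<times> J')"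
  obtain i k j l where e: "r = (prod_encode (i, k), prod_encode (j, l))"
    by (metis prod.collapse prod_decode_inverse)
  show "T r = 0" using r unfolding e by (intro assms) blast
qed

lemma supp_enc_left: "supp (prod_encode ` (I \<times> I')) J T \<longleftrightarrow>
    (\<forall>i k j. \<not> (i \<in> I \<and> k \<in> I' \<and> j \<in> J) \<longrightarrow> T (prod_encode (i, k), j) = 0)"
proof
  assume R: "\<forall>i k j. \<not> (i \<in> I \<and> k \<in> I' \<and> j \<in> J) \<longrightarrow> T (prod_encode (i, k), j) = 0"
  show "supp (prod_encode ` (I \<times> I')) J T"
    unfolding supp_def
  proof (intro allI impI)
    fix r assume r: "r \<notin> prod_encode ` (I \<times> I') \<times> J"
    obtain i k j where e: "r = (prod_encode (i, k), j)" by (metis prod.collapse prod_decode_inverse)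
    show "T r = 0" using r R unfolding e by blast
  qed
next
  assume L: "supp (prod_encode ` (I \<times> I')) J T"
  show "\<forall>i k j. \<not> (i \<in> I \<and> k \<in> I' \<and> j \<in> J) \<longrightarrow> T (prod_encode (i, k), j) = 0"
    by (intro allI impI suppD[OF L]) auto
qed

lemma supp_enc_right: "supp I (prod_encode ` (J \<times> J')) T \<longleftrightarrow>
    (\<forall>i j l. \<not> (i \<in> I \<and> j \<in> J \<and> l \<in> J') \<longrightarrow> T (i, prod_encode (j, l)) = 0)"
proof
  assume R: "\<forall>i j l. \<not> (i \<in> I \<and> j \<in> J \<and> l \<in> J') \<longrightarrow> T (i, prod_encode (j, l)) = 0"
  show "supp I (prod_encode ` (J \<times> J')) T"
    unfolding supp_def
  proof (intro allI impI)
    fix r assume r: "r \<notin> I \<times> prod_encode ` (J \<times> J')"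
    obtain i j l where e: "r = (i, prod_encode (j, l))" by (metis prod.collapse prod_decode_inverse)
    show "T r = 0" using r R unfolding e by blast
  qed
next
  assume L: "supp I (prod_encode ` (J \<times> J')) T"
  show "\<forall>i j l. \<not> (i \<in> I \<and> j \<in> J \<and> l \<in> J') \<longrightarrow> T (i, prod_encode (j, l)) = 0"
    by (intro allI impI suppD[OF L]) auto
qed

lemma kr_supp: "supp I J T \<Longrightarrow> supp I' J' U \<Longrightarrow> supp (prod_encode ` (I \<times> I')) (prod_encode ` (J \<times> J')) (kr T U)"
  by (rule supp_encI) (auto simp: kr_apply suppD)

lemma kr_mc: "mc (ix (tn X Y)) (kr T U) (kr T' U') = kr (mc (ix X) T T') (mc (ix Y) U U')"
  by (rule kr_eqI) (simp add: mc_def sum_tn kr_apply sum_product mult_ac)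

lemma kr_id: "kr (idm (ix X)) (idm (ix Y)) = idm (ix (tn X Y))"
  by (rule kr_eqI) (auto simp: kr_apply idm_def mem_tn)

lemma kr_linear: "kr (T + T') U = kr T U + kr T' U" "kr U (T + T') = kr U T + kr U T'" "kr 0 U = 0" "kr U 0 = 0"
  by (auto simp: kr_def fun_eq_iff algebra_simps)

lemma kr_Hom:
  assumes T: "T \<in> Hom X X'" and U: "U \<in> Hom Y Y'"
  shows "kr T U \<in> Hom (tn X Y) (tn X' Y')"
proof -
  have "(\<Sum>l\<in>ix (tn X' Y'). kr T U (l, q) *s mt (tn X' Y') p l) = (\<Sum>l\<in>ix (tn X Y). kr T U (p, l) *s mt (tn X Y) l q)"
    if "p \<in> ix (tn X' Y')" "q \<in> ix (tn X Y)" for p q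
  proof -
    obtain i k j l where p: "p = prod_encode (i, k)" "i \<in> ix X'" "k \<in> ix Y'"
      and q: "q = prod_encode (j, l)" "j \<in> ix X" "l \<in> ix Y"
      using \<open>p \<in> ix (tn X' Y')\<close> \<open>q \<in> ix (tn X Y)\<close> unfolding ix_tn by blast
    have "(\<Sum>l\<in>ix (tn X' Y'). kr T U (l, q) *s mt (tn X' Y') p l)
      = (\<Sum>x\<in>ix X'. T (x, j) *s mt X' i x) * (\<Sum>y\<in>ix Y'. U (y, l) *s mt Y' k y)"
      unfolding p q sum_tn by (simp add: kr_apply mt_tn sum_product scale_mult_left scale_mult_right mult_ac)
    also have "\<dots> = (\<Sum>x\<in>ix X. T (i, x) *s mt X x j) * (\<Sum>y\<in>ix Y. U (k, y) *s mt Y y l)"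
      using HomD[OF T p(2) q(2)] HomD[OF U p(3) q(3)] by simp
    also have "\<dots> = (\<Sum>l\<in>ix (tn X Y). kr T U (p, l) *s mt (tn X Y) l q)"
      unfolding p q sum_tn by (simp add: kr_apply mt_tn sum_product scale_mult_left scale_mult_right mult_ac)
    finally show ?thesis .
  qed
  then show ?thesis
    using kr_supp[OF Hom_supp[OF T] Hom_supp[OF U]] unfolding Hom_def ix_tn by simp
qed

lemma split_tn_left:
  assumes Y: "comod Y" and s: "split X X1 X2"
  shows "split (tn X Y) (tn X1 Y) (tn X2 Y)"
proof -
  obtain A1 B1 A2 B2 where A: "A1 \<in> Hom X1 X" "B1 \<in> Hom X X1" "A2 \<in> Hom X2 X" "B2 \<in> Hom X X2"
    and e: "mc (ix X) B1 A1 = idm (ix X1)" "mc (ix X) B2 A2 = idm (ix X2)"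
      "mc (ix X1) A1 B1 + mc (ix X2) A2 B2 = idm (ix X)" "mc (ix X) B1 A2 = 0" "mc (ix X) B2 A1 = 0"
    using s unfolding split_def by blast
  let ?i = "idm (ix Y) :: nat \<times> nat \<Rightarrow> 'k"
  have i: "?i \<in> Hom Y Y" "mc (ix Y) ?i ?i = ?i"
    using Hom_id[OF Y] mc_id_left[OF comod_finite[OF Y] supp_idm] .
  show ?thesis
    unfolding split_def
    using kr_Hom[OF A(1) i(1)] kr_Hom[OF A(2) i(1)] kr_Hom[OF A(3) i(1)] kr_Hom[OF A(4) i(1)]
    by (intro bexI[of _ "kr A1 ?i"] bexI[of _ "kr B1 ?i"] bexI[of _ "kr A2 ?i"] bexI[of _ "kr B2 ?i"])
      (simp_all add: kr_mc e i kr_id kr_linear(1)[symmetric] kr_linear(3))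
qed

lemma split_tn_right:
  assumes Y: "comod Y" and s: "split X X1 X2"
  shows "split (tn Y X) (tn Y X1) (tn Y X2)"
proof -
  obtain A1 B1 A2 B2 where A: "A1 \<in> Hom X1 X" "B1 \<in> Hom X X1" "A2 \<in> Hom X2 X" "B2 \<in> Hom X X2"
    and e: "mc (ix X) B1 A1 = idm (ix X1)" "mc (ix X) B2 A2 = idm (ix X2)"
      "mc (ix X1) A1 B1 + mc (ix X2) A2 B2 = idm (ix X)" "mc (ix X) B1 A2 = 0" "mc (ix X) B2 A1 = 0"
    using s unfolding split_def by blast
  let ?i = "idm (ix Y) :: nat \<times> nat \<Rightarrow> 'k"
  have i: "?i \<in> Hom Y Y" "mc (ix Y) ?i ?i = ?i"
    using Hom_id[OF Y] mc_id_left[OF comod_finite[OF Y] supp_idm] .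
  show ?thesis
    unfolding split_def
    using kr_Hom[OF i(1) A(1)] kr_Hom[OF i(1) A(2)] kr_Hom[OF i(1) A(3)] kr_Hom[OF i(1) A(4)]
    by (intro bexI[of _ "kr ?i A1"] bexI[of _ "kr ?i B1"] bexI[of _ "kr ?i A2"] bexI[of _ "kr ?i B2"])
      (simp_all add: kr_mc e i kr_id kr_linear(2)[symmetric] kr_linear(4))
qed

lemma additive_tn_left: "additive F \<Longrightarrow> comod Y \<Longrightarrow> additive (\<lambda>X. F (tn X Y))"
  unfolding additive_def by (intro allI impI) (meson comod_tn split_tn_left)

lemma additive_tn_right: "additive F \<Longrightarrow> comod Y \<Longrightarrow> additive (\<lambda>X. F (tn Y X))"
  unfolding additive_def by (intro allI impI) (meson comod_tn split_tn_right)

lemma iso_reindex: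
  assumes X: "comod X" and Y: "comod Y" and b: "bij_betw f (ix X) (ix Y)"
    and e: "\<And>i j. i \<in> ix X \<Longrightarrow> j \<in> ix X \<Longrightarrow> mt Y (f i) (f j) = mt X i j"
  shows "iso X Y"
proof -
  define A :: "nat \<times> nat \<Rightarrow> 'k" where "A = (\<lambda>(i, q). if i \<in> ix X \<and> q = f i then 1 else 0)"
  define C :: "nat \<times> nat \<Rightarrow> 'k" where "C = (\<lambda>(p, j). if j \<in> ix X \<and> p = f j then 1 else 0)"
  note fin = comod_finite[OF X] comod_finite[OF Y]
  have fY: "f i \<in> ix Y" if "i \<in> ix X" for i using b that by (auto simp: bij_betw_def)
  have inj: "f i = f j \<longleftrightarrow> i = j" if "i \<in> ix X" "j \<in> ix X" for i j using b that by (auto simp: bij_betw_def inj_on_def)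
  have sumY: "(\<Sum>q\<in>ix Y. g q) = (\<Sum>i\<in>ix X. g (f i))" for g :: "nat \<Rightarrow> 'v::comm_monoid_add"
    by (rule sum.reindex_bij_betw[OF b, symmetric])
  have allY: "(\<forall>q\<in>ix Y. P q) \<longleftrightarrow> (\<forall>i\<in>ix X. P (f i))" for P
    unfolding bij_betw_imp_surj_on[OF b, symmetric] by simp
  have "A \<in> Hom Y X"
    unfolding Hom_def mem_Collect_eq allY sumY
    using fY fin by (auto simp: A_def supp_def inj e if_distrib[of "\<lambda>t. t *s _"] cong: if_cong conj_cong)
  moreover have "C \<in> Hom X Y"
    unfolding Hom_def mem_Collect_eq allY sumY
    using fY fin by (auto simp: C_def supp_def inj e if_distrib[of "\<lambda>t. t *s _"] cong: if_cong conj_cong)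
  moreover have "mc (ix X) C A (p, q) = idm (ix Y) (p, q)" for p q
  proof -
    have "(\<Sum>l\<in>ix X. C (p, l) * A (l, q)) = (\<Sum>l\<in>ix X. if p = f l \<and> q = f l then 1 else 0)"
      by (intro sum.cong refl) (auto simp: C_def A_def)
    also have "\<dots> = (\<Sum>l\<in>ix Y. if p = l \<and> q = l then 1 else 0)"
      by (rule sumY[of "\<lambda>l. if p = l \<and> q = l then 1 else 0", symmetric])
    also have "\<dots> = (\<Sum>l\<in>ix Y. if p = l then (if q = p then 1 else 0) else 0)" by (intro sum.cong refl) auto
    also have "\<dots> = (if p = q \<and> p \<in> ix Y then 1 else 0)" using fin by simp
    finally show ?thesis by (simp add: mc_def idm_def)
  qed
  moreover have "mc (ix Y) A C (p, q) = idm (ix X) (p, q)" for p q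
  proof -
    have "(\<Sum>l\<in>ix Y. A (p, l) * C (l, q)) = (\<Sum>l\<in>ix X. A (p, f l) * C (f l, q))"
      by (rule sumY)
    also have "\<dots> = (\<Sum>l\<in>ix X. if p = l then (if q = p then 1 else 0) else 0)"
    proof (rule sum.cong[OF refl])
      fix l assume l: "l \<in> ix X"
      have "A (p, f l) = (if p = l then 1 else 0)" using l inj[of l p] by (auto simp: A_def)
      moreover have "C (f l, q) = (if q = l then 1 else 0)" using l inj[of l q] by (auto simp: C_def)
      ultimately show "A (p, f l) * C (f l, q) = (if p = l then (if q = p then 1 else 0) else 0)" by auto
    qed
    also have "\<dots> = (if p = q \<and> p \<in> ix X then 1 else 0)" using fin by simp
    finally show ?thesis by (simp add: mc_def idm_def)
  qed
  ultimately show ?thesis unfolding iso_def by (intro bexI[of _ A] bexI[of _ C]) (auto simp: fun_eq_iff)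
qed

lemma iso_assoc:
  assumes "comod X" "comod Y" "comod Z"
  shows "iso (tn (tn X Y) Z) (tn X (tn Y Z))"
proof (rule iso_reindex)
  let ?f = "\<lambda>p. prod_encode (fst (prod_decode (fst (prod_decode p))), prod_encode (snd (prod_decode (fst (prod_decode p))), snd (prod_decode p)))"
  show "bij_betw ?f (ix (tn (tn X Y) Z)) (ix (tn X (tn Y Z)))"
    by (rule bij_betw_byWitness[where f' = "\<lambda>p. prod_encode (prod_encode (fst (prod_decode p), fst (prod_decode (snd (prod_decode p)))), snd (prod_decode (snd (prod_decode p))))"])
      (auto simp: ix_tn)
  show "mt (tn X (tn Y Z)) (?f p) (?f q) = mt (tn (tn X Y) Z) p q" for p q
    by (simp add: tn_def mult.assoc)
qed (use assms comod_tn in blast)+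

lemma iso_unit_left: "comod X \<Longrightarrow> iso (tn un X) X"
  by (rule iso_reindex[where f = "\<lambda>p. snd (prod_decode p)"])
    (auto simp: comod_tn comod_un ix_un ix_tn mt_tn mt_un
      intro!: bij_betw_byWitness[where f' = "\<lambda>i. prod_encode (0, i)"])

lemma iso_unit_right: "comod X \<Longrightarrow> iso (tn X un) X"
  by (rule iso_reindex[where f = "\<lambda>p. fst (prod_decode p)"])
    (auto simp: comod_tn comod_un ix_un ix_tn mt_tn mt_un
      intro!: bij_betw_byWitness[where f' = "\<lambda>i. prod_encode (i, 0)"])

lemma m_eqI:
  assumes W: "comod W" "comod X" and f: "lin fs fs f" and fX: "\<And>T. T \<in> Hom W X \<Longrightarrow> f T \<in> Hom Y Z"
    and gX: "\<And>T. T \<in> Hom Y Z \<Longrightarrow> g T \<in> Hom W X" and gf: "\<And>T. g (f T) = T" and fg: "\<And>T. f (g T) = T"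
  shows "m W X = m Y Z"
proof -
  have "f ` Hom W X = Hom Y Z"
    using fX gX fg by (metis (no_types, opaque_lifting) image_subset_iff image_eqI subsetI subset_antisym)
  moreover have "T = 0" if "f T = 0" for T
    using gf[of T] gf[of 0] that lin_zero[OF f] by simp
  ultimately show ?thesis
    using fspp.dim_inj_image(2)[OF lin_linear_fs[OF f] fg_Hom[OF W]] by (simp add: m_def)
qed

text \<open>Frobenius reciprocity: moving \<open>V\<close> across does not change the matrix of a homomorphism, only the
  grouping of its indices.\<close>

lemma reciprocity_left:
  assumes V: "comod V" and X: "comod X" and Y: "comod Y"
  shows "m (tn (du V) X) Y = m X (tn V Y)"
proof (rule m_eqI)
  let ?f = "\<lambda>T (p, x). T (snd (prod_decode p), prod_encode (fst (prod_decode p), x))"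
  let ?g = "\<lambda>T (y, q). T (prod_encode (fst (prod_decode q), y), snd (prod_decode q))"
  show "lin fs fs ?f" by (intro linI) (auto simp: fun_eq_iff)
  show gf: "?g (?f T) = T" for T :: "nat \<times> nat \<Rightarrow> 'k" by (auto simp: fun_eq_iff)
  show fg: "?f (?g T) = T" for T :: "nat \<times> nat \<Rightarrow> 'k" by (auto simp: fun_eq_iff)
  have iff: "T \<in> Hom (tn (du V) X) Y \<longleftrightarrow> ?f T \<in> Hom X (tn V Y)" for T
  proof -
    have sup: "supp (ix Y) (ix (tn (du V) X)) T \<longleftrightarrow> supp (ix (tn V Y)) (ix X) (?f T)"
      unfolding ix_tn ix_du supp_enc_left supp_enc_right by auto
    let ?a = "\<lambda>y x v. \<Sum>y'\<in>ix Y. T (y', prod_encode (v, x)) *s mt Y y y'"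
    let ?b = "\<lambda>y x v. \<Sum>x'\<in>ix X. T (y, prod_encode (v, x')) *s mt X x' x"
    have eq: "(\<forall>v\<in>ix V. a v = (\<Sum>v'\<in>ix V. S (mt V v v') * b v')) \<longleftrightarrow> (\<forall>v\<in>ix V. (\<Sum>v'\<in>ix V. mt V v v' * a v') = b v)" for a b :: "nat \<Rightarrow> 'h"
    proof
      assume h: "\<forall>v\<in>ix V. a v = (\<Sum>v'\<in>ix V. S (mt V v v') * b v')"
      show "\<forall>v\<in>ix V. (\<Sum>v'\<in>ix V. mt V v v' * a v') = b v"
      proof
        fix v assume v: "v \<in> ix V"
        have "(\<Sum>v'\<in>ix V. mt V v v' * a v') = (\<Sum>w\<in>ix V. (\<Sum>v'\<in>ix V. mt V v v' * S (mt V v' w)) * b w)"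
          using h by (simp add: sum_distrib_left sum_distrib_right mult.assoc) (rule sum.swap)
        also have "\<dots> = (\<Sum>w\<in>ix V. if v = w then b w else 0)"
          using v by (intro sum.cong refl) (simp add: comod_S_right[OF V])
        finally show "(\<Sum>v'\<in>ix V. mt V v v' * a v') = b v" using v comod_finite[OF V] by simp
      qed
    next
      assume h: "\<forall>v\<in>ix V. (\<Sum>v'\<in>ix V. mt V v v' * a v') = b v"
      show "\<forall>v\<in>ix V. a v = (\<Sum>v'\<in>ix V. S (mt V v v') * b v')"
      proof
        fix v assume v: "v \<in> ix V"
        have "(\<Sum>v'\<in>ix V. S (mt V v v') * b v') = (\<Sum>v'\<in>ix V. S (mt V v v') * (\<Sum>w\<in>ix V. mt V v' w * a w))"
          using h by simp
        also have "\<dots> = (\<Sum>w\<in>ix V. (\<Sum>v'\<in>ix V. S (mt V v v') * mt V v' w) * a w)"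
          by (simp add: sum_distrib_left sum_distrib_right mult.assoc) (rule sum.swap)
        also have "\<dots> = (\<Sum>w\<in>ix V. if v = w then a w else 0)"
          using v by (intro sum.cong refl) (simp add: comod_S_left[OF V])
        finally show "a v = (\<Sum>v'\<in>ix V. S (mt V v v') * b v')" using v comod_finite[OF V] by simp
      qed
    qed
    have "(\<forall>i\<in>ix Y. \<forall>j\<in>ix (tn (du V) X). (\<Sum>l\<in>ix Y. T (l, j) *s mt Y i l) = (\<Sum>l\<in>ix (tn (du V) X). T (i, l) *s mt (tn (du V) X) l j))
      \<longleftrightarrow> (\<forall>y\<in>ix Y. \<forall>x\<in>ix X. \<forall>v\<in>ix V. ?a y x v = (\<Sum>v'\<in>ix V. S (mt V v v') * ?b y x v'))"
      unfolding ball_tn sum_tn mt_tn ix_du mt_du by (auto simp: sum_distrib_left scale_mult_right)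
    also have "\<dots> \<longleftrightarrow> (\<forall>y\<in>ix Y. \<forall>x\<in>ix X. \<forall>v\<in>ix V. (\<Sum>v'\<in>ix V. mt V v v' * ?a y x v') = ?b y x v)"
      unfolding eq ..
    also have "\<dots> \<longleftrightarrow> (\<forall>i\<in>ix (tn V Y). \<forall>j\<in>ix X. (\<Sum>l\<in>ix (tn V Y). ?f T (l, j) *s mt (tn V Y) i l) = (\<Sum>l\<in>ix X. ?f T (i, l) *s mt X l j))"
      unfolding ball_tn sum_tn mt_tn by (auto simp: sum_distrib_left scale_mult_right)
    finally show ?thesis unfolding Hom_def using sup by auto
  qed
  show "?f T \<in> Hom X (tn V Y)" if "T \<in> Hom (tn (du V) X) Y" for T using that iff by blast
  show "?g T \<in> Hom (tn (du V) X) Y" if "T \<in> Hom X (tn V Y)" for T using that iff[of "?g T"] fg[of T] by simp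
qed (use assms comod_tn comod_du in blast)+

lemma reciprocity_right:
  assumes V: "comod V" and X: "comod X" and Y: "comod Y"
  shows "m (tn X V) Y = m X (tn Y (du V))"
proof (rule m_eqI)
  let ?f = "\<lambda>T (p, x). T (fst (prod_decode p), prod_encode (x, snd (prod_decode p)))"
  let ?g = "\<lambda>T (y, q). T (prod_encode (y, snd (prod_decode q)), fst (prod_decode q))"
  show "lin fs fs ?f" by (intro linI) (auto simp: fun_eq_iff)
  show gf: "?g (?f T) = T" for T :: "nat \<times> nat \<Rightarrow> 'k" by (auto simp: fun_eq_iff)
  show fg: "?f (?g T) = T" for T :: "nat \<times> nat \<Rightarrow> 'k" by (auto simp: fun_eq_iff)
  have iff: "T \<in> Hom (tn X V) Y \<longleftrightarrow> ?f T \<in> Hom X (tn Y (du V))" for T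
  proof -
    have sup: "supp (ix Y) (ix (tn X V)) T \<longleftrightarrow> supp (ix (tn Y (du V))) (ix X) (?f T)"
      unfolding ix_tn ix_du supp_enc_left supp_enc_right by auto
    let ?a = "\<lambda>y x v. \<Sum>y'\<in>ix Y. T (y', prod_encode (x, v)) *s mt Y y y'"
    let ?b = "\<lambda>y x v. \<Sum>x'\<in>ix X. T (y, prod_encode (x', v)) *s mt X x' x"
    have eq: "(\<forall>v\<in>ix V. a v = (\<Sum>v'\<in>ix V. b v' * mt V v' v)) \<longleftrightarrow> (\<forall>v\<in>ix V. (\<Sum>v'\<in>ix V. a v' * S (mt V v' v)) = b v)" for a b :: "nat \<Rightarrow> 'h"
    proof
      assume h: "\<forall>v\<in>ix V. a v = (\<Sum>v'\<in>ix V. b v' * mt V v' v)"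
      show "\<forall>v\<in>ix V. (\<Sum>v'\<in>ix V. a v' * S (mt V v' v)) = b v"
      proof
        fix v assume v: "v \<in> ix V"
        have "(\<Sum>v'\<in>ix V. a v' * S (mt V v' v)) = (\<Sum>w\<in>ix V. b w * (\<Sum>v'\<in>ix V. mt V w v' * S (mt V v' v)))"
          using h by (simp add: sum_distrib_left sum_distrib_right mult.assoc) (rule sum.swap)
        also have "\<dots> = (\<Sum>w\<in>ix V. if w = v then b w else 0)"
          using v by (intro sum.cong refl) (simp add: comod_S_right[OF V])
        finally show "(\<Sum>v'\<in>ix V. a v' * S (mt V v' v)) = b v" using v comod_finite[OF V] by simp
      qed
    next
      assume h: "\<forall>v\<in>ix V. (\<Sum>v'\<in>ix V. a v' * S (mt V v' v)) = b v"
      show "\<forall>v\<in>ix V. a v = (\<Sum>v'\<in>ix V. b v' * mt V v' v)"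
      proof
        fix v assume v: "v \<in> ix V"
        have "(\<Sum>v'\<in>ix V. b v' * mt V v' v) = (\<Sum>v'\<in>ix V. (\<Sum>w\<in>ix V. a w * S (mt V w v')) * mt V v' v)"
          using h by simp
        also have "\<dots> = (\<Sum>w\<in>ix V. a w * (\<Sum>v'\<in>ix V. S (mt V w v') * mt V v' v))"
          by (simp add: sum_distrib_left sum_distrib_right mult.assoc) (rule sum.swap)
        also have "\<dots> = (\<Sum>w\<in>ix V. if w = v then a w else 0)"
          using v by (intro sum.cong refl) (simp add: comod_S_left[OF V])
        finally show "a v = (\<Sum>v'\<in>ix V. b v' * mt V v' v)" using v comod_finite[OF V] by simp
      qed
    qed
    have "(\<forall>i\<in>ix Y. \<forall>j\<in>ix (tn X V). (\<Sum>l\<in>ix Y. T (l, j) *s mt Y i l) = (\<Sum>l\<in>ix (tn X V). T (i, l) *s mt (tn X V) l j))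
      \<longleftrightarrow> (\<forall>y\<in>ix Y. \<forall>x\<in>ix X. \<forall>v\<in>ix V. ?a y x v = (\<Sum>x'\<in>ix X. \<Sum>v'\<in>ix V. T (y, prod_encode (x', v')) *s (mt X x' x * mt V v' v)))"
      unfolding ball_tn sum_tn mt_tn ..
    also have "\<dots> \<longleftrightarrow> (\<forall>y\<in>ix Y. \<forall>x\<in>ix X. \<forall>v\<in>ix V. ?a y x v = (\<Sum>v'\<in>ix V. ?b y x v' * mt V v' v))"
      by (subst sum.swap) (simp add: sum_distrib_right scale_mult_left)
    also have "\<dots> \<longleftrightarrow> (\<forall>y\<in>ix Y. \<forall>x\<in>ix X. \<forall>v\<in>ix V. (\<Sum>v'\<in>ix V. ?a y x v' * S (mt V v' v)) = ?b y x v)"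
      unfolding eq ..
    also have "\<dots> \<longleftrightarrow> (\<forall>y\<in>ix Y. \<forall>x\<in>ix X. \<forall>v\<in>ix V. (\<Sum>y'\<in>ix Y. \<Sum>v'\<in>ix V. T (y', prod_encode (x, v')) *s (mt Y y y' * S (mt V v' v))) = ?b y x v)"
    proof -
      have "(\<Sum>y'\<in>ix Y. \<Sum>v'\<in>ix V. T (y', prod_encode (x, v')) *s (mt Y y y' * S (mt V v' v)))
        = (\<Sum>v'\<in>ix V. ?a y x v' * S (mt V v' v))" for y x v
        by (subst sum.swap) (simp add: sum_distrib_right scale_mult_left)
      then show ?thesis by (simp only:)
    qed
    also have "\<dots> \<longleftrightarrow> (\<forall>i\<in>ix (tn Y (du V)). \<forall>j\<in>ix X. (\<Sum>l\<in>ix (tn Y (du V)). ?f T (l, j) *s mt (tn Y (du V)) i l) = (\<Sum>l\<in>ix X. ?f T (i, l) *s mt X l j))"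
      unfolding ball_tn sum_tn mt_tn ix_du mt_du by auto
    finally show ?thesis unfolding Hom_def using sup by auto
  qed
  show "?f T \<in> Hom X (tn Y (du V))" if "T \<in> Hom (tn X V) Y" for T using that iff by blast
  show "?g T \<in> Hom (tn X V) Y" if "T \<in> Hom X (tn Y (du V))" for T using that iff[of "?g T"] fg[of T] by simp
qed (use assms comod_tn comod_du in blast)+

end

context cosemisimple_hopf
begin

subsection \<open>The fusion rule\<close>

definition N :: "'h comd \<Rightarrow> 'h comd \<Rightarrow> 'h comd \<Rightarrow> nat" where
  "N a b c = m c (tn a b)"

definition st :: "'h comd \<Rightarrow> 'h comd" where
  "st a = rp (du a)"

definition one :: "'h comd" where
  "one = rp un"

lemma irr_un: "irr un"
proof -
  have "Hom un un \<subseteq> fsp.span {idm {0}}"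
  proof
    fix T :: "nat \<times> nat \<Rightarrow> 'k" assume "T \<in> Hom un un"
    then have T0: "T (i, j) = 0" if "i \<noteq> 0 \<or> j \<noteq> 0" for i j
      using suppD[OF Hom_supp, of T un un i j] that by (auto simp: ix_un)
    have "T (i, j) = fs (T (0, 0)) (idm {0}) (i, j)" for i j
      by (cases "i = 0 \<and> j = 0") (auto simp: idm_def T0)
    then have "T = fs (T (0, 0)) (idm {0})" by (intro ext) (metis surj_pair)
    then show "T \<in> fsp.span {idm {0}}" by (metis fsp.span_base fsp.span_scale insertI1)
  qed
  moreover have "fsp.span {idm {0}} \<subseteq> Hom un un"
    using Hom_id[OF comod_un] by (intro fsp.span_minimal subspace_Hom) (simp add: ix_un)
  ultimately have e: "Hom un un = fsp.span {idm {0}}" by blast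
  have "idm {0} \<noteq> (0 :: nat \<times> nat \<Rightarrow> 'k)" by (rule idm_nonzero) simp
  then have "m un un = 1"
    unfolding m_def e using fsp.dim_span_eq_card_independent[of "{idm {0}}"] by simp
  then show ?thesis by (simp add: irr_def comod_un)
qed

lemma irr_du: "irr a \<Longrightarrow> irr (du a)"
proof -
  assume a: "irr a"
  note ca = irr_comod[OF a]
  have "m (du a) (du a) = m (tn (du a) un) (du a)"
    using iso_m_left[OF _ _ _ iso_unit_right] comod_tn comod_un comod_du ca by metis
  also have "\<dots> = m un (tn a (du a))" by (rule reciprocity_left[OF ca comod_un comod_du[OF ca]])
  also have "\<dots> = m (tn un a) a" by (rule reciprocity_right[OF ca comod_un ca, symmetric])
  also have "\<dots> = m a a" using iso_m_left[OF _ _ _ iso_unit_left] comod_tn comod_un ca by metis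
  finally show ?thesis using a comod_du by (simp add: irr_def)
qed

lemma one_Irr: "one \<in> Irr"
  unfolding one_def by (rule rp_Irr[OF irr_un])

lemma iso_one: "iso one un"
  unfolding one_def by (rule iso_sym[OF rp_iso[OF irr_un]])

lemma st_Irr: "a \<in> Irr \<Longrightarrow> st a \<in> Irr"
  unfolding st_def by (intro rp_Irr irr_du Irr_irr)

lemma iso_st: "a \<in> Irr \<Longrightarrow> iso (du a) (st a)"
  unfolding st_def by (intro rp_iso irr_du Irr_irr)

lemma additive_tn_iso_left: "comod X \<Longrightarrow> comod Y \<Longrightarrow> comod Z \<Longrightarrow> iso X Y \<Longrightarrow> additive F \<Longrightarrow> F (tn X Z) = F (tn Y Z)"
  using additive_iso[OF additive_tn_left] .

lemma additive_tn_iso_right: "comod X \<Longrightarrow> comod Y \<Longrightarrow> comod Z \<Longrightarrow> iso X Y \<Longrightarrow> additive F \<Longrightarrow> F (tn Z X) = F (tn Z Y)"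
  using additive_iso[OF additive_tn_right] .

lemma N_one_left: "a \<in> Irr \<Longrightarrow> c \<in> Irr \<Longrightarrow> N one a c = (if a = c then 1 else 0)"
proof -
  assume a: "a \<in> Irr" and c: "c \<in> Irr"
  note C = Irr_comod[OF a] Irr_comod[OF c] Irr_comod[OF one_Irr] comod_un
  have "N one a c = m c (tn un a)"
    unfolding N_def by (rule additive_tn_iso_left[OF C(3,4,1) iso_one additive_m_right[OF C(2)]])
  also have "\<dots> = m c a" by (rule iso_m_right[OF comod_tn[OF C(4,1)] C(1,2) iso_unit_left[OF C(1)]])
  finally show ?thesis using Irr_m[OF c a] by auto
qed

lemma N_one_right: "a \<in> Irr \<Longrightarrow> c \<in> Irr \<Longrightarrow> N a one c = (if a = c then 1 else 0)"
proof -
  assume a: "a \<in> Irr" and c: "c \<in> Irr"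
  note C = Irr_comod[OF a] Irr_comod[OF c] Irr_comod[OF one_Irr] comod_un
  have "N a one c = m c (tn a un)"
    unfolding N_def by (rule additive_tn_iso_right[OF C(3,4,1) iso_one additive_m_right[OF C(2)]])
  also have "\<dots> = m c a" by (rule iso_m_right[OF comod_tn[OF C(1,4)] C(1,2) iso_unit_right[OF C(1)]])
  finally show ?thesis using Irr_m[OF c a] by auto
qed

lemma N_left:
  assumes a: "a \<in> Irr" and b: "b \<in> Irr" and c: "c \<in> Irr"
  shows "N a b c = N (st a) c b"
proof -
  note C = Irr_comod[OF a] Irr_comod[OF b] Irr_comod[OF c] Irr_comod[OF st_Irr[OF a]]
  have "N a b c = m (tn (du a) c) b" unfolding N_def by (rule reciprocity_left[OF C(1,3,2), symmetric])
  also have "\<dots> = m (tn (st a) c) b"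
    by (rule additive_tn_iso_left[OF comod_du[OF C(1)] C(4,3) iso_st[OF a] additive_m_left[OF C(2)]])
  also have "\<dots> = m b (tn (st a) c)" by (rule additive_expand(2)[OF comod_tn[OF C(4,3)] b])
  finally show ?thesis by (simp add: N_def)
qed

lemma N_right:
  assumes a: "a \<in> Irr" and b: "b \<in> Irr" and c: "c \<in> Irr"
  shows "N a b c = N c (st b) a"
proof -
  note C = Irr_comod[OF a] Irr_comod[OF b] Irr_comod[OF c] Irr_comod[OF st_Irr[OF b]]
  have "N a b c = m (tn a b) c"
    unfolding N_def by (rule additive_expand(2)[OF comod_tn[OF C(1,2)] c, symmetric])
  also have "\<dots> = m a (tn c (du b))" by (rule reciprocity_right[OF C(2,1,3)])
  also have "\<dots> = m a (tn c (st b))"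
    by (rule additive_tn_iso_right[OF comod_du[OF C(2)] C(4,3) iso_st[OF b] additive_m_right[OF C(1)]])
  finally show ?thesis by (simp add: N_def)
qed

lemma N_assoc:
  assumes a: "a \<in> Irr" and b: "b \<in> Irr" and c: "c \<in> Irr" and f: "f \<in> Irr"
  shows "(\<Sum>e\<in>Irr. N a b e * N e c f) = (\<Sum>e\<in>Irr. N b c e * N a e f)"
proof -
  note C = Irr_comod[OF a] Irr_comod[OF b] Irr_comod[OF c] Irr_comod[OF f]
  have "(\<Sum>e\<in>Irr. N a b e * N e c f) = m f (tn (tn a b) c)"
    unfolding N_def
    by (rule additive_expand(1)[OF comod_tn[OF C(1,2)] additive_tn_left[OF additive_m_right[OF C(4)] C(3)], symmetric])
  also have "\<dots> = m f (tn a (tn b c))"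
    by (rule iso_m_right[OF _ _ C(4) iso_assoc[OF C(1-3)]]) (use C comod_tn in blast)+
  also have "\<dots> = (\<Sum>e\<in>Irr. N b c e * N a e f)"
    unfolding N_def
    by (rule additive_expand(1)[OF comod_tn[OF C(2,3)] additive_tn_right[OF additive_m_right[OF C(4)] C(1)]])
  finally show ?thesis .
qed

lemma N_deg:
  assumes a: "a \<in> Irr" and b: "b \<in> Irr"
  shows "deg a * deg b = (\<Sum>c\<in>Irr. N a b c * deg c)"
proof -
  have "deg (tn a b) = deg a * deg b"
    unfolding ix_tn by (subst card_image) (auto simp: inj_prod_encode card_cartesian_product)
  then show ?thesis
    using additive_expand(1)[OF comod_tn[OF Irr_comod[OF a] Irr_comod[OF b]] additive_deg] by (simp add: N_def)
qed

lemma deg_one: "deg one = 1"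
  using additive_iso[OF additive_deg Irr_comod[OF one_Irr] comod_un iso_one] by (simp add: ix_un)

lemma st_st: "a \<in> Irr \<Longrightarrow> st (st a) = a"
proof -
  assume a: "a \<in> Irr"
  have "N (st (st a)) (st a) one = N one a (st (st a))"
    using N_left[OF st_Irr[OF a] one_Irr st_Irr[OF st_Irr[OF a]]] N_right[OF one_Irr a st_Irr[OF st_Irr[OF a]]]
      N_left[OF st_Irr[OF st_Irr[OF a]] st_Irr[OF a] one_Irr] N_right[OF st_Irr[OF st_Irr[OF a]] st_Irr[OF a] one_Irr]
      N_one_left N_one_right a st_Irr one_Irr by (metis zero_neq_one)
  then have "N one a (st (st a)) = N one (st (st a)) (st (st a))"
    using N_right[OF st_Irr[OF st_Irr[OF a]] st_Irr[OF a] one_Irr] by simp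
  then show ?thesis using N_one_left a st_Irr by (metis zero_neq_one)
qed

subsection \<open>Coefficient coalgebras\<close>

lemma D_entry: "comod X \<Longrightarrow> i \<in> ix X \<Longrightarrow> j \<in> ix X \<Longrightarrow> D b (mt X i j) = (\<Sum>l\<in>ix X. co b (mt X i l) *s mt X l j)"
  by (simp add: D_eq_SW comod_SW[OF _ _ _ vs bilin_co])

lemma E_entry: "comod X \<Longrightarrow> i \<in> ix X \<Longrightarrow> j \<in> ix X \<Longrightarrow> E b (mt X i j) = (\<Sum>l\<in>ix X. co b (mt X l j) *s mt X i l)"
  by (simp add: E_def comod_SW[OF _ _ _ vs bilin_co_right])

lemma cfI: "i \<in> ix X \<Longrightarrow> j \<in> ix X \<Longrightarrow> mt X i j \<in> cf X"
  by (auto simp: cf_def)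

lemma subco_cf:
  assumes "\<And>a. a \<in> \<Gamma> \<Longrightarrow> comod a"
  shows "subco (span (\<Union>a\<in>\<Gamma>. cf a))"
proof (rule subco_span)
  fix x b assume "x \<in> (\<Union>a\<in>\<Gamma>. cf a)"
  then obtain a i j where a: "a \<in> \<Gamma>" "i \<in> ix a" "j \<in> ix a" "x = mt a i j" by (auto simp: cf_def)
  have "D b x \<in> span (\<Union>a\<in>\<Gamma>. cf a)"
    unfolding a(4) D_entry[OF assms[OF a(1)] a(2,3)]
    using a by (intro span_sum span_scale span_base) (auto intro: cfI)
  moreover have "E b x \<in> span (\<Union>a\<in>\<Gamma>. cf a)"
    unfolding a(4) E_entry[OF assms[OF a(1)] a(2,3)]
    using a by (intro span_sum span_scale span_base) (auto intro: cfI)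
  ultimately show "D b x \<in> span (\<Union>a\<in>\<Gamma>. cf a) \<and> E b x \<in> span (\<Union>a\<in>\<Gamma>. cf a)" ..
qed

definition dl :: "'h comd \<times> nat \<times> nat \<Rightarrow> 'h \<Rightarrow> 'k" where
  "dl \<omega> x = representation (ent ` Om) x (ent \<omega>)"

lemma dl_lin: "lf (dl \<omega>)"
  unfolding dl_def
  by (rule linI) (simp_all add: representation_add representation_scale ent_basis span_ent)

lemma dl_ent: "\<omega> \<in> Om \<Longrightarrow> \<omega>' \<in> Om \<Longrightarrow> dl \<omega> (ent \<omega>') = (if \<omega> = \<omega>' then 1 else 0)"
  unfolding dl_def using ent_basis by (auto simp: representation_basis inj_on_def)

lemma dl_nonzero:
  assumes "x \<noteq> 0"
  shows "\<exists>\<omega>\<in>Om. dl \<omega> x \<noteq> 0"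
proof (rule ccontr)
  assume "\<not> ?thesis"
  then have 0: "representation (ent ` Om) x v = 0" if "v \<in> ent ` Om" for v using that by (auto simp: dl_def)
  have "x = (\<Sum>v\<in>ent ` Om. representation (ent ` Om) x v *s v)"
    by (rule sum_representation_eq[symmetric, OF ent_basis(2)]) (use span_ent finite_Om in auto)
  also have "\<dots> = 0" by (rule sum.neutral) (simp add: 0)
  finally show False using assms by simp
qed

lemma ent_eqI:
  assumes "lin scale t f" "lin scale t g" "\<And>\<omega>. \<omega> \<in> Om \<Longrightarrow> f (ent \<omega>) = g (ent \<omega>)" "vector_space t"
  shows "f x = g x"
proof -
  interpret t: vector_space t by fact
  have "x \<in> span (ent ` Om)" using span_ent by simp
  then show ?thesis
    by (induction rule: span_induct_alt)
      (auto simp: lin_zero[OF assms(1)] lin_zero[OF assms(2)] lin_add[OF assms(1)] lin_add[OF assms(2)]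
        lin_scale[OF assms(1)] lin_scale[OF assms(2)] assms(3))
qed

text \<open>Contracting \<open>\<Delta>\<^sup>2 x\<close> with dual basis functionals on both sides isolates a multiple of any entry of \<open>a\<close>.\<close>

lemma subco_contains_cf:
  assumes C: "subco C" and x: "x \<in> C" and a: "(a, i, j) \<in> Om" "dl (a, i, j) x \<noteq> 0"
  shows "cf a \<subseteq> C"
proof
  have sC: "subspace C" and slices: "\<And>x b. x \<in> C \<Longrightarrow> b \<in> B \<Longrightarrow> D b x \<in> C \<and> E b x \<in> C"
    using C by (auto simp: subco_def)
  have aI: "a \<in> Irr" "i \<in> ix a" "j \<in> ix a" using a(1) by (auto simp: Om_def)
  note ca = Irr_comod[OF aI(1)]
  have left: "SW (\<lambda>p q. \<phi> p *s q) x \<in> C" if "x \<in> C" for \<phi> x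
    unfolding SW_def using slices[OF that] by (intro subspace_sum[OF sC] subspace_scale[OF sC]) auto
  have right: "SW (\<lambda>p q. \<phi> q *s p) x \<in> C" if "x \<in> C" "lf \<phi>" for \<phi> x
  proof -
    have "SW (\<lambda>p q. \<phi> q *s p) x = (\<Sum>b\<in>B. \<phi> b *s E b x)"
    proof -
      have "SW (\<lambda>p q. \<phi> q *s p) x = SW (\<lambda>p q. \<Sum>b\<in>B. (co b q * \<phi> b) *s p) x"
        by (rule SW_cong, subst lin_co[OF that(2)]) (rule scale_sum_left)
      also have "\<dots> = (\<Sum>b\<in>B. \<phi> b *s E b x)"
        unfolding E_def SW_def by (subst sum.swap) (simp add: scale_sum_right mult.commute)
      finally show ?thesis .
    qed
    then show ?thesis using slices[OF that(1)] by (auto intro!: subspace_sum[OF sC] subspace_scale[OF sC])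
  qed
  fix y assume "y \<in> cf a"
  then obtain k l where kl: "k \<in> ix a" "l \<in> ix a" "y = mt a k l" by (auto simp: cf_def)
  have dle: "dl (a, p, q) (mt b r s) = (if b = a \<and> r = p \<and> s = q then 1 else 0)"
    if "p \<in> ix a" "q \<in> ix a" "b \<in> Irr" "r \<in> ix b" "s \<in> ix b" for p q r s b
    using dl_ent[of "(a, p, q)" "(b, r, s)"] that aI(1) by (auto simp: Om_def ent_def)
  have bl: "bilin scale scale (\<lambda>p q. dl \<omega> p *s q)" "bilin scale scale (\<lambda>p q. dl \<omega> q *s p)" for \<omega>
    by (intro bilinI linI; simp add: lin_add[OF dl_lin] lin_scale[OF dl_lin] algebra_simps)+
  have fin: "finite (ix a)" by (rule comod_finite[OF ca])
  have 1: "SW (\<lambda>p q. dl (a, i, k) p *s q) x = (\<Sum>q\<in>ix a. dl (a, i, q) x *s mt a k q)"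
  proof (rule ent_eqI[where t = scale and f = "SW (\<lambda>p q. dl (a, i, k) p *s q)"
        and g = "\<lambda>x. \<Sum>q\<in>ix a. dl (a, i, q) x *s mt a k q", OF _ _ _ vs])
    show "lh (SW (\<lambda>p q. dl (a, i, k) p *s q))" by (rule SW_lin[OF vs bl(1)])
    show "lh (\<lambda>x. \<Sum>q\<in>ix a. dl (a, i, q) x *s mt a k q)"
      by (intro linI) (simp_all add: lin_add[OF dl_lin] lin_scale[OF dl_lin] scale_left_distrib sum.distrib scale_sum_right)
    fix \<omega> assume w: "\<omega> \<in> Om"
    obtain b p q where \<omega>: "\<omega> = (b, p, q)" by (cases \<omega>)
    have bpq: "b \<in> Irr" "p \<in> ix b" "q \<in> ix b" using w unfolding \<omega> by (auto simp: Om_def)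
    have "SW (\<lambda>p q. dl (a, i, k) p *s q) (mt b p q) = (\<Sum>l\<in>ix b. dl (a, i, k) (mt b p l) *s mt b l q)"
      by (rule comod_SW[OF Irr_comod[OF bpq(1)] bpq(2,3) vs bl(1)])
    also have "\<dots> = (\<Sum>l\<in>ix b. if l = k then (if b = a \<and> p = i then mt b l q else 0) else 0)"
      using aI kl bpq by (intro sum.cong refl) (simp add: dle)
    also have "\<dots> = (if b = a \<and> p = i then mt a k q else 0)"
      using kl comod_finite[OF Irr_comod[OF bpq(1)]] by auto
    also have "\<dots> = (\<Sum>r\<in>ix a. if r = q then (if b = a \<and> p = i then mt a k r else 0) else 0)"
      using bpq fin by auto
    also have "\<dots> = (\<Sum>r\<in>ix a. dl (a, i, r) (mt b p q) *s mt a k r)"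
      using aI kl bpq by (intro sum.cong refl) (simp add: dle)
    finally show "SW (\<lambda>p q. dl (a, i, k) p *s q) (ent \<omega>) = (\<Sum>q\<in>ix a. dl (a, i, q) (ent \<omega>) *s mt a k q)"
      by (simp add: ent_def \<omega>)
  qed
  define z where "z = SW (\<lambda>p q. dl (a, i, k) p *s q) x"
  have zC: "z \<in> C" unfolding z_def by (rule left[OF x])
  have "SW (\<lambda>p q. dl (a, l, j) q *s p) z = (\<Sum>q\<in>ix a. dl (a, i, q) x *s (\<Sum>u\<in>ix a. dl (a, l, j) (mt a u q) *s mt a k u))"
    unfolding z_def 1
    by (simp add: lin_sum[OF SW_lin[OF vs bl(2)]] lin_scale[OF SW_lin[OF vs bl(2)]] comod_SW[OF ca _ _ vs bl(2)] kl)
  also have "\<dots> = (\<Sum>q\<in>ix a. if q = j then dl (a, i, q) x *s (\<Sum>u\<in>ix a. if u = l then mt a k u else 0) else 0)"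
    using aI kl by (intro sum.cong refl) (simp add: dle if_distrib[of "\<lambda>t. t *s _"] cong: if_cong)
  also have "\<dots> = dl (a, i, j) x *s y" using aI kl fin by simp
  finally have "dl (a, i, j) x *s y \<in> C" using right[OF zC dl_lin] by metis
  then have "inverse (dl (a, i, j) x) *s (dl (a, i, j) x *s y) \<in> C" by (rule subspace_scale[OF sC])
  then show "y \<in> C" using a(2) by simp
qed

text \<open>Entries of distinct irreducibles are part of one basis of \<open>H\<close>.\<close>

lemma dim_cf:
  assumes "\<Gamma> \<subseteq> Irr"
  shows "dim (span (\<Union>a\<in>\<Gamma>. cf a)) = (\<Sum>a\<in>\<Gamma>. deg a * deg a)"
proof -
  let ?O = "SIGMA a:\<Gamma>. ix a \<times> ix a"
  have e: "(\<Union>a\<in>\<Gamma>. cf a) = ent ` ?O" unfolding ent_def cf_def by force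
  have sub: "?O \<subseteq> Om" using assms by (auto simp: Om_def)
  have "independent (ent ` ?O)" by (rule independent_mono[OF ent_basis(2)]) (use sub in blast)
  then have "dim (span (ent ` ?O)) = card (ent ` ?O)" by (rule dim_span_eq_card_independent)
  also have "\<dots> = card ?O" by (rule card_image[OF inj_on_subset[OF ent_basis(1) sub]])
  also have "\<dots> = (\<Sum>a\<in>\<Gamma>. deg a * deg a)"
    using finite_subset[OF assms finite_Irr] comod_finite[OF Irr_comod] assms
    by (subst card_SigmaI) (auto simp: card_cartesian_product)
  finally show ?thesis by (simp add: e)
qed

lemma dim_simple: "a \<in> Irr \<Longrightarrow> dim (span (cf a)) = deg a * deg a"
  using dim_cf[of "{a}"] by (simp del: dim_span)

lemma simple_iff: "simple_subcoalgebra C \<longleftrightarrow> (\<exists>a\<in>Irr. C = span (cf a))"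
proof
  assume C: "simple_subcoalgebra C"
  then have sC: "subco C" and "C \<noteq> {0}" by (auto simp: simple_subcoalgebra_def subcoalgebra_iff)
  then obtain x where x: "x \<in> C" "x \<noteq> 0" using subspace_0 unfolding subco_def by blast
  obtain a i j where a: "(a, i, j) \<in> Om" "dl (a, i, j) x \<noteq> 0" using dl_nonzero[OF x(2)] by auto
  have aI: "a \<in> Irr" "ix a \<noteq> {}" using a(1) by (auto simp: Om_def)
  have sub: "span (cf a) \<subseteq> C"
    using subco_contains_cf[OF sC x(1) a] sC by (intro span_minimal) (auto simp: subco_def)
  have "subco (span (cf a))" using subco_cf[of "{a}"] Irr_comod[OF aI(1)] by simp
  moreover have "span (cf a) \<noteq> {0}"
  proof
    assume "span (cf a) = {0}"
    then have "dim (span (cf a)) = 0" by (metis dim_zero_space)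
    then show False using Irr_deg_pos[OF aI(1)] unfolding dim_simple[OF aI(1)] by simp
  qed
  ultimately have "span (cf a) = C" using C sub unfolding simple_subcoalgebra_def subcoalgebra_iff by blast
  then show "\<exists>a\<in>Irr. C = span (cf a)" using aI(1) by blast
next
  assume "\<exists>a\<in>Irr. C = span (cf a)"
  then obtain a where a: "a \<in> Irr" "C = span (cf a)" by blast
  have "subco C" using subco_cf[of "{a}"] Irr_comod[OF a(1)] a(2) by simp
  moreover have "C \<noteq> {0}"
  proof
    assume "C = {0}"
    then have "dim C = 0" by (metis dim_zero_space)
    then show False using Irr_deg_pos[OF a(1)] unfolding a(2) dim_simple[OF a(1)] by simp
  qed
  moreover have "E = {0} \<or> E = C" if E: "subco E" "E \<subseteq> C" for E
  proof (cases "E = {0}")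
    case False
    then obtain x where x: "x \<in> E" "x \<noteq> 0" using E subspace_0 unfolding subco_def by blast
    obtain b i j where b: "(b, i, j) \<in> Om" "dl (b, i, j) x \<noteq> 0" using dl_nonzero[OF x(2)] by auto
    have "b = a"
    proof (rule ccontr)
      assume "b \<noteq> a"
      have "dl (b, i, j) y = 0" if "y \<in> span (cf a)" for y
        using that
      proof (induction rule: span_induct_alt)
        case base then show ?case by (rule lin_zero[OF dl_lin])
      next
        case (step c y z)
        then obtain p q where "p \<in> ix a" "q \<in> ix a" "y = ent (a, p, q)" by (auto simp: cf_def ent_def)
        then have "dl (b, i, j) y = 0" using dl_ent[OF b(1), of "(a, p, q)"] a(1) \<open>b \<noteq> a\<close> by (auto simp: Om_def)
        then show ?case using step by (simp add: lin_add[OF dl_lin] lin_scale[OF dl_lin])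
      qed
      then show False using x E(2) b(2) a(2) by blast
    qed
    then have "cf a \<subseteq> E" using subco_contains_cf[OF E(1) x(1) b] by simp
    then have "span (cf a) \<subseteq> E" using E(1) by (intro span_minimal) (auto simp: subco_def)
    then show ?thesis using E(2) a(2) by blast
  qed simp
  ultimately show "simple_subcoalgebra C" unfolding simple_subcoalgebra_def subcoalgebra_iff by blast
qed

subsection \<open>The antipode\<close>

lemma S_image_cf: "S ` cf X = cf (du X)"
  unfolding cf_def ix_du mt_du by blast

lemma span_cf_du: "a \<in> Irr \<Longrightarrow> span (cf (du a)) = span (cf (st a))"
  using iso_cf[OF comod_du[OF Irr_comod] iso_st] iso_cf[OF Irr_comod[OF st_Irr] iso_sym[OF iso_st]] by blast

lemma linear_S: "Vector_Spaces.linear scale scale S"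
  using antipode_lin by (simp add: lin_iff_linear vs)

lemma S_span: "S ` span X = span (S ` X)"
proof -
  interpret vp: vector_space_pair scale scale ..
  show ?thesis using vp.linear_span_image[OF linear_S] by simp
qed

lemma S_span_cf: "a \<in> Irr \<Longrightarrow> S ` span (cf a) = span (cf (st a))"
  by (simp add: S_span S_image_cf span_cf_du)

text \<open>The antipode takes the coefficient coalgebra of \<open>a\<close> to that of the dual, and duality is an involution on irreducibles.\<close>

lemma S_bij: "bij S"
proof -
  have "cf a \<subseteq> range S" if "a \<in> Irr" for a
  proof -
    have "span (cf a) = S ` span (cf (st a))" using S_span_cf[OF st_Irr[OF that]] st_st[OF that] by simp
    then show ?thesis using span_superset[of "cf a"] by blast
  qed
  then have "ent ` Om \<subseteq> range S" unfolding ent_image by blast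
  moreover have "subspace (range S)" using S_span[of UNIV] by (metis span_UNIV subspace_span)
  ultimately have "span (ent ` Om) \<subseteq> range S" by (rule span_minimal)
  then have "surj S" using span_ent by auto
  moreover have "inj S" using linear_surj_imp_inj[OF linear_S \<open>surj S\<close>] .
  ultimately show ?thesis by (simp add: bij_def)
qed

text \<open>For the tensor product matrix \<open>Z\<close>, the matrix \<open>S(Z)\<close> is a left inverse, and the products on the right-hand side form a right
  inverse.\<close>

lemma S_mult_entries:
  assumes X: "comod X" and Y: "comod Y" and i: "i \<in> ix X" "j \<in> ix X" "k \<in> ix Y" "l \<in> ix Y"
  shows "S (mt X i j * mt Y k l) = S (mt Y k l) * S (mt X i j)"
proof -
  let ?Z = "tn X Y"
  have Z: "comod ?Z" by (rule comod_tn[OF X Y])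
  let ?s = "prod_encode (j, l)" and ?p = "prod_encode (i, k)"
  have sp: "?s \<in> ix ?Z" "?p \<in> ix ?Z" using i by (simp_all add: mem_tn)
  define G where "G r = S (mt Y (snd (prod_decode r)) l) * S (mt X (fst (prod_decode r)) j)" for r
  have ZG: "(\<Sum>r\<in>ix ?Z. mt ?Z q r * G r) = (if q = ?s then 1 else 0)" if "q \<in> ix ?Z" for q
  proof -
    obtain u v where q: "q = prod_encode (u, v)" "u \<in> ix X" "v \<in> ix Y" using \<open>q \<in> ix ?Z\<close> unfolding ix_tn by blast
    have "(\<Sum>r\<in>ix ?Z. mt ?Z q r * G r) = (\<Sum>x\<in>ix X. mt X u x * (\<Sum>y\<in>ix Y. mt Y v y * S (mt Y y l)) * S (mt X x j))"
      unfolding q sum_tn mt_tn G_def by (simp add: sum_distrib_left sum_distrib_right mult.assoc)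
    also have "\<dots> = (if v = l then \<Sum>x\<in>ix X. mt X u x * S (mt X x j) else 0)"
      using i q by (simp add: comod_S_right[OF Y])
    also have "\<dots> = (if q = ?s then 1 else 0)" using i q by (simp add: comod_S_right[OF X])
    finally show ?thesis .
  qed
  have "S (mt ?Z ?p ?s) = (\<Sum>q\<in>ix ?Z. if q = ?s then S (mt ?Z ?p q) else 0)"
    using sp comod_finite[OF Z] by simp
  also have "\<dots> = (\<Sum>q\<in>ix ?Z. S (mt ?Z ?p q) * (\<Sum>r\<in>ix ?Z. mt ?Z q r * G r))"
    by (intro sum.cong refl) (simp add: ZG)
  also have "\<dots> = (\<Sum>r\<in>ix ?Z. (\<Sum>q\<in>ix ?Z. S (mt ?Z ?p q) * mt ?Z q r) * G r)"
    by (simp add: sum_distrib_left sum_distrib_right mult.assoc) (rule sum.swap)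
  also have "\<dots> = (\<Sum>r\<in>ix ?Z. if ?p = r then G r else 0)"
    using sp by (intro sum.cong refl) (simp add: comod_S_left[OF Z])
  also have "\<dots> = G ?p" using sp comod_finite[OF Z] by simp
  finally show ?thesis by (simp add: mt_tn G_def)
qed

lemma S_mult: "S (x * y) = S y * S x"
proof -
  note sl = lin_add[OF antipode_lin] lin_scale[OF antipode_lin] lin_zero[OF antipode_lin]
  have 1: "S (x * y) = S y * S x" if "x \<in> cf reg" "y \<in> cf reg" for x y
    using that S_mult_entries[OF comod_reg comod_reg] by (auto simp: cf_def)
  have 2: "S (x * y) = S y * S x" if "x \<in> cf reg" "y \<in> span (cf reg)" for x y
    using that(2)
    by (induction rule: span_induct_alt)
      (auto simp: sl 1[OF that(1)] distrib_left distrib_right scale_mult_left scale_mult_right)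
  have "x \<in> span (cf reg)" "y \<in> span (cf reg)" by (simp_all add: cf_reg)
  from this(1) show ?thesis
    by (induction rule: span_induct_alt)
      (auto simp: sl 2[OF _ \<open>y \<in> span (cf reg)\<close>] distrib_left distrib_right scale_mult_left scale_mult_right)
qed

text \<open>The inverse antipode, which reverses the order of the legs: \<open>T(h\<^sub>2) h\<^sub>1 = \<epsilon>(h)\<close>.\<close>

definition T :: "'h \<Rightarrow> 'h" where "T = inv S"

lemma S_T: "S (T x) = x" and T_S: "T (S x) = x"
  unfolding T_def using S_bij by (simp_all add: bij_is_surj surj_f_inv_f bij_is_inj)

lemma T_lin: "lh T"
  by (rule linI) (metis S_T T_S lin_add[OF antipode_lin], metis S_T T_S lin_scale[OF antipode_lin])

lemma SW_T: "SW (\<lambda>a b. T b * a) h = \<epsilon> h *s 1"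
proof -
  have "S (SW (\<lambda>a b. T b * a) h) = SW (\<lambda>a b. S a * b) h"
    by (simp add: lin_SW[OF antipode_lin] S_mult S_T)
  also have "\<dots> = S (\<epsilon> h *s 1)" by (simp add: SW_antipode_left lin_scale[OF antipode_lin] S_one)
  finally show ?thesis by (metis T_S)
qed

subsection \<open>Hopf subalgebras\<close>

definition closed :: "'h comd set \<Rightarrow> bool" where
  "closed \<Gamma> \<longleftrightarrow> \<Gamma> \<subseteq> Irr \<and> one \<in> \<Gamma> \<and> (\<forall>a\<in>\<Gamma>. st a \<in> \<Gamma>) \<and>
     (\<forall>a\<in>\<Gamma>. \<forall>b\<in>\<Gamma>. \<forall>c\<in>Irr. N a b c \<noteq> 0 \<longrightarrow> c \<in> \<Gamma>)"

text \<open>The subspace \<open>K\<close> is a product-closed subcoalgebra because the entries of \<open>a b\<close> are spanned by those of its constituents.\<close>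

lemma closed_subalgebra:
  assumes \<Gamma>: "closed \<Gamma>"
  defines "K \<equiv> span (\<Union>a\<in>\<Gamma>. cf a)"
  shows "subco K" "1 \<in> K" "\<And>x y. x \<in> K \<Longrightarrow> y \<in> K \<Longrightarrow> x * y \<in> K" "\<And>x. x \<in> K \<Longrightarrow> T x \<in> K"
    "dim K = (\<Sum>a\<in>\<Gamma>. deg a * deg a)"
proof -
  have sub: "\<Gamma> \<subseteq> Irr" using \<Gamma> by (simp add: closed_def)
  have sK: "subspace K" by (simp add: K_def)
  have cfK: "span (cf a) \<subseteq> K" if "a \<in> \<Gamma>" for a
    unfolding K_def using that by (intro span_mono) blast
  show "subco K" unfolding K_def using sub Irr_comod by (intro subco_cf) blast
  show "dim K = (\<Sum>a\<in>\<Gamma>. deg a * deg a)" unfolding K_def by (rule dim_cf[OF sub])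
  have "1 \<in> cf un" by (auto simp: cf_def ix_un mt_un)
  then have "1 \<in> span (cf one)" using iso_cf[OF comod_un iso_sym[OF iso_one]] span_superset by blast
  then show "1 \<in> K" using cfK[of one] \<Gamma> by (auto simp: closed_def)
  have 1: "x * y \<in> K" if xy: "x \<in> (\<Union>a\<in>\<Gamma>. cf a)" "y \<in> (\<Union>a\<in>\<Gamma>. cf a)" for x y
  proof -
    obtain a i j where a: "a \<in> \<Gamma>" "i \<in> ix a" "j \<in> ix a" "x = mt a i j" using xy(1) unfolding cf_def by blast
    obtain b k l where b: "b \<in> \<Gamma>" "k \<in> ix b" "l \<in> ix b" "y = mt b k l" using xy(2) unfolding cf_def by blast
    have "x * y = mt (tn a b) (prod_encode (i, k)) (prod_encode (j, l))" by (simp add: mt_tn a b)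
    then have "x * y \<in> cf (tn a b)" using a b by (auto intro!: cfI simp: mem_tn)
    moreover have "cf (tn a b) \<subseteq> span (\<Union>c\<in>{c\<in>Irr. m c (tn a b) \<noteq> 0}. cf c)"
      using a b sub Irr_comod by (intro additive_expand(3) comod_tn) blast+
    moreover have "span (\<Union>c\<in>{c\<in>Irr. m c (tn a b) \<noteq> 0}. cf c) \<subseteq> K"
      unfolding K_def
    proof (rule span_mono, rule UN_mono)
      show "{c \<in> Irr. m c (tn a b) \<noteq> 0} \<subseteq> \<Gamma>"
      proof
        fix c assume "c \<in> {c \<in> Irr. m c (tn a b) \<noteq> 0}"
        then have "c \<in> Irr" "N a b c \<noteq> 0" unfolding N_def by blast+
        then show "c \<in> \<Gamma>" using \<Gamma> a(1) b(1) unfolding closed_def by blast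
      qed
    qed simp
    ultimately show ?thesis by (meson subsetD)
  qed
  have 2: "x * y \<in> K" if "x \<in> (\<Union>a\<in>\<Gamma>. cf a)" "y \<in> K" for x y
    using that(2)[unfolded K_def]
    by (induction rule: span_induct_alt)
      (auto simp: distrib_left scale_mult_right subspace_0[OF sK] intro!: subspace_add[OF sK] subspace_scale[OF sK] 1[OF that(1)])
  show "x * y \<in> K" if "x \<in> K" "y \<in> K" for x y
    using that(1)[unfolded K_def]
    by (induction rule: span_induct_alt)
      (auto simp: distrib_right scale_mult_left subspace_0[OF sK] intro!: subspace_add[OF sK] subspace_scale[OF sK] 2[OF _ that(2)])
  have "S ` cf a \<subseteq> K" if a: "a \<in> \<Gamma>" for a
  proof -
    have "S ` cf a \<subseteq> S ` span (cf a)" using span_superset by blast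
    also have "\<dots> = span (cf (st a))" using a sub by (intro S_span_cf) blast
    also have "\<dots> \<subseteq> K" using a \<Gamma> unfolding closed_def by (intro cfK) blast
    finally show ?thesis .
  qed
  then have "S ` (\<Union>a\<in>\<Gamma>. cf a) \<subseteq> K" by blast
  then have "S ` K \<subseteq> K" unfolding K_def S_span by (rule span_minimal[OF _ subspace_span])
  have fgK: "fg K" unfolding fg_def using sK span_Basis finite_Basis by blast
  interpret vp: kspace_pair scale scale ..
  have inj: "x = 0" if "S x = 0" for x using that T_S[of x] T_S[of 0] lin_zero[OF antipode_lin] by metis
  have "S ` K = K"
    using fg_dim_eq[OF fgK _ \<open>S ` K \<subseteq> K\<close>] vp.dim_inj_image[OF linear_S fgK inj] fg_subspace by simp
  then show "T x \<in> K" if "x \<in> K" for x using that T_S by (metis imageE)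
qed

end

section \<open>Dimensions of Hopf subalgebras\<close>

context kspace
begin

lemma dim_span_Un_le:
  assumes "fg V" "finite G"
  shows "fg (span (V \<union> G))" "dim (span (V \<union> G)) \<le> dim V + card G"
proof -
  obtain X where X: "finite X" "span X = V" "card X = dim V" using fg_basis[OF assms(1)] by metis
  have "span (V \<union> G) = span (X \<union> G)"
  proof (rule subset_antisym)
    have "V \<subseteq> span (X \<union> G)" unfolding X(2)[symmetric] by (rule span_mono) simp
    moreover have "G \<subseteq> span (X \<union> G)" using span_superset by blast
    ultimately show "span (V \<union> G) \<subseteq> span (X \<union> G)" by (intro span_minimal) auto
    have "X \<subseteq> V" using X(2) span_superset by blast
    then show "span (X \<union> G) \<subseteq> span (V \<union> G)" by (intro span_mono) auto
  qed
  moreover have "dim (span (X \<union> G)) \<le> card (X \<union> G)" using X(1) assms(2) by (intro dim_span_le_card) auto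
  moreover have "card (X \<union> G) \<le> card X + card G" by (rule card_Un_le)
  ultimately show "fg (span (V \<union> G))" "dim (span (V \<union> G)) \<le> dim V + card G"
    using X assms(2) fg_span[of "X \<union> G"] by auto
qed

end

context fd_hopf
begin

lemma fg_subspace_H: "subspace V \<Longrightarrow> fg V"
  unfolding fg_def using finite_Basis span_Basis by blast

definition fh :: "'k \<Rightarrow> ('x \<Rightarrow> 'h) \<Rightarrow> 'x \<Rightarrow> 'h" where
  "fh c u = (\<lambda>b. c *s u b)"

lemma fh_apply: "fh c u b = c *s u b" by (simp add: fh_def)

lemma kspace_fh: "kspace (fh :: 'k \<Rightarrow> ('x \<Rightarrow> 'h) \<Rightarrow> _)"
  by unfold_locales (auto simp: fh_def fun_eq_iff algebra_simps)

sublocale fhs: kspace "fh :: 'k \<Rightarrow> ('h \<Rightarrow> 'h) \<Rightarrow> _"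
  by (rule kspace_fh)

sublocale hf: kspace_pair scale "fh :: 'k \<Rightarrow> ('h \<Rightarrow> 'h) \<Rightarrow> _" ..

sublocale hh: kspace_pair scale scale ..

lemma vs_fh: "vector_space (fh :: 'k \<Rightarrow> ('h \<Rightarrow> 'h) \<Rightarrow> _)" ..

text \<open>Functions \<open>B \<rightarrow> H\<close> model \<open>H \<otimes> H\<close>: \<open>u\<close> stands for the sum of the \<open>b \<otimes> u b\<close>.\<close>

definition Full :: "'h set \<Rightarrow> ('h \<Rightarrow> 'h set) \<Rightarrow> ('h \<Rightarrow> 'h) set" where
  "Full A W = {u. (\<forall>b. b \<notin> A \<longrightarrow> u b = 0) \<and> (\<forall>b\<in>A. u b \<in> W b)}"

lemma Full_subspace: "(\<And>b. subspace (W b)) \<Longrightarrow> fhs.subspace (Full A W)"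
  unfolding fhs.subspace_def Full_def
  by (auto simp: fh_apply subspace_0 intro!: subspace_add subspace_scale)

lemma Full_dim:
  assumes W: "\<And>b. subspace (W b)"
  shows "finite A \<Longrightarrow> fhs.fg (Full A W) \<and> fhs.dim (Full A W) = (\<Sum>b\<in>A. dim (W b))"
proof (induction A rule: finite_induct)
  case empty
  have "Full {} W = {0}" by (auto simp: Full_def)
  then show ?case using fhs.fg_span[of "{}"] by (simp add: fhs.dim_zero_space)
next
  case (insert a A)
  let ?f = "\<lambda>x b. if b = a then x else (0::'h)"
  have f: "Vector_Spaces.linear scale fh ?f"
    unfolding lin_iff_linear[OF vs vs_fh, symmetric] by (intro linI) (auto simp: fun_eq_iff fh_apply)
  have e: "{u + ?f x | u x. u \<in> Full A W \<and> x \<in> W a} = Full (insert a A) W"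
  proof (intro equalityI subsetI)
    fix v assume "v \<in> {u + ?f x | u x. u \<in> Full A W \<and> x \<in> W a}"
    then obtain u x where v: "v = u + ?f x" "u \<in> Full A W" "x \<in> W a" by blast
    then show "v \<in> Full (insert a A) W" using insert.hyps by (auto simp: Full_def)
  next
    fix v assume v: "v \<in> Full (insert a A) W"
    have "v = (\<lambda>b. if b = a then 0 else v b) + ?f (v a)" by (auto simp: fun_eq_iff)
    moreover have "(\<lambda>b. if b = a then 0 else v b) \<in> Full A W" using v insert.hyps by (auto simp: Full_def)
    moreover have "v a \<in> W a" using v by (auto simp: Full_def)
    ultimately show "v \<in> {u + ?f x | u x. u \<in> Full A W \<and> x \<in> W a}" by blast
  qed
  have z: "{x \<in> W a. ?f x \<in> Full A W} = {0}"
  proof (intro equalityI subsetI)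
    fix x assume "x \<in> {x \<in> W a. ?f x \<in> Full A W}"
    then have "?f x a = 0" using insert.hyps unfolding Full_def by blast
    then show "x \<in> {0}" by simp
  next
    fix x :: 'h assume "x \<in> {0}"
    then show "x \<in> {x \<in> W a. ?f x \<in> Full A W}" using subspace_0[OF W] by (auto simp: Full_def)
  qed
  show ?case
    using hf.dim_add_image[OF f fg_subspace_H[OF W[of a]] conjunct1[OF insert.IH]] insert
    unfolding e z by (simp add: dim_zero_space)
qed

definition pure :: "'h \<Rightarrow> 'h \<Rightarrow> 'h \<Rightarrow> 'h" where
  "pure a x = (\<lambda>b. co b a *s x)"

lemma bilin_pure: "bilin scale fh pure"
  unfolding pure_def
  by (intro bilinI linI) (auto simp: fun_eq_iff fh_apply algebra_simps lin_add[OF co_lin] lin_scale[OF co_lin])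

lemmas pure_rules = lin_add[OF bilin1[OF bilin_pure]] lin_add[OF bilin2[OF bilin_pure]]
  lin_scale[OF bilin1[OF bilin_pure]] lin_scale[OF bilin2[OF bilin_pure]]
  lin_sum[OF bilin1[OF bilin_pure]] lin_sum[OF bilin2[OF bilin_pure]]

lemma pure_sum: "u \<in> Full B W \<Longrightarrow> u = (\<Sum>i\<in>B. pure i (u i))"
proof
  fix b assume u: "u \<in> Full B W"
  have "(\<Sum>i\<in>B. pure i (u i)) b = (\<Sum>i\<in>B. if b = i then u i else 0)"
    by (simp add: sum_apply pure_def co_basis if_distrib[of "\<lambda>t. t *s _"] cong: if_cong)
  then show "u b = (\<Sum>i\<in>B. pure i (u i)) b" using u finite_B by (auto simp: Full_def)
qed

lemma pure_Full: "subspace X \<Longrightarrow> x \<in> X \<Longrightarrow> pure a x \<in> Full B (\<lambda>_. X)"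
  by (auto simp: Full_def pure_def co_out intro!: subspace_scale)

text \<open>The diagonal right action of \<open>H\<close> on \<open>H \<otimes> H\<close>.\<close>

definition act :: "('h \<Rightarrow> 'h) \<Rightarrow> 'h \<Rightarrow> 'h \<Rightarrow> 'h" where
  "act u h = (\<Sum>i\<in>B. SW (\<lambda>p q. pure (i * p) (u i * q)) h)"

lemma bilin_act_pure: "bilin scale fh (\<lambda>p q. pure (a * p) (x * q))"
  by (intro bilinI linI) (simp_all add: pure_rules distrib_left scale_mult_right)

lemma act_lin1: "lin fh fh (\<lambda>u. act u h)"
  unfolding act_def SW_def
  by (intro linI) (simp_all add: pure_rules distrib_right scale_mult_left fh_apply sum.distrib fhs.scale_sum_right)

lemma act_lin2: "lin scale fh (act u)"
  unfolding act_def
  by (intro linI)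
    (simp_all add: lin_add[OF SW_lin[OF vs_fh bilin_act_pure]] lin_scale[OF SW_lin[OF vs_fh bilin_act_pure]]
      sum.distrib fhs.scale_sum_right)

lemma act_pure: "act (pure a x) h = SW (\<lambda>p q. pure (a * p) (x * q)) h"
proof -
  have "act (pure a x) h = SW (\<lambda>p q. \<Sum>i\<in>B. pure (i * p) (co i a *s (x * q))) h"
    unfolding act_def SW_def pure_def[of a x] by (subst sum.swap) (simp add: scale_mult_left)
  also have "\<dots> = SW (\<lambda>p q. pure (a * p) (x * q)) h"
  proof (rule SW_cong)
    fix p q
    have "pure (a * p) (x * q) = pure ((\<Sum>i\<in>B. co i a *s i) * p) (x * q)" by (simp add: co_sum)
    also have "\<dots> = (\<Sum>i\<in>B. pure (i * p) (co i a *s (x * q)))"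
      by (simp add: sum_distrib_right scale_mult_left pure_rules)
    finally show "(\<Sum>i\<in>B. pure (i * p) (co i a *s (x * q))) = pure (a * p) (x * q)" by simp
  qed
  finally show ?thesis .
qed

lemma act_eq_pure: "act u h = (\<Sum>i\<in>B. act (pure i (u i)) h)"
  unfolding act_pure by (simp add: act_def)

lemma act_assoc: "act (act u h) h' = act u (h * h')"
proof -
  have 1: "act (act (pure a x) h) h' = act (pure a x) (h * h')" for a x
    unfolding act_pure SW_mult[OF vs_fh bilin_act_pure] lin_SW[OF act_lin1] by (simp add: mult.assoc)
  show ?thesis
    unfolding act_eq_pure[of u] lin_sum[OF act_lin1] by (simp add: 1)
qed

lemma act_one: "u \<in> Full B W \<Longrightarrow> act u 1 = u"
  using pure_sum[of u W] unfolding act_eq_pure[of u] act_pure SW_one[OF vs_fh bilin_act_pure] by simp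

lemma act_Full: "act u h \<in> Full B (\<lambda>_. UNIV)"
proof -
  have s: "fhs.subspace (Full B (\<lambda>_. UNIV))" by (rule Full_subspace) simp
  show ?thesis
    unfolding act_def SW_def by (intro fhs.subspace_sum[OF s] pure_Full) auto
qed

subsection \<open>Ranks of induced modules\<close>

definition rideal :: "'h set \<Rightarrow> 'h set \<Rightarrow> bool" where
  "rideal K R \<longleftrightarrow> subspace R \<and> R \<subseteq> K \<and> (\<forall>x\<in>R. \<forall>z\<in>K. x * z \<in> R)"

definition ext :: "'h set \<Rightarrow> 'h set" where
  "ext R = span {x * h | x h. x \<in> R}"

text \<open>Let every proper right ideal \<open>R\<close> of \<open>K\<close> satisfy \<open>dim H - dim R H \<le> r (dim K - dim R)\<close>. Then the same bound holds for \<open>K\<close>-submodules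
  \<open>U \<subseteq> V\<close> of any \<open>H\<close>-module: adding one cyclic submodule \<open>w K\<close> at a time, the quotient \<open>(U + w K) / U\<close> is \<open>K / R\<close>, where \<open>R\<close> consists of the \<open>z\<close>
  with \<open>w z\<close> in \<open>U\<close>.\<close>

lemma induced_rank_bound:
  fixes t :: "'k \<Rightarrow> 'm::ab_group_add \<Rightarrow> 'm" and ac :: "'m \<Rightarrow> 'h \<Rightarrow> 'm" and r :: real
  assumes t: "kspace t"
    and K: "subspace K" "1 \<in> K" "\<And>x y. x \<in> K \<Longrightarrow> y \<in> K \<Longrightarrow> x * y \<in> K"
    and ac: "\<And>h. lin t t (\<lambda>u. ac u h)" "\<And>u. lin scale t (ac u)" "\<And>u h h'. ac (ac u h) h' = ac u (h * h')"
    and r: "\<And>R. rideal K R \<Longrightarrow> R \<noteq> K \<Longrightarrow> real (dim UNIV) - real (dim (ext R)) \<le> r * (real (dim K) - real (dim R))"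
    and F: "kspace.fg t F" "\<And>u h. u \<in> F \<Longrightarrow> ac u h \<in> F" "\<And>u. u \<in> F \<Longrightarrow> ac u 1 = u"
    and V: "module.subspace t V" "V \<subseteq> F" "\<And>v z. v \<in> V \<Longrightarrow> z \<in> K \<Longrightarrow> ac v z \<in> V"
    and U: "module.subspace t U" "U \<subseteq> V" "\<And>u z. u \<in> U \<Longrightarrow> z \<in> K \<Longrightarrow> ac u z \<in> U"
  shows "real (vector_space.dim t (module.span t {ac v h | v h. v \<in> V})) - real (vector_space.dim t (module.span t {ac u h | u h. u \<in> U}))
    \<le> r * (real (vector_space.dim t V) - real (vector_space.dim t U))"
proof -
  interpret t: kspace t by fact
  interpret ht: kspace_pair scale t ..
  have fgV: "t.fg V" by (rule t.fg_subset[OF F(1) V(1,2)])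
  note fgK = fg_subspace_H[OF K(1)]
  let ?H = "\<lambda>U. t.span {ac u h | u h. u \<in> U}"
  have HF: "?H U \<subseteq> F" if "U \<subseteq> F" for U
    by (rule t.span_minimal[OF _ t.fg_subspace[OF F(1)]]) (use that F(2) in blast)
  show ?thesis
    using U
  proof (induction "t.dim V - t.dim U" arbitrary: U rule: less_induct)
    case less
    show ?case
    proof (cases "U = V")
      case False
      then obtain w where w: "w \<in> V" "w \<notin> U" using less.prems by blast
      have wF: "w \<in> F" using w V(2) by blast
      have lw: "Vector_Spaces.linear scale t (ac w)"
        using ac(2) lin_iff_linear[OF vs t.vector_space_axioms] by blast
      define R where "R = {x\<in>K. ac w x \<in> U}"
      have "subspace R"
        using K(1) less.prems(1) unfolding R_def subspace_def t.subspace_def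
        by (auto simp: lin_add[OF ac(2)] lin_scale[OF ac(2)] lin_zero[OF ac(2)])
      then have R: "rideal K R"
        unfolding rideal_def R_def using K(3) less.prems(3) by (auto simp: ac(3)[symmetric])
      have RK: "R \<noteq> K"
      proof
        assume "R = K"
        then have "1 \<in> R" using K(2) by simp
        then show False using w(2) F(3)[OF wF] by (simp add: R_def)
      qed
      have fgU: "t.fg U" by (rule t.fg_subset[OF fgV less.prems(1,2)])
      define U' where "U' = {u + ac w x | u x. u \<in> U \<and> x \<in> K}"
      have U': "t.fg U'" "t.dim U' + dim R = t.dim U + dim K"
        using ht.dim_add_image[OF lw fgK fgU] unfolding U'_def R_def by auto
      have "dim R < dim K"
        using fg_dim_eq[OF fgK \<open>subspace R\<close>] R RK by (auto simp: rideal_def not_less)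
      have U'V: "U' \<subseteq> V"
        unfolding U'_def using less.prems(2) V(3)[OF w(1)] t.subspace_add[OF V(1)] by blast
      have U'K: "ac u z \<in> U'" if "u \<in> U'" "z \<in> K" for u z
      proof -
        obtain v x where "u = v + ac w x" "v \<in> U" "x \<in> K" using \<open>u \<in> U'\<close> unfolding U'_def by blast
        then have "ac u z = ac v z + ac w (x * z)" "ac v z \<in> U" "x * z \<in> K"
          using that(2) K(3) less.prems(3) by (simp_all add: lin_add[OF ac(1)] ac(3))
        then show ?thesis unfolding U'_def by blast
      qed
      have "t.dim U < t.dim V"
        using t.fg_dim_eq[OF fgV less.prems(1,2)] False by linarith
      then have "t.dim V - t.dim U' < t.dim V - t.dim U" using U'(2) \<open>dim R < dim K\<close> by linarith
      then have IH: "real (t.dim (?H V)) - real (t.dim (?H U')) \<le> r * (real (t.dim V) - real (t.dim U'))"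
        by (rule less.hyps[OF _ t.fg_subspace[OF U'(1)] U'V U'K])
      define Z where "Z = {u + ac w h | u h. u \<in> ?H U \<and> h \<in> UNIV}"
      have fgHU: "t.fg (?H U)"
        using t.fg_subset[OF F(1) t.subspace_span HF] less.prems(2) V(2) by blast
      have Z: "t.fg Z" "t.dim Z + dim {h\<in>UNIV. ac w h \<in> ?H U} = t.dim (?H U) + dim UNIV"
        using ht.dim_add_image[OF lw fg_subspace_H[OF subspace_UNIV] fgHU] unfolding Z_def by auto
      have sub: "subspace {h\<in>UNIV. ac w h \<in> ?H U}"
        unfolding subspace_def
        by (auto simp: lin_add[OF ac(2)] lin_scale[OF ac(2)] lin_zero[OF ac(2)] t.span_zero t.span_add t.span_scale)
      have "{x * h | x h. x \<in> R} \<subseteq> {h\<in>UNIV. ac w h \<in> ?H U}"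
      proof clarify
        fix x h assume "x \<in> R"
        then have "ac w x \<in> U" by (simp add: R_def)
        then have "ac (ac w x) h \<in> ?H U" by (intro t.span_base) blast
        then show "x * h \<in> UNIV \<and> ac w (x * h) \<in> ?H U" by (simp add: ac(3))
      qed
      then have "ext R \<subseteq> {h\<in>UNIV. ac w h \<in> ?H U}" unfolding ext_def by (rule span_minimal[OF _ sub])
      then have dR: "dim (ext R) \<le> dim {h\<in>UNIV. ac w h \<in> ?H U}" by (rule dim_subset)
      have "{ac u h | u h. u \<in> U'} \<subseteq> Z"
      proof
        fix y assume "y \<in> {ac u h | u h. u \<in> U'}"
        then obtain v x h where y: "y = ac (v + ac w x) h" "v \<in> U" unfolding U'_def by blast
        then have "y = ac v h + ac w (x * h)" by (simp add: lin_add[OF ac(1)] ac(3))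
        moreover have "ac v h \<in> ?H U" using y(2) by (intro t.span_base) blast
        ultimately show "y \<in> Z" unfolding Z_def by blast
      qed
      then have "?H U' \<subseteq> Z" by (rule t.span_minimal[OF _ t.fg_subspace[OF Z(1)]])
      then have "t.dim (?H U') \<le> t.dim Z" by (rule t.fg_dim_mono[OF Z(1) t.subspace_span])
      then have "real (t.dim (?H U')) \<le> real (t.dim (?H U)) + (real (dim UNIV) - real (dim (ext R)))"
        using Z(2) dR by linarith
      also have "\<dots> \<le> real (t.dim (?H U)) + r * (real (dim K) - real (dim R))" using r[OF R RK] by simp
      finally have "real (t.dim (?H V)) - real (t.dim (?H U))
        \<le> r * (real (t.dim V) - real (t.dim U')) + r * (real (dim K) - real (dim R))" using IH by linarith
      also have "\<dots> = r * (real (t.dim V) - real (t.dim U))"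
        using U'(2) by (simp add: distrib_left[symmetric])
      finally show ?thesis .
    qed simp
  qed
qed

text \<open>Let \<open>r\<close> be the maximum of \<open>(dim H - dim R H) / (dim K - dim R)\<close> over the proper right ideals \<open>R\<close> of \<open>K\<close>. Applied to
  \<open>K \<otimes> K + H \<otimes> R \<subseteq> H \<otimes> K\<close> inside \<open>H \<otimes> H\<close> for a maximising \<open>R\<close>, the bound yields \<open>r dim K \<le> dim H\<close>. For the augmentation ideal \<open>K\<^sup>+\<close>,
  the bounds \<open>dim K\<^sup>+H \<le> r (dim K - 1)\<close> and \<open>dim H - dim K\<^sup>+H \<le> r\<close> must then be equalities, and \<open>dim H = dim K (dim H - dim K\<^sup>+H)\<close>.\<close>

lemma adapted_dim_dvd:
  assumes K: "subco K" "1 \<in> K" "\<And>x y. x \<in> K \<Longrightarrow> y \<in> K \<Longrightarrow> x * y \<in> K"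
    and T: "lh T" "\<And>x. x \<in> K \<Longrightarrow> T x \<in> K" "\<And>h. lin_ext scale (\<lambda>(x, y). T y * x) (\<Delta> h) = \<epsilon> h *s 1"
    and BK: "BK \<subseteq> B" "span BK = K"
  shows "dim K dvd dim UNIV"
proof -
  define n where "n = dim UNIV"
  define k where "k = dim K"
  have n: "n = card B" unfolding n_def by simp
  have iBK: "independent BK" by (rule independent_mono[OF independent_Basis BK(1)])
  have k: "k = card BK" unfolding k_def BK(2)[symmetric] by (rule dim_span_eq_card_independent[OF iBK])
  have sK: "subspace K" using K(1) by (simp add: subco_def)
  have fgK: "fg K" by (rule fg_subspace_H[OF sK])
  have one0: "1 \<noteq> (0::'h)" by simp
  have bT: "bilin scale scale (\<lambda>x y. T y * x)"
    by (intro bilinI linI) (simp_all add: lin_add[OF T(1)] lin_scale[OF T(1)] distrib_left distrib_right scale_mult_left scale_mult_right)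
  have SWT: "SW (\<lambda>x y. T y * x) h = \<epsilon> h *s 1" for h using SW_eq[OF vs bT] T(3) by simp
  have coK: "co b x = 0" if "x \<in> K" "b \<notin> BK" for b x
    using representation_extend[OF independent_Basis _ BK(1), of x] that BK(2) representation_ne_zero[of BK x b]
    unfolding co_def by auto
  have DK: "D b x \<in> K" if "x \<in> K" "b \<in> B" for b x using K(1) that by (auto simp: subco_def)
  have DK0: "D b x = 0" if "x \<in> K" "b \<in> B" "b \<notin> BK" for b x
  proof -
    have "co c (D b x) = 0" if c: "c \<in> B" for c
    proof -
      have "E c x \<in> K" using K(1) c \<open>x \<in> K\<close> by (auto simp: subco_def)
      then show ?thesis using coK[of "E c x" b] co_E[OF \<open>b \<in> B\<close>, of c x] \<open>b \<notin> BK\<close> by simp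
    qed
    then show ?thesis using co_sum[of "D b x"] by (simp cong: sum.cong)
  qed
  define Q where "Q = {(real n - real (dim (ext R))) / (real k - real (dim R)) | R. rideal K R \<and> R \<noteq> K}"
  have ltk: "dim R < k" if "rideal K R" "R \<noteq> K" for R
    using fg_dim_eq[OF fgK] that unfolding k_def rideal_def by (meson not_less)
  have "Q \<subseteq> (\<lambda>(x, y). (real n - real x) / (real k - real y)) ` ({..n} \<times> {..k})"
  proof
    fix q assume "q \<in> Q"
    then obtain R where R: "rideal K R" "R \<noteq> K" "q = (real n - real (dim (ext R))) / (real k - real (dim R))"
      unfolding Q_def by blast
    have "dim (ext R) \<le> n" unfolding n_def by (rule dim_subset) simp
    then show "q \<in> (\<lambda>(x, y). (real n - real x) / (real k - real y)) ` ({..n} \<times> {..k})"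
      using ltk[OF R(1,2)] R(3) by (intro image_eqI[where x = "(dim (ext R), dim R)"]) auto
  qed
  then have finQ: "finite Q" by (rule finite_subset) simp
  have "rideal K {0}" using subspace_0[OF sK] by (auto simp: rideal_def subspace_single_0)
  moreover have "{0} \<noteq> K" using K(2) one0 by blast
  ultimately have "Q \<noteq> {}" unfolding Q_def by blast
  define r where "r = Max Q"
  have "r \<in> Q" unfolding r_def by (rule Max_in[OF finQ \<open>Q \<noteq> {}\<close>])
  then obtain R where R: "rideal K R" "R \<noteq> K" "r = (real n - real (dim (ext R))) / (real k - real (dim R))"
    unfolding Q_def by blast
  have rmax: "real n - real (dim (ext R')) \<le> r * (real k - real (dim R'))" if "rideal K R'" "R' \<noteq> K" for R'
  proof -
    have "(real n - real (dim (ext R'))) / (real k - real (dim R')) \<le> r"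
      unfolding r_def by (rule Max_ge[OF finQ]) (use that Q_def in blast)
    then show ?thesis using ltk[OF that] by (simp add: divide_le_eq)
  qed
  define s where "s = k - dim R"
  have s: "real k - real (dim R) = real s" "s > 0" using ltk[OF R(1,2)] unfolding s_def by auto
  have rs: "real n - real (dim (ext R)) = r * real s" using R(3) s by simp
  have sR: "subspace R" and RK: "R \<subseteq> K" using R(1) by (auto simp: rideal_def)
  \<comment> \<open>the modules \<open>H \<otimes> K\<close> and \<open>K \<otimes> K + H \<otimes> R\<close>\<close>
  define V where "V = Full B (\<lambda>_. K)"
  define V1 where "V1 = Full B (\<lambda>b. if b \<in> BK then K else R)"
  define F where "F = Full B (\<lambda>_. UNIV)"
  have subW: "subspace (if b \<in> BK then K else R)" for b using sK sR by simp
  have sV: "fhs.subspace V" and sV1: "fhs.subspace V1" and sF: "fhs.subspace F"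
    unfolding V_def V1_def F_def by (rule Full_subspace; use sK sR in simp)+
  have dV: "fhs.dim V = n * k" unfolding V_def n k_def using Full_dim[OF sK finite_B] by simp
  have dF: "fhs.fg F" "fhs.dim F = n * n" unfolding F_def using Full_dim[OF subspace_UNIV finite_B] n by simp_all
  have dV1: "fhs.dim V1 = k * k + (n - k) * dim R"
  proof -
    have "fhs.dim V1 = (\<Sum>b\<in>B. dim (if b \<in> BK then K else R))"
      unfolding V1_def using Full_dim[OF subW finite_B] by simp
    also have "\<dots> = (\<Sum>b\<in>B. if b \<in> BK then k else dim R)" by (intro sum.cong refl) (simp add: k_def)
    also have "\<dots> = (\<Sum>b\<in>B - BK. dim R) + (\<Sum>b\<in>BK. k)"
      using sum.subset_diff[OF BK(1) finite_B, of "\<lambda>b. if b \<in> BK then k else dim R"] by simp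
    finally show ?thesis using card_Diff_subset[OF finite_subset[OF BK(1) finite_B] BK(1)] n k by simp
  qed
  have kn: "k \<le> n" unfolding n k by (rule card_mono[OF finite_B BK(1)])
  have V1V: "V1 \<subseteq> V" and VF: "V \<subseteq> F" unfolding V_def V1_def F_def Full_def using RK by auto
  have VK: "act u z \<in> V" if u: "u \<in> V" and z: "z \<in> K" for u z
    unfolding act_def SW_def
  proof (intro fhs.subspace_sum[OF sV])
    fix i b assume "i \<in> B" "b \<in> B"
    then have "u i * D b z \<in> K" using u DK[OF z] K(3) by (auto simp: V_def Full_def)
    then show "pure (i * b) (u i * D b z) \<in> V" unfolding V_def by (rule pure_Full[OF sK])
  qed
  have V1K: "act u z \<in> V1" if u: "u \<in> V1" and z: "z \<in> K" for u z
    unfolding act_def SW_def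
  proof (intro fhs.subspace_sum[OF sV1])
    fix i b assume ib: "i \<in> B" "b \<in> B"
    show "pure (i * b) (u i * D b z) \<in> V1"
    proof (cases "i \<in> BK")
      case True
      have uK: "u i * D b z \<in> K" using u ib True DK[OF z] K(3) by (auto simp: V1_def Full_def)
      show ?thesis
      proof (cases "b \<in> BK")
        case True
        have "i * b \<in> K" using True \<open>i \<in> BK\<close> BK(2) span_base K(3) by metis
        then show ?thesis
          using coK[of "i * b"] uK subspace_scale[OF sK] subspace_0[OF sR]
          by (auto simp: V1_def Full_def pure_def co_out)
      next
        case False
        then show ?thesis using DK0[OF z ib(2)] fhs.subspace_0[OF sV1]
          by (simp add: pure_def zero_fun_def)
      qed
    next
      case False
      then have "u i * D b z \<in> R" using u ib DK[OF z] R(1) by (auto simp: V1_def Full_def rideal_def)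
      then show ?thesis using RK subspace_scale[OF sR]
        by (auto simp: V1_def Full_def pure_def co_out)
    qed
  qed
  let ?H = "\<lambda>U. fhs.span {act u h | u h. u \<in> U}"
  have bound: "real (fhs.dim (?H V)) - real (fhs.dim (?H V1)) \<le> r * (real (fhs.dim V) - real (fhs.dim V1))"
  proof (rule induced_rank_bound[OF kspace_fh sK K(2,3) act_lin1 act_lin2 act_assoc _ dF(1) _ _ sV VF VK sV1 V1V V1K])
    show "real (dim UNIV) - real (dim (ext R')) \<le> r * (real (dim K) - real (dim R'))"
      if "rideal K R'" "R' \<noteq> K" for R' using rmax[OF that] by (simp add: n_def k_def)
    show "act u h \<in> F" if "u \<in> F" for u h unfolding F_def by (rule act_Full)
    show "act u 1 = u" if "u \<in> F" for u using that unfolding F_def by (rule act_one)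
  qed
  have FH: "F \<subseteq> ?H V"
  proof
    fix u assume u: "u \<in> F"
    \<comment> \<open>\<open>a \<otimes> h = a S(h\<^sub>1) h\<^sub>2 \<otimes> h\<^sub>3\<close>\<close>
    have p1: "pure a h = SW (\<lambda>p q. act (pure (a * S p) 1) q) h" for a h
    proof -
      have tri: "trilin scale fh (\<lambda>p q1 q2. pure (a * S p * q1) q2)"
        by (auto simp: trilin_def lin_def pure_rules distrib_left distrib_right scale_mult_left scale_mult_right
            lin_add[OF antipode_lin] lin_scale[OF antipode_lin])
      have "SW (\<lambda>p q. act (pure (a * S p) 1) q) h = SW (\<lambda>x q2. SW (\<lambda>p q1. pure (a * S p * q1) q2) x) h"
        unfolding act_pure using SW_coassoc[OF vs_fh tri, of h] by simp
      also have "\<dots> = SW (\<lambda>x q2. pure a (\<epsilon> x *s q2)) h"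
      proof (rule SW_cong)
        fix x q2
        have l: "lin scale fh (\<lambda>y. pure (a * y) q2)"
          by (intro linI) (simp_all add: pure_rules distrib_left scale_mult_right)
        have "SW (\<lambda>p q1. pure (a * S p * q1) q2) x = pure (a * SW (\<lambda>p q1. S p * q1) x) q2"
          unfolding lin_SW[OF l] by (simp add: mult.assoc)
        then show "SW (\<lambda>p q1. pure (a * S p * q1) q2) x = pure a (\<epsilon> x *s q2)"
          by (simp add: SW_antipode_left scale_mult_right pure_rules)
      qed
      also have "\<dots> = pure a (SW (\<lambda>x q2. \<epsilon> x *s q2) h)" unfolding lin_SW[OF bilin1[OF bilin_pure]] ..
      finally show ?thesis by (simp add: SW_counit_left)
    qed
    have p2: "SW (\<lambda>p q. act (pure (a * S p) 1) q) h \<in> ?H V" for a h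
      unfolding SW_def V_def
      by (intro fhs.span_sum fhs.span_base) (use pure_Full[OF sK K(2)] in blast)
    have "pure a h \<in> ?H V" for a h by (subst p1) (rule p2)
    then have "(\<Sum>i\<in>B. pure i (u i)) \<in> ?H V" by (intro fhs.span_sum)
    then show "u \<in> ?H V" by (simp only: pure_sum[OF u[unfolded F_def], symmetric])
  qed
  have HF: "?H U \<subseteq> F" for U unfolding F_def
    by (rule fhs.span_minimal) (use act_Full Full_subspace in auto)
  have "?H V = F" by (rule subset_antisym[OF HF FH])
  then have dHV: "fhs.dim (?H V) = n * n" using dF(2) by (simp only:)
  define NH where "NH = Full B (\<lambda>_. ext R)"
  have sx: "subspace (ext R)" unfolding ext_def by simp
  have NH: "fhs.fg NH" "fhs.dim NH = n * dim (ext R)" unfolding NH_def using Full_dim[OF sx finite_B] n by simp_all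
  have sNH: "fhs.subspace NH" by (rule fhs.fg_subspace[OF NH(1)])
  obtain B0 where B0: "independent B0" "span B0 = R" "card B0 = dim R" "finite B0"
    using fg_basis[OF fg_subspace_H[OF sR]] by metis
  have "B0 \<subseteq> K" using B0(2) RK span_superset by blast
  obtain B1 where B1: "B0 \<subseteq> B1" "finite B1" "independent B1" "span B1 = K" "card B1 = dim K"
    using fg_extend_basis[OF fgK B0(1) \<open>B0 \<subseteq> K\<close>] by metis
  define G where "G = (\<lambda>(z, b). act (pure 1 z) b) ` ((B1 - B0) \<times> B)"
  have finG: "finite G" unfolding G_def using B1(2) finite_B by simp
  have "card G \<le> card ((B1 - B0) \<times> B)" unfolding G_def by (rule card_image_le) (use B1(2) finite_B in simp)
  also have "\<dots> = s * n" using card_Diff_subset[OF B0(4) B1(1)] B1(5) B0(3) n unfolding s_def k_def by (simp add: card_cartesian_product)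
  finally have cG: "card G \<le> s * n" .
  let ?Z = "fhs.span (NH \<union> G)"
  have ZN: "x \<in> ?Z" if "x \<in> NH" for x using that by (intro fhs.span_base) simp
  have actR: "act (pure a x) h \<in> NH" if "x \<in> R" for a x h
    unfolding act_pure SW_def NH_def
  proof (intro fhs.subspace_sum[OF sNH[unfolded NH_def]] pure_Full[OF sx])
    fix b show "x * D b h \<in> ext R" unfolding ext_def using that by (intro span_base) blast
  qed
  have actK: "act (pure 1 z) h \<in> ?Z" if z: "z \<in> K" for z h
  proof -
    have "z \<in> span (B0 \<union> (B1 - B0))" using z B1(1,4) by (simp add: Un_absorb1)
    then obtain x y where xy: "z = x + y" "x \<in> R" "y \<in> span (B1 - B0)" unfolding span_Un B0(2) by blast
    have l: "lin scale fh (\<lambda>y. act (pure 1 y) h)"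
      by (intro linI) (simp_all add: pure_rules lin_add[OF act_lin1] lin_scale[OF act_lin1])
    have "act (pure 1 y) h \<in> ?Z"
      using xy(3)
    proof (induction rule: span_induct_alt)
      case base
      show ?case unfolding lin_zero[OF l] by (rule fhs.span_zero)
    next
      case (step c v w)
      have "act (pure 1 v) h = (\<Sum>b\<in>B. fh (co b h) (act (pure 1 v) b))" by (rule lin_co[OF act_lin2])
      also have "\<dots> \<in> ?Z"
        using step(1) by (intro fhs.span_sum fhs.span_scale fhs.span_base) (auto simp: G_def)
      finally have "act (pure 1 v) h \<in> ?Z" .
      then show ?case unfolding lin_add[OF l] lin_scale[OF l] by (intro fhs.span_add fhs.span_scale step(2))
    qed
    then show ?thesis
      unfolding xy(1) lin_add[OF l] using ZN[OF actR[OF xy(2)]] by (intro fhs.span_add)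
  qed
  \<comment> \<open>\<open>y h\<^sub>1 \<otimes> x h\<^sub>2\<close> is \<open>1 \<otimes> x T(y\<^sub>2)\<close> acted on by \<open>y\<^sub>1 h\<close>\<close>
  have twist: "act (pure y x) h = SW (\<lambda>a b. act (pure 1 (x * T b)) (a * h)) y" for y x h
  proof -
    have Ts: "T (a + b) = T a + T b" "T (c *s a) = c *s T a" for a b c using T(1) by (simp_all add: lin_def)
    let ?f = "\<lambda>a1 a2 b. SW (\<lambda>h1 h2. pure (a1 * h1) (x * T b * (a2 * h2))) h"
    have tri: "trilin scale fh ?f"
      unfolding SW_def
      by (auto simp: trilin_def lin_def pure_rules distrib_left distrib_right scale_mult_left scale_mult_right
          Ts sum.distrib fhs.scale_sum_right)
    have "SW (\<lambda>a b. act (pure 1 (x * T b)) (a * h)) y = SW (\<lambda>a b. SW (\<lambda>a1 a2. ?f a1 a2 b) a) y"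
      unfolding act_pure SW_mult[OF vs_fh bilin_act_pure] by simp
    also have "\<dots> = SW (\<lambda>a1 c. SW (\<lambda>a2 b. ?f a1 a2 b) c) y" by (rule SW_coassoc[OF vs_fh tri])
    also have "\<dots> = SW (\<lambda>a1 c. SW (\<lambda>h1 h2. pure (\<epsilon> c *s a1 * h1) (x * h2)) h) y"
    proof (rule SW_cong)
      fix a1 c
      have l: "lin scale fh (\<lambda>v. SW (\<lambda>h1 h2. pure (a1 * h1) (x * v * h2)) h)"
        unfolding SW_def by (intro linI)
          (simp_all add: pure_rules distrib_left distrib_right scale_mult_left scale_mult_right sum.distrib fhs.scale_sum_right)
      have "SW (\<lambda>a2 b. ?f a1 a2 b) c = SW (\<lambda>a2 b. SW (\<lambda>h1 h2. pure (a1 * h1) (x * (T b * a2) * h2)) h) c"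
        by (simp add: mult.assoc)
      also have "\<dots> = SW (\<lambda>h1 h2. pure (a1 * h1) (x * SW (\<lambda>a2 b. T b * a2) c * h2)) h"
        by (rule lin_SW[OF l, symmetric])
      finally show "SW (\<lambda>a2 b. ?f a1 a2 b) c = SW (\<lambda>h1 h2. pure (\<epsilon> c *s a1 * h1) (x * h2)) h"
        by (simp add: SWT scale_mult_right scale_mult_left pure_rules)
    qed
    also have "\<dots> = SW (\<lambda>h1 h2. pure (SW (\<lambda>a1 c. \<epsilon> c *s a1) y * h1) (x * h2)) h"
    proof -
      have l: "lin scale fh (\<lambda>v. SW (\<lambda>h1 h2. pure (v * h1) (x * h2)) h)"
        unfolding SW_def by (intro linI) (simp_all add: pure_rules distrib_right scale_mult_left sum.distrib fhs.scale_sum_right)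
      show ?thesis by (rule lin_SW[OF l, symmetric])
    qed
    finally show ?thesis by (simp add: act_pure SW_counit_right)
  qed
  have "?H V1 \<subseteq> ?Z"
  proof (rule fhs.span_minimal[OF _ fhs.subspace_span], rule subsetI)
    fix y assume "y \<in> {act u h | u h. u \<in> V1}"
    then obtain u h where y: "y = act u h" "u \<in> V1" by blast
    have "act (pure i (u i)) h \<in> ?Z" if i: "i \<in> B" for i
    proof (cases "i \<in> BK")
      case True
      then have iK: "i \<in> K" using BK(2) span_base by blast
      have "act (pure i (u i)) h = (\<Sum>b\<in>B. act (pure 1 (u i * T (D b i))) (b * h))"
        unfolding twist[of i] SW_def ..
      moreover have "u i * T (D b i) \<in> K" if "b \<in> B" for b
        using y(2) i True K(3) T(2) DK[OF iK that] by (auto simp: V1_def Full_def)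
      ultimately show ?thesis using actK by (simp add: fhs.span_sum)
    next
      case False
      then have "u i \<in> R" using y(2) i by (auto simp: V1_def Full_def)
      then show ?thesis by (intro ZN actR)
    qed
    then show "y \<in> ?Z" unfolding y(1) act_eq_pure[of u] by (rule fhs.span_sum)
  qed
  then have "fhs.dim (?H V1) \<le> fhs.dim ?Z"
    by (rule fhs.fg_dim_mono[OF fhs.dim_span_Un_le(1)[OF NH(1) finG] fhs.subspace_span])
  also have "\<dots> \<le> n * dim (ext R) + s * n"
    using fhs.dim_span_Un_le(2)[OF NH(1) finG] NH(2) cG by linarith
  finally have "real (fhs.dim (?H V1)) \<le> real n * real (dim (ext R)) + real s * real n"
    by (simp only: of_nat_mult[symmetric] of_nat_add[symmetric] of_nat_le_iff)
  then have "real n * real n - (real n * real (dim (ext R)) + real s * real n) \<le> r * (real n * real k - (real k * real k + (real n - real k) * real (dim R)))"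
    using bound unfolding dHV dV dV1 using kn by (simp add: of_nat_diff)
  then have "real n * (real n - real (dim (ext R))) - real s * real n \<le> r * ((real n - real k) * (real k - real (dim R)))"
    by (simp add: algebra_simps)
  then have "real s * (r * real k) \<le> real s * real n"
    unfolding rs s(1) by (simp add: algebra_simps)
  then have rk: "r * real k \<le> real n" using s(2) by simp
  \<comment> \<open>the augmentation ideal, where the two estimates meet\<close>
  define Kp where "Kp = {x\<in>K. \<epsilon> x *s 1 \<in> {0::'h}}"
  have Kp: "rideal K Kp"
    using sK K(3) by (auto simp: Kp_def rideal_def subspace_def counit_mult lin_add[OF counit_lin] lin_scale[OF counit_lin] lin_zero[OF counit_lin])
  have "1 \<notin> Kp" by (simp add: Kp_def counit_one)
  then have KpK: "Kp \<noteq> K" using K(2) by metis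
  have dKp: "dim Kp + 1 = k"
  proof -
    have l: "Vector_Spaces.linear scale scale (\<lambda>x. \<epsilon> x *s 1)"
      unfolding lin_iff_linear[OF vs vs, symmetric]
      by (intro linI) (simp_all add: lin_add[OF counit_lin] lin_scale[OF counit_lin] scale_left_distrib)
    have "{u + \<epsilon> x *s 1 | u x. u \<in> {0::'h} \<and> x \<in> K} = span {1}"
    proof (intro equalityI subsetI)
      fix v assume "v \<in> span {1::'h}"
      then obtain c where "v = c *s 1" by (auto simp: span_singleton)
      moreover have "c *s 1 \<in> K" by (rule subspace_scale[OF sK K(2)])
      moreover have "\<epsilon> (c *s 1) = c" by (simp add: lin_scale[OF counit_lin] counit_one)
      ultimately show "v \<in> {u + \<epsilon> x *s 1 | u x. u \<in> {0::'h} \<and> x \<in> K}" by force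
    qed (auto simp: span_singleton)
    moreover have "dim (span {1::'h}) = 1" using dim_span_eq_card_independent[of "{1::'h}"] by simp
    ultimately show ?thesis
      using hh.dim_add_image(2)[OF l fgK fg_span[of "{}"]] unfolding Kp_def k_def by (simp add: dim_zero_space)
  qed
  have low: "real n - real (dim (ext Kp)) \<le> r" using rmax[OF Kp KpK] dKp by (simp add: algebra_simps flip: dKp)
  have sKp: "subspace Kp" using Kp by (simp add: rideal_def)
  have "real (dim (span {v * h | v h. v \<in> Kp})) - real (dim (span {u * h | u h. u \<in> {0}})) \<le> r * (real (dim Kp) - real (dim {0}))"
  proof (rule induced_rank_bound[where t = scale and F = UNIV and ac = "(*)" and K = K])
    show "kspace scale" ..
    show "fg UNIV" by (rule fg_subspace_H[OF subspace_UNIV])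
    show "real (dim UNIV) - real (dim (ext R')) \<le> r * (real (dim K) - real (dim R'))"
      if "rideal K R'" "R' \<noteq> K" for R' using rmax[OF that] by (simp add: n_def k_def)
    show "v * z \<in> Kp" if "v \<in> Kp" "z \<in> K" for v z using Kp that by (auto simp: rideal_def)
  qed (use sK K sKp subspace_0[OF sKp] in \<open>auto simp: lin_def distrib_left distrib_right scale_mult_left scale_mult_right mult.assoc subspace_single_0\<close>)
  moreover have "span {u * h | u h. u \<in> {0::'h}} = {0}"
    by (rule subset_antisym, rule span_minimal) (auto simp: subspace_single_0 span_zero)
  ultimately have up: "real (dim (ext Kp)) \<le> r * (real k - 1)"
    unfolding ext_def using dKp by (simp add: dim_zero_space flip: dKp)
  have k0: "real k > 0" using dKp by simp
  have "(real n - real (dim (ext Kp))) * real k \<le> real n"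
    using mult_right_mono[OF low, of "real k"] rk k0 by linarith
  moreover have "real n \<le> (real n - real (dim (ext Kp))) * real k"
  proof -
    have "real (dim (ext Kp)) * real k \<le> r * real k * (real k - 1)"
      using mult_right_mono[OF up, of "real k"] k0 by (simp add: mult_ac)
    also have "\<dots> \<le> real n * (real k - 1)" using rk dKp by (intro mult_right_mono) auto
    finally show ?thesis by (simp add: algebra_simps)
  qed
  ultimately have eq: "(real n - real (dim (ext Kp))) * real k = real n" by linarith
  have "dim (ext Kp) \<le> n" unfolding n_def by (rule dim_subset) simp
  then have "real ((n - dim (ext Kp)) * k) = real n" using eq by (simp add: of_nat_diff)
  then have "(n - dim (ext Kp)) * k = n" by (simp only: of_nat_eq_iff)
  then show ?thesis unfolding n_def[symmetric] k_def[symmetric] by (metis dvd_triv_right)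
qed

end

text \<open>The theorem of Nichols and Zoeller; a basis of \<open>K\<close> is extended to one of \<open>H\<close>.\<close>

theorem (in fd_hopf) hopf_subalgebra_dim_dvd:
  assumes K: "subcoalgebra K" "1 \<in> K" "\<And>x y. x \<in> K \<Longrightarrow> y \<in> K \<Longrightarrow> x * y \<in> K"
    and T: "lh T" "\<And>x. x \<in> K \<Longrightarrow> T x \<in> K" "\<And>h. lin_ext scale (\<lambda>(x, y). T y * x) (\<Delta> h) = \<epsilon> h *s 1"
  shows "dim K dvd dim UNIV"
proof -
  have sK: "subspace K" using K(1) by (simp add: subcoalgebra_def)
  obtain BK where BK: "independent BK" "span BK = K" using fg_basis[OF fg_subspace_H[OF sK]] by metis
  obtain B' where B': "BK \<subseteq> B'" "finite B'" "independent B'" "span B' = UNIV"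
    using fg_extend_basis[OF fg_subspace_H[OF subspace_UNIV] BK(1) subset_UNIV] by metis
  interpret b: fd_hopf scale \<Delta> \<epsilon> S B'
    using B' by unfold_locales auto
  show ?thesis
    using b.adapted_dim_dvd[OF _ K(2,3) T B'(1) BK(2)] K(1) by (simp add: b.subcoalgebra_iff)
qed

section \<open>Fusion rings\<close>

text \<open>A finite based ring: \<open>N a b c\<close> is the multiplicity of \<open>c\<close> in \<open>a b\<close>, \<open>st\<close> the duality and \<open>d\<close> the dimension.
  The axioms \<open>N_left\<close> and \<open>N_right\<close> are Frobenius reciprocity. Elements of the ring are integer functions; values
  outside \<open>I\<close> are irrelevant for \<open>ip\<close> and \<open>dg\<close>, while \<open>nn\<close> asks them to vanish.\<close>

locale fusion_ring =
  fixes I :: "'i set" and one :: 'i and st :: "'i \<Rightarrow> 'i" and N :: "'i \<Rightarrow> 'i \<Rightarrow> 'i \<Rightarrow> nat" and d :: "'i \<Rightarrow> nat"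
  assumes fin: "finite I" and one_in: "one \<in> I" and d_one: "d one = 1"
    and st_in: "a \<in> I \<Longrightarrow> st a \<in> I" and st_st: "a \<in> I \<Longrightarrow> st (st a) = a" and d_st: "a \<in> I \<Longrightarrow> d (st a) = d a"
    and d_pos: "a \<in> I \<Longrightarrow> d a > 0"
    and N_one_left: "a \<in> I \<Longrightarrow> c \<in> I \<Longrightarrow> N one a c = (if a = c then 1 else 0)"
    and N_one_right: "a \<in> I \<Longrightarrow> c \<in> I \<Longrightarrow> N a one c = (if a = c then 1 else 0)"
    and N_left: "a \<in> I \<Longrightarrow> b \<in> I \<Longrightarrow> c \<in> I \<Longrightarrow> N a b c = N (st a) c b"
    and N_right: "a \<in> I \<Longrightarrow> b \<in> I \<Longrightarrow> c \<in> I \<Longrightarrow> N a b c = N c (st b) a"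
    and N_assoc: "a \<in> I \<Longrightarrow> b \<in> I \<Longrightarrow> c \<in> I \<Longrightarrow> f \<in> I \<Longrightarrow>
      (\<Sum>e\<in>I. N a b e * N e c f) = (\<Sum>e\<in>I. N b c e * N a e f)"
    and N_deg: "a \<in> I \<Longrightarrow> b \<in> I \<Longrightarrow> d a * d b = (\<Sum>c\<in>I. N a b c * d c)"
begin

definition el :: "'i \<Rightarrow> 'i \<Rightarrow> int" where "el a = (\<lambda>c. if c = a then 1 else 0)"

definition mul :: "('i \<Rightarrow> int) \<Rightarrow> ('i \<Rightarrow> int) \<Rightarrow> 'i \<Rightarrow> int" (infixl \<open>\<star>\<close> 70) where
  "u \<star> v = (\<lambda>c. if c \<in> I then \<Sum>a\<in>I. \<Sum>b\<in>I. u a * v b * int (N a b c) else 0)"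

definition ip :: "('i \<Rightarrow> int) \<Rightarrow> ('i \<Rightarrow> int) \<Rightarrow> int" where "ip u v = (\<Sum>c\<in>I. u c * v c)"

definition dg :: "('i \<Rightarrow> int) \<Rightarrow> int" where "dg u = (\<Sum>c\<in>I. u c * int (d c))"

definition nn :: "('i \<Rightarrow> int) \<Rightarrow> bool" where "nn u \<longleftrightarrow> (\<forall>c. 0 \<le> u c) \<and> (\<forall>c. c \<notin> I \<longrightarrow> u c = 0)"

lemma el_simps: "el a a = 1" "a \<noteq> c \<Longrightarrow> el a c = 0" "c \<noteq> a \<Longrightarrow> el a c = 0"
  by (auto simp: el_def)

lemma el_inj: "el a = el b \<longleftrightarrow> a = b"
  by (metis el_simps(1,2) zero_neq_one)

lemma mul_add: "u \<star> (v + w) = u \<star> v + u \<star> w" "(u + v) \<star> w = u \<star> w + v \<star> w"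
  "u \<star> (v - w) = u \<star> v - u \<star> w" "(u - v) \<star> w = u \<star> w - v \<star> w"
  by (auto simp: mul_def fun_eq_iff algebra_simps sum.distrib sum_subtractf)

lemma ip_add: "ip u (v + w) = ip u v + ip u w" "ip (u + v) w = ip u w + ip v w"
  "ip u (v - w) = ip u v - ip u w" "ip (u - v) w = ip u w - ip v w"
  by (auto simp: ip_def algebra_simps sum.distrib sum_subtractf)

lemma dg_add: "dg (u + v) = dg u + dg v" "dg (u - v) = dg u - dg v"
  by (auto simp: dg_def algebra_simps sum.distrib sum_subtractf)

lemma ip_sym: "ip u v = ip v u" by (simp add: ip_def mult.commute)

lemma sum_el: "a \<in> I \<Longrightarrow> (\<Sum>c\<in>I. el a c * f c) = f a" "a \<in> I \<Longrightarrow> (\<Sum>c\<in>I. f c * el a c) = f a"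
proof -
  assume a: "a \<in> I"
  have "(\<Sum>c\<in>I. el a c * f c) = (\<Sum>c\<in>I. if c = a then f c else 0)" by (rule sum.cong) (auto simp: el_def)
  then show *: "(\<Sum>c\<in>I. el a c * f c) = f a" using a fin by simp
  then show "(\<Sum>c\<in>I. f c * el a c) = f a" by (simp add: mult.commute)
qed

lemma ip_el: "a \<in> I \<Longrightarrow> ip (el a) v = v a" "a \<in> I \<Longrightarrow> ip v (el a) = v a"
  by (simp_all add: ip_def sum_el)

lemma dg_el: "a \<in> I \<Longrightarrow> dg (el a) = int (d a)"
  by (simp add: dg_def sum_el)

lemma dg_zero: "dg 0 = 0" by (simp add: dg_def)

lemma mul_el: "a \<in> I \<Longrightarrow> b \<in> I \<Longrightarrow> c \<in> I \<Longrightarrow> (el a \<star> el b) c = int (N a b c)"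
  by (simp add: mul_def mult.assoc sum_distrib_left[symmetric] sum_el)

lemma nn_el: "a \<in> I \<Longrightarrow> nn (el a)" by (auto simp: nn_def el_def)

lemma nn_mul: "nn u \<Longrightarrow> nn v \<Longrightarrow> nn (u \<star> v)" by (auto simp: nn_def mul_def intro!: sum_nonneg)

lemma nn_ge: "nn u \<Longrightarrow> 0 \<le> u c" by (simp add: nn_def)

lemma mul_app: "c \<in> I \<Longrightarrow> (u \<star> v) c = (\<Sum>a\<in>I. \<Sum>b\<in>I. u a * v b * int (N a b c))"
  by (simp add: mul_def)

lemma mul_assoc: "(u \<star> v) \<star> w = u \<star> (v \<star> w)"
proof
  fix f
  show "((u \<star> v) \<star> w) f = (u \<star> (v \<star> w)) f"
  proof (cases "f \<in> I")
    case True
    have "((u \<star> v) \<star> w) f = (\<Sum>e\<in>I. \<Sum>c\<in>I. (\<Sum>a\<in>I. \<Sum>b\<in>I. u a * v b * int (N a b e)) * w c * int (N e c f))"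
      using True by (simp add: mul_app cong: sum.cong)
    also have "\<dots> = (\<Sum>e\<in>I. \<Sum>c\<in>I. \<Sum>a\<in>I. \<Sum>b\<in>I. u a * v b * w c * int (N a b e * N e c f))"
      by (simp add: sum_distrib_left sum_distrib_right mult_ac)
    also have "\<dots> = (\<Sum>a\<in>I. \<Sum>b\<in>I. \<Sum>e\<in>I. \<Sum>c\<in>I. u a * v b * w c * int (N a b e * N e c f))"
      by (rule sum_rotate4)
    also have "\<dots> = (\<Sum>a\<in>I. \<Sum>b\<in>I. \<Sum>c\<in>I. \<Sum>e\<in>I. u a * v b * w c * int (N a b e * N e c f))"
      by (intro sum.cong[OF refl] sum.swap)
    also have "\<dots> = (\<Sum>a\<in>I. \<Sum>b\<in>I. \<Sum>c\<in>I. u a * v b * w c * int (\<Sum>e\<in>I. N a b e * N e c f))"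
      by (simp add: sum_distrib_left)
    also have "\<dots> = (\<Sum>a\<in>I. \<Sum>b\<in>I. \<Sum>c\<in>I. u a * v b * w c * int (\<Sum>e\<in>I. N b c e * N a e f))"
      using True by (simp only: N_assoc cong: sum.cong)
    also have "\<dots> = (\<Sum>a\<in>I. \<Sum>b\<in>I. \<Sum>c\<in>I. \<Sum>e\<in>I. u a * (v b * w c * int (N b c e)) * int (N a e f))"
      by (simp add: sum_distrib_left mult_ac)
    also have "\<dots> = (\<Sum>a\<in>I. \<Sum>e\<in>I. \<Sum>b\<in>I. \<Sum>c\<in>I. u a * (v b * w c * int (N b c e)) * int (N a e f))"
      by (intro sum.cong[OF refl] sum_rotate3)
    also have "\<dots> = (u \<star> (v \<star> w)) f"
      using True by (simp add: mul_app sum_distrib_left sum_distrib_right cong: sum.cong)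
    finally show ?thesis .
  qed (simp add: mul_def)
qed

lemma one_mul: "(\<And>c. c \<notin> I \<Longrightarrow> v c = 0) \<Longrightarrow> el one \<star> v = v"
proof
  fix c assume v: "\<And>c. c \<notin> I \<Longrightarrow> v c = 0"
  show "(el one \<star> v) c = v c"
  proof (cases "c \<in> I")
    case True
    have "(el one \<star> v) c = (\<Sum>a\<in>I. if a = one then \<Sum>b\<in>I. v b * int (N one b c) else 0)"
      using True by (auto simp: mul_def el_def intro!: sum.cong)
    also have "\<dots> = (\<Sum>b\<in>I. v b * int (N one b c))" using fin one_in by simp
    also have "\<dots> = (\<Sum>b\<in>I. if b = c then v b else 0)"
      using True by (intro sum.cong) (auto simp: N_one_left)
    finally show ?thesis using fin True by simp
  qed (simp add: mul_def v)
qed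

lemma mul_one: "(\<And>c. c \<notin> I \<Longrightarrow> v c = 0) \<Longrightarrow> v \<star> el one = v"
proof
  fix c assume v: "\<And>c. c \<notin> I \<Longrightarrow> v c = 0"
  show "(v \<star> el one) c = v c"
  proof (cases "c \<in> I")
    case True
    have "(v \<star> el one) c = (\<Sum>a\<in>I. \<Sum>b\<in>I. if b = one then v a * int (N a one c) else 0)"
      using True by (auto simp: mul_def el_def intro!: sum.cong)
    also have "\<dots> = (\<Sum>a\<in>I. v a * int (N a one c))" using fin one_in by simp
    also have "\<dots> = (\<Sum>a\<in>I. if a = c then v a else 0)"
      using True by (intro sum.cong) (auto simp: N_one_right)
    finally show ?thesis using fin True by simp
  qed (simp add: mul_def v)
qed

lemma el_out: "a \<in> I \<Longrightarrow> c \<notin> I \<Longrightarrow> el a c = 0" by (auto simp: el_def)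

lemma one_mul_el: "a \<in> I \<Longrightarrow> el one \<star> el a = el a" and mul_el_one: "a \<in> I \<Longrightarrow> el a \<star> el one = el a"
  by (simp_all add: one_mul mul_one el_out)

lemma ip_left: "a \<in> I \<Longrightarrow> ip (el a \<star> v) w = ip v (el (st a) \<star> w)"
proof -
  assume a: "a \<in> I"
  have L: "(el x \<star> y) c = (\<Sum>b\<in>I. y b * int (N x b c))" if "x \<in> I" "c \<in> I" for x y c
  proof -
    have "(el x \<star> y) c = (\<Sum>a\<in>I. if a = x then \<Sum>b\<in>I. y b * int (N x b c) else 0)"
      using that by (auto simp: mul_def el_def intro!: sum.cong)
    then show ?thesis using fin that by simp
  qed
  have "ip (el a \<star> v) w = (\<Sum>c\<in>I. \<Sum>b\<in>I. v b * w c * int (N a b c))"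
    unfolding ip_def using a by (simp add: L sum_distrib_left sum_distrib_right mult_ac)
  also have "\<dots> = (\<Sum>b\<in>I. \<Sum>c\<in>I. v b * w c * int (N (st a) c b))"
    using a by (subst sum.swap) (simp add: N_left cong: sum.cong)
  also have "\<dots> = ip v (el (st a) \<star> w)"
    unfolding ip_def using a st_in by (simp add: L sum_distrib_left mult_ac)
  finally show ?thesis .
qed

lemma ip_right: "b \<in> I \<Longrightarrow> ip (v \<star> el b) w = ip v (w \<star> el (st b))"
proof -
  assume b: "b \<in> I"
  have L: "(y \<star> el x) c = (\<Sum>a\<in>I. y a * int (N a x c))" if "x \<in> I" "c \<in> I" for x y c
  proof -
    have "(y \<star> el x) c = (\<Sum>a\<in>I. \<Sum>b\<in>I. if b = x then y a * int (N a x c) else 0)"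
      using that by (auto simp: mul_def el_def intro!: sum.cong)
    then show ?thesis using fin that by simp
  qed
  have "ip (v \<star> el b) w = (\<Sum>c\<in>I. \<Sum>a\<in>I. v a * w c * int (N a b c))"
    unfolding ip_def using b by (simp add: L sum_distrib_left sum_distrib_right mult_ac)
  also have "\<dots> = (\<Sum>a\<in>I. \<Sum>c\<in>I. v a * w c * int (N c (st b) a))"
    using b N_right by (subst sum.swap) (intro sum.cong refl, simp)
  also have "\<dots> = ip v (w \<star> el (st b))"
    unfolding ip_def using b st_in by (simp add: L sum_distrib_left mult_ac)
  finally show ?thesis .
qed

lemma dg_mul: "dg (u \<star> v) = dg u * dg v"
proof -
  have "dg (u \<star> v) = (\<Sum>c\<in>I. \<Sum>a\<in>I. \<Sum>b\<in>I. u a * v b * int (N a b c * d c))"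
    unfolding dg_def by (simp add: mul_def sum_distrib_right mult.assoc)
  also have "\<dots> = (\<Sum>a\<in>I. \<Sum>b\<in>I. \<Sum>c\<in>I. u a * v b * int (N a b c * d c))" by (rule sum_rotate3[symmetric])
  also have "\<dots> = (\<Sum>a\<in>I. \<Sum>b\<in>I. u a * v b * int (d a * d b))"
    by (intro sum.cong refl) (simp add: N_deg sum_distrib_left del: of_nat_mult)
  also have "\<dots> = dg u * dg v" unfolding dg_def sum_product by (simp add: mult_ac)
  finally show ?thesis .
qed

lemma N_star: "a \<in> I \<Longrightarrow> b \<in> I \<Longrightarrow> c \<in> I \<Longrightarrow> N a b c = N (st b) (st a) (st c)"
  using N_left[of a b c] N_right[of "st a" c b] N_left[of b "st c" "st a"] st_in by simp

lemma st_one: "st one = one"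
  using N_one_left[OF st_in[OF one_in] one_in] N_right[OF one_in st_in[OF one_in] one_in] st_st[OF one_in]
    N_one_left[OF one_in one_in] by (metis zero_neq_one)

lemma star_mul: "a \<in> I \<Longrightarrow> b \<in> I \<Longrightarrow> c \<in> I \<Longrightarrow> (el a \<star> el b) c = (el (st b) \<star> el (st a)) (st c)"
  by (simp add: mul_el st_in N_star[of a b c])

lemma nn_dg: "nn u \<Longrightarrow> 0 \<le> dg u" by (auto simp: nn_def dg_def intro!: sum_nonneg)

lemma dom: "nn u \<Longrightarrow> c \<in> I \<Longrightarrow> u c * int (d c) \<le> dg u"
  unfolding dg_def using fin by (intro member_le_sum) (auto simp: nn_def)

lemma nn_diff: "nn u \<Longrightarrow> 1 \<le> u c \<Longrightarrow> nn (u - el c)"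
  by (auto simp: nn_def el_def)

lemma nn_in: "nn u \<Longrightarrow> 1 \<le> u c \<Longrightarrow> c \<in> I"
  by (auto simp: nn_def)

lemma nn_dg0: "nn u \<Longrightarrow> dg u = 0 \<Longrightarrow> u = 0"
proof
  fix c assume u: "nn u" "dg u = 0"
  show "u c = 0 c"
  proof (cases "c \<in> I")
    case True
    then have "u c * int (d c) \<le> 0" using dom[OF u(1)] u(2) by simp
    then show ?thesis using nn_ge[OF u(1), of c] d_pos[OF True] by (simp add: mult_le_0_iff)
  qed (use u in \<open>auto simp: nn_def\<close>)
qed

lemma peel:
  assumes "nn u" "dg u > 0"
  obtains c where "c \<in> I" "1 \<le> u c" "nn (u - el c)" "dg (u - el c) = dg u - int (d c)" "int (d c) \<le> dg u"
proof -
  have "\<exists>c. 1 \<le> u c"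
  proof (rule ccontr)
    assume "\<nexists>c. 1 \<le> u c"
    then have "u c = 0" for c using nn_ge[OF assms(1), of c] by (metis antisym_conv2 not_le zless_imp_add1_zle add_0)
    then have "u = 0" by (simp add: fun_eq_iff)
    then show False using assms(2) by (simp add: dg_zero)
  qed
  then obtain c where c: "1 \<le> u c" by blast
  have cI: "c \<in> I" by (rule nn_in[OF assms(1) c])
  have n: "nn (u - el c)" by (rule nn_diff[OF assms(1) c])
  have e: "dg (u - el c) = dg u - int (d c)" by (simp add: dg_add dg_el cI)
  show thesis using that[OF cI c n e] nn_dg[OF n] e by simp
qed

lemma ip_ge1: "c \<in> I \<Longrightarrow> (u c)\<^sup>2 \<le> ip u u"
  unfolding ip_def using fin member_le_sum[of c I "\<lambda>c. u c * u c"] by (auto simp: power2_eq_square)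

lemma ip_ge2: "a \<in> I \<Longrightarrow> b \<in> I \<Longrightarrow> a \<noteq> b \<Longrightarrow> (u a)\<^sup>2 + (u b)\<^sup>2 \<le> ip u u"
proof -
  assume ab: "a \<in> I" "b \<in> I" "a \<noteq> b"
  have "(\<Sum>c\<in>{a, b}. u c * u c) \<le> ip u u" unfolding ip_def by (rule sum_mono2) (use ab fin in auto)
  then show ?thesis using ab by (simp add: power2_eq_square)
qed

lemma ip_pos: "nn u \<Longrightarrow> dg u > 0 \<Longrightarrow> ip u u > 0"
proof -
  assume "nn u" "dg u > 0"
  then obtain c where "c \<in> I" "1 \<le> u c" by (rule peel)
  then show ?thesis using ip_ge1[of c u] by (smt (verit) one_le_power)
qed

lemma norm_sub: "1 \<le> u c \<Longrightarrow> c \<in> I \<Longrightarrow> ip (u - el c) (u - el c) = ip u u - 2 * u c + 1"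
  by (simp add: ip_add ip_el el_simps)

lemma diff_eqD: "u - v = w \<Longrightarrow> u = v + w" for u :: "'i \<Rightarrow> int"
  by (drule sym) simp

text \<open>In a lattice with orthonormal basis, a nonnegative vector of norm 1 or 2 is a sum of one or two distinct
  basis vectors.\<close>

lemma norm1: "nn u \<Longrightarrow> ip u u = 1 \<Longrightarrow> \<exists>h\<in>I. u = el h"
proof -
  assume u: "nn u" "ip u u = 1"
  have "dg u > 0"
  proof (rule ccontr)
    assume "\<not> dg u > 0"
    then have "u = 0" using nn_dg[OF u(1)] nn_dg0[OF u(1)] by simp
    then show False using u(2) by (simp add: ip_def)
  qed
  then obtain c where c: "c \<in> I" "1 \<le> u c" "nn (u - el c)" using peel[OF u(1)] by metis
  have "ip (u - el c) (u - el c) \<le> 0" using norm_sub[of u c, OF c(2,1)] u(2) c(2) by linarith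
  then have "dg (u - el c) = 0" using ip_pos[OF c(3)] nn_dg[OF c(3)] by linarith
  then have "u - el c = 0" by (rule nn_dg0[OF c(3)])
  then have "u = el c + 0" by (rule diff_eqD)
  then show ?thesis using c(1) by (intro bexI[of _ c]) simp_all
qed

lemma norm2: "nn u \<Longrightarrow> ip u u = 2 \<Longrightarrow> \<exists>a\<in>I. \<exists>b\<in>I. a \<noteq> b \<and> u = el a + el b"
proof -
  assume u: "nn u" "ip u u = 2"
  have "dg u > 0"
  proof (rule ccontr)
    assume "\<not> dg u > 0"
    then have "u = 0" using nn_dg[OF u(1)] nn_dg0[OF u(1)] by simp
    then show False using u(2) by (simp add: ip_def)
  qed
  then obtain c where c: "c \<in> I" "1 \<le> u c" "nn (u - el c)" using peel[OF u(1)] by metis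
  have "\<not> 2 \<le> u c"
  proof
    assume "2 \<le> u c"
    then have "2\<^sup>2 \<le> (u c)\<^sup>2" by (intro power_mono) auto
    then show False using ip_ge1[OF c(1), of u] u(2) by simp
  qed
  then have uc: "u c = 1" using c(2) by linarith
  have "ip (u - el c) (u - el c) = 1" using norm_sub[of u c, OF c(2,1)] u(2) uc by simp
  then obtain b where b: "b \<in> I" "u - el c = el b" using norm1[OF c(3)] by blast
  have "(u - el c) c = 0" using uc by (simp add: el_simps)
  then have "b \<noteq> c" using b(2) by (auto simp: el_simps)
  moreover have "u = el c + el b" by (rule diff_eqD[OF b(2)])
  ultimately show ?thesis using b(1) c(1) by (intro bexI[of _ c] bexI[of _ b] conjI) simp_all
qed

subsection \<open>Elements of degree one\<close>

lemma grp_inv: "g \<in> I \<Longrightarrow> d g = 1 \<Longrightarrow> el g \<star> el (st g) = el one"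
proof -
  assume g: "g \<in> I" "d g = 1"
  let ?u = "el g \<star> el (st g)"
  have n: "nn ?u" using g st_in by (intro nn_mul nn_el)
  have "N g (st g) one = 1" using g N_right[OF g(1) st_in[OF g(1)] one_in] st_st N_one_left by simp
  then have u1: "?u one = 1" using g st_in one_in by (simp add: mul_el)
  have "dg ?u = 1" using g by (simp add: dg_mul dg_el st_in d_st)
  then have "dg (?u - el one) = 0" by (simp add: dg_add dg_el one_in d_one)
  then have "?u - el one = 0" using nn_dg0[OF nn_diff[OF n]] u1 by simp
  then show ?thesis by simp
qed

lemma grp_inv': "g \<in> I \<Longrightarrow> d g = 1 \<Longrightarrow> el (st g) \<star> el g = el one"
  using grp_inv[of "st g"] by (simp add: st_in d_st st_st)

lemma grp_iso: "g \<in> I \<Longrightarrow> d g = 1 \<Longrightarrow> nn u \<Longrightarrow> ip (u \<star> el g) (v \<star> el g) = ip u v"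
  using mul_one[of v] mul_one[of u] by (simp add: ip_right mul_assoc grp_inv ip_sym[of u] ip_sym[of "u \<star> _"] nn_def)

lemma grp_right: "a \<in> I \<Longrightarrow> g \<in> I \<Longrightarrow> d g = 1 \<Longrightarrow> \<exists>h\<in>I. el a \<star> el g = el h \<and> d h = d a"
proof -
  assume a: "a \<in> I" and g: "g \<in> I" "d g = 1"
  have n: "nn (el a \<star> el g)" using a g by (intro nn_mul nn_el)
  have "ip (el a \<star> el g) (el a \<star> el g) = 1" using a g by (simp add: grp_iso nn_el ip_el el_simps)
  then obtain h where h: "h \<in> I" "el a \<star> el g = el h" using norm1[OF n] by blast
  have "dg (el h) = int (d a)" unfolding h(2)[symmetric] using a g by (simp add: dg_mul dg_el)
  then show ?thesis using h by (auto simp: dg_el)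
qed

lemma grp_left: "a \<in> I \<Longrightarrow> g \<in> I \<Longrightarrow> d g = 1 \<Longrightarrow> \<exists>h\<in>I. el g \<star> el a = el h \<and> d h = d a"
proof -
  assume a: "a \<in> I" and g: "g \<in> I" "d g = 1"
  have n: "nn (el g \<star> el a)" using a g by (intro nn_mul nn_el)
  have "ip (el g \<star> el a) (el g \<star> el a) = ip (el a) (el (st g) \<star> el g \<star> el a)"
    using g by (simp add: ip_left mul_assoc)
  also have "\<dots> = 1" using a g by (simp add: grp_inv' one_mul_el ip_el el_simps)
  finally obtain h where h: "h \<in> I" "el g \<star> el a = el h" using norm1[OF n] by blast
  have "dg (el h) = int (d a)" unfolding h(2)[symmetric] using a g by (simp add: dg_mul dg_el)
  then show ?thesis using h by (auto simp: dg_el)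
qed

definition closed :: "'i set \<Rightarrow> bool" where
  "closed \<Gamma> \<longleftrightarrow> \<Gamma> \<subseteq> I \<and> one \<in> \<Gamma> \<and> (\<forall>a\<in>\<Gamma>. st a \<in> \<Gamma>) \<and>
     (\<forall>a\<in>\<Gamma>. \<forall>b\<in>\<Gamma>. \<forall>c\<in>I. N a b c \<noteq> 0 \<longrightarrow> c \<in> \<Gamma>)"

definition stab :: "'i \<Rightarrow> 'i set" where
  "stab a = {g\<in>I. d g = 1 \<and> el g \<star> el a = el a}"

lemma stab_closed: "a \<in> I \<Longrightarrow> closed (stab a)"
  unfolding closed_def
proof (intro conjI ballI impI)
  assume a: "a \<in> I"
  show "stab a \<subseteq> I" by (auto simp: stab_def)
  show "one \<in> stab a" using a by (simp add: stab_def one_in d_one one_mul_el)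
  show "st g \<in> stab a" if "g \<in> stab a" for g
  proof -
    have g: "g \<in> I" "d g = 1" "el g \<star> el a = el a" using that by (auto simp: stab_def)
    have "el (st g) \<star> el a = el (st g) \<star> (el g \<star> el a)" by (simp add: g)
    also have "\<dots> = (el (st g) \<star> el g) \<star> el a" by (rule mul_assoc[symmetric])
    also have "\<dots> = el a" using g a by (simp add: grp_inv' one_mul_el)
    finally show ?thesis using g by (simp add: stab_def st_in d_st)
  qed
  fix g h c assume "g \<in> stab a" "h \<in> stab a" and c: "c \<in> I" "N g h c \<noteq> 0"
  then have gh: "g \<in> I" "d g = 1" "el g \<star> el a = el a" "h \<in> I" "d h = 1" "el h \<star> el a = el a"
    by (auto simp: stab_def)
  obtain k where k: "k \<in> I" "el g \<star> el h = el k" "d k = d g" using grp_right[OF gh(1,4,5)] gh(2,5) by auto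
  have "(el g \<star> el h) c \<noteq> 0" using c gh by (simp add: mul_el)
  then have "c = k" unfolding k(2) by (auto simp: el_def split: if_splits)
  moreover have "el k \<star> el a = el a" unfolding k(2)[symmetric] mul_assoc gh ..
  ultimately show "c \<in> stab a" using k gh by (simp add: stab_def)
qed

text \<open>By reciprocity the multiplicity of \<open>g\<close> in \<open>a a\<^sup>*\<close> is that of \<open>a\<close> in the irreducible \<open>g a\<close>.\<close>

lemma stab_mult: "a \<in> I \<Longrightarrow> g \<in> I \<Longrightarrow> d g = 1 \<Longrightarrow> (el a \<star> el (st a)) g = (if g \<in> stab a then 1 else 0)"
proof -
  assume a: "a \<in> I" and g: "g \<in> I" "d g = 1"
  have "(el a \<star> el (st a)) g = ip (el a) (el g \<star> el a)"
    using a g by (simp add: ip_el(2)[OF g(1), symmetric] ip_right st_in st_st)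
  moreover obtain h where h: "h \<in> I" "el g \<star> el a = el h" using grp_left[OF a g] by blast
  moreover have "el a h = (if h = a then 1 else 0)" by (simp add: el_def)
  ultimately show ?thesis using a g by (simp add: stab_def ip_el el_inj)
qed

lemma stab_right: "a \<in> I \<Longrightarrow> st a = a \<Longrightarrow> g \<in> I \<Longrightarrow> d g = 1 \<Longrightarrow> el a \<star> el g = el a \<Longrightarrow> g \<in> stab a"
proof -
  assume a: "a \<in> I" "st a = a" and g: "g \<in> I" "d g = 1" "el a \<star> el g = el a"
  have "(el a \<star> el (st a)) g = ip (el a) (el (st a) \<star> el g)"
    using a g by (simp add: ip_el(2)[OF g(1), symmetric] ip_left)
  also have "\<dots> = 1" using a g by (simp add: ip_el el_simps)
  finally show ?thesis using stab_mult[OF a(1) g(1,2)] by (simp split: if_splits)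
qed

end

text \<open>The situation of a Hopf algebra of dimension prime to 6, where closed sets correspond to Hopf subalgebras.\<close>

locale odd_fusion_ring = fusion_ring +
  assumes odd: "a \<in> I \<Longrightarrow> odd (d a)"
    and coprime6: "closed \<Gamma> \<Longrightarrow> odd (\<Sum>a\<in>\<Gamma>. d a * d a) \<and> \<not> 3 dvd (\<Sum>a\<in>\<Gamma>. d a * d a)"
begin

text \<open>An integer has the parity of its square, so for odd degrees both numbers have the parity of the sum of the coordinates.\<close>

lemma norm_parity: "even (ip u u) \<longleftrightarrow> even (dg u)"
proof -
  have "even (\<Sum>c\<in>A. u c * u c) \<longleftrightarrow> even (\<Sum>c\<in>A. u c * int (d c))" if "finite A" "A \<subseteq> I" for A
    using that by (induction A rule: finite_induct) (auto simp: odd)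
  then show ?thesis unfolding ip_def dg_def using fin by blast
qed

lemma has_grp1: "nn u \<Longrightarrow> dg u = 1 \<Longrightarrow> \<exists>g\<in>I. d g = 1 \<and> 1 \<le> u g"
proof -
  assume u: "nn u" "dg u = 1"
  then obtain c where "c \<in> I" "1 \<le> u c" "int (d c) \<le> dg u" using peel[OF u(1)] by (metis zero_less_one)
  then show ?thesis using u d_pos[of c] by (intro bexI[of _ c]) auto
qed

lemma has_grp2: "nn u \<Longrightarrow> dg u = 2 \<Longrightarrow> \<exists>g\<in>I. d g = 1 \<and> 1 \<le> u g"
proof -
  assume u: "nn u" "dg u = 2"
  then obtain c where c: "c \<in> I" "1 \<le> u c" "int (d c) \<le> dg u" using peel[OF u(1)] by (metis zero_less_numeral)
  have "d c = 1 \<or> d c = 2" using c u(2) d_pos[of c] by linarith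
  then have "d c = 1" using odd[OF c(1)] by auto
  then show ?thesis using c by blast
qed

lemma has_grp4: "nn u \<Longrightarrow> dg u = 4 \<Longrightarrow> \<exists>g\<in>I. d g = 1 \<and> 1 \<le> u g"
proof -
  assume u: "nn u" "dg u = 4"
  then obtain c where c: "c \<in> I" "1 \<le> u c" "nn (u - el c)" "dg (u - el c) = dg u - int (d c)" "int (d c) \<le> dg u"
    using peel[OF u(1)] by (metis zero_less_numeral)
  have "d c = 1 \<or> d c = 2 \<or> d c = 3 \<or> d c = 4" using c u(2) d_pos[of c] by linarith
  then consider "d c = 1" | "d c = 3" using odd[OF c(1)] by auto
  then show ?thesis
  proof cases
    case 2
    then obtain g where g: "g \<in> I" "d g = 1" "1 \<le> (u - el c) g" using has_grp1[OF c(3)] c(4) u(2) by auto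
    then have "1 \<le> u g" by (simp add: el_def split: if_splits)
    then show ?thesis using g by blast
  qed (use c in blast)
qed

lemma order2: "g \<in> I \<Longrightarrow> d g = 1 \<Longrightarrow> el g \<star> el g = el one \<Longrightarrow> g = one"
proof (rule ccontr)
  assume g: "g \<in> I" "d g = 1" "el g \<star> el g = el one" and ne: "g \<noteq> one"
  have "el (st g) = el (st g) \<star> (el g \<star> el g)" using g by (simp add: mul_el_one st_in)
  also have "\<dots> = (el (st g) \<star> el g) \<star> el g" by (rule mul_assoc[symmetric])
  also have "\<dots> = el g" using g by (simp add: grp_inv' one_mul_el)
  finally have sg: "st g = g" by (simp add: el_inj)
  have c0: "c = one" if "c \<in> I" "N g g c \<noteq> 0" for c
    using that g mul_el[OF g(1,1) that(1)] by (auto simp: el_def split: if_splits)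
  have "closed {one, g}"
    unfolding closed_def
    using g sg c0 by (auto simp: one_in st_one N_one_left N_one_right split: if_splits)
  then have "odd (\<Sum>a\<in>{one, g}. d a * d a)" using coprime6 by blast
  then show False using g ne d_one by simp
qed

lemma stab_card: "a \<in> I \<Longrightarrow> odd (card (stab a)) \<and> \<not> 3 dvd card (stab a)"
proof -
  assume "a \<in> I"
  moreover have "(\<Sum>g\<in>stab a. d g * d g) = card (stab a)" by (simp add: stab_def)
  ultimately show ?thesis using coprime6[OF stab_closed] by metis
qed

lemma finite_stab: "finite (stab a)" using fin by (simp add: stab_def)

lemma split_stab:
  assumes a: "a \<in> I"
  obtains w where "el a \<star> el (st a) = (\<Sum>g\<in>stab a. el g) + w" "nn w" "\<And>g. g \<in> I \<Longrightarrow> d g = 1 \<Longrightarrow> w g = 0"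
    "dg w = int (d a * d a) - int (card (stab a))"
proof -
  let ?v = "el a \<star> el (st a)"
  define w where "w = ?v - (\<Sum>g\<in>stab a. el g)"
  have n: "nn ?v" using a by (intro nn_mul nn_el st_in)
  have s: "(\<Sum>g\<in>stab a. el g) c = (if c \<in> stab a then 1 else 0)" for c
    unfolding sum_apply el_def using finite_stab[of a] by simp
  have ws: "w c = (if c \<in> stab a then 0 else ?v c)" for c
    using stab_mult[OF a, of c] unfolding w_def fun_diff_def s by (auto simp: stab_def)
  have "nn w" using n unfolding nn_def ws by auto
  moreover have "w g = 0" if "g \<in> I" "d g = 1" for g using stab_mult[OF a that] by (simp add: ws)
  moreover have "dg (\<Sum>g\<in>stab a. el g) = int (card (stab a))"
  proof -
    have "dg (\<Sum>g\<in>A. el g) = int (card A)" if "finite A" "A \<subseteq> stab a" for A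
      using that by (induction A rule: finite_induct) (auto simp: dg_zero dg_add dg_el stab_def)
    then show ?thesis using finite_stab by blast
  qed
  then have "dg w = int (d a * d a) - int (card (stab a))"
    unfolding w_def using a by (simp add: dg_add dg_mul dg_el st_in d_st)
  ultimately show thesis using that[of w] by (simp add: w_def)
qed

text \<open>The stabiliser of \<open>a\<close> has order at most 9 and prime to 6, hence 1, 5 or 7; the last two leave a remainder of
  degree 4 or 2 without constituents of degree one, which does not exist. The remainder of degree 8 has to be \<open>3 + 5\<close>, and
  both constituents are self-dual because their degrees differ.\<close>

lemma deg3_square:
  assumes a: "a \<in> I" "d a = 3"
  shows "\<exists>\<psi>\<in>I. \<exists>\<phi>\<in>I. d \<psi> = 3 \<and> d \<phi> = 5 \<and> st \<psi> = \<psi> \<and> st \<phi> = \<phi> \<and> el a \<star> el (st a) = el one + el \<psi> + el \<phi>"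
proof -
  let ?v = "el a \<star> el (st a)"
  obtain w where w: "?v = (\<Sum>g\<in>stab a. el g) + w" "nn w" "\<And>g. g \<in> I \<Longrightarrow> d g = 1 \<Longrightarrow> w g = 0"
    "dg w = 9 - int (card (stab a))" using split_stab[OF a(1)] a(2) by auto
  have ng: "dg u \<noteq> 1 \<and> dg u \<noteq> 2 \<and> dg u \<noteq> 4" if "nn u" "\<And>c. u c \<le> w c" for u
  proof -
    have "\<not> (\<exists>g\<in>I. d g = 1 \<and> 1 \<le> u g)"
    proof
      assume "\<exists>g\<in>I. d g = 1 \<and> 1 \<le> u g"
      then obtain g where "g \<in> I" "d g = 1" "1 \<le> u g" by blast
      then show False using w(3)[of g] that(2)[of g] by linarith
    qed
    then show ?thesis using has_grp1[OF that(1)] has_grp2[OF that(1)] has_grp4[OF that(1)] by blast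
  qed
  have le: "(u - el c) x \<le> w x" if "\<And>x. u x \<le> w x" for u c x using that[of x] by (auto simp: el_def)
  have sc: "odd (card (stab a))" "\<not> 3 dvd card (stab a)" using stab_card[OF a(1)] by auto
  have "card (stab a) \<le> 9" using nn_dg[OF w(2)] w(4) by linarith
  then have "card (stab a) \<in> {0,1,2,3,4,5,6,7,8,9}" by auto
  then have "card (stab a) = 1 \<or> card (stab a) = 5 \<or> card (stab a) = 7" using sc by auto
  then have s1: "card (stab a) = 1" using ng[OF w(2)] w(4) by auto
  then have "stab a = {one}" using stab_closed[OF a(1)] unfolding closed_def by (metis card_1_singletonE singletonD)
  then have v: "?v = el one + w" using w(1) by simp
  have dw: "dg w = 8" using w(4) s1 by simp
  obtain c where c: "c \<in> I" "1 \<le> w c" "nn (w - el c)" "dg (w - el c) = 8 - int (d c)" "int (d c) \<le> 8"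
    using peel[OF w(2)] dw by (metis zero_less_numeral)
  have "d c \<noteq> 1" using c w(3) by force
  moreover have "d c \<in> {0,1,2,3,4,5,6,7,8}" using c(5) by auto
  moreover have "dg (w - el c) \<noteq> 1 \<and> dg (w - el c) \<noteq> 2 \<and> dg (w - el c) \<noteq> 4"
    by (rule ng[OF c(3)]) (rule le, rule order_refl)
  ultimately have dc: "d c = 3 \<or> d c = 5" using odd[OF c(1)] c(4) by auto
  then have "dg (w - el c) > 0" using c(4) by auto
  then obtain e where e: "e \<in> I" "1 \<le> (w - el c) e" "nn (w - el c - el e)"
    "dg (w - el c - el e) = dg (w - el c) - int (d e)" "int (d e) \<le> dg (w - el c)"
    using peel[OF c(3)] by metis
  have we: "1 \<le> w e" by (rule order_trans[OF e(2)]) (rule le, rule order_refl)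
  have "d e \<noteq> 1" using we w(3)[OF e(1)] by auto
  moreover have "dg (w - el c - el e) \<noteq> 1 \<and> dg (w - el c - el e) \<noteq> 2 \<and> dg (w - el c - el e) \<noteq> 4"
    by (rule ng[OF e(3)]) (rule le, rule le, rule order_refl)
  moreover have "d e \<in> {0,1,2,3,4,5}" using e(5) c(4) dc by auto
  ultimately have de: "dg (w - el c - el e) = 0 \<and> (d c = 3 \<and> d e = 5 \<or> d c = 5 \<and> d e = 3)"
    using dc odd[OF e(1)] e(4,5) c(4) by auto
  then have "w - el c - el e = 0" using nn_dg0[OF e(3)] by blast
  then have "w = el c + (el e + 0)" by (intro diff_eqD)
  then have wce: "w = el c + el e" by simp
  have sym: "?v (st x) = ?v x" if "x \<in> I" for x
    using star_mul[OF a(1) st_in[OF a(1)] that] st_st[OF a(1)] by simp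
  have self: "st x = x" if x: "x = c \<or> x = e" for x
  proof -
    have xI: "x \<in> I" using x c e by blast
    have "?v x \<ge> 1" unfolding v wce using x by (auto simp: el_def)
    then have "?v (st x) \<ge> 1" using sym[OF xI] by simp
    then have "st x = one \<or> st x = c \<or> st x = e" unfolding v wce by (auto simp: el_def split: if_splits)
    moreover have "d (st x) = d x" by (rule d_st[OF xI])
    moreover have "y = x" if "y = one \<or> y = c \<or> y = e" "d y = d x" for y using that x de d_one by auto
    ultimately show ?thesis by blast
  qed
  show ?thesis
  proof (cases "d c = 3")
    case True
    have "?v = el one + el c + el e" by (simp only: v wce add.assoc)
    then show ?thesis using True de c(1) e(1) self by (intro bexI[of _ c] bexI[of _ e] conjI) simp_all
  next
    case False
    have "?v = el one + el e + el c" by (simp only: v wce add.assoc add.commute[of "el e"])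
    then show ?thesis using False de c(1) e(1) self by (intro bexI[of _ e] bexI[of _ c] conjI) simp_all
  qed
qed

text \<open>If \<open>\<chi>\<^sup>2 = 1 + \<psi> + \<phi>\<close> with \<open>\<psi> \<noteq> \<chi>\<close>, then \<open>\<chi>\<psi> = \<chi> + w\<close> with \<open>w\<close> of degree 6, hence of even norm;
  so \<open>\<langle>\<chi>\<^sup>2, \<psi>\<^sup>2\<rangle> = |\<chi>\<psi>|\<^sup>2 \<ge> 3\<close>, which forces \<open>\<psi>\<^sup>2 = \<chi>\<^sup>2\<close>.\<close>

lemma so3_generator:
  assumes a: "a \<in> I" "d a = 3"
  shows "\<exists>\<chi>\<in>I. \<exists>\<phi>\<in>I. d \<chi> = 3 \<and> d \<phi> = 5 \<and> st \<chi> = \<chi> \<and> st \<phi> = \<phi> \<and> el \<chi> \<star> el \<chi> = el one + el \<chi> + el \<phi>"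
proof -
  obtain \<chi> where \<chi>: "\<chi> \<in> I" "d \<chi> = 3" "st \<chi> = \<chi>" using deg3_square[OF a] by blast
  obtain \<psi> \<phi> where \<psi>: "\<psi> \<in> I" "d \<psi> = 3" "st \<psi> = \<psi>" and \<phi>: "\<phi> \<in> I" "d \<phi> = 5" "st \<phi> = \<phi>"
    and sq: "el \<chi> \<star> el \<chi> = el one + el \<psi> + el \<phi>"
    using deg3_square[OF \<chi>(1,2)] \<chi>(3) by auto
  show ?thesis
  proof (cases "\<psi> = \<chi>")
    case True
    then show ?thesis using \<chi> \<phi> sq by (intro bexI[of _ \<chi>] bexI[of _ \<phi>]) auto
  next
    case False
    obtain \<psi>' \<phi>' where \<psi>': "\<psi>' \<in> I" "d \<psi>' = 3" and \<phi>': "\<phi>' \<in> I" "d \<phi>' = 5" "st \<phi>' = \<phi>'"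
      and sq': "el \<psi> \<star> el \<psi> = el one + el \<psi>' + el \<phi>'"
      using deg3_square[OF \<psi>(1,2)] \<psi>(3) by auto
    let ?u = "el \<chi> \<star> el \<psi>"
    have nu: "nn ?u" using \<chi> \<psi> by (intro nn_mul nn_el)
    have u1: "?u \<chi> = 1"
    proof -
      have "?u \<chi> = ip (el \<psi>) (el \<chi> \<star> el \<chi>)" using \<chi> by (simp add: ip_el(2)[OF \<chi>(1), symmetric] ip_left)
      also have "\<dots> = 1" unfolding sq using \<psi> \<phi> d_one by (simp add: ip_add ip_el one_in) (auto simp: el_def)
      finally show ?thesis .
    qed
    have nw: "nn (?u - el \<chi>)" by (rule nn_diff[OF nu]) (simp add: u1)
    have dw: "dg (?u - el \<chi>) = 6" using \<chi> \<psi> by (simp add: dg_add dg_mul dg_el)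
    have "ip (?u - el \<chi>) (?u - el \<chi>) = ip ?u ?u - 1" using norm_sub[of ?u \<chi>] u1 \<chi> by simp
    moreover have "ip (?u - el \<chi>) (?u - el \<chi>) > 0" using ip_pos[OF nw] dw by simp
    moreover have "even (ip (?u - el \<chi>) (?u - el \<chi>))" using norm_parity dw by simp
    ultimately have n3: "ip ?u ?u \<ge> 3" by presburger
    have "ip ?u ?u = ip (el \<psi>) (el \<chi> \<star> (el \<chi> \<star> el \<psi>))" using \<chi> by (simp add: ip_left)
    also have "\<dots> = ip ((el \<chi> \<star> el \<chi>) \<star> el \<psi>) (el \<psi>)" by (simp add: mul_assoc ip_sym)
    also have "\<dots> = ip (el \<chi> \<star> el \<chi>) (el \<psi> \<star> el \<psi>)" using \<psi> by (simp add: ip_right)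
    also have "\<dots> = 1 + (if \<psi> = \<psi>' then 1 else 0) + (if \<phi> = \<phi>' then 1 else 0)"
      unfolding sq sq' using \<psi> \<phi> \<psi>' \<phi>' d_one by (simp add: ip_add ip_el one_in) (auto simp: el_def)
    finally have "\<psi>' = \<psi>" using n3 by (auto split: if_splits)
    then show ?thesis using \<psi> \<phi>' sq' by (intro bexI[of _ \<psi>] bexI[of _ \<phi>']) auto
  qed
qed

end

section \<open>The Clebsch-Gordan rule of \<open>SO(3)\<close>\<close>

text \<open>The elements \<open>1\<close>, \<open>\<chi>\<close>, \<open>\<phi>\<close> multiply like the representations of \<open>SO(3)\<close> of dimensions 1, 3 and 5.\<close>

locale so3_ring = odd_fusion_ring +
  fixes \<chi> \<phi>
  assumes \<chi>: "\<chi> \<in> I" "d \<chi> = 3" "st \<chi> = \<chi>" and \<phi>: "\<phi> \<in> I" "d \<phi> = 5" "st \<phi> = \<phi>"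
    and sq: "el \<chi> \<star> el \<chi> = el one + el \<chi> + el \<phi>"
begin

abbreviation X where "X v \<equiv> el \<chi> \<star> v"
abbreviation Y where "Y v \<equiv> el \<phi> \<star> v"

lemma el_at: "el a c = (if c = a then 1 else 0)" by (simp add: el_def)

lemma diff_at: "(u - el c) c = u c - 1" by (simp add: el_at)

lemma diff_el_le: "u c \<le> t \<Longrightarrow> (u - el a) c \<le> t" by (auto simp: el_at)

lemma nnX: "nn v \<Longrightarrow> nn (X v)" and nnY: "nn v \<Longrightarrow> nn (Y v)"
  using \<chi>(1) \<phi>(1) by (auto intro: nn_mul nn_el)

lemma dgX: "dg (X v) = 3 * dg v" and dgY: "dg (Y v) = 5 * dg v"
  by (simp_all add: dg_mul dg_el \<chi> \<phi>)

lemma X_ip: "ip (X u) v = ip u (X v)" and Y_ip: "ip (Y u) v = ip u (Y v)"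
  using ip_left[OF \<chi>(1)] ip_left[OF \<phi>(1)] \<chi>(3) \<phi>(3) by simp_all

lemma X_val: "c \<in> I \<Longrightarrow> (X v) c = ip v (X (el c))"
  using X_ip[of v "el c"] by (simp add: ip_el)

lemma X_sym: "a \<in> I \<Longrightarrow> c \<in> I \<Longrightarrow> (X (el a)) c = (X (el c)) a"
  by (simp add: X_val[of c "el a"] ip_el)

lemma Y_el: "a \<in> I \<Longrightarrow> Y (el a) = X (X (el a)) - X (el a) - el a"
proof -
  assume a: "a \<in> I"
  have "X (X (el a)) = (el one + el \<chi> + el \<phi>) \<star> el a" unfolding mul_assoc[symmetric] sq ..
  then show ?thesis using a by (simp add: mul_add one_mul_el)
qed

lemma XY: "X (el \<phi>) = Y (el \<chi>)"
proof -
  have "el \<phi> = X (el \<chi>) - el one - el \<chi>" unfolding sq by simp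
  then show ?thesis using Y_el[OF \<chi>(1)] \<chi>(1) by (simp add: mul_add mul_el_one one_mul_el)
qed

lemma dom2: "nn u \<Longrightarrow> a \<in> I \<Longrightarrow> b \<in> I \<Longrightarrow> a \<noteq> b \<Longrightarrow> u a * int (d a) + u b * int (d b) \<le> dg u"
proof -
  assume u: "nn u" and ab: "a \<in> I" "b \<in> I" "a \<noteq> b"
  have "(\<Sum>c\<in>{a, b}. u c * int (d c)) \<le> dg u" unfolding dg_def
    by (rule sum_mono2) (use ab fin u in \<open>auto simp: nn_def\<close>)
  then show ?thesis using ab by simp
qed

lemma dom3: "nn u \<Longrightarrow> a \<in> I \<Longrightarrow> b \<in> I \<Longrightarrow> c \<in> I \<Longrightarrow> a \<noteq> b \<Longrightarrow> a \<noteq> c \<Longrightarrow> b \<noteq> c \<Longrightarrow>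
  u a * int (d a) + u b * int (d b) + u c * int (d c) \<le> dg u"
proof -
  assume u: "nn u" and ab: "a \<in> I" "b \<in> I" "c \<in> I" "a \<noteq> b" "a \<noteq> c" "b \<noteq> c"
  have "(\<Sum>c\<in>{a, b, c}. u c * int (d c)) \<le> dg u" unfolding dg_def
    by (rule sum_mono2) (use ab fin u in \<open>auto simp: nn_def\<close>)
  then show ?thesis using ab by simp
qed

text \<open>If \<open>g\<close> of degree one occurs in \<open>s a\<close> with \<open>s\<close> self-dual, then \<open>a\<close> occurs in the irreducible \<open>s g\<close>.\<close>

lemma grp_mul: "s \<in> I \<Longrightarrow> st s = s \<Longrightarrow> a \<in> I \<Longrightarrow> g \<in> I \<Longrightarrow> d g = 1 \<Longrightarrow> 1 \<le> (el s \<star> el a) g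
  \<Longrightarrow> el s \<star> el g = el a \<and> d a = d s"
proof -
  assume s: "s \<in> I" "st s = s" and a: "a \<in> I" and g: "g \<in> I" "d g = 1" and 1: "1 \<le> (el s \<star> el a) g"
  obtain h where h: "h \<in> I" "el s \<star> el g = el h" "d h = d s" using grp_right[OF s(1) g] by blast
  have "(el s \<star> el a) g = ip (el a) (el s \<star> el g)"
    using s g by (simp add: ip_el(2)[OF g(1), symmetric] ip_left)
  then have "1 \<le> el h a" using 1 a h(2) by (simp add: ip_el)
  then have "a = h" by (simp add: el_at split: if_splits)
  then show ?thesis using h by simp
qed

lemma X_grp:
  assumes "a \<in> I" "g \<in> I" "d g = 1" "1 \<le> (X (el a)) g"
  shows "X (el g) = el a \<and> d a = 3"
  using grp_mul[OF \<chi>(1,3) assms] \<chi>(2) by simp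

lemma Y_grp:
  assumes "a \<in> I" "g \<in> I" "d g = 1" "1 \<le> (Y (el a)) g"
  shows "Y (el g) = el a \<and> d a = 5"
  using grp_mul[OF \<phi>(1,3) assms] \<phi>(2) by simp

text \<open>Degrees being odd, a vector of degree 1, 2 or 4 has a constituent of degree one.\<close>

lemma X_small:
  assumes "a \<in> I" "nn u" "\<And>c. u c \<le> (X (el a)) c" "dg u = 1 \<or> dg u = 2 \<or> dg u = 4"
  obtains g where "g \<in> I" "d g = 1" "X (el g) = el a" "d a = 3"
proof -
  obtain g where g: "g \<in> I" "d g = 1" "1 \<le> u g"
    using has_grp1[OF assms(2)] has_grp2[OF assms(2)] has_grp4[OF assms(2)] assms(4) by blast
  have "1 \<le> (X (el a)) g" using g(3) assms(3)[of g] by linarith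
  then show thesis using X_grp[OF assms(1) g(1,2)] that g by blast
qed

text \<open>The translate of \<open>\<chi>\<^sup>2 = 1 + \<chi> + \<phi>\<close> by an element \<open>g\<close> of degree one.\<close>

lemma X_translate:
  assumes "g \<in> I" "d g = 1" "a \<in> I" "X (el g) = el a"
  obtains h where "h \<in> I" "d h = 5" "Y (el g) = el h" "X (el a) = el g + el a + el h"
proof -
  obtain h where h: "h \<in> I" "Y (el g) = el h" "d h = d \<phi>" using grp_right[OF \<phi>(1) assms(1,2)] by blast
  have "el h = X (el a) - el a - el g" using Y_el[OF assms(1)] h(2) assms(4) by simp
  then have "X (el a) = el g + el a + el h" by simp
  then show thesis using that[of h] h \<phi>(2) by simp
qed

lemma X_stab: "g \<in> I \<Longrightarrow> d g = 1 \<Longrightarrow> X (el g) = el \<chi> \<Longrightarrow> g = one"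
proof -
  assume g: "g \<in> I" "d g = 1" "X (el g) = el \<chi>"
  have "g \<in> stab \<chi>" by (rule stab_right[OF \<chi>(1,3) g])
  then have "(X (el \<chi>)) g = 1" using stab_mult[OF \<chi>(1) g(1,2)] \<chi>(3) by simp
  then show ?thesis unfolding sq using g(2) \<chi>(2) \<phi>(2) by (auto simp: el_at split: if_splits)
qed

text \<open>Odd order of the groups involved: \<open>a g\<^sup>2 = a\<close> with trivial stabiliser means \<open>g\<^sup>2 = 1\<close>.\<close>

lemma grp_square: "g \<in> I \<Longrightarrow> d g = 1 \<Longrightarrow> a \<in> I \<Longrightarrow> (el a \<star> el g) \<star> el g = el a
  \<Longrightarrow> (\<And>h. h \<in> I \<Longrightarrow> d h = 1 \<Longrightarrow> el a \<star> el h = el a \<Longrightarrow> h = one) \<Longrightarrow> g = one"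
proof -
  assume g: "g \<in> I" "d g = 1" and a: "a \<in> I" and e: "(el a \<star> el g) \<star> el g = el a"
    and s: "\<And>h. h \<in> I \<Longrightarrow> d h = 1 \<Longrightarrow> el a \<star> el h = el a \<Longrightarrow> h = one"
  obtain h where h: "h \<in> I" "el g \<star> el g = el h" "d h = d g" using grp_right[OF g(1) g] by blast
  have "el a \<star> el h = el a" using e unfolding mul_assoc h(2) .
  then have "h = one" using s[OF h(1)] h(3) g(2) by simp
  then show ?thesis using order2[OF g] h(2) by simp
qed

lemma two_el: "el a + el b = el c + el f \<Longrightarrow> d a \<noteq> d f \<Longrightarrow> b = f \<and> a = c"
proof -
  assume e: "el a + el b = el c + el f" and ne: "d a \<noteq> d f"
  have "(el a + el b) f = (el c + el f) f" using e by simp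
  then have b: "b = f" using ne by (auto simp: el_at split: if_splits)
  then have "el a = el c" using e by simp
  then show ?thesis using b by (simp add: el_inj)
qed

text \<open>The degree is then a sum of odd numbers that are at least 3.\<close>

lemma no_grp_small:
  assumes "nn u" "\<And>g. g \<in> I \<Longrightarrow> d g = 1 \<Longrightarrow> \<not> 1 \<le> u g"
  shows "dg u \<noteq> 1" "dg u \<noteq> 2" "dg u \<noteq> 4"
    and "dg u = 3 \<Longrightarrow> \<exists>a\<in>I. d a = 3 \<and> u = el a"
    and "dg u = 5 \<Longrightarrow> \<exists>a\<in>I. d a = 5 \<and> u = el a"
    and "dg u = 6 \<Longrightarrow> \<exists>a\<in>I. \<exists>b\<in>I. d a = 3 \<and> d b = 3 \<and> u = el a + el b"
proof -
  have small: "dg v \<noteq> 1 \<and> dg v \<noteq> 2 \<and> dg v \<noteq> 4" if "nn v" "\<And>c. v c \<le> u c" for v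
  proof -
    have "\<not> (\<exists>g\<in>I. d g = 1 \<and> 1 \<le> v g)"
    proof
      assume "\<exists>g\<in>I. d g = 1 \<and> 1 \<le> v g"
      then obtain g where "g \<in> I" "d g = 1" "1 \<le> v g" by blast
      then show False using assms(2)[of g] that(2)[of g] by linarith
    qed
    then show ?thesis using has_grp1[OF that(1)] has_grp2[OF that(1)] has_grp4[OF that(1)] by blast
  qed
  show "dg u \<noteq> 1" "dg u \<noteq> 2" "dg u \<noteq> 4" using small[OF assms(1)] by simp_all
  have step: thesis
    if v: "nn v" "\<And>c. v c \<le> u c" "dg v > 0" and t: "\<And>c. c \<in> I \<Longrightarrow> 3 \<le> d c \<Longrightarrow> odd (d c) \<Longrightarrow> nn (v - el c)
      \<Longrightarrow> (\<And>x. (v - el c) x \<le> u x) \<Longrightarrow> dg (v - el c) = dg v - int (d c) \<Longrightarrow> 0 \<le> dg (v - el c) \<Longrightarrow> thesis"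
    for v thesis
  proof -
    obtain c where c: "c \<in> I" "1 \<le> v c" "nn (v - el c)" "dg (v - el c) = dg v - int (d c)"
      by (rule peel[OF v(1,3)])
    have "\<not> d c = 1" using assms(2)[OF c(1)] c(2) v(2)[of c] by linarith
    then have 3: "3 \<le> d c" using odd[OF c(1)] d_pos[OF c(1)] by presburger
    have le: "(v - el c) x \<le> u x" for x using v(2)[of x] by (auto simp: el_at)
    show thesis by (rule t[OF c(1) 3 odd[OF c(1)] c(3) le c(4) nn_dg[OF c(3)]])
  qed
  have last: "v = el c" if "nn (v - el c)" "dg (v - el c) = 0" for v c
    using diff_eqD[OF nn_dg0[OF that]] by simp
  show "\<exists>a\<in>I. d a = 3 \<and> u = el a" if 3: "dg u = 3"
  proof (rule step[OF assms(1) order_refl])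
    fix c assume c: "c \<in> I" "3 \<le> d c" "nn (u - el c)" "dg (u - el c) = dg u - int (d c)" "0 \<le> dg (u - el c)"
    then have dc: "d c = 3" using 3 by linarith
    show ?thesis using last[OF c(3)] c(1,4) 3 dc by (intro bexI[of _ c] conjI) simp_all
  qed (simp add: 3)
  show "\<exists>a\<in>I. d a = 5 \<and> u = el a" if 5: "dg u = 5"
  proof (rule step[OF assms(1) order_refl])
    fix c assume c: "c \<in> I" "3 \<le> d c" "odd (d c)" "nn (u - el c)" "\<And>x. (u - el c) x \<le> u x"
      "dg (u - el c) = dg u - int (d c)" "0 \<le> dg (u - el c)"
    have "dg (u - el c) \<noteq> 2" using small[OF c(4,5)] by blast
    then have "d c \<noteq> 3" using c(6) 5 by linarith
    moreover have "d c \<noteq> 4" using c(3) by auto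
    ultimately have dc: "d c = 5" using c(2,6,7) 5 by linarith
    show ?thesis using last[OF c(4)] c(1,6) 5 dc by (intro bexI[of _ c] conjI) simp_all
  qed (simp add: 5)
  show "\<exists>a\<in>I. \<exists>b\<in>I. d a = 3 \<and> d b = 3 \<and> u = el a + el b" if 6: "dg u = 6"
  proof (rule step[OF assms(1) order_refl])
    fix c assume c: "c \<in> I" "3 \<le> d c" "odd (d c)" "nn (u - el c)" "\<And>x. (u - el c) x \<le> u x"
      "dg (u - el c) = dg u - int (d c)" "0 \<le> dg (u - el c)"
    have "dg (u - el c) \<noteq> 1" using small[OF c(4,5)] by blast
    then have "d c \<noteq> 5" using c(6) 6 by linarith
    moreover have "d c \<noteq> 4" "d c \<noteq> 6" using c(3) by auto
    ultimately have dc: "d c = 3" using c(2,6,7) 6 by linarith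
    then have 3: "dg (u - el c) = 3" using c(6) 6 by simp
    show ?thesis
    proof (rule step[of "u - el c", OF c(4,5)])
      fix b assume b: "b \<in> I" "3 \<le> d b" "nn (u - el c - el b)"
        "dg (u - el c - el b) = dg (u - el c) - int (d b)" "0 \<le> dg (u - el c - el b)"
      then have db: "d b = 3" using 3 by linarith
      then have "dg (u - el c - el b) = 0" using b(4) 3 by linarith
      then have "u - el c = el b" by (rule last[OF b(3)])
      then have u: "u = el c + el b" by (rule diff_eqD)
      show ?thesis by (rule bexI[OF _ c(1)], rule bexI[OF _ b(1)]) (rule conjI[OF dc conjI[OF db u]])
    qed (simp add: 3)
  qed (simp add: 6)
qed

end

text \<open>The \<open>SO(3)\<close> rule holds for \<open>q 0, \<dots>, q (k - 1)\<close>. The aim is to continue it by one step.\<close>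

locale so3_chain = so3_ring +
  fixes k :: nat and q :: "nat \<Rightarrow> 'a"
  assumes k2: "2 \<le> k" and q0: "q 0 = one" and q1: "q (Suc 0) = \<chi>" and q2: "q 2 = \<phi>"
    and qI: "i \<le> k \<Longrightarrow> q i \<in> I" and qd: "i \<le> k \<Longrightarrow> d (q i) = 2 * i + 1"
    and qX: "1 \<le> i \<Longrightarrow> i < k \<Longrightarrow> X (el (q i)) = el (q (i - 1)) + el (q i) + el (q (Suc i))"
begin

lemma q_eq: "i \<le> k \<Longrightarrow> j \<le> k \<Longrightarrow> q i = q j \<longleftrightarrow> i = j"
proof
  assume ij: "i \<le> k" "j \<le> k" and "q i = q j"
  then have "d (q i) = d (q j)" by (simp only:)
  then show "i = j" unfolding qd[OF ij(1)] qd[OF ij(2)] by linarith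
qed simp

abbreviation x where "x \<equiv> el (q k)"

text \<open>The part of \<open>\<chi> q k\<close> beyond \<open>q (k - 1)\<close>; the rule predicts \<open>R = q k + q (k + 1)\<close>.\<close>

definition R where "R = X x - el (q (k - 1))"

lemma Xx: "X x = el (q (k - 1)) + R" by (simp add: R_def)

lemma X_low: "i < k \<Longrightarrow> (X x) (q i) = (if i = k - 1 then 1 else 0)"
proof -
  assume i: "i < k"
  have "(X x) (q i) = (X (el (q i))) (q k)" using i by (intro X_sym qI) auto
  also have "\<dots> = (if i = k - 1 then 1 else 0)"
  proof (cases "i = 0")
    case True
    then show ?thesis using k2 q_eq[of k 1] by (simp add: q0 mul_el_one \<chi> el_at q1)
  next
    case False
    then have "X (el (q i)) = el (q (i - 1)) + el (q i) + el (q (Suc i))" using i by (intro qX) auto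
    then show ?thesis using i False q_eq[of k "i - 1"] q_eq[of k i] q_eq[of k "Suc i"] by (auto simp: el_at)
  qed
  finally show ?thesis .
qed

lemma R_low: "i < k \<Longrightarrow> R (q i) = 0"
  using X_low[of i] q_eq[of i "k - 1"] by (auto simp: R_def el_at)

lemma R_le: "R c \<le> (X x) c" by (simp add: R_def el_at)

lemma nnR: "nn R"
  unfolding R_def using X_low[of "k - 1"] k2 by (intro nn_diff nnX nn_el qI) auto

lemma dgR: "dg R = 4 * int k + 4"
  using k2 by (simp add: R_def dg_add dgX dg_el qI qd of_nat_diff)

lemma R_pos:
  assumes "1 \<le> R c"
  shows "c \<in> I" "i < k \<Longrightarrow> c \<noteq> q i" "(X (el c)) (q k) = R c" "R c * int (2 * k + 1) \<le> 3 * int (d c)" "3 \<le> d c"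
    "nn (X (el c) - x)"
proof -
  show cI: "c \<in> I" by (rule nn_in[OF nnR assms])
  show ne: "c \<noteq> q i" if "i < k" for i using R_low[OF that] assms by auto
  show e: "(X (el c)) (q k) = R c"
    using X_sym[OF cI qI[OF order_refl]] ne[of "k - 1"] k2 by (auto simp: R_def el_at)
  have dR: "R c * int (2 * k + 1) \<le> 3 * int (d c)"
    using dom[OF nnX[OF nn_el[OF cI]] qI[OF order_refl]] by (simp add: e dgX dg_el cI qd)
  then show "R c * int (2 * k + 1) \<le> 3 * int (d c)" .
  have "1 * int (2 * k + 1) \<le> R c * int (2 * k + 1)" using assms by (intro mult_right_mono) auto
  then have "int (2 * k + 1) \<le> 3 * int (d c)" using order_trans[OF _ dR] by simp
  then have "5 \<le> 3 * d c" using k2 by linarith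
  then show "3 \<le> d c" using odd[OF cI] by presburger
  show "nn (X (el c) - x)" by (rule nn_diff[OF nnX[OF nn_el[OF cI]]]) (use e assms in simp)
qed

lemma Xq: "X (el (q (k - 1))) = el (q (k - 2)) + el (q (k - 1)) + x"
proof -
  have "X (el (q (k - 1))) = el (q (k - 1 - 1)) + el (q (k - 1)) + el (q (Suc (k - 1)))" using k2 by (intro qX) auto
  moreover have "k - 1 - 1 = k - 2" "Suc (k - 1) = k" using k2 by auto
  ultimately show ?thesis by (simp only:)
qed

lemma Yx: "Y x = el (q (k - 2)) + (X R - R)"
proof -
  have "X (X x) = el (q (k - 2)) + el (q (k - 1)) + x + X R" unfolding Xx by (simp only: mul_add Xq)
  then show ?thesis unfolding Y_el[OF qI[OF order_refl]] by (simp add: Xx)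
qed

text \<open>Otherwise \<open>R - 2 q k\<close> has degree 2 and contains an element of degree one, so that \<open>q k\<close> would have degree 3.\<close>

lemma loop_le1: "R (q k) \<le> 1"
proof (rule ccontr)
  assume 2: "\<not> R (q k) \<le> 1"
  have n1: "nn (R - x)" by (rule nn_diff[OF nnR]) (use 2 in simp)
  have n2: "nn (R - x - x)" by (rule nn_diff[OF n1]) (use 2 in \<open>simp add: el_at\<close>)
  have "dg (R - x - x) = dg R - dg x - dg x" by (simp only: dg_add)
  then have "dg (R - x - x) = 2" by (simp add: dgR dg_el qI qd)
  moreover have "(R - x - x) c \<le> (X x) c" for c by (intro diff_el_le R_le)
  ultimately obtain g where "d (q k) = 3" using X_small[OF qI[OF order_refl] n2] by blast
  then show False using qd[of k] k2 by simp
qed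

text \<open>Multiplication by \<open>q 3 = \<chi> \<phi> - \<phi> - \<chi>\<close>.\<close>

lemma P3: "3 \<le> k \<Longrightarrow> el (q 3) \<star> v = X (Y v) - Y v - X v"
proof -
  assume "3 \<le> k"
  then have "X (el \<phi>) = el \<chi> + el \<phi> + el (q 3)" using qX[of 2] by (simp add: q1 q2)
  then have "el (q 3) = X (el \<phi>) - el \<phi> - el \<chi>" by simp
  then show ?thesis by (simp add: mul_add mul_assoc)
qed

subsection \<open>The case of multiplicity one\<close>

text \<open>Otherwise \<open>\<chi> c - q k\<close> has degree 2, so \<open>c = \<chi> g\<close> has degree 3 and \<open>\<chi> c = g + c + \<phi> g\<close>, where nothing of degree \<open>2k + 1 = 7\<close>
  occurs.\<close>

lemma mult_one_degree: "R (q k) = 1 \<Longrightarrow> 1 \<le> R c \<Longrightarrow> c \<noteq> q k \<Longrightarrow> 3 * d c \<noteq> 2 * k + 3"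
proof
  assume c: "1 \<le> R c" "c \<noteq> q k" and e: "3 * d c = 2 * k + 3"
  note Rc = R_pos[OF c(1)]
  have "dg (X (el c) - x) = 2" using e by (simp add: dg_add dgX dg_el Rc(1) qI qd)
  moreover have "(X (el c) - x) a \<le> (X (el c)) a" for a by (intro diff_el_le order_refl)
  ultimately obtain g where g: "g \<in> I" "d g = 1" "X (el g) = el c" "d c = 3"
    using X_small[OF Rc(1,6)] by blast
  have k3: "k = 3" using e g(4) by simp
  obtain h where h: "h \<in> I" "d h = 5" "X (el c) = el g + el c + el h" by (rule X_translate[OF g(1,2) Rc(1) g(3)])
  have "d (q k) = 7" using qd[of k] k3 by simp
  then have "g \<noteq> q k" "h \<noteq> q k" using g(2) h(2) by auto
  then have "(X (el c)) (q k) = 0" unfolding h(3) using c(2) by (simp add: el_at)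
  then show False using Rc(3) c(1) by simp
qed

text \<open>Degrees force \<open>\<chi> \<beta> = \<chi> \<beta>' = q k\<close>. The product \<open>(q 3) \<beta> = q (k - 2) + q k + \<chi> \<beta>'' - \<beta>' - \<beta>''\<close> is nonnegative, so \<open>\<chi> \<beta>''\<close> contains
  \<open>\<beta>'\<close>, \<open>\<beta>''\<close> and \<open>q k\<close>, which is too much for its degree.\<close>

lemma mult_one_three:
  assumes 1: "R (q k) = 1" and e: "R = x + (el \<beta> + el \<beta>' + el \<beta>'')" and I: "\<beta> \<in> I" "\<beta>' \<in> I" "\<beta>'' \<in> I"
    and dd: "3 * d \<beta> = 2 * k + 1" "3 * d \<beta>' = 2 * k + 1"
  shows False
proof -
  have "dg R = dg x + (dg (el \<beta>) + dg (el \<beta>') + dg (el \<beta>''))" unfolding e by (simp only: dg_add)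
  then have d'': "3 * d \<beta>'' = 2 * k + 7" using dd by (simp add: dgR dg_el I qI qd)
  have nx: "\<beta> \<noteq> q k" "\<beta>' \<noteq> q k" "\<beta>'' \<noteq> q k" using dd d'' k2 qd[of k] by auto
  have ne: "\<beta> \<noteq> \<beta>''" "\<beta>' \<noteq> \<beta>''" using dd d'' by auto
  have R1: "1 \<le> R \<beta>" "1 \<le> R \<beta>'" "1 \<le> R \<beta>''" unfolding e by (simp_all add: el_at)
  have ne': "\<beta> \<noteq> \<beta>'"
  proof
    assume "\<beta> = \<beta>'"
    then have "2 \<le> R \<beta>" unfolding e by (simp add: el_at)
    then have "2 * int (2 * k + 1) \<le> R \<beta> * int (2 * k + 1)" by (intro mult_right_mono) auto
    then have "2 * int (2 * k + 1) \<le> 3 * int (d \<beta>)" using R_pos(4)[OF R1(1)] by (rule order_trans)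
    then have "int (2 * (2 * k + 1)) \<le> int (3 * d \<beta>)" by simp
    then have "2 * (2 * k + 1) \<le> 3 * d \<beta>" by (simp only: of_nat_le_iff)
    then show False using dd by simp
  qed
  have k4: "4 \<le> k" using R_pos(5)[OF R1(1)] dd by linarith
  have X1: "X (el b) = x" if b: "b \<in> I" "1 \<le> R b" "3 * d b = 2 * k + 1" for b
  proof -
    have "dg (X (el b) - x) = 0" using b(3) by (simp add: dg_add dgX dg_el b(1) qI qd)
    then have "X (el b) - x = 0" by (rule nn_dg0[OF R_pos(6)[OF b(2)]])
    then show ?thesis by simp
  qed
  have X\<beta>: "X (el \<beta>) = x" "X (el \<beta>') = x" using X1 I R1 dd by simp_all
  have Y\<beta>: "Y (el \<beta>) = el (q (k - 1)) + el \<beta>' + el \<beta>''"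
    unfolding Y_el[OF I(1)] X\<beta>(1) Xx e by (simp add: algebra_simps)
  have V: "el (q 3) \<star> el \<beta> = el (q (k - 2)) + x + X (el \<beta>'') - el \<beta>' - el \<beta>''"
    using k4 by (simp only: P3 Y\<beta> mul_add Xq X\<beta>) (simp add: algebra_simps)
  have nnV: "nn (el (q 3) \<star> el \<beta>)" using k4 by (intro nn_mul nn_el qI I) auto
  have low: "b \<noteq> q (k - 2)" if "1 \<le> R b" for b using R_pos(2)[OF that, of "k - 2"] k2 by simp
  have 1: "1 \<le> (X (el \<beta>'')) \<beta>'"
    using nn_ge[OF nnV, of \<beta>'] low[OF R1(2)] nx ne ne' unfolding V by (simp add: el_at)
  have 2: "1 \<le> (X (el \<beta>'')) \<beta>''"
    using nn_ge[OF nnV, of \<beta>''] low[OF R1(3)] nx ne ne' unfolding V by (simp add: el_at)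
  have 3: "1 \<le> (X (el \<beta>'')) (q k)" using R_pos(3)[OF R1(3)] R1(3) by simp
  have "(X (el \<beta>'')) \<beta>' * int (d \<beta>') + (X (el \<beta>'')) \<beta>'' * int (d \<beta>'') + (X (el \<beta>'')) (q k) * int (d (q k)) \<le> dg (X (el \<beta>''))"
    by (rule dom3) (use nx ne I in \<open>auto intro: nnX nn_el qI\<close>)
  moreover have "1 * int (d \<beta>') \<le> (X (el \<beta>'')) \<beta>' * int (d \<beta>')" "1 * int (d \<beta>'') \<le> (X (el \<beta>'')) \<beta>'' * int (d \<beta>'')"
    "1 * int (d (q k)) \<le> (X (el \<beta>'')) (q k) * int (d (q k))"
    using 1 2 3 by (intro mult_right_mono; simp)+
  ultimately have "int (d \<beta>') + int (d \<beta>'') + int (d (q k)) \<le> 3 * int (d \<beta>'')" by (simp add: dgX dg_el I)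
  then show False using dd d'' k4 qd[of k] by simp
qed

text \<open>The constituents of \<open>R - q k\<close> have degree at least \<open>(2k + 1) / 3\<close> and total degree \<open>2k + 3\<close>. By parity there are one or
  three of them, and in the second case two have the minimal degree.\<close>

lemma mult_one:
  assumes 1: "R (q k) = 1"
  shows "\<exists>r\<in>I. d r = 2 * k + 3 \<and> R = x + el r"
proof -
  define u where "u = R - x"
  have Ru: "R = x + u" by (simp add: u_def)
  have nu: "nn u" unfolding u_def by (rule nn_diff[OF nnR]) (simp add: 1)
  have dgu: "dg u = 2 * int k + 3" by (simp add: u_def dg_add dgR dg_el qI qd)
  have uq: "u (q k) = 0" by (simp add: u_def 1 el_at)
  have comp: "3 * d c = 2 * k + 1 \<or> 3 * d c \<ge> 2 * k + 5" "odd (d c)" "3 \<le> d c" if c: "1 \<le> u c" for c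
  proof -
    have ne: "c \<noteq> q k" using c uq by auto
    have Rc: "1 \<le> R c" "R c = u c" using c ne by (simp_all add: Ru el_at)
    have "1 * int (2 * k + 1) \<le> R c * int (2 * k + 1)" using Rc by (intro mult_right_mono) auto
    then have "1 * int (2 * k + 1) \<le> 3 * int (d c)" using R_pos(4)[OF Rc(1)] by (rule order_trans)
    then have "int (2 * k + 1) \<le> int (3 * d c)" by simp
    then have le: "2 * k + 1 \<le> 3 * d c" by (simp only: of_nat_le_iff)
    show o: "odd (d c)" by (rule odd[OF R_pos(1)[OF Rc(1)]])
    show "3 \<le> d c" by (rule R_pos(5)[OF Rc(1)])
    show "3 * d c = 2 * k + 1 \<or> 3 * d c \<ge> 2 * k + 5"
      using le o mult_one_degree[OF 1 Rc(1) ne] by presburger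
  qed
  have "dg u > 0" using dgu by simp
  then obtain b1 where b1: "b1 \<in> I" "1 \<le> u b1" "nn (u - el b1)" "dg (u - el b1) = dg u - int (d b1)" by (rule peel[OF nu])
  show ?thesis
  proof (cases "dg (u - el b1) = 0")
    case True
    then have "u = el b1 + 0" by (intro diff_eqD nn_dg0[OF b1(3)])
    then have "R = x + el b1" using Ru by simp
    moreover have "d b1 = 2 * k + 3" using True b1(4) dgu by linarith
    ultimately show ?thesis using b1(1) by (intro bexI[of _ b1] conjI)
  next
    case False
    then have "dg (u - el b1) > 0" using nn_dg[OF b1(3)] by simp
    then obtain b2 where b2: "b2 \<in> I" "1 \<le> (u - el b1) b2" "nn (u - el b1 - el b2)"
      "dg (u - el b1 - el b2) = dg (u - el b1) - int (d b2)" by (rule peel[OF b1(3)])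
    have u2: "1 \<le> u b2" by (rule order_trans[OF b2(2)]) (intro diff_el_le order_refl)
    have "odd (dg (u - el b1 - el b2))" using b2(4) b1(4) dgu comp(2)[OF b1(2)] comp(2)[OF u2] by simp
    then have "dg (u - el b1 - el b2) \<noteq> 0" by (metis even_zero)
    then have "dg (u - el b1 - el b2) > 0" using nn_dg[OF b2(3)] by simp
    then obtain b3 where b3: "b3 \<in> I" "1 \<le> (u - el b1 - el b2) b3" "nn (u - el b1 - el b2 - el b3)"
      "dg (u - el b1 - el b2 - el b3) = dg (u - el b1 - el b2) - int (d b3)" by (rule peel[OF b2(3)])
    have u3: "1 \<le> u b3" by (rule order_trans[OF b3(2)]) (intro diff_el_le order_refl)
    have 0: "dg (u - el b1 - el b2 - el b3) = 0"
    proof (rule ccontr)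
      assume "dg (u - el b1 - el b2 - el b3) \<noteq> 0"
      then have "dg (u - el b1 - el b2 - el b3) > 0" using nn_dg[OF b3(3)] by simp
      then obtain b4 where b4: "b4 \<in> I" "1 \<le> (u - el b1 - el b2 - el b3) b4"
        "int (d b4) \<le> dg (u - el b1 - el b2 - el b3)" by (rule peel[OF b3(3)])
      have u4: "1 \<le> u b4" by (rule order_trans[OF b4(2)]) (intro diff_el_le order_refl)
      have "d b1 + d b2 + d b3 + d b4 \<le> 2 * k + 3" using b4(3) b3(4) b2(4) b1(4) dgu by linarith
      then show False using comp(1,3)[OF b1(2)] comp(1,3)[OF u2] comp(1,3)[OF u3] comp(1,3)[OF u4] by linarith
    qed
    have "u - el b1 - el b2 - el b3 = 0" by (rule nn_dg0[OF b3(3) 0])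
    then have "u - el b1 - el b2 = el b3" by simp
    then have u: "u = el b1 + (el b2 + el b3)" by (intro diff_eqD)
    have s: "d b1 + d b2 + d b3 = 2 * k + 3" using 0 b3(4) b2(4) b1(4) dgu by linarith
    consider "3 * d b1 = 2 * k + 1" "3 * d b2 = 2 * k + 1" | "3 * d b1 = 2 * k + 1" "3 * d b3 = 2 * k + 1"
      | "3 * d b2 = 2 * k + 1" "3 * d b3 = 2 * k + 1"
      using comp(1)[OF b1(2)] comp(1)[OF u2] comp(1)[OF u3] s by linarith
    then have False
    proof cases
      case a: 1
      have "R = x + (el b1 + el b2 + el b3)" unfolding Ru u by (simp only: add_ac)
      then show ?thesis using mult_one_three[OF 1 _ b1(1) b2(1) b3(1) a] by blast
    next
      case a: 2
      have "R = x + (el b1 + el b3 + el b2)" unfolding Ru u by (simp only: add_ac)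
      then show ?thesis using mult_one_three[OF 1 _ b1(1) b3(1) b2(1) a] by blast
    next
      case a: 3
      have "R = x + (el b2 + el b3 + el b1)" unfolding Ru u by (simp only: add_ac)
      then show ?thesis using mult_one_three[OF 1 _ b2(1) b3(1) b1(1) a] by blast
    qed
    then show ?thesis ..
  qed
qed

subsection \<open>The case of multiplicity zero\<close>

text \<open>The vector \<open>\<chi> R - R = \<phi> q k - q (k - 2)\<close> is nonnegative, of degree \<open>8k + 8\<close>, and contains \<open>q k\<close> with multiplicity \<open>|R|\<^sup>2\<close>.\<close>

lemma norm_R:
  assumes 0: "R (q k) = 0"
  shows "(X R) (q k) = ip R R" "nn (X R - R)" "dg (X R - R) = 8 * int k + 8" "ip R R = 2 \<or> ip R R = 4"
proof -
  have "(X R) (q k) = ip R (el (q (k - 1)) + R)" using X_val[OF qI[OF order_refl], of R] unfolding Xx .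
  also have "\<dots> = ip R R" using R_low[of "k - 1"] k2 by (simp add: ip_add ip_el qI)
  finally show XR: "(X R) (q k) = ip R R" .
  have nY: "nn (Y x)" by (intro nnY nn_el qI) simp
  show W: "nn (X R - R)"
    unfolding nn_def
  proof (intro conjI allI impI)
    fix c
    show "0 \<le> (X R - R) c"
    proof (cases "c = q (k - 2)")
      case True
      then show ?thesis using nn_ge[OF nnX[OF nnR], of c] R_low[of "k - 2"] k2 by simp
    next
      case False
      then show ?thesis using nn_ge[OF nY, of c] unfolding Yx by (simp add: el_at)
    qed
    show "(X R - R) c = 0" if "c \<notin> I" using nnX[OF nnR] nnR that by (simp add: nn_def)
  qed
  show D: "dg (X R - R) = 8 * int k + 8" by (simp add: dg_add dgX dgR)
  have pos: "ip R R > 0" by (rule ip_pos[OF nnR]) (simp add: dgR)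
  have ev: "even (ip R R)" unfolding norm_parity dgR by simp
  have "(X R - R) (q k) * int (d (q k)) \<le> dg (X R - R)" by (rule dom[OF W]) (simp add: qI)
  then have le: "ip R R * int (2 * k + 1) \<le> 8 * int k + 8" unfolding D using 0 XR by (simp add: qd)
  have "\<not> 5 \<le> ip R R"
  proof
    assume "5 \<le> ip R R"
    then have "5 * int (2 * k + 1) \<le> ip R R * int (2 * k + 1)" by (intro mult_right_mono) auto
    then have "5 * int (2 * k + 1) \<le> 8 * int k + 8" using le by (rule order_trans)
    then show False using k2 by simp
  qed
  then show "ip R R = 2 \<or> ip R R = 4" using pos ev by presburger
qed

text \<open>Norm 4 forces \<open>k = 2\<close> and \<open>\<phi>\<^sup>2 = \<Sum>g + 4 \<phi>\<close> with five elements \<open>g\<close> of degree one, which together with \<open>\<phi>\<close> form a closed set of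
  dimension 30.\<close>

lemma norm_four: "R (q k) = 0 \<Longrightarrow> ip R R \<noteq> 4"
proof
  assume 0: "R (q k) = 0" and 4: "ip R R = 4"
  note NR = norm_R[OF 0]
  let ?W = "X R - R"
  have Wq: "?W (q k) = 4" using NR(1) 4 0 by simp
  have n1: "nn (?W - x)" by (rule nn_diff[OF NR(2)]) (use Wq in linarith)
  have n2: "nn (?W - x - x)" by (rule nn_diff[OF n1]) (simp only: diff_at, use Wq in linarith)
  have n3: "nn (?W - x - x - x)" by (rule nn_diff[OF n2]) (simp only: diff_at, use Wq in linarith)
  have n4: "nn (?W - x - x - x - x)" by (rule nn_diff[OF n3]) (simp only: diff_at, use Wq in linarith)
  have "dg (?W - x - x - x - x) = dg ?W - dg x - dg x - dg x - dg x" by (simp only: dg_add)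
  then have "dg (?W - x - x - x - x) = 4" using NR(3) by (simp add: dg_el qI qd)
  then obtain g where g: "g \<in> I" "d g = 1" "1 \<le> (?W - x - x - x - x) g" using has_grp4[OF n4] by blast
  have "1 \<le> ?W g" by (rule order_trans[OF g(3)]) (intro diff_el_le order_refl)
  then have "1 \<le> (Y x) g" unfolding Yx by (auto simp: el_at)
  then have "d (q k) = 5" using Y_grp[OF qI[OF order_refl] g(1,2)] by blast
  then have "k = 2" using qd[of k] by simp
  then have x: "x = el \<phi>" and W: "Y (el \<phi>) = el one + ?W" using Yx q2 q0 by simp_all
  have ne: "\<phi> \<noteq> one" using \<phi> d_one by auto
  have 4: "(Y (el \<phi>)) \<phi> = 4" unfolding W using Wq \<open>k = 2\<close> q2 ne by (simp add: el_at)
  obtain w where w: "Y (el (st \<phi>)) = (\<Sum>g\<in>stab \<phi>. el g) + w" "nn w" "\<And>g. g \<in> I \<Longrightarrow> d g = 1 \<Longrightarrow> w g = 0"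
    "dg w = int (d \<phi> * d \<phi>) - int (card (stab \<phi>))" by (rule split_stab[OF \<phi>(1)]) blast
  have w1: "Y (el \<phi>) = (\<Sum>g\<in>stab \<phi>. el g) + w" using w(1) by (simp only: \<phi>(3))
  have st: "(\<Sum>g\<in>stab \<phi>. el g) c = (if c \<in> stab \<phi> then 1 else 0)" for c
    unfolding sum_apply el_def using finite_stab[of \<phi>] by simp
  have ns: "\<phi> \<notin> stab \<phi>" using \<phi>(2) by (simp add: stab_def)
  have w4: "w \<phi> = 4"
  proof -
    have "(\<Sum>g\<in>stab \<phi>. el g) \<phi> + w \<phi> = 4" using 4 unfolding w1 by (simp only: plus_fun_apply)
    then show ?thesis unfolding st using ns by simp
  qed
  let ?x = "el \<phi>"
  have n1: "nn (w - ?x)" by (rule nn_diff[OF w(2)]) (simp add: w4)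
  have n2: "nn (w - ?x - ?x)" by (rule nn_diff[OF n1]) (simp only: diff_at, use w4 in linarith)
  have n3: "nn (w - ?x - ?x - ?x)" by (rule nn_diff[OF n2]) (simp only: diff_at, use w4 in linarith)
  have n4: "nn (w - ?x - ?x - ?x - ?x)" by (rule nn_diff[OF n3]) (simp only: diff_at, use w4 in linarith)
  have "dg (w - ?x - ?x - ?x - ?x) = dg w - dg ?x - dg ?x - dg ?x - dg ?x" by (simp only: dg_add)
  then have dgw: "dg (w - ?x - ?x - ?x - ?x) = 5 - int (card (stab \<phi>))" using w(4) \<phi> by (simp add: dg_el)
  have ng: "\<not> 1 \<le> (w - ?x - ?x - ?x - ?x) g" if g: "g \<in> I" "d g = 1" for g
  proof
    assume "1 \<le> (w - ?x - ?x - ?x - ?x) g"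
    also have "\<dots> \<le> w g" by (intro diff_el_le order_refl)
    finally show False using w(3)[OF g] by simp
  qed
  have "card (stab \<phi>) \<le> 5" using nn_dg[OF n4] dgw by linarith
  then have "card (stab \<phi>) \<in> {0, 1, 2, 3, 4, 5}" by auto
  moreover have "card (stab \<phi>) \<noteq> 1" using no_grp_small(3)[OF n4 ng] dgw by linarith
  ultimately have s5: "card (stab \<phi>) = 5" using stab_card[OF \<phi>(1)] by auto
  have "w - ?x - ?x - ?x - ?x = 0" by (rule nn_dg0[OF n4]) (use dgw s5 in linarith)
  then have w0: "w c = 0" if "c \<noteq> \<phi>" for c
    using that fun_cong[of "w - ?x - ?x - ?x - ?x" 0 c] by (simp add: el_at)
  have "closed (insert \<phi> (stab \<phi>))"
    unfolding closed_def
  proof (intro conjI ballI impI)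
    have cl: "closed (stab \<phi>)" by (rule stab_closed[OF \<phi>(1)])
    show "insert \<phi> (stab \<phi>) \<subseteq> I" using \<phi>(1) by (auto simp: stab_def)
    show "one \<in> insert \<phi> (stab \<phi>)" using cl by (simp add: closed_def)
    show "st a \<in> insert \<phi> (stab \<phi>)" if "a \<in> insert \<phi> (stab \<phi>)" for a
      using that cl \<phi>(3) by (auto simp: closed_def)
    fix a b c assume ab: "a \<in> insert \<phi> (stab \<phi>)" "b \<in> insert \<phi> (stab \<phi>)" and c: "c \<in> I" "N a b c \<noteq> 0"
    have left: "c' = \<phi>" if "g \<in> stab \<phi>" "c' \<in> I" "N g \<phi> c' \<noteq> 0" for g c'
    proof -
      have "g \<in> I" using that(1) by (simp add: stab_def)
      then have "(el g \<star> el \<phi>) c' \<noteq> 0" using mul_el[OF _ \<phi>(1) that(2)] that(3) by simp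
      then show ?thesis using that(1) by (simp add: stab_def el_at split: if_splits)
    qed
    consider "a \<in> stab \<phi>" "b \<in> stab \<phi>" | "a \<in> stab \<phi>" "b = \<phi>" | "a = \<phi>" "b \<in> stab \<phi>" | "a = \<phi>" "b = \<phi>"
      using ab by blast
    then show "c \<in> insert \<phi> (stab \<phi>)"
    proof cases
      case 1
      then show ?thesis using cl c unfolding closed_def by blast
    next
      case 2
      then show ?thesis using left[OF 2(1) c(1)] c(2) unfolding 2(2) by blast
    next
      case 3
      have bI: "b \<in> I" "st b \<in> stab \<phi>" using 3(2) cl unfolding closed_def by blast+
      have "N (st b) \<phi> (st c) \<noteq> 0" using N_star[OF \<phi>(1) bI(1) c(1)] c(2) unfolding 3(1) \<phi>(3) by linarith
      then have "st c = \<phi>" using left[OF bI(2) st_in[OF c(1)]] by simp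
      then have "c = \<phi>" using st_st[OF c(1)] \<phi>(3) by metis
      then show ?thesis by blast
    next
      case 4
      have "(Y (el \<phi>)) c \<noteq> 0" using c(2) mul_el[OF \<phi>(1) \<phi>(1) c(1)] unfolding 4 by simp
      then have "((\<Sum>g\<in>stab \<phi>. el g) + w) c \<noteq> 0" unfolding w1 .
      then have "(\<Sum>g\<in>stab \<phi>. el g) c + w c \<noteq> 0" unfolding plus_fun_apply .
      then show ?thesis using st[of c] w0[of c] by (cases "c \<in> stab \<phi>"; cases "c = \<phi>") simp_all
    qed
  qed
  then have "odd (\<Sum>a\<in>insert \<phi> (stab \<phi>). d a * d a)" using coprime6 by blast
  moreover have "(\<Sum>a\<in>insert \<phi> (stab \<phi>). d a * d a) = 25 + (\<Sum>a\<in>stab \<phi>. d a * d a)"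
    using ns finite_stab[of \<phi>] \<phi>(2) by simp
  moreover have "(\<Sum>a\<in>stab \<phi>. d a * d a) = card (stab \<phi>)" by (simp add: stab_def)
  ultimately show False using s5 by simp
qed

end

text \<open>The remaining failure: \<open>\<chi> q k = q (k - 1) + \<beta> + \<gamma>\<close>, where \<open>\<beta>\<close> and \<open>\<gamma>\<close> have degree sum \<open>4k + 4\<close>.\<close>

locale so3_two = so3_chain +
  fixes \<beta> \<gamma>
  assumes Rq: "R (q k) = 0" and Rsum: "R = el \<beta> + el \<gamma>" and \<beta>I: "\<beta> \<in> I" and \<gamma>I: "\<gamma> \<in> I" and lt: "d \<beta> < d \<gamma>"
begin

lemma ne: "\<beta> \<noteq> \<gamma>" "\<gamma> \<noteq> \<beta>" using lt by auto

lemma R1: "R \<beta> = 1" "R \<gamma> = 1" unfolding Rsum using ne by (simp_all add: el_at)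

lemma R1': "1 \<le> R \<beta>" "1 \<le> R \<gamma>" using R1 by simp_all

lemma deg_sum: "d \<beta> + d \<gamma> = 4 * k + 4"
proof -
  have "dg R = int (d \<beta>) + int (d \<gamma>)" unfolding Rsum by (simp add: dg_add dg_el \<beta>I \<gamma>I)
  then show ?thesis using dgR by linarith
qed

lemma deg_le: "d \<beta> \<le> 2 * k + 1" "2 * k + 3 \<le> d \<gamma>"
  using deg_sum lt odd[OF \<beta>I] by presburger+

lemma nq: "i \<le> k \<Longrightarrow> \<beta> \<noteq> q i" "i \<le> k \<Longrightarrow> \<gamma> \<noteq> q i"
proof -
  assume "i \<le> k"
  then consider "i < k" | "i = k" by linarith
  then have "\<beta> \<noteq> q i \<and> \<gamma> \<noteq> q i"
  proof cases
    case 1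
    then show ?thesis using R_pos(2)[OF R1'(1) 1] R_pos(2)[OF R1'(2) 1] by simp
  next
    case 2
    then show ?thesis using Rq R1 by auto
  qed
  then show "\<beta> \<noteq> q i" "\<gamma> \<noteq> q i" by simp_all
qed

lemma norm_two: "ip R R = 2"
  unfolding Rsum using ne by (simp add: ip_add ip_el \<beta>I \<gamma>I) (simp add: el_at)

abbreviation bb where "bb \<equiv> (X (el \<beta>)) \<beta>"
abbreviation bc where "bc \<equiv> (X (el \<beta>)) \<gamma>"
abbreviation cc where "cc \<equiv> (X (el \<gamma>)) \<gamma>"

lemma cb: "(X (el \<gamma>)) \<beta> = bc" by (rule X_sym[OF \<gamma>I \<beta>I])

lemma Xq1: "(X (el \<beta>)) (q k) = 1" "(X (el \<gamma>)) (q k) = 1"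
  using R_pos(3)[OF R1'(1)] R_pos(3)[OF R1'(2)] R1 by simp_all

lemma pos: "0 \<le> bb" "0 \<le> bc" "0 \<le> cc"
  using nn_ge[OF nnX[OF nn_el[OF \<beta>I]]] nn_ge[OF nnX[OF nn_el[OF \<gamma>I]]] by simp_all

lemma XR: "X R = X (el \<beta>) + X (el \<gamma>)" unfolding Rsum by (simp add: mul_add)

lemma W: "1 \<le> bb + bc" "1 \<le> bc + cc"
  using nn_ge[OF norm_R(2)[OF Rq], of \<beta>] nn_ge[OF norm_R(2)[OF Rq], of \<gamma>] unfolding XR
  by (simp_all add: R1 cb)

lemma deg_bound: "int (2 * k + 1) + bb * int (d \<beta>) + bc * int (d \<gamma>) \<le> 3 * int (d \<beta>)"
  "int (2 * k + 1) + bc * int (d \<beta>) + cc * int (d \<gamma>) \<le> 3 * int (d \<gamma>)"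
proof -
  have "(X (el b)) (q k) * int (d (q k)) + (X (el b)) \<beta> * int (d \<beta>) + (X (el b)) \<gamma> * int (d \<gamma>) \<le> dg (X (el b))" if "b \<in> I" for b
    by (rule dom3) (use that ne nq[of k] \<beta>I \<gamma>I in \<open>auto intro: nnX nn_el qI\<close>)
  from this[OF \<beta>I] this[OF \<gamma>I] show "int (2 * k + 1) + bb * int (d \<beta>) + bc * int (d \<gamma>) \<le> 3 * int (d \<beta>)"
    "int (2 * k + 1) + bc * int (d \<beta>) + cc * int (d \<gamma>) \<le> 3 * int (d \<gamma>)"
    by (simp_all add: Xq1 cb dgX dg_el \<beta>I \<gamma>I qd)
qed

text \<open>If \<open>\<gamma>\<close> occurred twice in \<open>\<chi>\<gamma>\<close> and the rest had degree 2, then \<open>\<gamma>\<close> would have degree 3.\<close>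

lemma no_double: "2 \<le> cc \<Longrightarrow> d \<gamma> \<noteq> 2 * k + 3"
proof
  assume 2: "2 \<le> cc" and dc: "d \<gamma> = 2 * k + 3"
  have n1: "nn (X (el \<gamma>) - x)" by (rule R_pos(6)[OF R1'(2)])
  have xc: "x \<gamma> = 0" using nq(2)[of k] by (simp add: el_at)
  have n2: "nn (X (el \<gamma>) - x - el \<gamma>)" by (rule nn_diff[OF n1]) (use 2 xc in simp)
  have n3: "nn (X (el \<gamma>) - x - el \<gamma> - el \<gamma>)" by (rule nn_diff[OF n2]) (simp only: diff_at, use 2 xc in simp)
  have "dg (X (el \<gamma>) - x - el \<gamma> - el \<gamma>) = dg (X (el \<gamma>)) - dg x - dg (el \<gamma>) - dg (el \<gamma>)" by (simp only: dg_add)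
  then have "dg (X (el \<gamma>) - x - el \<gamma> - el \<gamma>) = 2" using dc by (simp add: dgX dg_el \<gamma>I qI qd)
  moreover have "(X (el \<gamma>) - x - el \<gamma> - el \<gamma>) c \<le> (X (el \<gamma>)) c" for c by (intro diff_el_le order_refl)
  ultimately obtain g where "d \<gamma> = 3" using X_small[OF \<gamma>I n3] by blast
  then show False using dc k2 by simp
qed

lemma q_ne: "i \<le> k \<Longrightarrow> j \<le> k \<Longrightarrow> i \<noteq> j \<Longrightarrow> q i \<noteq> q j"
  using q_eq by blast

text \<open>For \<open>k \<ge> 3\<close> the multiplicity of \<open>q k\<close> in \<open>(q 3) q k\<close> equals \<open>bb + 2 bc + cc - 4\<close>. Its nonnegativity contradicts the degree
  bounds on \<open>\<chi> \<beta>\<close> and \<open>\<chi> \<gamma>\<close>.\<close>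

lemma k_eq_2: "k = 2"
proof (rule ccontr)
  assume "k \<noteq> 2"
  then have k3: "3 \<le> k" using k2 by simp
  let ?V = "el (q 3) \<star> x"
  have q': "q (k - 1) \<in> I" "q (k - 2) \<in> I" by (simp_all add: qI)
  have qn: "q (k - 1) \<noteq> q k" "q k \<noteq> q (k - 1)" "q (k - 2) \<noteq> q k" "q k \<noteq> q (k - 2)" "q (k - 1) \<noteq> q (k - 2)" "q (k - 2) \<noteq> q (k - 1)"
    by (rule q_ne; use k2 in linarith)+
  have Rq': "R (q (k - 1)) = 0" "R (q (k - 2)) = 0" using R_low[of "k - 1"] R_low[of "k - 2"] k2 by auto
  have XRq': "(X R) (q (k - 1)) = 0"
    unfolding X_val[OF q'(1)] Xq using q' by (simp only: ip_add ip_el qI order_refl Rq' Rq)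
  have XRR: "ip (X R) R = bb + 2 * bc + cc"
    unfolding XR unfolding Rsum by (simp add: ip_add ip_el \<beta>I \<gamma>I cb)
  have "(X (Y x)) (q k) = ip (el (q (k - 2)) + (X R - R)) (el (q (k - 1)) + R)"
    using X_val[OF qI[OF order_refl], of "Y x"] unfolding Xx Yx .
  also have "\<dots> = bb + 2 * bc + cc - 2"
    using q' by (simp only: ip_add ip_el XRR norm_two Rq' XRq') (simp only: el_at qn, simp)
  finally have XY: "(X (Y x)) (q k) = bb + 2 * bc + cc - 2" .
  have Yq: "(Y x) (q k) = 2" unfolding Yx using norm_R(1)[OF Rq] norm_two Rq qn by (simp add: el_at)
  have Xk: "(X x) (q k) = 0" unfolding Xx using Rq qn by (simp add: el_at)
  have "nn ?V" using k3 by (intro nn_mul nn_el qI) auto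
  then have "0 \<le> ?V (q k)" by (rule nn_ge)
  then have four: "4 \<le> bb + 2 * bc + cc" unfolding P3[OF k3] minus_apply XY Yq Xk by simp
  define M where "M = int (2 * k + 1)"
  have M7: "7 \<le> M" using k3 by (simp add: M_def)
  have db: "int (d \<beta>) \<le> M" "0 < int (d \<beta>)" "int (d \<beta>) + int (d \<gamma>) = 2 * M + 2" "M + 2 \<le> int (d \<gamma>)"
    using deg_le deg_sum d_pos[OF \<beta>I] by (simp_all add: M_def)
  note D = deg_bound[folded M_def]
  have bnn: "0 \<le> bb * int (d \<beta>)" "0 \<le> bc * int (d \<gamma>)" using pos by simp_all
  consider "2 \<le> bc" | "bc = 1" | "bc = 0" using pos(2) by linarith
  then show False
  proof cases
    case 1
    then have "2 * int (d \<gamma>) \<le> bc * int (d \<gamma>)" by (intro mult_right_mono) auto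
    then show ?thesis using D(1) db bnn M7 by linarith
  next
    case 2
    have D': "M + bb * int (d \<beta>) + int (d \<gamma>) \<le> 3 * int (d \<beta>)" "M + int (d \<beta>) + cc * int (d \<gamma>) \<le> 3 * int (d \<gamma>)"
      using D 2 by simp_all
    have "bb = 0"
    proof (rule ccontr)
      assume "bb \<noteq> 0"
      then have "1 * int (d \<beta>) \<le> bb * int (d \<beta>)" using pos(1) by (intro mult_right_mono) auto
      then show False using D'(1) db by linarith
    qed
    then have "2 \<le> cc" using four 2 by simp
    then have "2 * int (d \<gamma>) \<le> cc * int (d \<gamma>)" by (intro mult_right_mono) auto
    then show ?thesis using D' db bnn(1) M7 by linarith
  next
    case 3
    have D': "M + bb * int (d \<beta>) \<le> 3 * int (d \<beta>)" "M + cc * int (d \<gamma>) \<le> 3 * int (d \<gamma>)"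
      using D 3 by simp_all
    have "bb \<le> 2"
    proof (rule ccontr)
      assume "\<not> bb \<le> 2"
      then have "3 * int (d \<beta>) \<le> bb * int (d \<beta>)" by (intro mult_right_mono) auto
      then show False using D'(1) M7 by linarith
    qed
    moreover have "cc \<le> 2"
    proof (rule ccontr)
      assume "\<not> cc \<le> 2"
      then have "3 * int (d \<gamma>) \<le> cc * int (d \<gamma>)" by (intro mult_right_mono) auto
      then show False using D'(2) M7 by linarith
    qed
    ultimately have 2: "bb = 2" "cc = 2" using four 3 by linarith+
    then have "int (d \<beta>) = M" using D'(1) db(1) by simp
    then have "d \<gamma> = 2 * k + 3" using db unfolding M_def by simp
    then show ?thesis using no_double 2 by simp
  qed
qed

lemma x\<phi>: "x = el \<phi>" using q2 k_eq_2 by simp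

lemma X\<phi>: "X (el \<phi>) = el \<chi> + el \<beta> + el \<gamma>"
proof -
  have "k - 1 = Suc 0" using k_eq_2 by simp
  then have "q (k - 1) = \<chi>" using q1 by (simp only:)
  then show ?thesis using Xx unfolding x\<phi> Rsum by (simp only: add.assoc)
qed

lemma Y\<phi>: "Y (el \<phi>) = el one + (X (el \<beta>) + X (el \<gamma>) - (el \<beta> + el \<gamma>))"
proof -
  have "q (k - 2) = one" using k_eq_2 q0 by simp
  then show ?thesis using Yx unfolding x\<phi> XR Rsum by (simp only: mul_add)
qed

lemma deg12: "d \<beta> + d \<gamma> = 12" "3 \<le> d \<beta>"
  using deg_sum k_eq_2 R_pos(5)[OF R1'(1)] by simp_all

lemma low: "\<beta> \<noteq> one" "\<beta> \<noteq> \<chi>" "\<beta> \<noteq> \<phi>" "\<gamma> \<noteq> one" "\<gamma> \<noteq> \<chi>" "\<gamma> \<noteq> \<phi>"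
  using nq[of 0] nq[of "Suc 0"] nq[of 2] k2 q0 q1 q2 by auto

lemma X\<beta>\<phi>: "(X (el \<beta>)) \<phi> = 1" "(X (el \<gamma>)) \<phi> = 1" using Xq1 q2 k_eq_2 by simp_all

text \<open>Right translation of \<open>\<chi>\<phi> = \<chi> + \<beta> + \<gamma>\<close>.\<close>

lemma X\<phi>_translate: "Y (el g) = el h \<Longrightarrow> X (el h) = X (el g) + el \<beta> \<star> el g + el \<gamma> \<star> el g"
proof -
  assume "Y (el g) = el h"
  then have "X (el h) = X (el \<phi>) \<star> el g" by (simp add: mul_assoc)
  then show ?thesis unfolding X\<phi> by (simp add: mul_add)
qed

text \<open>In degree 3 the element \<open>\<beta>\<close> would be \<open>\<chi> g\<close> with \<open>\<phi> g = \<phi>\<close>; translating \<open>\<chi> \<phi>\<close> by \<open>g\<close> yields \<open>\<beta> g = \<chi>\<close>, hence \<open>g\<^sup>2 = 1\<close>.\<close>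

lemma deg3: "d \<beta> \<noteq> 3"
proof
  assume d3: "d \<beta> = 3"
  then have d9: "d \<gamma> = 9" using deg12 by simp
  have n: "nn (X (el \<beta>) - x)" by (rule R_pos(6)[OF R1'(1)])
  have "dg (X (el \<beta>) - x) = 4" unfolding x\<phi> using d3 by (simp add: dg_add dgX dg_el \<beta>I \<phi>)
  moreover have "(X (el \<beta>) - x) c \<le> (X (el \<beta>)) c" for c by (intro diff_el_le order_refl)
  ultimately obtain g where g: "g \<in> I" "d g = 1" "X (el g) = el \<beta>" using X_small[OF \<beta>I n] by blast
  obtain h where h: "h \<in> I" "d h = 5" "Y (el g) = el h" "X (el \<beta>) = el g + el \<beta> + el h"
    by (rule X_translate[OF g(1,2) \<beta>I g(3)])
  have "(el g + el \<beta> + el h) \<phi> = 1" using X\<beta>\<phi>(1) unfolding h(4) .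
  then have "h = \<phi>" using g(2) d3 \<phi>(2) by (auto simp: el_at split: if_splits)
  then have Yg: "Y (el g) = el \<phi>" using h(3) by simp
  obtain b where b: "b \<in> I" "el \<beta> \<star> el g = el b" "d b = d \<beta>" using grp_right[OF \<beta>I g(1,2)] by blast
  obtain c where c: "c \<in> I" "el \<gamma> \<star> el g = el c" "d c = d \<gamma>" using grp_right[OF \<gamma>I g(1,2)] by blast
  have "el \<chi> + el \<beta> + el \<gamma> = el \<beta> + el b + el c" using X\<phi>_translate[OF Yg] unfolding X\<phi> g(3) b(2) c(2) .
  then have "el b + el c = el \<chi> + el \<gamma>" by (simp add: add_ac)
  then have "b = \<chi>" using two_el b(3) d3 d9 by simp
  then have "el \<beta> \<star> el g = el \<chi>" using b(2) by simp
  then have "(el \<chi> \<star> el g) \<star> el g = el \<chi>" unfolding g(3) .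
  then have "g = one" using grp_square[OF g(1,2) \<chi>(1)] X_stab by blast
  then have "el \<chi> = el \<beta>" using g(3) \<chi>(1) by (simp add: mul_el_one)
  then show False using low(2) by (simp add: el_inj)
qed

lemma deg57: "d \<beta> = 5" "d \<gamma> = 7"
proof -
  have "d \<beta> \<le> 5" using deg_le(1) k_eq_2 by simp
  moreover have "d \<beta> \<noteq> 4" using odd[OF \<beta>I] by auto
  ultimately show "d \<beta> = 5" using deg3 deg12(2) by linarith
  then show "d \<gamma> = 7" using deg12(1) by simp
qed

lemma bounds: "5 * bb + 7 * bc \<le> 10" "5 * bc + 7 * cc \<le> 16"
  using deg_bound unfolding deg57 k_eq_2 by simp_all

text \<open>Translation by \<open>g\<close> permutes the constituents of \<open>\<chi> \<phi>\<close>, whose degrees 3, 5, 7 are distinct, so it fixes \<open>\<chi>\<close>.\<close>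

lemma Y_stab: "g \<in> I \<Longrightarrow> d g = 1 \<Longrightarrow> Y (el g) = el \<phi> \<Longrightarrow> g = one"
proof -
  assume g: "g \<in> I" "d g = 1" and Yg: "Y (el g) = el \<phi>"
  obtain a where a: "a \<in> I" "X (el g) = el a" "d a = d \<chi>" using grp_right[OF \<chi>(1) g] by blast
  obtain b where b: "b \<in> I" "el \<beta> \<star> el g = el b" "d b = d \<beta>" using grp_right[OF \<beta>I g] by blast
  obtain c where c: "c \<in> I" "el \<gamma> \<star> el g = el c" "d c = d \<gamma>" using grp_right[OF \<gamma>I g] by blast
  have "el \<chi> + el \<beta> + el \<gamma> = el a + el b + el c" using X\<phi>_translate[OF Yg] unfolding X\<phi> a(2) b(2) c(2) .
  then have "(el \<chi> + el \<beta> + el \<gamma>) \<chi> = (el a + el b + el c) \<chi>" by (simp only:)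
  moreover have "b \<noteq> \<chi>" "c \<noteq> \<chi>" using b(3) c(3) deg57 \<chi>(2) by auto
  ultimately have "a = \<chi>" using low by (auto simp: el_at split: if_splits)
  then show ?thesis using X_stab[OF g] a(2) by simp
qed

text \<open>An element \<open>g\<close> of degree one in \<open>\<chi> a\<close> makes \<open>a = \<chi> g\<close>, of degree 3.\<close>

lemma no_grp_X: "a \<in> I \<Longrightarrow> d a \<noteq> 3 \<Longrightarrow> (\<And>c. u c \<le> (X (el a)) c) \<Longrightarrow> g \<in> I \<Longrightarrow> d g = 1 \<Longrightarrow> \<not> 1 \<le> u g"
proof
  assume a: "a \<in> I" "d a \<noteq> 3" and le: "\<And>c. u c \<le> (X (el a)) c" and g: "g \<in> I" "d g = 1" "1 \<le> u g"
  have "d a = 3" using X_grp[OF a(1) g(1,2) order_trans[OF g(3) le]] by (rule conjunct2)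
  then show False using a(2) by (rule notE[rotated])
qed

text \<open>Otherwise \<open>\<chi> \<beta> = \<phi> + \<gamma> + \<alpha>\<close> with \<open>\<alpha> = \<chi> g\<close> of degree 3 and \<open>\<beta> = \<phi> g\<close>; translating again by \<open>g\<close> gives \<open>\<beta> g = \<phi>\<close>, hence
  \<open>g\<^sup>2 = 1\<close>.\<close>

lemma bc_eq_0: "bc = 0"
proof (rule ccontr)
  assume "bc \<noteq> 0"
  then have bc: "bc = 1" and bb: "bb = 0" using bounds(1) pos by linarith+
  let ?u = "X (el \<beta>) - x - el \<gamma>"
  have n1: "nn (X (el \<beta>) - x)" by (rule R_pos(6)[OF R1'(1)])
  have n2: "nn ?u" by (rule nn_diff[OF n1]) (use bc nq(2)[of k] in \<open>simp add: el_at\<close>)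
  have "dg ?u = dg (X (el \<beta>)) - dg x - dg (el \<gamma>)" by (simp only: dg_add)
  then have d3: "dg ?u = 3" unfolding x\<phi> by (simp add: dgX dg_el \<beta>I \<gamma>I \<phi> deg57)
  have le: "?u c \<le> (X (el \<beta>)) c" for c by (intro diff_el_le order_refl)
  have ng: "\<not> 1 \<le> ?u g" if "g \<in> I" "d g = 1" for g
    by (rule no_grp_X[of \<beta> ?u, OF \<beta>I _ le that]) (simp add: deg57)
  obtain \<alpha> where \<alpha>: "\<alpha> \<in> I" "d \<alpha> = 3" "?u = el \<alpha>"
    using no_grp_small(4)[of ?u, OF n2 ng d3] by blast
  have X\<beta>: "X (el \<beta>) = el \<phi> + (el \<gamma> + el \<alpha>)" using \<alpha>(3) unfolding x\<phi> by (intro diff_eqD)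
  have 1: "1 \<le> (X (el \<alpha>)) \<beta>" unfolding X_sym[OF \<alpha>(1) \<beta>I] X\<beta> by (simp add: el_at)
  have n: "nn (X (el \<alpha>) - el \<beta>)" by (rule nn_diff[OF nnX[OF nn_el[OF \<alpha>(1)]] 1])
  have "dg (X (el \<alpha>) - el \<beta>) = 4" by (simp add: dg_add dgX dg_el \<alpha> \<beta>I deg57)
  moreover have "(X (el \<alpha>) - el \<beta>) c \<le> (X (el \<alpha>)) c" for c by (intro diff_el_le order_refl)
  ultimately obtain g where g: "g \<in> I" "d g = 1" "X (el g) = el \<alpha>" using X_small[OF \<alpha>(1) n] by blast
  obtain h where h: "h \<in> I" "d h = 5" "Y (el g) = el h" "X (el \<alpha>) = el g + el \<alpha> + el h"
    by (rule X_translate[OF g(1,2) \<alpha>(1) g(3)])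
  have "1 \<le> (el g + el \<alpha> + el h) \<beta>" using 1 unfolding h(4) .
  then have "h = \<beta>" using g(2) \<alpha>(2) deg57 by (auto simp: el_at split: if_splits)
  then have Yg: "Y (el g) = el \<beta>" using h(3) by simp
  obtain b where b: "b \<in> I" "el \<beta> \<star> el g = el b" "d b = d \<beta>" using grp_right[OF \<beta>I g(1,2)] by blast
  obtain c where c: "c \<in> I" "el \<gamma> \<star> el g = el c" "d c = d \<gamma>" using grp_right[OF \<gamma>I g(1,2)] by blast
  have "el \<phi> + (el \<gamma> + el \<alpha>) = el \<alpha> + el b + el c" using X\<phi>_translate[OF Yg] unfolding X\<beta> g(3) b(2) c(2) .
  then have "el b + el c = el \<phi> + el \<gamma>" by (simp add: add_ac)
  then have "b = \<phi>" using two_el b(3) deg57 by simp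
  then have "el \<beta> \<star> el g = el \<phi>" using b(2) by simp
  then have "(el \<phi> \<star> el g) \<star> el g = el \<phi>" unfolding Yg .
  then have "g = one" using grp_square[OF g(1,2) \<phi>(1)] Y_stab by blast
  then have "el \<phi> = el \<beta>" using Yg \<phi>(1) by (simp add: mul_el_one)
  then show False using low(3) by (simp add: el_inj)
qed

lemma cc_eq_1: "cc = 1"
proof -
  have "d \<gamma> = 2 * k + 3" using deg57 k_eq_2 by simp
  then have "\<not> 2 \<le> cc" using no_double by blast
  then show ?thesis using W(2) bc_eq_0 by linarith
qed

lemma \<eta>: "\<exists>\<eta>\<in>I. d \<eta> = 9 \<and> X (el \<gamma>) = el \<phi> + (el \<gamma> + el \<eta>)"
proof -
  let ?u = "X (el \<gamma>) - x - el \<gamma>"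
  have n1: "nn (X (el \<gamma>) - x)" by (rule R_pos(6)[OF R1'(2)])
  have n2: "nn ?u" by (rule nn_diff[OF n1]) (use cc_eq_1 nq(2)[of k] in \<open>simp add: el_at\<close>)
  have "dg ?u = dg (X (el \<gamma>)) - dg x - dg (el \<gamma>)" by (simp only: dg_add)
  then have d9: "dg ?u = 9" unfolding x\<phi> by (simp add: dgX dg_el \<gamma>I \<phi> deg57)
  have ule: "?u c \<le> (X (el \<gamma>)) c" for c by (intro diff_el_le order_refl)
  obtain c where c: "c \<in> I" "1 \<le> ?u c" "nn (?u - el c)" "dg (?u - el c) = dg ?u - int (d c)" by (rule peel[OF n2]) (simp add: d9)
  have le: "(?u - el c) a \<le> (X (el \<gamma>)) a" for a by (intro diff_el_le order_refl)
  have ng: "\<not> 1 \<le> (?u - el c) g" if "g \<in> I" "d g = 1" for g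
    by (rule no_grp_X[of \<gamma> "?u - el c", OF \<gamma>I _ le that]) (simp add: deg57)
  have Xc: "1 \<le> (X (el c)) \<gamma>" using order_trans[OF c(2) ule] X_sym[OF \<gamma>I c(1)] by simp
  have "d c \<noteq> 1"
  proof
    assume "d c = 1"
    then have "\<not> 1 \<le> ?u c" by (intro no_grp_X[of \<gamma> ?u, OF \<gamma>I _ ule c(1)]) (simp add: deg57)
    then show False using c(2) by (rule notE)
  qed
  moreover have "d c \<noteq> 3"
  proof
    assume 3: "d c = 3"
    have n: "nn (X (el c) - el \<gamma>)" by (rule nn_diff[OF nnX[OF nn_el[OF c(1)]] Xc])
    have "dg (X (el c) - el \<gamma>) = 2" by (simp add: dg_add dgX dg_el c(1) 3 \<gamma>I deg57)
    moreover have "(X (el c) - el \<gamma>) a \<le> (X (el c)) a" for a by (intro diff_el_le order_refl)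
    ultimately obtain g where g: "g \<in> I" "d g = 1" "X (el g) = el c" using X_small[OF c(1) n] by blast
    obtain h where h: "h \<in> I" "d h = 5" "X (el c) = el g + el c + el h"
      by (rule X_translate[OF g(1,2) c(1) g(3)])
    have "1 \<le> (el g + el c + el h) \<gamma>" using Xc unfolding h(3) .
    then show False using g(2) h(2) 3 deg57 by (auto simp: el_at split: if_splits)
  qed
  moreover have "d c \<noteq> 5" "d c \<noteq> 7" "d c \<noteq> 8" using no_grp_small(1-3)[of "?u - el c", OF c(3) ng] c(4) d9 by linarith+
  moreover have "odd (d c)" by (rule odd[OF c(1)])
  moreover have "int (d c) \<le> 9" using nn_dg[OF c(3)] c(4) d9 by simp
  ultimately have d9': "d c = 9" by presburger
  then have "?u - el c = 0" using nn_dg0[OF c(3)] c(4) d9 by simp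
  then have "X (el \<gamma>) = el \<phi> + (el \<gamma> + (el c + 0))" unfolding x\<phi> by (intro diff_eqD)
  then show ?thesis using c(1) d9' by (intro bexI[of _ c]) simp_all
qed

end

locale so3_eta = so3_two +
  fixes \<eta>
  assumes \<eta>I: "\<eta> \<in> I" and d\<eta>: "d \<eta> = 9" and X\<gamma>: "X (el \<gamma>) = el \<phi> + (el \<gamma> + el \<eta>)"
begin

lemma dne: "d a \<noteq> d c \<Longrightarrow> a \<noteq> c" by blast

lemma nes: "one \<noteq> \<chi>" "one \<noteq> \<phi>" "one \<noteq> \<beta>" "one \<noteq> \<gamma>" "one \<noteq> \<eta>" "\<chi> \<noteq> one" "\<chi> \<noteq> \<phi>" "\<chi> \<noteq> \<beta>" "\<chi> \<noteq> \<gamma>" "\<chi> \<noteq> \<eta>"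
  "\<phi> \<noteq> one" "\<phi> \<noteq> \<chi>" "\<phi> \<noteq> \<gamma>" "\<phi> \<noteq> \<eta>" "\<beta> \<noteq> one" "\<beta> \<noteq> \<chi>" "\<beta> \<noteq> \<gamma>" "\<beta> \<noteq> \<eta>"
  "\<gamma> \<noteq> one" "\<gamma> \<noteq> \<chi>" "\<gamma> \<noteq> \<phi>" "\<gamma> \<noteq> \<beta>" "\<gamma> \<noteq> \<eta>" "\<eta> \<noteq> one" "\<eta> \<noteq> \<chi>" "\<eta> \<noteq> \<phi>" "\<eta> \<noteq> \<beta>" "\<eta> \<noteq> \<gamma>"
  by (rule dne, simp add: d_one \<chi> \<phi> deg57 d\<eta>)+

lemma nes': "\<phi> \<noteq> \<beta>" "\<beta> \<noteq> \<phi>" using low(3) by simp_all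

lemmas Is = one_in \<chi>(1) \<phi>(1) \<beta>I \<gamma>I \<eta>I

abbreviation b where "b \<equiv> el \<beta> \<star> el (st \<beta>)"

lemma b_val: "c \<in> I \<Longrightarrow> (el c \<star> el \<beta>) \<beta> = b c"
proof -
  assume c: "c \<in> I"
  have "(el c \<star> el \<beta>) \<beta> = ip (el c \<star> el \<beta>) (el \<beta>)" by (simp add: ip_el \<beta>I)
  also have "\<dots> = ip (el c) b" by (rule ip_right[OF \<beta>I])
  finally show ?thesis by (simp add: ip_el c)
qed

lemma b_one: "b one = 1" using b_val[OF one_in] by (simp add: one_mul_el \<beta>I el_at)

lemma nnb: "nn b" by (intro nn_mul nn_el st_in \<beta>I)

lemma dgb: "dg b = 25" by (simp add: dg_mul dg_el \<beta>I st_in d_st deg57)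

lemma dom_set: "nn u \<Longrightarrow> A \<subseteq> I \<Longrightarrow> (\<Sum>c\<in>A. u c * int (d c)) \<le> dg u"
  unfolding dg_def by (rule sum_mono2[OF fin]) (auto simp: nn_def)

text \<open>The norm of \<open>\<phi> \<beta>\<close> in terms of the constituents of \<open>\<phi>\<^sup>2\<close> and of \<open>\<beta> \<beta>\<^sup>*\<close>.\<close>

lemma norm_Y\<beta>: "ip (Y (el \<beta>)) (Y (el \<beta>)) = (Y (el \<phi>) \<star> el \<beta>) \<beta>"
proof -
  have "ip (Y (el \<beta>)) (Y (el \<beta>)) = ip (Y (Y (el \<beta>))) (el \<beta>)" by (rule Y_ip[symmetric])
  then show ?thesis by (simp add: mul_assoc ip_el \<beta>I)
qed

text \<open>The norm of \<open>\<phi> \<beta> = \<chi> + \<gamma> + \<phi> + 2 \<beta>\<close> is 7, which requires more of \<open>\<beta>\<close> and \<open>\<eta>\<close> in \<open>\<beta> \<beta>\<^sup>*\<close> than its degree 25 allows.\<close>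

lemma bb_ne_2: "bb \<noteq> 2"
proof
  assume 2: "bb = 2"
  let ?u = "X (el \<beta>) - x - el \<beta> - el \<beta>"
  have n1: "nn (X (el \<beta>) - x)" by (rule R_pos(6)[OF R1'(1)])
  have x0: "x \<beta> = 0" using nq(1)[of k] by (simp add: el_at)
  have n2: "nn (X (el \<beta>) - x - el \<beta>)" by (rule nn_diff[OF n1]) (use 2 x0 in simp)
  have n3: "nn ?u" by (rule nn_diff[OF n2]) (simp only: diff_at, use 2 x0 in simp)
  have "dg ?u = dg (X (el \<beta>)) - dg x - dg (el \<beta>) - dg (el \<beta>)" by (simp only: dg_add)
  then have "dg ?u = 0" unfolding x\<phi> by (simp add: dgX dg_el \<beta>I \<phi> deg57)
  then have "?u = 0" by (rule nn_dg0[OF n3])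
  then have "X (el \<beta>) = el \<phi> + (el \<beta> + (el \<beta> + 0))" unfolding x\<phi> by (intro diff_eqD)
  then have X\<beta>: "X (el \<beta>) = el \<phi> + el \<beta> + el \<beta>" by (simp only: add.assoc add_0_right)
  have Y\<beta>: "Y (el \<beta>) = el \<chi> + el \<gamma> + el \<phi> + el \<beta> + el \<beta>"
    unfolding Y_el[OF \<beta>I] X\<beta> mul_add X\<phi> by (simp add: algebra_simps)
  have Y\<phi>': "Y (el \<phi>) = el one + el \<phi> + el \<phi> + el \<beta> + el \<eta>"
    unfolding Y\<phi> X\<beta> X\<gamma> by (simp add: algebra_simps)
  have Yb: "(Y (el \<beta>)) \<beta> = 2" unfolding Y\<beta> plus_fun_apply by (simp add: el_at nes nes')
  have "ip (Y (el \<beta>)) (Y (el \<beta>)) = 7"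
    unfolding Y\<beta> by (simp only: ip_add ip_el Is plus_fun_apply) (simp add: el_at nes nes')
  moreover have "(Y (el \<phi>) \<star> el \<beta>) \<beta> = 5 + b \<beta> + b \<eta>"
    unfolding Y\<phi>' mul_add plus_fun_apply b_val[OF one_in] b_val[OF \<beta>I] b_val[OF \<eta>I] Yb b_one by simp
  ultimately have s: "b \<beta> + b \<eta> = 2" unfolding norm_Y\<beta> by linarith
  have "b \<chi> = 2" "b \<phi> = 2" using b_val[OF \<chi>(1)] b_val[OF \<phi>(1)] 2 Yb by simp_all
  moreover have "(\<Sum>c\<in>{one, \<chi>, \<phi>, \<beta>, \<eta>}. b c * int (d c)) \<le> 25"
    unfolding dgb[symmetric] by (rule dom_set[OF nnb]) (use Is in simp)
  ultimately have "1 + 6 + 10 + 5 * b \<beta> + 9 * b \<eta> \<le> 25"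
    using nes nes' by (simp add: b_one d_one \<chi> \<phi> deg57 d\<eta>)
  moreover have "0 \<le> b \<beta>" "0 \<le> b \<eta>" using nn_ge[OF nnb] by simp_all
  ultimately show False using s by linarith
qed

lemma bb_eq_1: "bb = 1"
  using bounds(1) W(1) bc_eq_0 bb_ne_2 by linarith

lemma \<zeta>: "\<exists>\<zeta>\<in>I. d \<zeta> = 5 \<and> X (el \<beta>) = el \<phi> + (el \<beta> + el \<zeta>)"
proof -
  let ?u = "X (el \<beta>) - x - el \<beta>"
  have n1: "nn (X (el \<beta>) - x)" by (rule R_pos(6)[OF R1'(1)])
  have n2: "nn ?u" by (rule nn_diff[OF n1]) (use bb_eq_1 nq(1)[of k] in \<open>simp add: el_at\<close>)
  have "dg ?u = dg (X (el \<beta>)) - dg x - dg (el \<beta>)" by (simp only: dg_add)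
  then have d5: "dg ?u = 5" unfolding x\<phi> by (simp add: dgX dg_el \<beta>I \<phi> deg57)
  have le: "?u c \<le> (X (el \<beta>)) c" for c by (intro diff_el_le order_refl)
  have ng: "\<not> 1 \<le> ?u g" if "g \<in> I" "d g = 1" for g
    by (rule no_grp_X[of \<beta> ?u, OF \<beta>I _ le that]) (simp add: deg57)
  obtain \<zeta> where \<zeta>: "\<zeta> \<in> I" "d \<zeta> = 5" "?u = el \<zeta>"
    using no_grp_small(5)[of ?u, OF n2 ng d5] by blast
  have "X (el \<beta>) = el \<phi> + (el \<beta> + el \<zeta>)" using \<zeta>(3) unfolding x\<phi> by (intro diff_eqD)
  then show ?thesis using \<zeta>(1,2) by (intro bexI[of _ \<zeta>] conjI)
qed

end

text \<open>The last case, \<open>\<chi> \<beta> = \<phi> + \<beta> + \<zeta>\<close> and \<open>\<chi> \<gamma> = \<phi> + \<gamma> + \<eta>\<close> with degrees 5 and 9 of \<open>\<zeta>\<close> and \<open>\<eta>\<close>.\<close>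

locale so3_zeta = so3_eta +
  fixes \<zeta>
  assumes \<zeta>I: "\<zeta> \<in> I" and d\<zeta>: "d \<zeta> = 5" and X\<beta>: "X (el \<beta>) = el \<phi> + (el \<beta> + el \<zeta>)"
begin

lemma \<zeta>n: "\<zeta> \<noteq> \<phi>" "\<zeta> \<noteq> \<beta>" "\<phi> \<noteq> \<zeta>" "\<beta> \<noteq> \<zeta>"
  using X\<beta>\<phi>(1) bb_eq_1 unfolding X\<beta> by (auto simp: el_at nes nes' split: if_splits)

lemma \<zeta>n': "\<zeta> \<noteq> one" "one \<noteq> \<zeta>" "\<zeta> \<noteq> \<chi>" "\<chi> \<noteq> \<zeta>" "\<zeta> \<noteq> \<gamma>" "\<gamma> \<noteq> \<zeta>" "\<zeta> \<noteq> \<eta>" "\<eta> \<noteq> \<zeta>"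
  by (rule dne, simp add: d_one \<chi> \<phi> deg57 d\<eta> d\<zeta>)+

lemmas distinct = nes nes' \<zeta>n \<zeta>n'

lemma Y\<phi>': "Y (el \<phi>) = el one + el \<phi> + el \<phi> + el \<zeta> + el \<eta>"
  unfolding Y\<phi> X\<beta> X\<gamma> by (simp add: algebra_simps)

lemma Y\<beta>: "Y (el \<beta>) = el \<chi> + el \<gamma> + X (el \<zeta>)"
  unfolding Y_el[OF \<beta>I] X\<beta> mul_add X\<phi> by (simp add: algebra_simps X\<beta>)

lemma X\<zeta>: "(X (el \<zeta>)) \<beta> = 1" "(X (el \<zeta>)) \<chi> = 0" "(X (el \<zeta>)) \<gamma> = 0" "(X (el \<zeta>)) \<phi> = 0" "(X (el \<zeta>)) one = 0"
  unfolding X_sym[OF \<zeta>I \<beta>I] X_sym[OF \<zeta>I \<chi>(1)] X_sym[OF \<zeta>I \<gamma>I] X_sym[OF \<zeta>I \<phi>(1)] X_sym[OF \<zeta>I one_in]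
    X\<beta> sq X\<gamma> X\<phi> mul_el_one[OF \<chi>(1)] plus_fun_apply
  by (simp_all add: el_at distinct)

lemma nnX\<zeta>: "nn (X (el \<zeta>))" by (intro nnX nn_el \<zeta>I)

text \<open>If \<open>\<zeta> = \<phi> g\<close>, then \<open>\<beta> g = \<beta>\<close> because \<open>\<chi> \<zeta>\<close> contains \<open>\<beta>\<close>; translating \<open>\<chi> \<beta>\<close> gives \<open>\<zeta> g = \<phi>\<close> and \<open>g\<^sup>2 = 1\<close>.\<close>

lemma Y_grp_ne: "g \<in> I \<Longrightarrow> d g = 1 \<Longrightarrow> Y (el g) \<noteq> el \<zeta>"
proof
  assume g: "g \<in> I" "d g = 1" and Yg: "Y (el g) = el \<zeta>"
  obtain a where a: "a \<in> I" "X (el g) = el a" "d a = d \<chi>" using grp_right[OF \<chi>(1) g] by blast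
  obtain b where b: "b \<in> I" "el \<beta> \<star> el g = el b" "d b = d \<beta>" using grp_right[OF \<beta>I g] by blast
  obtain c where c: "c \<in> I" "el \<gamma> \<star> el g = el c" "d c = d \<gamma>" using grp_right[OF \<gamma>I g] by blast
  have "X (el \<zeta>) = el a + el b + el c" using X\<phi>_translate[OF Yg] unfolding a(2) b(2) c(2) .
  then have "(el a + el b + el c) \<beta> = 1" using X\<zeta>(1) by (simp only:)
  moreover have "a \<noteq> \<beta>" "c \<noteq> \<beta>" using a(3) c(3) deg57 \<chi>(2) by auto
  ultimately have "b = \<beta>" by (auto simp: el_at split: if_splits)
  then have \<beta>g: "el \<beta> \<star> el g = el \<beta>" using b(2) by simp
  have "X (el \<beta>) = X (el \<beta>) \<star> el g" unfolding mul_assoc \<beta>g ..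
  then have "el \<phi> + (el \<beta> + el \<zeta>) = el \<zeta> + (el \<beta> + el \<zeta> \<star> el g)" unfolding X\<beta> mul_add \<beta>g Yg .
  then have "el \<zeta> \<star> el g = el \<phi>" by (simp add: algebra_simps)
  then have "(el \<phi> \<star> el g) \<star> el g = el \<phi>" unfolding Yg .
  then have "g = one" using grp_square[OF g \<phi>(1)] Y_stab by blast
  then have "el \<phi> = el \<zeta>" using Yg \<phi>(1) by (simp add: mul_el_one)
  then show False using \<zeta>n(3) by (simp add: el_inj)
qed

lemma X\<zeta>_deg3: "c \<in> I \<Longrightarrow> d c = 3 \<Longrightarrow> (X (el \<zeta>)) c = 0"
proof (rule ccontr)
  assume c: "c \<in> I" "d c = 3" and "(X (el \<zeta>)) c \<noteq> 0"
  then have 1: "1 \<le> (X (el c)) \<zeta>" using nn_ge[OF nnX\<zeta>, of c] X_sym[OF \<zeta>I c(1)] by linarith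
  have n: "nn (X (el c) - el \<zeta>)" by (rule nn_diff[OF nnX[OF nn_el[OF c(1)]] 1])
  have "dg (X (el c) - el \<zeta>) = 4" by (simp add: dg_add dgX dg_el c \<zeta>I d\<zeta>)
  moreover have "(X (el c) - el \<zeta>) a \<le> (X (el c)) a" for a by (intro diff_el_le order_refl)
  ultimately obtain g where g: "g \<in> I" "d g = 1" "X (el g) = el c" using X_small[OF c(1) n] by blast
  obtain h where h: "h \<in> I" "d h = 5" "Y (el g) = el h" "X (el c) = el g + el c + el h"
    by (rule X_translate[OF g(1,2) c(1) g(3)])
  have "1 \<le> (el g + el c + el h) \<zeta>" using 1 unfolding h(4) .
  then have "h = \<zeta>" using g(2) c(2) d\<zeta> by (auto simp: el_at split: if_splits)
  then show False using Y_grp_ne[OF g(1,2)] h(3) by simp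
qed

text \<open>Since \<open>\<chi>\<close> and \<open>\<phi>\<close> commute, \<open>\<chi> \<phi>\<close> is self-dual, and its constituents have distinct degrees.\<close>

lemma st\<beta>: "st \<beta> = \<beta>"
proof -
  have "(X (el \<phi>)) \<beta> = (X (el \<phi>)) (st \<beta>)"
    using star_mul[OF \<chi>(1) \<phi>(1) \<beta>I] \<chi>(3) \<phi>(3) XY by simp
  then have "(X (el \<phi>)) (st \<beta>) = 1" unfolding X\<phi> by (simp add: el_at distinct)
  then have "st \<beta> = \<chi> \<or> st \<beta> = \<beta> \<or> st \<beta> = \<gamma>" unfolding X\<phi> by (auto simp: el_at split: if_splits)
  moreover have "st \<beta> \<noteq> \<chi>" "st \<beta> \<noteq> \<gamma>" using d_st[OF \<beta>I] deg57 \<chi>(2) by auto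
  ultimately show ?thesis by blast
qed

lemma b_vals: "b \<chi> = 1" "b \<phi> = 1"
proof -
  show "b \<chi> = 1" using b_val[OF \<chi>(1)] bb_eq_1 by simp
  show "b \<phi> = 1" unfolding b_val[OF \<phi>(1), symmetric] Y\<beta> plus_fun_apply X\<zeta> by (simp add: el_at distinct)
qed

lemma norm_\<zeta>: "ip (X (el \<zeta>)) (X (el \<zeta>)) = 1 + b \<zeta> + b \<eta>"
proof -
  have "ip (Y (el \<beta>)) (Y (el \<beta>)) = 2 + ip (X (el \<zeta>)) (X (el \<zeta>))"
    unfolding Y\<beta> by (simp only: ip_add ip_el Is X\<zeta> plus_fun_apply) (simp add: el_at distinct)
  moreover have "(Y (el \<phi>) \<star> el \<beta>) \<beta> = 3 + b \<zeta> + b \<eta>"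
    unfolding Y\<phi>' mul_add plus_fun_apply b_val[OF one_in] b_val[OF \<phi>(1)] b_val[OF \<zeta>I] b_val[OF \<eta>I] b_vals b_one by simp
  ultimately show ?thesis unfolding norm_Y\<beta> by linarith
qed

lemma norm_\<zeta>_ge: "3 \<le> ip (X (el \<zeta>)) (X (el \<zeta>))"
proof -
  have dg: "dg (X (el \<zeta>)) = 15" by (simp add: dgX dg_el \<zeta>I d\<zeta>)
  have "odd (ip (X (el \<zeta>)) (X (el \<zeta>)))" unfolding norm_parity dg by simp
  moreover have "0 < ip (X (el \<zeta>)) (X (el \<zeta>))" by (rule ip_pos[OF nnX\<zeta>]) (simp add: dg)
  moreover have "ip (X (el \<zeta>)) (X (el \<zeta>)) \<noteq> 1"
  proof
    assume "ip (X (el \<zeta>)) (X (el \<zeta>)) = 1"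
    then obtain h where h: "h \<in> I" "X (el \<zeta>) = el h" using norm1[OF nnX\<zeta>] by blast
    have "el h \<beta> = 1" using X\<zeta>(1) unfolding h(2) .
    then have "h = \<beta>" by (simp add: el_at split: if_splits)
    then show False using dg unfolding h(2) by (simp add: dg_el \<beta>I deg57)
  qed
  ultimately show ?thesis by presburger
qed

lemma b_grp: "g \<in> I \<Longrightarrow> d g = 1 \<Longrightarrow> 1 \<le> b g \<Longrightarrow> g = one"
proof -
  assume g: "g \<in> I" "d g = 1" and 1: "1 \<le> b g"
  have "g \<in> stab \<beta>" using stab_mult[OF \<beta>I g] 1 by (simp split: if_splits)
  then have g\<beta>: "el g \<star> el \<beta> = el \<beta>" by (simp add: stab_def)
  have g': "st g \<in> I" "d (st g) = 1" using g by (simp_all add: st_in d_st)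
  obtain z where z: "z \<in> I" "el \<beta> \<star> el (st g) = el z" using grp_right[OF \<beta>I g'] by blast
  have "el z \<beta> = 1" using star_mul[OF g(1) \<beta>I \<beta>I] unfolding g\<beta> st\<beta> z(2) by (simp add: el_at)
  then have "z = \<beta>" by (simp add: el_at split: if_splits)
  then have \<beta>g: "el \<beta> \<star> el (st g) = el \<beta>" using z(2) by simp
  obtain p where p: "p \<in> I" "el \<phi> \<star> el (st g) = el p" using grp_right[OF \<phi>(1) g'] by blast
  obtain r where r: "r \<in> I" "el \<zeta> \<star> el (st g) = el r" using grp_right[OF \<zeta>I g'] by blast
  have "X (el \<beta>) = X (el \<beta>) \<star> el (st g)" unfolding mul_assoc \<beta>g ..
  then have "el \<phi> + (el \<beta> + el \<zeta>) = el p + (el \<beta> + el r)" unfolding X\<beta> mul_add \<beta>g p(2) r(2) .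
  then have "(el \<phi> + (el \<beta> + el \<zeta>)) p = (el p + (el \<beta> + el r)) p" by (simp only:)
  then have "p = \<phi> \<or> p = \<zeta>" by (auto simp: el_at split: if_splits)
  moreover have "p \<noteq> \<zeta>" using Y_grp_ne[OF g'] p(2) by auto
  ultimately have "st g = one" using Y_stab[OF g'] p(2) by simp
  then show "g = one" using st_st[OF g(1)] st_one by simp
qed

text \<open>The norm of \<open>\<chi> \<zeta>\<close> is at least 3, which leaves only \<open>\<beta>\<^sup>2 = 1 + \<chi> + \<phi> + 2 \<zeta> + c\<^sub>1 + c\<^sub>2\<close> with \<open>c\<^sub>1\<close>, \<open>c\<^sub>2\<close> of degree 3, and norm exactly 3.
  The multiplicity of \<open>\<zeta>\<close> in \<open>\<zeta> \<beta> = \<chi> \<beta>\<^sup>2 - \<phi> \<beta> - \<beta>\<^sup>2\<close> is \<open>t - 2\<close>, where \<open>t\<close> is that of \<open>\<zeta>\<close> in \<open>\<chi> \<zeta>\<close>. So \<open>t \<ge> 2\<close>, and the norm of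
  \<open>\<chi> \<zeta>\<close> is at least \<open>2\<^sup>2 + 1\<close>.\<close>

lemma contradiction: False
proof -
  let ?u = "b - el one - el \<chi> - el \<phi>"
  have n1: "nn (b - el one)" by (rule nn_diff[OF nnb]) (simp add: b_one)
  have n2: "nn (b - el one - el \<chi>)" by (rule nn_diff[OF n1]) (simp add: b_vals el_at distinct)
  have n3: "nn ?u" by (rule nn_diff[OF n2]) (simp add: b_vals el_at distinct)
  have "dg ?u = dg b - dg (el one) - dg (el \<chi>) - dg (el \<phi>)" by (simp only: dg_add)
  then have dgu: "dg ?u = 16" by (simp add: dgb dg_el Is d_one \<chi> \<phi>)
  have u\<zeta>: "?u \<zeta> = b \<zeta>" and u\<eta>: "?u \<eta> = b \<eta>" and u1: "?u one = 0"
    by (simp_all add: el_at distinct b_one)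
  have ng: "\<not> 1 \<le> v g" if v: "\<And>c. v c \<le> ?u c" and g: "g \<in> I" "d g = 1" for v g
  proof
    assume 1: "1 \<le> v g"
    have "1 \<le> ?u g" using order_trans[OF 1 v] .
    moreover have "?u g \<le> b g" by (intro diff_el_le order_refl)
    ultimately have "g = one" using b_grp[OF g] by linarith
    then show False using \<open>1 \<le> ?u g\<close> u1 by simp
  qed
  have s: "2 \<le> b \<zeta> + b \<eta>" using norm_\<zeta> norm_\<zeta>_ge by linarith
  have dm: "b \<zeta> * 5 + b \<eta> * 9 \<le> 16"
    using dom2[OF n3 \<zeta>I \<eta>I \<zeta>n'(7)] unfolding u\<zeta> u\<eta> dgu by (simp add: d\<zeta> d\<eta>)
  have p: "0 \<le> b \<zeta>" "0 \<le> b \<eta>" using nn_ge[OF nnb] by simp_all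
  have n4: "nn (?u - el \<zeta>)" by (rule nn_diff[OF n3]) (use u\<zeta> s dm p in linarith)
  have d4: "dg (?u - el \<zeta>) = 11" using dgu by (simp only: dg_add) (simp add: dg_el \<zeta>I d\<zeta>)
  have \<eta>0: "b \<eta> = 0"
  proof (rule ccontr)
    assume "b \<eta> \<noteq> 0"
    then have 1: "b \<eta> = 1" using s dm p by linarith
    have n: "nn (?u - el \<zeta> - el \<eta>)"
      by (rule nn_diff[OF n4]) (simp only: minus_apply, use u\<eta> 1 in \<open>simp add: el_at distinct\<close>)
    have "dg (?u - el \<zeta> - el \<eta>) = 2" using d4 by (simp only: dg_add) (simp add: dg_el \<eta>I d\<eta>)
    moreover have le: "(?u - el \<zeta> - el \<eta>) c \<le> ?u c" for c by (intro diff_el_le order_refl)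
    have "\<not> 1 \<le> (?u - el \<zeta> - el \<eta>) g" if "g \<in> I" "d g = 1" for g
      by (rule ng[of "?u - el \<zeta> - el \<eta>", OF le that])
    ultimately show False using no_grp_small(2)[of "?u - el \<zeta> - el \<eta>", OF n] by blast
  qed
  have n5: "nn (?u - el \<zeta> - el \<zeta>)"
    by (rule nn_diff[OF n4]) (simp only: diff_at, use u\<zeta> s \<eta>0 in linarith)
  have d5: "dg (?u - el \<zeta> - el \<zeta>) = 6" using d4 by (simp only: dg_add) (simp add: dg_el \<zeta>I d\<zeta>)
  have \<zeta>2: "b \<zeta> = 2"
  proof (rule ccontr)
    assume "b \<zeta> \<noteq> 2"
    then have 3: "3 \<le> b \<zeta>" using s \<eta>0 by linarith
    have n: "nn (?u - el \<zeta> - el \<zeta> - el \<zeta>)"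
      by (rule nn_diff[OF n5]) (simp only: diff_at, use u\<zeta> 3 in linarith)
    have "dg (?u - el \<zeta> - el \<zeta> - el \<zeta>) = 1" using d5 by (simp only: dg_add) (simp add: dg_el \<zeta>I d\<zeta>)
    moreover have le: "(?u - el \<zeta> - el \<zeta> - el \<zeta>) c \<le> ?u c" for c by (intro diff_el_le order_refl)
    have "\<not> 1 \<le> (?u - el \<zeta> - el \<zeta> - el \<zeta>) g" if "g \<in> I" "d g = 1" for g
      by (rule ng[of "?u - el \<zeta> - el \<zeta> - el \<zeta>", OF le that])
    ultimately show False using no_grp_small(1)[of "?u - el \<zeta> - el \<zeta> - el \<zeta>", OF n] by blast
  qed
  have le5: "(?u - el \<zeta> - el \<zeta>) c \<le> ?u c" for c by (intro diff_el_le order_refl)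
  obtain c1 c2 where c: "c1 \<in> I" "c2 \<in> I" "d c1 = 3" "d c2 = 3" "?u - el \<zeta> - el \<zeta> = el c1 + el c2"
    using no_grp_small(6)[of "?u - el \<zeta> - el \<zeta>", OF n5 ng[of "?u - el \<zeta> - el \<zeta>", OF le5] d5] by blast
  have bsum: "b = el one + (el \<chi> + (el \<phi> + (el \<zeta> + (el \<zeta> + (el c1 + el c2)))))"
    by (rule diff_eqD, rule diff_eqD, rule diff_eqD, rule diff_eqD, rule diff_eqD, rule c(5))
  let ?t = "(X (el \<zeta>)) \<zeta>"
  have "(X b) \<zeta> = ip b (X (el \<zeta>))" by (rule X_val[OF \<zeta>I])
  also have "\<dots> = 2 * ?t"
    unfolding bsum by (simp only: ip_add ip_el Is \<zeta>I c(1,2) X\<zeta> X\<zeta>_deg3[OF c(1,3)] X\<zeta>_deg3[OF c(2,4)])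
  finally have Xb: "(X b) \<zeta> = 2 * ?t" .
  have "el \<zeta> = X (el \<beta>) - el \<phi> - el \<beta>" unfolding X\<beta> by simp
  then have "el \<zeta> \<star> el \<beta> = X b - Y (el \<beta>) - b" by (simp add: mul_add mul_assoc st\<beta>)
  then have "(el \<zeta> \<star> el \<beta>) \<zeta> = (X b) \<zeta> - (Y (el \<beta>)) \<zeta> - b \<zeta>" by simp
  moreover have "(Y (el \<beta>)) \<zeta> = ?t" unfolding Y\<beta> plus_fun_apply by (simp add: el_at distinct)
  moreover have "0 \<le> (el \<zeta> \<star> el \<beta>) \<zeta>" by (intro nn_ge nn_mul nn_el \<zeta>I \<beta>I)
  ultimately have "2 \<le> ?t" using Xb \<zeta>2 by linarith
  then have "2\<^sup>2 \<le> ?t\<^sup>2" by (intro power_mono) auto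
  moreover have "?t\<^sup>2 + ((X (el \<zeta>)) \<beta>)\<^sup>2 \<le> 3"
    using ip_ge2[OF \<zeta>I \<beta>I \<zeta>n(2), of "X (el \<zeta>)"] unfolding norm_\<zeta> \<zeta>2 \<eta>0 by simp
  ultimately show False unfolding X\<zeta> by simp
qed

end

context so3_two
begin

lemma contradiction: False
proof -
  obtain \<eta> where \<eta>: "\<eta> \<in> I" "d \<eta> = 9" "X (el \<gamma>) = el \<phi> + (el \<gamma> + el \<eta>)" using \<eta> by blast
  interpret e: so3_eta I one st N d \<chi> \<phi> k q \<beta> \<gamma> \<eta> by unfold_locales (fact \<eta>)+
  obtain \<zeta> where \<zeta>: "\<zeta> \<in> I" "d \<zeta> = 5" "X (el \<beta>) = el \<phi> + (el \<beta> + el \<zeta>)" using e.\<zeta> by blast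
  interpret z: so3_zeta I one st N d \<chi> \<phi> k q \<beta> \<gamma> \<eta> \<zeta> by unfold_locales (fact \<zeta>)+
  show False by (rule z.contradiction)
qed

end

context so3_chain
begin

lemma extend: "\<exists>r\<in>I. d r = 2 * k + 3 \<and> X x = el (q (k - 1)) + x + el r"
proof -
  have "R (q k) = 1 \<or> R (q k) = 0" using loop_le1 nn_ge[OF nnR, of "q k"] by linarith
  then show ?thesis
  proof
    assume "R (q k) = 1"
    then obtain r where r: "r \<in> I" "d r = 2 * k + 3" "R = x + el r" using mult_one by blast
    have "X x = el (q (k - 1)) + x + el r" unfolding Xx r(3) by (simp only: add.assoc)
    then show ?thesis using r(1,2) by (intro bexI[of _ r] conjI)
  next
    assume 0: "R (q k) = 0"
    have "ip R R = 2" using norm_R(4)[OF 0] norm_four[OF 0] by blast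
    then obtain a c where ac: "a \<in> I" "c \<in> I" "a \<noteq> c" "R = el a + el c" using norm2[OF nnR] by blast
    have "dg R = int (d a) + int (d c)" unfolding ac(4) by (simp add: dg_add dg_el ac(1,2))
    then have s: "d a + d c = 4 * k + 4" using dgR by linarith
    have "d a \<noteq> d c" using odd[OF ac(1)] s by presburger
    then consider "d a < d c" | "d c < d a" by linarith
    then have False
    proof cases
      case 1
      interpret t: so3_two I one st N d \<chi> \<phi> k q a c by unfold_locales (fact 0 ac 1)+
      show ?thesis by (rule t.contradiction)
    next
      case 2
      have e: "R = el c + el a" unfolding ac(4) by (rule add.commute)
      interpret t: so3_two I one st N d \<chi> \<phi> k q c a by unfold_locales (fact 0 e ac 2)+
      show ?thesis by (rule t.contradiction)
    qed
    then show ?thesis ..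
  qed
qed

lemma chain_Suc: "\<exists>q'. so3_chain I one st N d \<chi> \<phi> (Suc k) q'"
proof -
  obtain r where r: "r \<in> I" "d r = 2 * k + 3" "X x = el (q (k - 1)) + x + el r" using extend by blast
  let ?q = "q(Suc k := r)"
  have "so3_chain I one st N d \<chi> \<phi> (Suc k) ?q"
  proof unfold_locales
    show "2 \<le> Suc k" "?q 0 = one" "?q (Suc 0) = \<chi>" "?q 2 = \<phi>" using k2 q0 q1 q2 by simp_all
    fix i
    show "?q i \<in> I" if "i \<le> Suc k" using that qI[of i] r(1) by (cases "i = Suc k") simp_all
    show "d (?q i) = 2 * i + 1" if "i \<le> Suc k" using that qd[of i] r(2) by (cases "i = Suc k") simp_all
    show "X (el (?q i)) = el (?q (i - 1)) + el (?q i) + el (?q (Suc i))" if i: "1 \<le> i" "i < Suc k"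
    proof (cases "i = k")
      case True
      have "k - 1 \<noteq> Suc k" by arith
      then have "?q k = q k" "?q (k - 1) = q (k - 1)" "?q (Suc k) = r" by simp_all
      then show ?thesis using r(3) unfolding True by (simp only:)
    next
      case False
      moreover have "i - 1 \<noteq> Suc k" using i by arith
      ultimately have "?q i = q i" "?q (i - 1) = q (i - 1)" "?q (Suc i) = q (Suc i)" using i by simp_all
      then show ?thesis using qX[of i] i False by (simp only:)
    qed
  qed
  then show ?thesis by blast
qed

end

context so3_ring
begin

lemma chain_exists: "2 \<le> k \<Longrightarrow> \<exists>q. so3_chain I one st N d \<chi> \<phi> k q"
proof (induction k rule: dec_induct)
  case base
  let ?q = "\<lambda>i::nat. if i = 0 then one else if i = 1 then \<chi> else \<phi>"
  have "so3_chain I one st N d \<chi> \<phi> 2 ?q"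
  proof unfold_locales
    show "2 \<le> (2::nat)" "?q 0 = one" "?q (Suc 0) = \<chi>" "?q 2 = \<phi>" by simp_all
    fix i :: nat
    show "?q i \<in> I" by (simp add: one_in \<chi> \<phi>)
    show "d (?q i) = 2 * i + 1" if "i \<le> 2"
    proof -
      consider "i = 0" | "i = 1" | "i = 2" using \<open>i \<le> 2\<close> by linarith
      then show ?thesis by cases (simp_all add: d_one \<chi> \<phi>)
    qed
    show "X (el (?q i)) = el (?q (i - 1)) + el (?q i) + el (?q (Suc i))" if "1 \<le> i" "i < 2"
    proof -
      have i: "i = 1" using that by linarith
      show ?thesis unfolding i by (simp add: sq)
    qed
  qed
  then show ?case by blast
next
  case (step k)
  then obtain q where "so3_chain I one st N d \<chi> \<phi> k q" by blast
  then show ?case by (rule so3_chain.chain_Suc)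
qed

lemma infinite_chain: False
proof -
  obtain q where "so3_chain I one st N d \<chi> \<phi> (card I + 2) q" using chain_exists[of "card I + 2"] by auto
  then interpret c: so3_chain I one st N d \<chi> \<phi> "card I + 2" q .
  have "inj_on q {..card I}" by (rule inj_onI) (use c.q_eq in simp)
  moreover have "q ` {..card I} \<subseteq> I" using c.qI by auto
  ultimately have "card {..card I} \<le> card I" using card_inj_on_le fin by blast
  then show False by simp
qed

end

theorem (in odd_fusion_ring) no_degree_3: "a \<in> I \<Longrightarrow> d a \<noteq> 3"
proof
  assume "a \<in> I" "d a = 3"
  then obtain \<chi> \<phi> where "\<chi> \<in> I" "\<phi> \<in> I" "d \<chi> = 3" "d \<phi> = 5" "st \<chi> = \<chi>" "st \<phi> = \<phi>"
    "el \<chi> \<star> el \<chi> = el one + el \<chi> + el \<phi>" using so3_generator by blast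
  then interpret so3_ring I one st N d \<chi> \<phi> by unfold_locales
  show False by (rule infinite_chain)
qed

section \<open>Cosemisimple Hopf algebras of odd dimension\<close>

context cosemisimple_hopf
begin

sublocale fus: fusion_ring Irr one st N deg
proof unfold_locales
  show "deg (st a) = deg a" if "a \<in> Irr" for a
    using additive_iso[OF additive_deg comod_du[OF Irr_comod[OF that]] Irr_comod[OF st_Irr[OF that]] iso_st[OF that]]
    by (simp add: ix_du)
qed (fact finite_Irr one_Irr deg_one st_Irr st_st Irr_deg_pos N_one_left N_one_right N_left N_right N_assoc N_deg)+

text \<open>The inverse antipode serves as the antipode of the opposite algebra in the theorem of Nichols and Zoeller.\<close>

lemma closed_dvd:
  assumes "fus.closed \<Gamma>"
  shows "(\<Sum>a\<in>\<Gamma>. deg a * deg a) dvd dim UNIV"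
proof -
  have \<Gamma>: "closed \<Gamma>" using assms unfolding closed_def fus.closed_def .
  note K = closed_subalgebra[OF \<Gamma>]
  have b: "bilin scale scale (\<lambda>x y. T y * x)"
    by (auto simp: bilin_def lin_def lin_add[OF T_lin] lin_scale[OF T_lin] distrib_left distrib_right
        scale_mult_left scale_mult_right)
  have "lin_ext scale (\<lambda>(x, y). T y * x) (\<Delta> h) = \<epsilon> h *s 1" for h
    unfolding SW_eq[OF vs b] by (rule SW_T)
  then have "dim (span (\<Union>a\<in>\<Gamma>. cf a)) dvd dim UNIV"
    using K(1,2) by (intro hopf_subalgebra_dim_dvd[OF _ _ K(3) T_lin K(4)]) (simp_all add: subcoalgebra_iff)
  then show ?thesis unfolding K(5) .
qed

lemma three_dvd_dim:
  assumes "odd (dim UNIV)" "simple_subcoalgebra C" "dim C = 9" "\<And>C. simple_subcoalgebra C \<Longrightarrow> odd (dim C)"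
  shows "3 dvd dim UNIV"
proof (rule ccontr)
  assume 3: "\<not> 3 dvd dim UNIV"
  interpret odd_fusion_ring Irr one st N deg
  proof unfold_locales
    show "odd (deg a)" if "a \<in> Irr" for a
    proof -
      have "simple_subcoalgebra (span (cf a))" unfolding simple_iff using that by blast
      then have "odd (dim (span (cf a)))" by (rule assms(4))
      then show ?thesis unfolding dim_simple[OF that] by simp
    qed
    show "odd (\<Sum>a\<in>\<Gamma>. deg a * deg a) \<and> \<not> 3 dvd (\<Sum>a\<in>\<Gamma>. deg a * deg a)" if "fus.closed \<Gamma>" for \<Gamma>
      using closed_dvd[OF that] assms(1) 3 by (meson dvd_trans)
  qed
  obtain a where a: "a \<in> Irr" "C = span (cf a)" using assms(2) by (auto simp: simple_iff)
  then have "deg a * deg a = 3 * 3" using assms(3) unfolding a(2) dim_simple[OF a(1)] by simp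
  then have "deg a = 3" by (metis power2_eq_square power2_eq_iff_nonneg zero_le)
  then show False using no_degree_3[OF a(1)] by simp
qed

end

theorem corollary3p5:
  fixes scale :: "'k::alg_closed_field \<Rightarrow> 'h::ring_1 \<Rightarrow> 'h"
    and \<Delta> :: "'h \<Rightarrow> ('h \<times> 'h \<Rightarrow>\<^sub>0 'k)"
    and \<epsilon> :: "'h \<Rightarrow> 'k"
    and S :: "'h \<Rightarrow> 'h"
    and B :: "'h set"
  assumes "hopf_algebra scale \<Delta> \<epsilon> S"
    and "finite_dimensional_vector_space scale B"
    and "coalgebra.cosemisimple scale \<Delta>"
    and "odd (vector_space.dim scale (UNIV :: 'h set))"
    and "\<exists>C. coalgebra.simple_subcoalgebra scale \<Delta> C \<and> vector_space.dim scale C = 9"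
    and "\<not> (\<exists>C. coalgebra.simple_subcoalgebra scale \<Delta> C \<and> even (vector_space.dim scale C))"
  shows "3 dvd vector_space.dim scale (UNIV :: 'h set)"
proof -
  interpret fd_hopf scale \<Delta> \<epsilon> S B
    using assms(1,2) by (rule fd_hopf.intro)
  obtain \<Lambda> where "haar \<Lambda>" using haar_exists[OF assms(3)] by blast
  then interpret cosemisimple_hopf scale \<Delta> \<epsilon> S B \<Lambda>
    by unfold_locales
  obtain C where C: "simple_subcoalgebra C" "dim C = 9" using assms(5) by blast
  show ?thesis by (rule three_dvd_dim[OF assms(4) C]) (use assms(6) in blast)
qed

end
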